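(* Let $x,y,z\in\mathbb{Z}^d$ with $y\neq z$, and assume the random walk $S$ is not the simple random walk on $\mathbb{Z}$. Then \[ H_{x,y,z}(\infty)=\frac{\rho_d(x-z)+\rho_d(y-z)-\rho_d(y-x)}{2\rho_d(y-z)}\in(0,1)\quad\text{for } d=1 \text{ or } d=2, \] \[ H_{x,y,z}(\infty)=\frac{G_0(\mathbf 0,\mathbf 0)\rho_d(y-z)-G_0(\mathbf 0,\mathbf 0)\rho_d(y-x)+G_0(y,z)\rho_d(x-z)}{\rho_d(y-z)\,(G_0(\mathbf 0,\mathbf 0)+G_0(y,z))}\in(0,1)\quad\text{for } d\ge 3. \] Moreover, the functions $C_d(\cdot,\cdot)$ are strictly positive on $\{(u,v)\in\mathbb{Z}^d\times\mathbb{Z}^d:\ v\neq\mathbf 0\}$, and as $t\to\infty$, \[ H_{x,y,z}(\infty)-H_{x,y,z}(t)\sim\frac{C_1(x-z,y-z)}{\sqrt t}\ (d=1),\qquad H_{x,y,z}(\infty)-H_{x,y,z}(t)\sim\frac{C_2(x-z,y-z)}{\ln t}\ (d=2), \] \[ H_{x,y,z}(\infty)-H_{x,y,z}(t)\sim\frac{C_d(x-z,y-z)}{t^{d/2-1}}\ (d\ge 3). \]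
   Context: Fix $d\in\mathbb{N}$. Let $a(\cdot):\mathbb{Z}^d\to\mathbb{R}$ satisfy $a(z)\ge 0$ for $z\ne\mathbf 0$, $a(\mathbf 0)=-a<0$, $\sum_{z}a(z)=0$, $a(z)=a(-z)$ for all $z$, and $\sum_z\|z\|^2a(z)<\infty$. Let $S=\{S(t),t\ge0\}$ be the continuous-time Markov chain on $\mathbb{Z}^d$ with generator $(a(y-x))_{x,y\in\mathbb{Z}^d}$ (right-continuous version): it stays at its current state an exponential time with parameter $a$, then jumps from $x$ to $y\ne x$ with probability $a(y-x)/a$, independently of the past. Write $p(t;x,y)=\mathsf P(S(t)=y\mid S(0)=x)$ and assume irreducibility: for all $x,y$ there is $t>0$ with $p(t;x,y)>0$. The simple random walk on $\mathbb{Z}$ is the case $d=1$, $a(1)=a(-1)=a/2$, $a(k)=0$ for $|k|>1$. Notation: $\phi(\theta)=\sum_z a(z)\cos(z,\theta)$ for $\theta\in[-\pi,\pi]^d$; $\gamma_d=\big((2\pi)^{d/2}\sqrt{|\det\phi''(\mathbf 0)|}\big)^{-1}$ with $\phi''(\mathbf 0)$ the Hessian of $\phi$ at $\mathbf 0$; $G_\lambda(x,y)=\int_0^\infty e^{-\lambda t}p(t;x,y)\,dt$ for $\lambda>0$, and for $d\ge3$ also for $\lambda=0$ (then finite); $\rho_d(\mathbf 0)=1$ and for $x\ne\mathbf 0$, $\rho_d(x)=a\lim_{\lambda\to0+}(G_\lambda(\mathbf 0,\mathbf 0)-G_\lambda(\mathbf 0,x))=\frac{a}{(2\pi)^d}\int_{[-\pi,\pi]^d}\frac{\cos(x,\theta)-1}{\phi(\theta)}d\theta$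 (finite). Let $\tau=\inf\{t\ge0:S(t)\ne S(0)\}$. For $y\ne z$, $\tau_{y,z}=\inf\{t\ge\tau:S(t)=y,\ S(u)\ne z\ \forall u\in[\tau,t]\}$ ($\inf\emptyset=\infty$), $H_{x,y,z}(t)=\mathsf P(\tau_{y,z}\le t\mid S(0)=x)$ for $t\ge0$, and $H_{x,y,z}(\infty)=\lim_{t\to\infty}H_{x,y,z}(t)$. For $x,y\in\mathbb{Z}^d$, $y\ne\mathbf 0$ (in $C_1$, $x,y\in\mathbb{Z}$): $C_1(x,y)=\frac{\rho_1(y-x)+\rho_1(x)-\rho_1(y)}{4a\pi\gamma_1}+\frac{a\pi y^2\gamma_1^3(\rho_1(y-x)-\rho_1(x)-\rho_1(y))}{\rho_1^2(y)}+\frac{2a\pi xy\gamma_1^3}{\rho_1(y)}$, $C_2(x,y)=\frac{\rho_2(y-x)+\rho_2(x)-\rho_2(y)}{4a\gamma_2}$, $C_d(x,y)=\frac{2\gamma_d(\rho_d(y-x)+\rho_d(x)-\rho_d(y))}{a(d-2)(G_0(\mathbf 0,\mathbf 0)+G_0(\mathbf 0,y))^2}$ for $d\ge3$. *)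

theory Defs
  imports "HOL-Probability.Probability" "HOL-Library.Landau_Symbols"
begin

definition rate :: "(int^'n \<Rightarrow> real) \<Rightarrow> real" where
  "rate a = - a 0"

definition ip :: "int^'n \<Rightarrow> real^'n \<Rightarrow> real" where
  "ip z \<theta> = (\<Sum>i\<in>UNIV. real_of_int (z $ i) * \<theta> $ i)"

definition sqn :: "int^'n \<Rightarrow> real" where
  "sqn z = (\<Sum>i\<in>UNIV. (real_of_int (z $ i))^2)"

(* the unique coordinate of a point of Z^1 (for d = 1, sc z = z) *)
definition sc :: "int^'n \<Rightarrow> real" where
  "sc z = (\<Sum>i\<in>UNIV. real_of_int (z $ i))"

definition phi :: "(int^'n \<Rightarrow> real) \<Rightarrow> real^'n \<Rightarrow> real" where
  "phi a \<theta> = (\<Sum>\<^sub>\<infinity>z. a z * cos (ip z \<theta>))"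

definition hess :: "(int^'n \<Rightarrow> real) \<Rightarrow> real^'n^'n" where
  "hess a = (\<chi> i j. deriv (\<lambda>s. deriv (\<lambda>t. phi a (t *\<^sub>R axis i 1 + s *\<^sub>R axis j 1)) 0) 0)"

definition gamma_d :: "(int^'n \<Rightarrow> real) \<Rightarrow> real" where
  "gamma_d a = 1 / ((2 * pi) powr (real CARD('n) / 2) * sqrt \<bar>det (hess a)\<bar>)"

definition rho :: "(int^'n \<Rightarrow> real) \<Rightarrow> int^'n \<Rightarrow> real" where
  "rho a x = (if x = 0 then 1 else
     rate a / (2 * pi) ^ CARD('n) *
       integral (cbox (- (\<chi> i. pi)) (\<chi> i. pi)) (\<lambda>\<theta>. (cos (ip x \<theta>) - 1) / phi a \<theta>))"

definition hold_measure :: "(int^'n \<Rightarrow> real) \<Rightarrow> real measure" where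
  "hold_measure a = density lborel (\<lambda>t. ennreal (exponential_density (rate a) t))"

definition jump_measure :: "(int^'n \<Rightarrow> real) \<Rightarrow> (int^'n) measure" where
  "jump_measure a = density (count_space UNIV)
      (\<lambda>z. ennreal (if z = 0 then 0 else a z / rate a))"

definition Omega :: "(int^'n \<Rightarrow> real) \<Rightarrow> (nat \<Rightarrow> real \<times> (int^'n)) measure" where
  "Omega a = PiM UNIV (\<lambda>_. hold_measure a \<Otimes>\<^sub>M jump_measure a)"

definition jtime :: "(nat \<Rightarrow> real \<times> (int^'n)) \<Rightarrow> nat \<Rightarrow> real" where
  "jtime \<omega> n = (\<Sum>k<n. fst (\<omega> k))"

definition jpos :: "int^'n \<Rightarrow> (nat \<Rightarrow> real \<times> (int^'n)) \<Rightarrow> nat \<Rightarrow> int^'n" where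
  "jpos x \<omega> n = x + (\<Sum>k<n. snd (\<omega> k))"

definition njumps :: "(nat \<Rightarrow> real \<times> (int^'n)) \<Rightarrow> real \<Rightarrow> nat" where
  "njumps \<omega> t = card {n. 1 \<le> n \<and> jtime \<omega> n \<le> t}"

(* right-continuous path S(t) with S(0) = x *)
definition S :: "int^'n \<Rightarrow> (nat \<Rightarrow> real \<times> (int^'n)) \<Rightarrow> real \<Rightarrow> int^'n" where
  "S x \<omega> t = jpos x \<omega> (njumps \<omega> t)"

definition p :: "(int^'n \<Rightarrow> real) \<Rightarrow> real \<Rightarrow> int^'n \<Rightarrow> int^'n \<Rightarrow> real" where
  "p a t x y = measure (Omega a) {\<omega> \<in> space (Omega a). S x \<omega> t = y}"

definition G0 :: "(int^'n \<Rightarrow> real) \<Rightarrow> int^'n \<Rightarrow> int^'n \<Rightarrow> real" where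
  "G0 a x y = integral {0..} (\<lambda>t. p a t x y)"

definition tau :: "int^'n \<Rightarrow> (nat \<Rightarrow> real \<times> (int^'n)) \<Rightarrow> ereal" where
  "tau x \<omega> = Inf (ereal ` {t. 0 \<le> t \<and> S x \<omega> t \<noteq> S x \<omega> 0})"

definition tau_yz :: "int^'n \<Rightarrow> int^'n \<Rightarrow> int^'n \<Rightarrow> (nat \<Rightarrow> real \<times> (int^'n)) \<Rightarrow> ereal" where
  "tau_yz x y z \<omega> = Inf (ereal ` {t. tau x \<omega> \<le> ereal t \<and> S x \<omega> t = y \<and>
        (\<forall>u. tau x \<omega> \<le> ereal u \<and> u \<le> t \<longrightarrow> S x \<omega> u \<noteq> z)})"

definition H :: "(int^'n \<Rightarrow> real) \<Rightarrow> int^'n \<Rightarrow> int^'n \<Rightarrow> int^'n \<Rightarrow> real \<Rightarrow> real" where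
  "H a x y z t = measure (Omega a) {\<omega> \<in> space (Omega a). tau_yz x y z \<omega> \<le> ereal t}"

definition Hinf :: "(int^'n \<Rightarrow> real) \<Rightarrow> int^'n \<Rightarrow> int^'n \<Rightarrow> int^'n \<Rightarrow> real" where
  "Hinf a x y z = Lim at_top (H a x y z)"

definition admissible :: "(int^'n \<Rightarrow> real) \<Rightarrow> bool" where
  "admissible a \<longleftrightarrow>
     (\<forall>z. z \<noteq> 0 \<longrightarrow> a z \<ge> 0) \<and> a 0 < 0 \<and> (a has_sum 0) UNIV \<and>
     (\<forall>z. a z = a (- z)) \<and> (\<lambda>z. sqn z * a z) summable_on UNIV \<and>
     (\<forall>x y. \<exists>t>0. p a t x y > 0)"

definition is_srw :: "(int^'n \<Rightarrow> real) \<Rightarrow> bool" where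
  "is_srw a \<longleftrightarrow> CARD('n) = 1 \<and>
     a (\<chi> i. 1) = rate a / 2 \<and> a (\<chi> i. -1) = rate a / 2 \<and>
     (\<forall>k. \<bar>sc k\<bar> > 1 \<longrightarrow> a k = 0)"

definition C1 :: "(int^'n \<Rightarrow> real) \<Rightarrow> int^'n \<Rightarrow> int^'n \<Rightarrow> real" where
  "C1 a u v =
     (rho a (v - u) + rho a u - rho a v) / (4 * rate a * pi * gamma_d a)
     + rate a * pi * (sc v)^2 * (gamma_d a)^3 * (rho a (v - u) - rho a u - rho a v) / (rho a v)^2
     + 2 * rate a * pi * sc u * sc v * (gamma_d a)^3 / rho a v"

definition C2 :: "(int^'n \<Rightarrow> real) \<Rightarrow> int^'n \<Rightarrow> int^'n \<Rightarrow> real" where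
  "C2 a u v = (rho a (v - u) + rho a u - rho a v) / (4 * rate a * gamma_d a)"

definition Cd :: "(int^'n \<Rightarrow> real) \<Rightarrow> int^'n \<Rightarrow> int^'n \<Rightarrow> real" where
  "Cd a u v = 2 * gamma_d a * (rho a (v - u) + rho a u - rho a v) /
     (rate a * (real CARD('n) - 2) * (G0 a 0 0 + G0 a 0 v)^2)"

end

theory Submission
  imports Defs "HOL-Real_Asymp.Real_Asymp"
begin

text \<open>The jump chain is observed at the jump times of a Poisson process, so \<open>p\<close> and \<open>H\<close> are Poissonised
  versions of return probabilities \<open>q n\<close> and first hitting probabilities \<open>fh\<close> of the chain. The renewal
  equations for the first visits to \<open>y\<close> and \<open>z\<close> express the generating function \<open>Fs\<close> of \<open>fh\<close> by the resolvent
  \<open>Qs\<close> and its differences \<open>Rs\<close>, which converge to \<open>rho\<close>; this gives the limit of \<open>H\<close>. The local limit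
  theorem, proved by scaling the Fourier integral, yields \<open>p a t x y \<sim> \<gamma> t\<^sup>-\<^sup>d\<^sup>/\<^sup>2\<close>.

  For \<open>d \<le> 2\<close> Abelian theorems turn this into the expansion of \<open>Fs\<close> at \<open>1\<close>, and since the tail of \<open>H\<close> is
  monotone, Karamata's theorem recovers its asymptotics. For \<open>d \<ge> 3\<close> the time spent at \<open>y\<close> after time
  \<open>t\<close>, starting at \<open>x\<close>, is split according to the first visit to \<open>{y, z}\<close>: this is a pair of linear equations for the tails of
  \<open>H a x y z\<close> and \<open>H a x z y\<close> whose convolution terms are asymptotically \<open>t\<^sup>1\<^sup>-\<^sup>d\<^sup>/\<^sup>2\<close> times a constant.\<close>

section \<open>A Tauberian theorem for monotone functions\<close>

text \<open>The size of the tail forces the two methods. In dimensions one and two the tail decays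
  like \<open>1 / sqrt t\<close> or \<open>1 / ln t\<close>, its Laplace transform blows up at 0,
  and the blow-up carries the leading constant. In dimension d \<ge> 3 the tail decays like
  \<open>t powr (1 - d / 2)\<close>, which is integrable from d = 5 on; the transform is then finite
  at 0 and the wanted term is hidden behind regular ones, so the argument stays in the time domain.
  Laplace transforms enter through the substitution s = r / (r + l): integrating a Poissonised
  sequence against \<open>exp (- (l * t))\<close> gives its generating function at s, up to a
  factor. The simple random walk on Z is excluded because it cannot jump over a point, so that z may
  shield y from x; every other admissible walk has two steps g and h with h different from g and -g,
  and this is the form in which the hypothesis is used. The degenerate starting points x = y and x =
  z need no separate treatment: \<open>H\<close> ignores the initial visit, and the convention
  \<open>rho a 0 = 1\<close> accounts for exactly this.\<close>

definition gamma_dens :: "real \<Rightarrow> real \<Rightarrow> real" where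
  "gamma_dens \<rho> t = indicator {0..} t * t powr (\<rho> - 1) / Gamma \<rho>"

lemma gamma_dens_nonneg: "\<rho> > 0 \<Longrightarrow> 0 \<le> gamma_dens \<rho> t"
  unfolding gamma_dens_def by (simp add: less_imp_le)

lemma borel_measurable_gamma_dens [measurable]: "gamma_dens \<rho> \<in> borel_measurable borel"
  unfolding gamma_dens_def by measurable

text \<open>Euler's integral for \<kappa> = 1, rescaled. The measure with this density is the one
  whose Laplace transform is a pure power, which makes it the limit measure in Karamata's
  argument.\<close>

lemma has_bochner_integral_gamma_dens:
  fixes \<kappa> \<rho> :: real
  assumes "\<kappa> > 0" "\<rho> > 0"
  shows "has_bochner_integral lborel (\<lambda>t. exp (- (\<kappa> * t)) * gamma_dens \<rho> t) (\<kappa> powr - \<rho>)"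
proof -
  let ?f = "\<lambda>t. exp (- t) * gamma_dens \<rho> t"
  have G: "Gamma \<rho> > 0" using assms by simp
  have "(\<integral>\<^sup>+t. ennreal (?f t) \<partial>lborel) = (\<integral>\<^sup>+t. ennreal (1 / Gamma \<rho>) * ennreal (indicator {0..} t * t powr (\<rho> - 1) / exp t) \<partial>lborel)"
    using G by (intro nn_integral_cong) (auto simp: gamma_dens_def ennreal_mult'[symmetric] exp_minus field_simps)
  also have "\<dots> = ennreal (1 / Gamma \<rho>) * ennreal (Gamma \<rho>)"
    by (subst nn_integral_cmult) (auto simp: Gamma_conv_nn_integral_real[OF assms(2)])
  also have "\<dots> = ennreal 1"
    using G by (simp add: ennreal_mult'[symmetric])
  finally have "has_bochner_integral lborel ?f 1"
    using assms by (intro has_bochner_integral_nn_integral) (auto simp: gamma_dens_nonneg)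
  then have "has_bochner_integral lborel (\<lambda>t. ?f (0 + \<kappa> * t)) (1 /\<^sub>R \<bar>\<kappa>\<bar>)"
    using assms by (subst (asm) lborel_has_bochner_integral_real_affine_iff[of \<kappa> _ _ 0]) auto
  then have "has_bochner_integral lborel (\<lambda>t. \<kappa> powr (1 - \<rho>) * ?f (\<kappa> * t)) (\<kappa> powr (1 - \<rho>) * (1 / \<kappa>))"
    using assms by (intro has_bochner_integral_mult_right) (auto simp: inverse_eq_divide)
  moreover have "\<kappa> powr (1 - \<rho>) * (1 / \<kappa>) = \<kappa> powr - \<rho>"
    using assms by (simp add: powr_diff powr_minus field_simps)
  moreover have "\<kappa> powr (1 - \<rho>) * ?f (\<kappa> * t) = exp (- (\<kappa> * t)) * gamma_dens \<rho> t" for t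
  proof (cases "t \<ge> 0")
    case True
    have "\<kappa> powr (1 - \<rho>) * (\<kappa> * t) powr (\<rho> - 1) = t powr (\<rho> - 1)"
      using assms True by (simp add: powr_mult mult.assoc[symmetric] powr_add[symmetric])
    then show ?thesis
      using assms True by (simp add: gamma_dens_def field_simps)
  next
    case False
    then show ?thesis using assms by (simp add: gamma_dens_def zero_le_mult_iff)
  qed
  ultimately show ?thesis by simp
qed

text \<open>Karamata's argument: Weierstrass approximation passes the asymptotics from the monomials
  \<open>e\<^sup>-\<^sup>k\<^sup>t\<close> to continuous test functions; testing against a bump on \<open>[1, 1 + \<epsilon>]\<close> then squeezes a monotone
  density directly, without a separate monotone density theorem.\<close>

locale karamata =
  fixes f w :: "real \<Rightarrow> real" and \<rho> :: real
  assumes meas: "f \<in> borel_measurable borel"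
    and mono: "\<And>s t. 0 \<le> s \<Longrightarrow> s \<le> t \<Longrightarrow> f t \<le> f s"
    and nonneg: "\<And>t. 0 \<le> t \<Longrightarrow> 0 \<le> f t"
    and \<rho>: "0 < \<rho>" "\<rho> \<le> 1"
    and int: "\<And>l. l > 0 \<Longrightarrow> integrable lborel (\<lambda>t. exp (- (l * t)) * (indicator {0..} t * f t))"
    and wpos: "eventually (\<lambda>l. w l > 0) (at_right 0)"
    and conv: "((\<lambda>l. (LINT t|lborel. exp (- (l * t)) * (indicator {0..} t * f t)) / w l) \<longlongrightarrow> 1) (at_right 0)"
    and rv: "\<And>k. k > 0 \<Longrightarrow> ((\<lambda>l. w (k * l) / w l) \<longlongrightarrow> k powr - \<rho>) (at_right 0)"
begin

section \<open>Convergence of the test integrals\<close>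

definition F :: "real \<Rightarrow> real" where "F t = indicator {0..} t * f t"

lemma F_meas[measurable]: "F \<in> borel_measurable borel"
  unfolding F_def using meas by measurable

lemma F_nonneg: "0 \<le> F t" by (simp add: F_def nonneg indicator_def)

text \<open>The test function q is read in the variable \<open>exp (- (l * t))\<close>, which lives
  in [0, 1]; the extra factor \<open>exp (- (l * t))\<close> keeps the integral finite for every
  bounded q. \<open>Il\<close> is the limiting functional as l tends to 0.\<close>

definition Ir :: "(real \<Rightarrow> real) \<Rightarrow> real \<Rightarrow> real" where
  "Ir q l = (LINT t|lborel. exp (- (l * t)) * q (exp (- (l * t))) * F t) / w l"

definition Il :: "(real \<Rightarrow> real) \<Rightarrow> real" where
  "Il q = (LINT t|lborel. exp (- t) * q (exp (- t)) * gamma_dens \<rho> t)"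

lemma int_monom: "l > 0 \<Longrightarrow> integrable lborel (\<lambda>t. exp (- (l * t)) * exp (- (l * t)) ^ k * F t)"
proof -
  assume l: "l > 0"
  have "exp (- ((real k + 1) * l * t)) = exp (- (l * t)) * exp (- (l * t)) ^ k" for t
    by (simp add: exp_of_nat_mult[symmetric] exp_add[symmetric] algebra_simps)
  then show ?thesis using int[of "(real k + 1) * l"] l by (simp add: F_def)
qed

text \<open>The monomial only changes the parameter of the transform from l to
  \<open>(k + 1) * l\<close>; regular variation of \<open>w\<close> then produces
  \<open>(k + 1) powr - \<rho>\<close>, which is the transform of \<open>gamma_dens \<rho>\<close>
  at k + 1.\<close>

lemma Ir_monom: "((\<lambda>l. Ir (\<lambda>x. x ^ k) l) \<longlongrightarrow> Il (\<lambda>x. x ^ k)) (at_right 0)"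
proof -
  let ?L = "\<lambda>l. LINT t|lborel. exp (- (l * t)) * F t"
  let ?k = "real k + 1"
  have *: "filterlim (\<lambda>l. ?k * l) (at_right 0) (at_right (0::real))"
    unfolding filterlim_at by (auto intro!: tendsto_eq_intros simp: eventually_at_filter)
  have c: "((\<lambda>l. ?L (?k * l) / w (?k * l)) \<longlongrightarrow> 1) (at_right 0)"
    using filterlim_compose[OF conv *] by (simp add: F_def)
  have "((\<lambda>l. ?L (?k * l) / w (?k * l) * (w (?k * l) / w l)) \<longlongrightarrow> 1 * ?k powr - \<rho>) (at_right 0)"
    by (intro tendsto_mult c rv) simp
  moreover have "eventually (\<lambda>l. ?L (?k * l) / w (?k * l) * (w (?k * l) / w l) = Ir (\<lambda>x. x ^ k) l) (at_right 0)"
    using filterlim_iff[THEN iffD1, OF *, rule_format, OF wpos] wpos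
  proof eventually_elim
    case (elim l)
    have "exp (- (?k * l * t)) = exp (- (l * t)) * exp (- (l * t)) ^ k" for t
      by (simp add: exp_of_nat_mult[symmetric] exp_add[symmetric] algebra_simps)
    with elim show ?case by (simp add: Ir_def)
  qed
  ultimately have "((\<lambda>l. Ir (\<lambda>x. x ^ k) l) \<longlongrightarrow> ?k powr - \<rho>) (at_right 0)"
    by (auto elim: Lim_transform_eventually)
  moreover have "Il (\<lambda>x. x ^ k) = ?k powr - \<rho>"
  proof -
    have "exp (- (?k * t)) = exp (- t) * exp (- t) ^ k" for t :: real
      by (simp add: exp_of_nat_mult[symmetric] exp_add[symmetric] algebra_simps)
    then show ?thesis
      unfolding Il_def using has_bochner_integral_integral_eq[OF has_bochner_integral_gamma_dens[of ?k \<rho>]] \<rho>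
      by simp
  qed
  ultimately show ?thesis by simp
qed

lemma int_gamma_monom: "integrable lborel (\<lambda>t. exp (- t) * exp (- t) ^ k * gamma_dens \<rho> t)"
proof -
  have "exp (- ((real k + 1) * t)) = exp (- t) * exp (- t) ^ k" for t :: real
    by (simp add: exp_of_nat_mult[symmetric] exp_add[symmetric] algebra_simps)
  then show ?thesis
    using has_bochner_integral_gamma_dens[of "real k + 1" \<rho>] \<rho> by (simp add: has_bochner_integral_iff)
qed

lemma Ir_poly: "((\<lambda>l. Ir (\<lambda>x. \<Sum>i\<le>n. c i * x ^ i) l) \<longlongrightarrow> Il (\<lambda>x. \<Sum>i\<le>n. c i * x ^ i)) (at_right 0)"
proof -
  have "Ir (\<lambda>x. \<Sum>i\<le>n. c i * x ^ i) l = (\<Sum>i\<le>n. c i * Ir (\<lambda>x. x ^ i) l)" if "l > 0" for l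
  proof -
    have "(LINT t|lborel. exp (- (l * t)) * (\<Sum>i\<le>n. c i * exp (- (l * t)) ^ i) * F t)
       = (LINT t|lborel. (\<Sum>i\<le>n. c i * (exp (- (l * t)) * exp (- (l * t)) ^ i * F t)))"
      by (intro Bochner_Integration.integral_cong) (auto simp: sum_distrib_left sum_distrib_right mult_ac)
    also have "\<dots> = (\<Sum>i\<le>n. c i * (LINT t|lborel. exp (- (l * t)) * exp (- (l * t)) ^ i * F t))"
      using int_monom[OF that] by (subst Bochner_Integration.integral_sum) (auto intro!: integrable_mult_right)
    finally show ?thesis by (simp add: Ir_def sum_divide_distrib)
  qed
  then have "eventually (\<lambda>l. (\<Sum>i\<le>n. c i * Ir (\<lambda>x. x ^ i) l) = Ir (\<lambda>x. \<Sum>i\<le>n. c i * x ^ i) l) (at_right 0)"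
    by (simp add: eventually_at_filter)
  moreover have "((\<lambda>l. \<Sum>i\<le>n. c i * Ir (\<lambda>x. x ^ i) l) \<longlongrightarrow> (\<Sum>i\<le>n. c i * Il (\<lambda>x. x ^ i))) (at_right 0)"
    by (intro tendsto_intros Ir_monom)
  moreover have "(\<Sum>i\<le>n. c i * Il (\<lambda>x. x ^ i)) = Il (\<lambda>x. \<Sum>i\<le>n. c i * x ^ i)"
  proof -
    have "(LINT t|lborel. exp (- t) * (\<Sum>i\<le>n. c i * exp (- t) ^ i) * gamma_dens \<rho> t)
       = (LINT t|lborel. (\<Sum>i\<le>n. c i * (exp (- t) * exp (- t) ^ i * gamma_dens \<rho> t)))"
      by (intro Bochner_Integration.integral_cong) (auto simp: sum_distrib_left sum_distrib_right mult_ac)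
    also have "\<dots> = (\<Sum>i\<le>n. c i * (LINT t|lborel. exp (- t) * exp (- t) ^ i * gamma_dens \<rho> t))"
      using int_gamma_monom by (subst Bochner_Integration.integral_sum) (auto intro!: integrable_mult_right)
    finally show ?thesis by (simp add: Il_def)
  qed
  ultimately show ?thesis by (auto elim: Lim_transform_eventually)
qed

text \<open>Stated for a general density G because it is applied to both sides: to \<open>F\<close>
  at scale l and to \<open>gamma_dens \<rho>\<close> at scale 1. Vanishing of G on the negative axis
  keeps \<open>exp (- (l * t))\<close> in [0, 1], where q and p are compared.\<close>

lemma close_integrals:
  fixes G q p :: "real \<Rightarrow> real" and l \<delta> :: real
  assumes G: "integrable lborel (\<lambda>t. exp (- (l * t)) * G t)" "G \<in> borel_measurable borel" "\<And>t. 0 \<le> G t" "\<And>t. t < 0 \<Longrightarrow> G t = 0"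
    and l: "l > 0" and c: "continuous_on {0..1} q" "continuous_on {0..1} p" and "\<And>x. x \<in> {0..1} \<Longrightarrow> \<bar>q x - p x\<bar> \<le> \<delta>"
  shows "\<bar>(LINT t|lborel. exp (- (l * t)) * q (exp (- (l * t))) * G t) - (LINT t|lborel. exp (- (l * t)) * p (exp (- (l * t))) * G t)\<bar>
    \<le> \<delta> * (LINT t|lborel. exp (- (l * t)) * G t)"
proof -
  have in01: "exp (- (l * t)) \<in> {0..1}" if "t \<ge> 0" for t using that l by auto
  have int: "integrable lborel (\<lambda>t. exp (- (l * t)) * h (exp (- (l * t))) * G t)" if h: "continuous_on {0..1} h" for h
  proof -
    obtain B where B: "\<And>x. x \<in> {0..1} \<Longrightarrow> \<bar>h x\<bar> \<le> B"
      using compact_imp_bounded[OF compact_continuous_image[OF h compact_Icc]] unfolding bounded_iff by (fastforce simp: image_iff)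
    have "0 \<le> B" using B[of 0] by simp
    have m: "(\<lambda>x. indicator {0..1} x *\<^sub>R h x) \<in> borel_measurable borel"
      by (rule borel_measurable_continuous_on_indicator) (use h in auto)
    have eq: "(\<lambda>t. exp (- (l * t)) * h (exp (- (l * t))) * G t) = (\<lambda>t. exp (- (l * t)) * (indicator {0..1} (exp (- (l * t))) *\<^sub>R h (exp (- (l * t)))) * G t)"
    proof
      fix t :: real
      show "exp (- (l * t)) * h (exp (- (l * t))) * G t = exp (- (l * t)) * (indicator {0..1} (exp (- (l * t))) *\<^sub>R h (exp (- (l * t)))) * G t"
        using in01[of t] G(4)[of t] by (cases "t \<ge> 0") auto
    qed
    have meas: "(\<lambda>t. exp (- (l * t)) * h (exp (- (l * t))) * G t) \<in> borel_measurable lborel"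
      unfolding eq using m G(2) by measurable
    show ?thesis
    proof (rule Bochner_Integration.integrable_bound[OF integrable_mult_right[OF G(1), of B] meas])
      show "AE t in lborel. norm (exp (- (l * t)) * h (exp (- (l * t))) * G t) \<le> norm (B * (exp (- (l * t)) * G t))"
      proof (rule AE_I2)
        fix t :: real
        show "norm (exp (- (l * t)) * h (exp (- (l * t))) * G t) \<le> norm (B * (exp (- (l * t)) * G t))"
          using mult_right_mono[OF B[OF in01[of t]], of "exp (- (l * t)) * G t"] G(3)[of t] G(4)[of t] \<open>0 \<le> B\<close>
          by (cases "t \<ge> 0") (auto simp: abs_mult mult_ac)
      qed
    qed
  qed
  note iq = int[OF c(1)] and ip = int[OF c(2)]
  have "\<bar>(LINT t|lborel. exp (- (l * t)) * q (exp (- (l * t))) * G t) - (LINT t|lborel. exp (- (l * t)) * p (exp (- (l * t))) * G t)\<bar>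
      \<le> (LINT t|lborel. \<bar>exp (- (l * t)) * q (exp (- (l * t))) * G t - exp (- (l * t)) * p (exp (- (l * t))) * G t\<bar>)"
    unfolding Bochner_Integration.integral_diff[OF iq ip, symmetric] by (rule integral_abs_bound)
  also have "\<dots> \<le> (LINT t|lborel. \<delta> * (exp (- (l * t)) * G t))"
  proof (rule integral_mono)
    show "integrable lborel (\<lambda>t. \<bar>exp (- (l * t)) * q (exp (- (l * t))) * G t - exp (- (l * t)) * p (exp (- (l * t))) * G t\<bar>)"
      by (rule Bochner_Integration.integrable_abs[OF Bochner_Integration.integrable_diff[OF iq ip]])
    show "integrable lborel (\<lambda>t. \<delta> * (exp (- (l * t)) * G t))"
      by (rule integrable_mult_right[OF G(1)])
    fix t :: real
    show "\<bar>exp (- (l * t)) * q (exp (- (l * t))) * G t - exp (- (l * t)) * p (exp (- (l * t))) * G t\<bar> \<le> \<delta> * (exp (- (l * t)) * G t)"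
    proof (cases "t \<ge> 0")
      case True
      have "exp (- (l * t)) * q (exp (- (l * t))) * G t - exp (- (l * t)) * p (exp (- (l * t))) * G t
        = (q (exp (- (l * t))) - p (exp (- (l * t)))) * (exp (- (l * t)) * G t)" by (simp add: algebra_simps)
      moreover have "0 \<le> exp (- (l * t)) * G t" using G(3)[of t] by simp
      ultimately have "\<bar>exp (- (l * t)) * q (exp (- (l * t))) * G t - exp (- (l * t)) * p (exp (- (l * t))) * G t\<bar>
        = \<bar>q (exp (- (l * t))) - p (exp (- (l * t)))\<bar> * (exp (- (l * t)) * G t)"
        using G(3)[of t] by (simp add: abs_mult)
      also have "\<dots> \<le> \<delta> * (exp (- (l * t)) * G t)"
        by (rule mult_right_mono[OF assms(8)[OF in01[OF True]]]) (use G(3)[of t] in simp)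
      finally show ?thesis .
    next
      case False
      then have "G t = 0" by (intro G(4)) simp
      then show ?thesis by simp
    qed
  qed
  finally show ?thesis by simp
qed

lemma Ir_cont:
  assumes q: "continuous_on {0..1} q"
  shows "((\<lambda>l. Ir q l) \<longlongrightarrow> Il q) (at_right 0)"
proof (rule tendstoI)
  fix e :: real assume "e > 0"
  \<comment> \<open>Budget: \<open>2 * \<delta>\<close> for replacing q by p in \<open>Ir\<close>
    (the normalised mass is below 2), \<delta> for the convergence on p, and \<delta> for returning
    from p to q in \<open>Il\<close>.\<close>
  define \<delta> where "\<delta> = e / 5"
  have \<delta>: "\<delta> > 0" using \<open>e > 0\<close> by (simp add: \<delta>_def)
  obtain p where "real_polynomial_function p" and p: "\<And>x. x \<in> {0..1} \<Longrightarrow> \<bar>q x - p x\<bar> < \<delta>"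
    using Stone_Weierstrass_real_polynomial_function[OF compact_Icc q \<delta>] by blast
  then obtain c n where pc: "p = (\<lambda>x. \<Sum>i\<le>n. c i * x ^ i)" by (auto simp: real_polynomial_function_iff_sum)
  have pcont: "continuous_on {0..1} p" unfolding pc by (intro continuous_intros)
  have A: "eventually (\<lambda>l. dist (Ir p l) (Il p) < \<delta>) (at_right 0)"
    using tendstoD[OF Ir_poly \<delta>] unfolding pc .
  have B: "eventually (\<lambda>l. (LINT t|lborel. exp (- (l * t)) * F t) / w l < 2) (at_right 0)"
    using order_tendstoD(2)[OF conv, of 2] by (simp add: F_def)
  have hb: "has_bochner_integral lborel (\<lambda>t. exp (- (1 * t)) * gamma_dens \<rho> t) 1"
    using has_bochner_integral_gamma_dens[of 1 \<rho>] \<rho> by simp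
  have C: "\<bar>Il q - Il p\<bar> \<le> \<delta>"
    using close_integrals[of 1 "gamma_dens \<rho>" q p \<delta>] hb p q pcont \<rho>
    by (auto simp: Il_def has_bochner_integral_iff gamma_dens_nonneg less_imp_le) (simp add: gamma_dens_def)
  have "eventually (\<lambda>l. l > 0) (at_right (0::real))" by (simp add: eventually_at_filter)
  with A B wpos show "eventually (\<lambda>l. dist (Ir q l) (Il q) < e) (at_right 0)"
  proof eventually_elim
    case (elim l)
    have "\<bar>Ir q l - Ir p l\<bar> \<le> \<delta> * ((LINT t|lborel. exp (- (l * t)) * F t) / w l)"
    proof -
      have "\<bar>(LINT t|lborel. exp (- (l * t)) * q (exp (- (l * t))) * F t) - (LINT t|lborel. exp (- (l * t)) * p (exp (- (l * t))) * F t)\<bar>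
        \<le> \<delta> * (LINT t|lborel. exp (- (l * t)) * F t)"
      proof (rule close_integrals[OF _ _ _ _ _ q pcont])
        show "integrable lborel (\<lambda>t. exp (- (l * t)) * F t)" using int[of l] elim by (simp add: F_def)
        show "\<bar>q x - p x\<bar> \<le> \<delta>" if "x \<in> {0..1}" for x using p[OF that] by simp
      qed (use elim F_nonneg F_meas in \<open>simp_all\<close>, simp add: F_def)
      then show ?thesis using elim
        by (simp add: Ir_def diff_divide_distrib[symmetric] abs_divide divide_right_mono)
    qed
    also have "\<dots> \<le> \<delta> * 2" using elim \<delta> by (intro mult_left_mono) auto
    finally show ?case using elim(1) C \<delta> by (simp add: dist_real_def \<delta>_def abs_if split: if_splits)
  qed
qed

section \<open>Squeezing the density with a bump\<close>

context
  fixes \<epsilon> :: real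
  assumes \<epsilon>: "\<epsilon> > 0"
begin

text \<open>A tent in the variable \<open>exp (- t)\<close> that lives over t in
  [1, 1 + \<epsilon>]. Continuity is what \<open>Ir_cont\<close> asks for; an indicator would not
  qualify.\<close>

definition bump :: "real \<Rightarrow> real" where
  "bump x = max 0 (min (x - exp (- (1 + \<epsilon>))) (exp (- 1) - x))"

definition g :: "real \<Rightarrow> real" where "g t = exp (- t) * bump (exp (- t))"

lemma bump_cont: "continuous_on A bump" unfolding bump_def by (intro continuous_intros)
lemma g_nonneg: "0 \<le> g t" by (simp add: g_def bump_def)
lemma g_meas[measurable]: "g \<in> borel_measurable borel" unfolding g_def bump_def by measurable
lemma g_supp: "g t \<noteq> 0 \<Longrightarrow> 1 \<le> t \<and> t \<le> 1 + \<epsilon>"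
proof (rule ccontr)
  assume "g t \<noteq> 0" "\<not> (1 \<le> t \<and> t \<le> 1 + \<epsilon>)"
  then have "exp (- 1) - exp (- t) \<le> 0 \<or> exp (- t) - exp (- (1 + \<epsilon>)) \<le> 0" by auto
  then have "bump (exp (- t)) = 0" unfolding bump_def by (intro max.absorb1) (auto simp: min_le_iff_disj)
  with \<open>g t \<noteq> 0\<close> show False by (simp add: g_def)
qed
lemma g_pos: "1 < t \<Longrightarrow> t < 1 + \<epsilon> \<Longrightarrow> 0 < g t"
  by (auto simp: g_def bump_def max_def min_def)
lemma g_le: "g t \<le> indicator {1..1+\<epsilon>} t"
proof (cases "g t = 0")
  case False
  then have t: "1 \<le> t" "t \<le> 1 + \<epsilon>" using g_supp by auto
  have e: "exp (- t) \<le> 1" using t by simp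
  have "bump (exp (- t)) \<le> exp (- t)"
    unfolding bump_def by (intro max.boundedI min.coboundedI1) auto
  then have "bump (exp (- t)) \<le> 1" using e by linarith
  then have "bump (exp (- t)) \<le> 1" "0 \<le> bump (exp (-t))" "exp (- t) \<le> 1"
    using e by (auto simp: bump_def)
  then have "exp (- t) * bump (exp (- t)) \<le> 1 * 1" by (intro mult_mono) auto
  then show ?thesis using t by (simp add: g_def)
qed auto

lemma g_int: "integrable lborel g"
proof (rule Bochner_Integration.integrable_bound)
  show "integrable lborel (indicator {1..1+\<epsilon>} :: real \<Rightarrow> real)" by (rule integrable_real_indicator) (auto simp: emeasure_lborel_Icc_eq)
  show "AE t in lborel. norm (g t) \<le> norm (indicator {1..1+\<epsilon>} t :: real)"
    using g_le g_nonneg by (auto simp: abs_of_nonneg)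
qed simp

definition c where "c = (LINT t|lborel. g t)"

lemma c_pos: "c > 0"
proof -
  have "c \<noteq> 0"
  proof
    assume "c = 0"
    then have "AE t in lborel. g t = 0"
      unfolding c_def using integral_nonneg_eq_0_iff_AE[OF g_int] g_nonneg by auto
    then have "AE t in lborel. t \<notin> {1<..<1+\<epsilon>}"
      by eventually_elim (use g_pos in fastforce)
    then have "emeasure lborel {1<..<1+\<epsilon>} = 0"
      by (subst (asm) AE_iff_measurable[OF _ refl]) (auto simp: greaterThanLessThan_def greaterThan_def lessThan_def Int_def)
    then show False using \<epsilon> by simp
  qed
  moreover have "c \<ge> 0" unfolding c_def using g_nonneg by (intro integral_nonneg_AE) auto
  ultimately show ?thesis by simp
qed

text \<open>On the support of \<open>g\<close> the factor \<open>t powr (\<rho> - 1)\<close> lies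
  between \<open>(1 + \<epsilon>) powr (\<rho> - 1)\<close> and 1, because \<rho> \<le> 1.\<close>

lemma Il_bump: "(1 + \<epsilon>) powr (\<rho> - 1) / Gamma \<rho> * c \<le> Il bump" "Il bump \<le> c / Gamma \<rho>"
proof -
  have G: "Gamma \<rho> > 0" using \<rho> by simp
  have i: "integrable lborel (\<lambda>t. g t * (indicator {1..1+\<epsilon>} t * gamma_dens \<rho> t))"
  proof (rule Bochner_Integration.integrable_bound[OF integrable_mult_right[OF g_int, of "1 / Gamma \<rho>"]])
    show "AE x in lborel. norm (g x * (indicator {1..1 + \<epsilon>} x * gamma_dens \<rho> x)) \<le> norm (1 / Gamma \<rho> * g x)"
    proof (rule AE_I2)
      fix t :: real
      have "t powr (\<rho> - 1) \<le> 1" if "1 \<le> t" using powr_mono[of "\<rho> - 1" 0 t] that \<rho> by simp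
      then have "\<bar>g t\<bar> * \<bar>indicator {1..1 + \<epsilon>} t * gamma_dens \<rho> t\<bar> \<le> \<bar>g t\<bar> * (1 / Gamma \<rho>)"
        using G by (intro mult_left_mono) (auto simp: gamma_dens_def indicator_def divide_right_mono)
      then show "norm (g t * (indicator {1..1 + \<epsilon>} t * gamma_dens \<rho> t)) \<le> norm (1 / Gamma \<rho> * g t)"
        using G by (simp add: abs_mult abs_divide)
    qed
  qed simp
  have eq: "Il bump = (LINT t|lborel. g t * (indicator {1..1+\<epsilon>} t * gamma_dens \<rho> t))"
    unfolding Il_def using g_supp by (intro Bochner_Integration.integral_cong) (fastforce simp: indicator_def g_def)+
  show "Il bump \<le> c / Gamma \<rho>"
  proof -
    have "Il bump \<le> (LINT t|lborel. 1 / Gamma \<rho> * g t)" unfolding eq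
    proof (intro integral_mono i integrable_mult_right g_int)
      fix t :: real
      have "t powr (\<rho> - 1) \<le> 1" if "1 \<le> t" using powr_mono[of "\<rho> - 1" 0 t] that \<rho> by simp
      then show "g t * (indicator {1..1 + \<epsilon>} t * gamma_dens \<rho> t) \<le> 1 / Gamma \<rho> * g t"
        using g_nonneg[of t] G by (auto simp: indicator_def gamma_dens_def field_simps intro!: mult_left_le)
    qed
    then show ?thesis by (simp add: c_def)
  qed
  show "(1 + \<epsilon>) powr (\<rho> - 1) / Gamma \<rho> * c \<le> Il bump"
  proof -
    have "(LINT t|lborel. (1 + \<epsilon>) powr (\<rho> - 1) / Gamma \<rho> * g t) \<le> Il bump" unfolding eq
    proof (intro integral_mono i integrable_mult_right g_int)
      fix t :: real
      show "(1 + \<epsilon>) powr (\<rho> - 1) / Gamma \<rho> * g t \<le> g t * (indicator {1..1 + \<epsilon>} t * gamma_dens \<rho> t)"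
      proof (cases "g t = 0")
        case False
        then have t: "1 \<le> t" "t \<le> 1 + \<epsilon>" using g_supp by auto
        then have "(1 + \<epsilon>) powr (\<rho> - 1) \<le> t powr (\<rho> - 1)" using \<rho> by (intro powr_mono2') auto
        then show ?thesis using t g_nonneg[of t] G by (auto simp: gamma_dens_def field_simps intro!: mult_left_mono)
      qed simp
    qed
    then show ?thesis by (simp add: c_def)
  qed
qed

text \<open>The stretched bump sits on [T, T * (1 + \<epsilon>)] and has mass \<open>T * c\<close>;
  there the antitone f is caught between its values at the two ends.\<close>

lemma squeeze:
  assumes "T > 0"
  shows "T * c * f (T * (1 + \<epsilon>)) \<le> (LINT t|lborel. g (1 / T * t) * F t)" "(LINT t|lborel. g (1 / T * t) * F t) \<le> T * c * f T"
proof -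
  have hb: "has_bochner_integral lborel (\<lambda>t. g (0 + 1 / T * t)) (c /\<^sub>R \<bar>1 / T\<bar>)"
    using lborel_has_bochner_integral_real_affine_iff[of "1 / T" g c 0] assms g_int
    by (simp add: has_bochner_integral_iff c_def)
  then have gi: "integrable lborel (\<lambda>t. g (1 / T * t))" and gv: "(LINT t|lborel. g (1 / T * t)) = T * c"
    using assms by (auto simp: has_bochner_integral_iff)
  have bd: "f (T * (1 + \<epsilon>)) * g (1 / T * t) \<le> g (1 / T * t) * F t" "g (1 / T * t) * F t \<le> f T * g (1 / T * t)" for t
  proof -
    have "f (T * (1 + \<epsilon>)) * g (1 / T * t) \<le> g (1 / T * t) * F t \<and> g (1 / T * t) * F t \<le> f T * g (1 / T * t)"
    proof (cases "g (1 / T * t) = 0")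
      case False
      then have "1 \<le> 1 / T * t" "1 / T * t \<le> 1 + \<epsilon>" using g_supp by blast+
      then have t: "T \<le> t" "t \<le> T * (1 + \<epsilon>)" using assms by (auto simp: field_simps)
      then have "f t \<le> f T" "f (T * (1 + \<epsilon>)) \<le> f t" using assms by (auto intro!: mono)
      then show ?thesis using t assms g_nonneg[of "1 / T * t"] by (simp add: F_def mult.commute[of _ "g (t / T)"] mult_left_mono)
    qed simp
    then show "f (T * (1 + \<epsilon>)) * g (1 / T * t) \<le> g (1 / T * t) * F t" "g (1 / T * t) * F t \<le> f T * g (1 / T * t)" by auto
  qed
  have i: "integrable lborel (\<lambda>t. g (1 / T * t) * F t)"
    by (rule Bochner_Integration.integrable_bound[OF integrable_mult_right[OF gi, of "f T"]])
      (use bd(2) g_nonneg F_nonneg nonneg[of T] assms in \<open>auto simp: abs_mult\<close>)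
  show "T * c * f (T * (1 + \<epsilon>)) \<le> (LINT t|lborel. g (1 / T * t) * F t)"
    using integral_mono[OF integrable_mult_right[OF gi, of "f (T * (1 + \<epsilon>))"] i bd(1)] gv by (simp add: mult_ac)
  show "(LINT t|lborel. g (1 / T * t) * F t) \<le> T * c * f T"
    using integral_mono[OF i integrable_mult_right[OF gi, of "f T"] bd(2)] gv by (simp add: mult_ac)
qed

lemma at_right_inv: "filterlim (\<lambda>T. k / T) (at_right 0) at_top" if "k > 0" for k :: real
  unfolding filterlim_at using that
  by (auto intro!: tendsto_divide_0[OF tendsto_const] filterlim_ident filterlim_at_top_imp_at_infinity eventually_mono[OF eventually_gt_at_top[of 0]])

text \<open>A bump starting at T bounds \<open>f T\<close> from below, a bump ending at T bounds it
  from above.\<close>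

lemma near:
  assumes "\<delta> > 0"
  shows "eventually (\<lambda>T. (1 + \<epsilon>) powr (\<rho> - 1) / Gamma \<rho> - \<delta> < T * f T / w (1 / T)) at_top"
    "eventually (\<lambda>T. T * f T / w (1 / T) < (1 + \<epsilon>) powr (1 - \<rho>) / Gamma \<rho> + \<delta>) at_top"
proof -
  have lim: "((\<lambda>l. Ir bump l / c) \<longlongrightarrow> Il bump / c) (at_right 0)"
    using c_pos by (intro tendsto_divide Ir_cont bump_cont) auto
  have Ir_eq: "Ir bump (1 / T) = (LINT t|lborel. g (1 / T * t) * F t) / w (1 / T)" for T
    by (simp add: Ir_def g_def)
  show "eventually (\<lambda>T. (1 + \<epsilon>) powr (\<rho> - 1) / Gamma \<rho> - \<delta> < T * f T / w (1 / T)) at_top"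
  proof -
    have "(1 + \<epsilon>) powr (\<rho> - 1) / Gamma \<rho> \<le> Il bump / c"
      using Il_bump(1) c_pos by (simp add: le_divide_eq)
    then have "(1 + \<epsilon>) powr (\<rho> - 1) / Gamma \<rho> - \<delta> < Il bump / c" using assms by simp
    from order_tendstoD(1)[OF filterlim_compose[OF lim at_right_inv[of 1]] this]
    have "eventually (\<lambda>T. (1 + \<epsilon>) powr (\<rho> - 1) / Gamma \<rho> - \<delta> < Ir bump (1 / T) / c) at_top" by simp
    moreover have "eventually (\<lambda>T. w (1 / T) > 0) at_top"
      using filterlim_iff[THEN iffD1, OF at_right_inv[of 1], rule_format, OF _ wpos] by simp
    ultimately show ?thesis using eventually_gt_at_top[of 0]
    proof eventually_elim
      case (elim T)
      have "Ir bump (1 / T) / c \<le> T * f T / w (1 / T)"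
        using squeeze(2)[OF elim(3)] elim c_pos by (simp add: Ir_eq field_simps)
      with elim show ?case by simp
    qed
  qed
  show "eventually (\<lambda>T. T * f T / w (1 / T) < (1 + \<epsilon>) powr (1 - \<rho>) / Gamma \<rho> + \<delta>) at_top"
  proof -
    \<comment> \<open>The bump at scale \<open>T / ?k\<close> ends at T. Moving the scale costs
      \<open>?k * ?k powr - \<rho> = ?k powr (1 - \<rho>)\<close> by regular variation of
      \<open>w\<close>.\<close>
    let ?k = "1 + \<epsilon>"
    have k: "?k > 0" using \<epsilon> by simp
    have l1: "((\<lambda>T. ?k * (Ir bump (?k / T) / c) * (w (?k * (1 / T)) / w (1 / T))) \<longlongrightarrow> ?k * (Il bump / c) * ?k powr - \<rho>) at_top"
      by (intro tendsto_mult tendsto_const filterlim_compose[OF lim at_right_inv[OF k]]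
          filterlim_compose[OF rv[OF k] at_right_inv[of 1]]) simp
    have "?k * (Il bump / c) * ?k powr - \<rho> \<le> ?k * (1 / Gamma \<rho>) * ?k powr - \<rho>"
      using Il_bump(2) c_pos k by (intro mult_right_mono mult_left_mono) (auto simp: divide_le_eq mult.commute)
    also have "\<dots> = ?k powr (1 - \<rho>) / Gamma \<rho>"
      using k by (simp add: powr_diff powr_minus field_simps)
    finally have "?k * (Il bump / c) * ?k powr - \<rho> < ?k powr (1 - \<rho>) / Gamma \<rho> + \<delta>" using assms by simp
    from order_tendstoD(2)[OF l1 this]
    have "eventually (\<lambda>T. ?k * (Ir bump (?k / T) / c) * (w (?k * (1 / T)) / w (1 / T)) < ?k powr (1 - \<rho>) / Gamma \<rho> + \<delta>) at_top" .
    moreover have "eventually (\<lambda>T. w (1 / T) > 0) at_top"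
      using filterlim_iff[THEN iffD1, OF at_right_inv[of 1], rule_format, OF _ wpos] by simp
    moreover have "eventually (\<lambda>T. w (?k / T) > 0) at_top"
      using filterlim_iff[THEN iffD1, OF at_right_inv[OF k], rule_format, OF wpos] by simp
    ultimately show ?thesis using eventually_gt_at_top[of 0]
    proof eventually_elim
      case (elim T)
      have T: "T / ?k > 0" using elim k by simp
      have "T / ?k * c * f T \<le> Ir bump (?k / T) * w (?k / T)"
        using squeeze(1)[OF T] k elim Ir_eq[of "T / ?k"] by simp
      then have "T * f T / w (1 / T) \<le> ?k * (Ir bump (?k / T) / c) * (w (?k * (1 / T)) / w (1 / T))"
        using k c_pos elim by (simp add: field_simps)
      with elim show ?case by simp
    qed
  qed
qed

end

text \<open>The two constants of \<open>near\<close> meet at \<open>1 / Gamma \<rho>\<close> when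
  \<epsilon> tends to 0.\<close>

theorem tauberian: "((\<lambda>T. T * f T / w (1 / T)) \<longlongrightarrow> 1 / Gamma \<rho>) at_top"
proof (rule tendstoI)
  fix e :: real assume e: "e > 0"
  have l: "((\<lambda>\<epsilon>. (1 + \<epsilon>) powr \<alpha> / Gamma \<rho>) \<longlongrightarrow> 1 / Gamma \<rho>) (at_right 0)" for \<alpha>
    using \<rho> by (auto intro!: tendsto_eq_intros simp: Gamma_eq_zero_iff nonpos_Ints_def)
  have "eventually (\<lambda>\<epsilon>. dist ((1 + \<epsilon>) powr (\<rho> - 1) / Gamma \<rho>) (1 / Gamma \<rho>) < e / 2
     \<and> dist ((1 + \<epsilon>) powr (1 - \<rho>) / Gamma \<rho>) (1 / Gamma \<rho>) < e / 2 \<and> \<epsilon> > 0) (at_right 0)"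
    using tendstoD[OF l, of "e/2"] e by (intro eventually_conj) (auto simp: eventually_at_filter)
  then obtain \<epsilon> where \<epsilon>: "dist ((1 + \<epsilon>) powr (\<rho> - 1) / Gamma \<rho>) (1 / Gamma \<rho>) < e / 2"
     "dist ((1 + \<epsilon>) powr (1 - \<rho>) / Gamma \<rho>) (1 / Gamma \<rho>) < e / 2" "\<epsilon> > 0"
    using eventually_happens'[OF trivial_limit_at_right_real] by blast
  show "eventually (\<lambda>T. dist (T * f T / w (1 / T)) (1 / Gamma \<rho>) < e) at_top"
    using near(1)[OF \<epsilon>(3) half_gt_zero[OF e]] near(2)[OF \<epsilon>(3) half_gt_zero[OF e]]
  proof eventually_elim
    case (elim T)
    have aux: "\<bar>X - G\<bar> < e" if "A - e/2 < X" "X < B + e/2" "\<bar>A - G\<bar> < e/2" "\<bar>B - G\<bar> < e/2" for X A B G :: real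
      using that unfolding abs_less_iff by (auto simp: field_simps)
    show ?case unfolding dist_real_def
      by (rule aux[OF elim \<epsilon>(1,2)[unfolded dist_real_def]])
  qed
qed

end

section \<open>The law of the hitting times\<close>

locale walk =
  fixes a :: "int^'n \<Rightarrow> real"
  assumes adm: "admissible a"
begin

abbreviation "r \<equiv> rate a"

lemma r_pos: "r > 0" using adm by (simp add: rate_def admissible_def)
lemma a_nonneg: "z \<noteq> 0 \<Longrightarrow> a z \<ge> 0" using adm by (simp add: admissible_def)
lemma a_has_sum: "(a has_sum 0) UNIV" using adm by (simp add: admissible_def)
lemma a_sym: "a (- z) = a z" using adm by (simp add: admissible_def)

definition b :: "int^'n \<Rightarrow> real" where "b z = (if z = 0 then 0 else a z / r)"

lemma b_nonneg: "b z \<ge> 0" using r_pos a_nonneg by (simp add: b_def)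
lemma b_sym: "b (- z) = b z" by (simp add: b_def a_sym)

lemma b_has_sum: "(b has_sum 1) UNIV"
proof -
  have "((\<lambda>z. a z / r) has_sum 0 / r) UNIV"
    using has_sum_cmult_left[OF a_has_sum, of "1 / r"] by simp
  moreover have "((\<lambda>z. if z \<in> {0} then - a 0 / r else 0) has_sum (- a 0 / r)) UNIV"
    by (rule has_sum_finite_neutralI[where B = "{0}"]) auto
  ultimately have "((\<lambda>z. a z / r + (if z \<in> {0} then - a 0 / r else 0)) has_sum (0 / r + - a 0 / r)) UNIV"
    by (rule has_sum_add)
  also have "(\<lambda>z. a z / r + (if z \<in> {0} then - a 0 / r else 0)) = b"
    by (auto simp: b_def fun_eq_iff)
  also have "0 / r + - a 0 / r = 1" using r_pos by (simp add: rate_def)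
  finally show ?thesis .
qed

lemma nn_integral_b: "(\<integral>\<^sup>+z. ennreal (b z) \<partial>count_space UNIV) = 1"
proof -
  have s: "b summable_on UNIV" using b_has_sum by (auto simp: summable_on_def)
  then have as: "Infinite_Sum.abs_summable_on b UNIV" using b_nonneg by (simp add: abs_of_nonneg)
  then have i: "integrable (count_space UNIV) b"
    unfolding abs_summable_equivalent Infinite_Set_Sum.abs_summable_on_def .
  have "infsetsum b UNIV = 1"
    using infsetsum_infsum[OF as[unfolded abs_summable_equivalent]] infsumI[OF b_has_sum] by simp
  then show ?thesis
    using nn_integral_eq_integral[OF i] b_nonneg by (simp add: infsetsum_def)
qed

definition J :: "(int^'n) pmf" where "J = embed_pmf b"

lemma pmf_J: "pmf J z = b z"
  unfolding J_def by (rule pmf_embed_pmf[OF b_nonneg nn_integral_b])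

lemma jump_measure_eq: "jump_measure a = measure_pmf J"
  unfolding jump_measure_def measure_pmf_eq_density by (auto simp: pmf_J b_def intro!: density_cong)

abbreviation "hold \<equiv> hold_measure a"

lemma prob_hold: "prob_space hold"
  unfolding hold_measure_def using r_pos by (rule prob_space_exponential_density)

lemma sets_hold[measurable_cong]: "sets hold = sets borel" by (simp add: hold_measure_def)
lemma space_hold[simp]: "space hold = UNIV" by (simp add: hold_measure_def)

section \<open>The path space and its decomposition at the first step\<close>

abbreviation "M1 \<equiv> hold \<Otimes>\<^sub>M measure_pmf J"

sublocale hold: prob_space hold by (rule prob_hold)
sublocale step: pair_prob_space hold "measure_pmf J" by unfold_locales
sublocale seq: sequence_space M1 by unfold_locales

abbreviation "Om \<equiv> Omega a"

lemma Omega_eq: "Om = Pi\<^sub>M UNIV (\<lambda>_. M1)" by (simp add: Omega_def jump_measure_eq)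

sublocale om: prob_space Om unfolding Omega_eq by unfold_locales

lemma space_Omega[simp]: "space Om = UNIV"
  by (simp add: Omega_eq space_PiM space_pair_measure PiE_def extensional_def)

lemma meas_comp: "(\<lambda>\<omega>. \<omega> k) \<in> measurable Om M1" unfolding Omega_eq by measurable

lemma meas_fst: "(\<lambda>\<omega>. fst (\<omega> k)) \<in> borel_measurable Om"
proof -
  have "fst \<in> measurable M1 borel" using measurable_fst[of hold "measure_pmf J"] by (simp cong: measurable_cong_sets add: sets_hold)
  from measurable_compose[OF meas_comp this] show ?thesis by simp
qed

lemma meas_snd: "(\<lambda>\<omega>. snd (\<omega> k)) \<in> measurable Om (count_space UNIV)"
proof -
  have "snd \<in> measurable M1 (count_space UNIV)" using measurable_snd[of hold "measure_pmf J"] by (simp cong: measurable_cong_sets)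
  from measurable_compose[OF meas_comp this] show ?thesis by simp
qed

lemma meas_jtime[measurable]: "(\<lambda>\<omega>. jtime \<omega> n) \<in> borel_measurable Om"
  unfolding jtime_def by (intro borel_measurable_sum meas_fst)

lemma meas_jpos[measurable]: "(\<lambda>\<omega>. jpos x \<omega> n) \<in> measurable Om (count_space UNIV)"
proof (induction n)
  case (Suc n)
  have "(\<lambda>\<omega>. (\<lambda>u \<omega>. u + snd (\<omega> n)) (jpos x \<omega> n) \<omega>) \<in> measurable Om (count_space UNIV)"
  proof (rule measurable_compose_countable[where f = "\<lambda>u \<omega>. u + snd (\<omega> n)", OF _ Suc])
    fix u :: "int^'n"
    show "(\<lambda>\<omega>. u + snd (\<omega> n)) \<in> measurable Om (count_space UNIV)"
      by (rule measurable_compose[OF meas_snd]) simp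
  qed
  then show ?case by (simp add: jpos_def add.assoc)
qed (simp add: jpos_def)

lemma jtime_case_nat: "jtime (case_nat s \<omega>) (Suc n) = fst s + jtime \<omega> n"
  by (simp add: jtime_def sum.lessThan_Suc_shift del: sum.lessThan_Suc)

lemma jpos_case_nat: "jpos x (case_nat s \<omega>) (Suc n) = jpos (x + snd s) \<omega> n"
  by (simp add: jpos_def sum.lessThan_Suc_shift add.assoc del: sum.lessThan_Suc)

lemma jpos_0[simp]: "jpos x \<omega> 0 = x" by (simp add: jpos_def)
lemma jtime_0[simp]: "jtime \<omega> 0 = 0" by (simp add: jtime_def)

text \<open>Prepending an independent step to a path preserves the product law. This is the Markov
  property in the form used here: the laws of \<open>Ev\<close> and \<open>Fv\<close> are computed
  by conditioning on the first pair of holding time and jump.\<close>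

lemma emeasure_step:
  assumes A: "A \<in> sets Om"
  shows "emeasure Om A = (\<integral>\<^sup>+s. \<integral>\<^sup>+w. emeasure Om {\<omega>. case_nat (s, w) \<omega> \<in> A} \<partial>measure_pmf J \<partial>hold)"
proof -
  have A': "A \<in> sets seq.S" using A by (simp add: Omega_eq)
  have m: "(\<lambda>(s, \<omega>). case_nat s \<omega>) \<in> measurable (M1 \<Otimes>\<^sub>M seq.S) seq.S" by measurable
  have "emeasure Om A = emeasure (distr (M1 \<Otimes>\<^sub>M seq.S) seq.S (\<lambda>(s, \<omega>). case_nat s \<omega>)) A"
    by (simp add: seq.PiM_iter Omega_eq)
  also have "\<dots> = (\<integral>\<^sup>+u. indicator A u \<partial>distr (M1 \<Otimes>\<^sub>M seq.S) seq.S (\<lambda>(s, \<omega>). case_nat s \<omega>))"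
    using A' by (intro nn_integral_indicator[symmetric]) simp
  also have "\<dots> = (\<integral>\<^sup>+q. indicator A (case_nat (fst q) (snd q)) \<partial>(M1 \<Otimes>\<^sub>M seq.S))"
    using A' by (subst nn_integral_distr[OF m]) (auto simp: case_prod_unfold)
  also have "\<dots> = (\<integral>\<^sup>+s. \<integral>\<^sup>+\<omega>. indicator A (case_nat s \<omega>) \<partial>seq.S \<partial>M1)"
    using A' m by (subst seq.P.nn_integral_fst[symmetric]) (auto simp: case_prod_unfold)
  also have "\<dots> = (\<integral>\<^sup>+s. emeasure Om {\<omega>. case_nat s \<omega> \<in> A} \<partial>M1)"
  proof (intro nn_integral_cong)
    fix s assume "s \<in> space M1"
    then have "case_nat s \<in> measurable seq.S seq.S" by measurable
    then have "{\<omega> \<in> space seq.S. case_nat s \<omega> \<in> A} \<in> sets seq.S"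
      using measurable_sets[OF _ A', of "case_nat s" seq.S] by (simp add: vimage_def Int_def conj_commute)
    then have "{\<omega>. case_nat s \<omega> \<in> A} \<in> sets Om" using space_Omega by (simp add: Omega_eq)
    moreover have "indicator A (case_nat s \<omega>) = (indicator {\<omega>. case_nat s \<omega> \<in> A} \<omega> :: ennreal)" for \<omega> by (simp add: indicator_def)
    ultimately show "(\<integral>\<^sup>+\<omega>. indicator A (case_nat s \<omega>) \<partial>seq.S) = emeasure Om {\<omega>. case_nat s \<omega> \<in> A}"
      by (simp add: Omega_eq)
  qed
  also have "\<dots> = (\<integral>\<^sup>+s. \<integral>\<^sup>+w. emeasure Om {\<omega>. case_nat (s, w) \<omega> \<in> A} \<partial>measure_pmf J \<partial>hold)"
  proof (subst measure_pmf.nn_integral_fst)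
    have "(\<lambda>s. \<integral>\<^sup>+\<omega>. indicator A (case_nat s \<omega>) \<partial>seq.S) \<in> borel_measurable M1"
      using A' m by (intro seq.P.borel_measurable_nn_integral_fst[of "\<lambda>q. indicator A (case_nat (fst q) (snd q))", simplified]) (auto simp: case_prod_unfold)
    moreover have "(\<integral>\<^sup>+\<omega>. indicator A (case_nat s \<omega>) \<partial>seq.S) = emeasure Om {\<omega>. case_nat s \<omega> \<in> A}" if "s \<in> space M1" for s
    proof -
      have "case_nat s \<in> measurable seq.S seq.S" using that by measurable
      then have "{\<omega> \<in> space seq.S. case_nat s \<omega> \<in> A} \<in> sets seq.S"
      using measurable_sets[OF _ A', of "case_nat s" seq.S] by (simp add: vimage_def Int_def conj_commute)
      then have "{\<omega>. case_nat s \<omega> \<in> A} \<in> sets Om" using space_Omega by (simp add: Omega_eq)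
      moreover have "indicator A (case_nat s \<omega>) = (indicator {\<omega>. case_nat s \<omega> \<in> A} \<omega> :: ennreal)" for \<omega> by (simp add: indicator_def)
      ultimately show ?thesis by (simp add: Omega_eq)
    qed
    ultimately show "(\<lambda>s. emeasure Om {\<omega>. case_nat s \<omega> \<in> A}) \<in> borel_measurable M1"
      by (simp cong: measurable_cong)
  qed simp
  finally show ?thesis .
qed

text \<open>The chain killed on leaving Z: it must be at y after n jumps with no visit to Z at the
  times 0, ..., n - 1, while the endpoint itself may lie in Z. Empty Z gives the n-step transition
  probabilities, Z = {y, z} gives first passage.\<close>

primrec hit :: "(int^'n) set \<Rightarrow> int^'n \<Rightarrow> nat \<Rightarrow> int^'n \<Rightarrow> real" where
  "hit Z y 0 x = (if x = y then 1 else 0)"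
| "hit Z y (Suc n) x = (if x \<in> Z then 0 else measure_pmf.expectation J (\<lambda>v. hit Z y n (x + v)))"

lemma hit_bounds: "0 \<le> hit Z y n x \<and> hit Z y n x \<le> 1"
proof (induction n arbitrary: x)
  case (Suc n)
  have "measure_pmf.expectation J (\<lambda>v. hit Z y n (x + v)) \<le> 1"
    using Suc by (intro measure_pmf.integral_le_const measure_pmf.integrable_const_bound[where B = 1]) auto
  with Suc show ?case by (auto intro!: integral_nonneg_AE)
qed simp

lemma hit_nonneg: "0 \<le> hit Z y n x" and hit_le_1: "hit Z y n x \<le> 1"
  using hit_bounds by auto

lemma integrable_J_bounded: "(\<And>v. \<bar>f v\<bar> \<le> B) \<Longrightarrow> integrable (measure_pmf J) (f :: _ \<Rightarrow> real)"
  by (rule measure_pmf.integrable_const_bound[where B = B]) auto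

lemma nn_integral_J_hit: "(\<integral>\<^sup>+v. ennreal (hit Z y n (x + v)) \<partial>measure_pmf J) = ennreal (measure_pmf.expectation J (\<lambda>v. hit Z y n (x + v)))"
  by (intro nn_integral_eq_integral integrable_J_bounded[where B = 1]) (auto simp: abs_of_nonneg hit_nonneg hit_le_1)

definition Ev :: "(int^'n) set \<Rightarrow> int^'n \<Rightarrow> nat \<Rightarrow> int^'n \<Rightarrow> (nat \<Rightarrow> real \<times> (int^'n)) \<Rightarrow> bool" where
  "Ev Z y l x \<omega> \<longleftrightarrow> jpos x \<omega> l = y \<and> (\<forall>m<l. jpos x \<omega> m \<notin> Z)"

lemma Ev_case_nat: "Ev Z y (Suc l) x (case_nat s \<omega>) \<longleftrightarrow> x \<notin> Z \<and> Ev Z y l (x + snd s) \<omega>"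
  unfolding Ev_def by (auto simp: less_Suc_eq_0_disj jpos_case_nat)

lemma meas_Ev[measurable]: "Measurable.pred Om (Ev Z y l x)"
  unfolding Ev_def[abs_def] by measurable

text \<open>Distribution function of the n-th jump time: a point mass at 0 for n = 0, an Erlang law
  with n stages otherwise.\<close>

definition Er :: "nat \<Rightarrow> real \<Rightarrow> ennreal" where
  "Er n t = (case n of 0 \<Rightarrow> indicator {0..} t | Suc k \<Rightarrow> ennreal (erlang_CDF k r t))"

text \<open>One more exponential waiting time adds a stage to the Erlang law. The double integral is
  exchanged so that the densities can be convolved first and integrated up to t afterwards.\<close>

lemma Er_Suc: "(\<integral>\<^sup>+s. Er n (t - s) \<partial>hold) = Er (Suc n) t"
proof (cases n)
  case 0
  have "(\<integral>\<^sup>+s. Er n (t - s) \<partial>hold) = (\<integral>\<^sup>+s. ennreal (erlang_density 0 r s) * indicator {..t} s \<partial>lborel)"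
    unfolding hold_measure_def by (subst nn_integral_density) (auto simp: 0 Er_def intro!: nn_integral_cong split: split_indicator)
  then show ?thesis using nn_integral_erlang_density[of r 0 t] r_pos 0 by (simp add: Er_def)
next
  case (Suc k)
  have mm: "(\<lambda>x. Er n (t - x)) \<in> borel_measurable borel"
    unfolding Er_def Suc erlang_CDF_def by simp
  have "(\<integral>\<^sup>+s. Er n (t - s) \<partial>hold) = (\<integral>\<^sup>+s. ennreal (erlang_density 0 r s) * Er n (t - s) \<partial>lborel)"
    unfolding hold_measure_def using mm by (subst nn_integral_density) auto
  also have "\<dots> = (\<integral>\<^sup>+s. \<integral>\<^sup>+v. ennreal (erlang_density 0 r s) * (ennreal (erlang_density k r (v - s)) * indicator {..t} v) \<partial>lborel \<partial>lborel)"
  proof (intro nn_integral_cong)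
    fix s :: real
    have "Er n (t - s) = (\<integral>\<^sup>+v. ennreal (erlang_density k r v) * indicator {..t - s} v \<partial>lborel)"
      using nn_integral_erlang_density[of r k "t - s"] r_pos Suc by (simp add: Er_def)
    also have "\<dots> = (\<integral>\<^sup>+v. ennreal (erlang_density k r (- s + 1 * v)) * indicator {..t - s} (- s + 1 * v) \<partial>lborel)"
      by (subst nn_integral_real_affine[where c = 1 and t = "- s"]) auto
    also have "\<dots> = (\<integral>\<^sup>+v. ennreal (erlang_density k r (v - s)) * indicator {..t} v \<partial>lborel)"
      by (intro nn_integral_cong) (auto split: split_indicator)
    finally show "ennreal (erlang_density 0 r s) * Er n (t - s) = (\<integral>\<^sup>+v. ennreal (erlang_density 0 r s) * (ennreal (erlang_density k r (v - s)) * indicator {..t} v) \<partial>lborel)"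
      by (simp add: nn_integral_cmult)
  qed
  also have "\<dots> = (\<integral>\<^sup>+v. \<integral>\<^sup>+s. ennreal (erlang_density 0 r s) * (ennreal (erlang_density k r (v - s)) * indicator {..t} v) \<partial>lborel \<partial>lborel)"
    by (intro lborel_pair.Fubini') measurable
  also have "\<dots> = (\<integral>\<^sup>+v. (\<integral>\<^sup>+s. ennreal (erlang_density k r (v - s)) * ennreal (erlang_density 0 r s) \<partial>lborel) * indicator {..t} v \<partial>lborel)"
    by (intro nn_integral_cong) (subst nn_integral_multc[symmetric], auto simp: mult_ac)
  also have "\<dots> = (\<integral>\<^sup>+v. ennreal (erlang_density (Suc k) r v) * indicator {..t} v \<partial>lborel)"
    using fun_cong[OF convolution_erlang_density[OF r_pos, of k 0]] by simp
  also have "\<dots> = Er (Suc n) t"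
    using nn_integral_erlang_density[of r "Suc k" t] r_pos Suc by (simp add: Er_def)
  finally show ?thesis .
qed

lemma Er_meas: "(\<lambda>s. Er n (t - s)) \<in> borel_measurable hold"
  by (cases n) (auto simp: Er_def erlang_CDF_def measurable_cong_sets[OF sets_hold refl])

lemma sets_EvT: "{\<omega>. jtime \<omega> n \<le> t \<and> Ev Z y l x \<omega>} \<in> sets Om"
proof -
  have "{\<omega>\<in>space Om. jtime \<omega> n \<le> t \<and> Ev Z y l x \<omega>} \<in> sets Om" by measurable
  then show ?thesis by simp
qed

text \<open>Clock and jump chain are independent, hence the product form. The clock may be read at a
  later index than the chain (the premise l \<le> n follows below): \<open>p_sums\<close> compares
  the clock at n and n + 1 while the position stays at n.\<close>

lemma emeasure_Ev:
  "l \<le> n \<Longrightarrow> emeasure Om {\<omega>. jtime \<omega> n \<le> t \<and> Ev Z y l x \<omega>} = Er n t * ennreal (hit Z y l x)"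
proof (induction n arbitrary: l x t Z y)
  case 0
  then show ?case using om.emeasure_space_1 by (auto simp: Ev_def Er_def indicator_def)
next
  case (Suc n)
  have int: "(\<integral>\<^sup>+s. \<integral>\<^sup>+w. Er n (t - s) * ennreal (h w) \<partial>measure_pmf J \<partial>hold) = Er (Suc n) t * (\<integral>\<^sup>+w. ennreal (h w) \<partial>measure_pmf J)" for h :: "int^'n \<Rightarrow> real"
    using Er_meas by (simp add: nn_integral_cmult nn_integral_multc Er_Suc)
  show ?case
  proof (cases l)
    case 0
    \<comment> \<open>With l = 0 and start equal to target the event \<open>Ev\<close> is vacuous,
      which isolates the law of the clock.\<close>
    have *: "emeasure Om {\<omega>. jtime \<omega> n \<le> t} = Er n t" for t
      using Suc.IH[of 0 t "{}" 0 0] by (simp add: Ev_def)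
    have "emeasure Om {\<omega>. jtime \<omega> (Suc n) \<le> t \<and> Ev {} x 0 x \<omega>} = (\<integral>\<^sup>+s. \<integral>\<^sup>+w. Er n (t - s) * ennreal 1 \<partial>measure_pmf J \<partial>hold)"
    proof (subst emeasure_step[OF sets_EvT], intro nn_integral_cong)
      fix s w
      have "{\<omega>. case_nat (s, w) \<omega> \<in> {\<omega>. jtime \<omega> (Suc n) \<le> t \<and> Ev {} x 0 x \<omega>}} = {\<omega>. jtime \<omega> n \<le> t - s}"
        by (auto simp: Ev_def jtime_case_nat)
      then show "emeasure Om {\<omega>. case_nat (s, w) \<omega> \<in> {\<omega>. jtime \<omega> (Suc n) \<le> t \<and> Ev {} x 0 x \<omega>}} = Er n (t - s) * ennreal 1"
        by (simp add: *)
    qed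
    then have "emeasure Om {\<omega>. jtime \<omega> (Suc n) \<le> t} = Er (Suc n) t"
      unfolding int by (simp add: Ev_def)
    then show ?thesis using 0 by (auto simp: Ev_def)
  next
    case (Suc l')
    have "emeasure Om {\<omega>. case_nat (s, w) \<omega> \<in> {\<omega>. jtime \<omega> (Suc n) \<le> t \<and> Ev Z y l x \<omega>}}
      = Er n (t - s) * ennreal (if x \<in> Z then 0 else hit Z y l' (x + w))" for s w
    proof -
      have "{\<omega>. case_nat (s, w) \<omega> \<in> {\<omega>. jtime \<omega> (Suc n) \<le> t \<and> Ev Z y l x \<omega>}}
        = (if x \<in> Z then {} else {\<omega>. jtime \<omega> n \<le> t - s \<and> Ev Z y l' (x + w) \<omega>})"
        by (auto simp: Suc Ev_case_nat jtime_case_nat)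
      then show ?thesis using Suc.IH[of l' "t - s" Z y "x + w"] Suc Suc.prems by auto
    qed
    then have "emeasure Om {\<omega>. jtime \<omega> (Suc n) \<le> t \<and> Ev Z y l x \<omega>}
      = Er (Suc n) t * (\<integral>\<^sup>+w. ennreal (if x \<in> Z then 0 else hit Z y l' (x + w)) \<partial>measure_pmf J)"
      by (subst emeasure_step[OF sets_EvT]) (simp add: int)
    also have "(\<integral>\<^sup>+w. ennreal (if x \<in> Z then 0 else hit Z y l' (x + w)) \<partial>measure_pmf J) = ennreal (hit Z y l x)"
      by (simp add: Suc nn_integral_J_hit)
    finally show ?thesis .
  qed
qed

text \<open>Indexing: \<open>fh y z n x\<close> refers to a first visit at the jump number \<open>n + 1\<close>.\<close>

definition fh :: "int^'n \<Rightarrow> int^'n \<Rightarrow> nat \<Rightarrow> int^'n \<Rightarrow> real" where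
  "fh y z n x = measure_pmf.expectation J (\<lambda>v. hit {y, z} y n (x + v))"

text \<open>The position before the first jump is unconstrained, since \<open>tau_yz\<close> looks
  only at times from the first jump on. Earlier visits to y are excluded as well as visits to z, so
  that the events are disjoint in n.\<close>

definition Fv :: "int^'n \<Rightarrow> int^'n \<Rightarrow> nat \<Rightarrow> int^'n \<Rightarrow> (nat \<Rightarrow> real \<times> (int^'n)) \<Rightarrow> bool" where
  "Fv y z n x \<omega> \<longleftrightarrow> jpos x \<omega> (Suc n) = y \<and> (\<forall>m<n. jpos x \<omega> (Suc m) \<notin> {y, z})"

lemma meas_Fv[measurable]: "Measurable.pred Om (Fv y z n x)"
  unfolding Fv_def[abs_def] by measurable

lemma emeasure_Fv:
  "emeasure Om {\<omega>. jtime \<omega> (Suc n) \<le> t \<and> Fv y z n x \<omega>} = Er (Suc n) t * ennreal (fh y z n x)"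
proof -
  have sets: "{\<omega>. jtime \<omega> (Suc n) \<le> t \<and> Fv y z n x \<omega>} \<in> sets Om"
  proof -
    have "{\<omega>\<in>space Om. jtime \<omega> (Suc n) \<le> t \<and> Fv y z n x \<omega>} \<in> sets Om" by measurable
    then show ?thesis by simp
  qed
  have "emeasure Om {\<omega>. case_nat (s, w) \<omega> \<in> {\<omega>. jtime \<omega> (Suc n) \<le> t \<and> Fv y z n x \<omega>}}
      = Er n (t - s) * ennreal (hit {y, z} y n (x + w))" for s w
  proof -
    have "{\<omega>. case_nat (s, w) \<omega> \<in> {\<omega>. jtime \<omega> (Suc n) \<le> t \<and> Fv y z n x \<omega>}}
        = {\<omega>. jtime \<omega> n \<le> t - s \<and> Ev {y, z} y n (x + w) \<omega>}"
      by (auto simp: Fv_def Ev_def jtime_case_nat jpos_case_nat)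
    then show ?thesis using emeasure_Ev[of n n] by simp
  qed
  then have "emeasure Om {\<omega>. jtime \<omega> (Suc n) \<le> t \<and> Fv y z n x \<omega>}
      = (\<integral>\<^sup>+s. Er n (t - s) * ennreal (fh y z n x) \<partial>hold)"
    by (subst emeasure_step[OF sets]) (simp add: nn_integral_cmult nn_integral_J_hit fh_def)
  also have "\<dots> = Er (Suc n) t * ennreal (fh y z n x)"
    using Er_meas by (simp add: nn_integral_multc Er_Suc)
  finally show ?thesis .
qed

lemma emeasure_jtime: "emeasure Om {\<omega>. jtime \<omega> n \<le> t} = Er n t"
  using emeasure_Ev[of 0 n t "{}" 0 0] by (simp add: Ev_def)

section \<open>Non-degenerate paths\<close>

definition good :: "(nat \<Rightarrow> real \<times> (int^'n)) \<Rightarrow> bool" where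
  "good \<omega> \<longleftrightarrow> (\<forall>k. fst (\<omega> k) > 0) \<and> (\<forall>k. snd (\<omega> k) \<noteq> 0) \<and> (\<forall>t. \<exists>n. jtime \<omega> n > t)"

lemma Er_Suc_eq: "t \<ge> 0 \<Longrightarrow> Er (Suc n) t = ennreal (1 - (\<Sum>k\<le>n. (r * t) ^ k * exp (- r * t) / fact k))"
  by (simp add: Er_def erlang_CDF_def)

lemma poisson_sums: "(\<lambda>k. (r * t) ^ k * exp (- r * t) / fact k) sums 1"
proof -
  have "(\<lambda>k. (r * t) ^ k /\<^sub>R fact k) sums exp (r * t)" by (rule exp_converges)
  then have "(\<lambda>k. exp (- r * t) * ((r * t) ^ k /\<^sub>R fact k)) sums (exp (- r * t) * exp (r * t))" by (rule sums_mult)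
  then show ?thesis by (simp add: exp_add[symmetric] field_simps)
qed

text \<open>Positive holding times and nonzero jumps hold coordinatewise. Explosion before time m
  would put all jump times below m; its probability is at most the mass of a Poisson law beyond n,
  for every n.\<close>

lemma AE_good: "AE \<omega> in Om. good \<omega>"
proof -
  have 1: "AE \<omega> in Om. fst (\<omega> k) > 0 \<and> snd (\<omega> k) \<noteq> 0" for k
  proof -
    have pos: "AE s in hold. s > 0"
    proof -
      have "AE s in lborel. s \<noteq> (0::real)" by (rule AE_lborel_singleton)
      then have "AE s in lborel. 0 < ennreal (exponential_density r s) \<longrightarrow> s > 0"
        by eventually_elim (auto simp: exponential_density_def not_less)
      then show ?thesis unfolding hold_measure_def by (subst AE_density) auto
    qed
    have nz: "AE w in measure_pmf J. w \<noteq> 0"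
      by (rule AE_pmfI) (auto simp: set_pmf_iff pmf_J b_def)
    have "AE w in M1. fst w > 0 \<and> snd w \<noteq> 0"
    proof (rule AE_conjI)
      have "AE s in distr M1 hold fst. s > 0" unfolding measure_pmf.distr_pair_fst by (rule pos)
      then show "AE w in M1. fst w > 0" by (rule AE_distrD[rotated]) simp
      have "AE s in distr M1 (measure_pmf J) snd. s \<noteq> 0"
      proof -
        have "distr M1 (measure_pmf J) snd = measure_pmf J"
          by (rule measure_eqI) (auto simp: emeasure_distr vimage_snd hold.emeasure_space_1 measure_pmf.emeasure_pair_measure_Times simp flip: space_hold)
        then show ?thesis using nz by (simp only:)
      qed
      then show "AE w in M1. snd w \<noteq> 0" by (rule AE_distrD[rotated]) simp
    qed
    then show ?thesis unfolding Omega_eq by (rule AE_PiM_component[rotated 2]) (auto intro: prob_space_pair prob_hold measure_pmf.prob_space_axioms)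
  qed
  have 2: "AE \<omega> in Om. \<exists>n. jtime \<omega> n > real m" for m
  proof -
    let ?B = "{\<omega>. \<forall>n. jtime \<omega> n \<le> real m}"
    have "{\<omega>\<in>space Om. \<forall>n. jtime \<omega> n \<le> real m} \<in> sets Om" by measurable
    then have B: "?B \<in> sets Om" by simp
    have "emeasure Om ?B \<le> ennreal (1 - (\<Sum>k\<le>n. (r * real m) ^ k * exp (- r * real m) / fact k))" for n
    proof -
      have "{\<omega>\<in>space Om. jtime \<omega> (Suc n) \<le> real m} \<in> sets Om" by measurable
      then have "emeasure Om ?B \<le> emeasure Om {\<omega>. jtime \<omega> (Suc n) \<le> real m}" by (intro emeasure_mono) auto
      then show ?thesis by (simp add: emeasure_jtime Er_Suc_eq)
    qed
    moreover have "(\<lambda>n. ennreal (1 - (\<Sum>k\<le>n. (r * real m) ^ k * exp (- r * real m) / fact k))) \<longlonglongrightarrow> ennreal (1 - 1)"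
      using poisson_sums[of "real m"] by (intro tendsto_ennrealI tendsto_diff tendsto_const) (simp add: sums_def_le)
    ultimately have "emeasure Om ?B \<le> ennreal (1 - 1)" by (intro LIMSEQ_le_const) auto
    then have "emeasure Om ?B = 0" by simp
    then show ?thesis using B by (intro AE_I[of _ _ ?B]) (auto simp: not_less)
  qed
  have "AE \<omega> in Om. (\<forall>k. fst (\<omega> k) > 0 \<and> snd (\<omega> k) \<noteq> 0) \<and> (\<forall>m::nat. \<exists>n. jtime \<omega> n > real m)"
    using 1 2 by (simp add: AE_all_countable)
  then show ?thesis
  proof eventually_elim
    case (elim \<omega>)
    have "\<exists>n. jtime \<omega> n > t" for t
    proof -
      obtain m :: nat where "t < real m" using reals_Archimedean2 by blast
      then show ?thesis using elim by (meson less_trans)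
    qed
    then show ?case using elim by (auto simp: good_def)
  qed
qed

context
  fixes \<omega> assumes g: "good \<omega>"
begin

lemma jtime_strict_mono: "strict_mono (jtime \<omega>)"
  using g by (intro strict_mono_Suc_iff[THEN iffD2]) (simp add: good_def jtime_def)

lemma jtime_less_iff: "jtime \<omega> m < jtime \<omega> n \<longleftrightarrow> m < n" and jtime_le_iff: "jtime \<omega> m \<le> jtime \<omega> n \<longleftrightarrow> m \<le> n"
  using jtime_strict_mono by (simp_all add: strict_mono_less strict_mono_less_eq)

lemma njumps_eqI: "jtime \<omega> n \<le> t \<Longrightarrow> t < jtime \<omega> (Suc n) \<Longrightarrow> njumps \<omega> t = n"
proof -
  assume t: "jtime \<omega> n \<le> t" "t < jtime \<omega> (Suc n)"
  have iff: "jtime \<omega> k \<le> t \<longleftrightarrow> k \<le> n" for k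
  proof
    assume "jtime \<omega> k \<le> t"
    then have "jtime \<omega> k < jtime \<omega> (Suc n)" using t by simp
    then show "k \<le> n" by (simp add: jtime_less_iff)
  next
    assume "k \<le> n"
    then have "jtime \<omega> k \<le> jtime \<omega> n" by (simp add: jtime_le_iff)
    then show "jtime \<omega> k \<le> t" using t by simp
  qed
  have "{k. 1 \<le> k \<and> jtime \<omega> k \<le> t} = {1..n}" unfolding iff by auto
  then show ?thesis by (simp add: njumps_def)
qed

lemma ex_interval: "t \<ge> 0 \<Longrightarrow> \<exists>n. jtime \<omega> n \<le> t \<and> t < jtime \<omega> (Suc n)"
proof -
  assume t: "t \<ge> 0"
  obtain N where N: "jtime \<omega> N > t" using g unfolding good_def by blast
  define n where "n = (LEAST n. jtime \<omega> n > t)"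
  have n: "jtime \<omega> n > t" unfolding n_def by (rule LeastI[of "\<lambda>n. jtime \<omega> n > t", OF N])
  then obtain m where m: "n = Suc m" using t by (cases n) auto
  then have "\<not> jtime \<omega> m > t" using not_less_Least[of m "\<lambda>n. jtime \<omega> n > t"] unfolding n_def[symmetric] by simp
  with n m show ?thesis by (intro exI[of _ m]) auto
qed

lemma S_jtime: "S x \<omega> (jtime \<omega> n) = jpos x \<omega> n"
proof -
  have "njumps \<omega> (jtime \<omega> n) = n" by (rule njumps_eqI) (auto simp: jtime_less_iff)
  then show ?thesis by (simp add: S_def)
qed

lemma tau_eq: "tau x \<omega> = ereal (jtime \<omega> 1)"
  unfolding tau_def
proof (rule antisym)
  have 0: "S x \<omega> 0 = x" using S_jtime[of x 0] by simp
  have "jpos x \<omega> 1 \<noteq> x" using g by (simp add: jpos_def good_def)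
  then have "S x \<omega> (jtime \<omega> 1) \<noteq> S x \<omega> 0" using S_jtime[of x 1] 0 by simp
  moreover have "0 \<le> jtime \<omega> 1" using jtime_le_iff[of 0 1] by simp
  ultimately show "Inf (ereal ` {t. 0 \<le> t \<and> S x \<omega> t \<noteq> S x \<omega> 0}) \<le> ereal (jtime \<omega> 1)"
    by (intro Inf_lower) auto
  show "ereal (jtime \<omega> 1) \<le> Inf (ereal ` {t. 0 \<le> t \<and> S x \<omega> t \<noteq> S x \<omega> 0})"
  proof (rule Inf_greatest, safe)
    fix t :: real assume t: "0 \<le> t" "S x \<omega> t \<noteq> S x \<omega> 0"
    show "ereal (jtime \<omega> 1) \<le> ereal t"
    proof (rule ccontr)
      assume "\<not> ereal (jtime \<omega> 1) \<le> ereal t"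
      then have "njumps \<omega> t = 0" using t by (intro njumps_eqI) auto
      then show False using t 0 by (simp add: S_def)
    qed
  qed
qed

text \<open>Paths are constant between jump times, so the infimum in \<open>tau_yz\<close> is
  attained at the first jump that lands on y with z avoided so far.\<close>

lemma tau_yz_le_iff: "tau_yz x y z \<omega> \<le> ereal t \<longleftrightarrow> (\<exists>n. jtime \<omega> (Suc n) \<le> t \<and> Fv y z n x \<omega>)" if yz: "y \<noteq> z"
proof
  assume "\<exists>n. jtime \<omega> (Suc n) \<le> t \<and> Fv y z n x \<omega>"
  then obtain n where n: "jtime \<omega> (Suc n) \<le> t" "Fv y z n x \<omega>" by auto
  have "S x \<omega> u \<noteq> z" if u: "tau x \<omega> \<le> ereal u" "u \<le> jtime \<omega> (Suc n)" for u
  proof -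
    have u1: "jtime \<omega> 1 \<le> u" using u by (simp add: tau_eq)
    then have "0 \<le> u" using jtime_le_iff[of 0 1] by simp
    then obtain m where m: "jtime \<omega> m \<le> u" "u < jtime \<omega> (Suc m)" using ex_interval by auto
    have "m \<le> Suc n" using m u jtime_le_iff[of m "Suc n"] by simp
    moreover have "1 \<le> m" using jtime_less_iff[of 1 "Suc m"] u1 m by simp
    ultimately obtain k where k: "m = Suc k" "k \<le> n" by (cases m) auto
    have "S x \<omega> u = jpos x \<omega> m" using njumps_eqI[OF m] by (simp add: S_def)
    then show ?thesis using n(2) k yz by (cases "k = n") (auto simp: Fv_def)
  qed
  then have "tau_yz x y z \<omega> \<le> ereal (jtime \<omega> (Suc n))"
    unfolding tau_yz_def using n S_jtime[of x "Suc n"] jtime_le_iff[of 1 "Suc n"]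
    by (intro Inf_lower) (auto simp: tau_eq Fv_def)
  also have "\<dots> \<le> ereal t" using n by simp
  finally show "tau_yz x y z \<omega> \<le> ereal t" .
next
  assume le: "tau_yz x y z \<omega> \<le> ereal t"
  let ?A = "{t. tau x \<omega> \<le> ereal t \<and> S x \<omega> t = y \<and> (\<forall>u. tau x \<omega> \<le> ereal u \<and> u \<le> t \<longrightarrow> S x \<omega> u \<noteq> z)}"
  \<comment> \<open>\<open>P\<close> still allows earlier visits to y; passing to its least index
    removes them and yields \<open>Fv\<close>.\<close>
  define P where "P n \<longleftrightarrow> jpos x \<omega> (Suc n) = y \<and> (\<forall>k\<le>n. jpos x \<omega> (Suc k) \<noteq> z)" for n
  have A: "\<exists>n. jtime \<omega> (Suc n) \<le> s \<and> P n" if "s \<in> ?A" for s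
  proof -
    have s1: "jtime \<omega> 1 \<le> s" using that by (simp add: tau_eq)
    then have "0 \<le> s" using jtime_le_iff[of 0 1] by simp
    then obtain m where m: "jtime \<omega> m \<le> s" "s < jtime \<omega> (Suc m)" using ex_interval by auto
    have "1 \<le> m" using jtime_less_iff[of 1 "Suc m"] s1 m by simp
    then obtain n where n: "m = Suc n" by (cases m) auto
    have "S x \<omega> s = jpos x \<omega> m" using njumps_eqI[OF m] by (simp add: S_def)
    then have "jpos x \<omega> (Suc n) = y" using that n by simp
    moreover have "jpos x \<omega> (Suc k) \<noteq> z" if "k \<le> n" for k
    proof -
      have "jtime \<omega> (Suc k) \<le> jtime \<omega> m" "jtime \<omega> 1 \<le> jtime \<omega> (Suc k)" using that n by (simp_all add: jtime_le_iff)
      then have "jtime \<omega> (Suc k) \<le> s" "tau x \<omega> \<le> ereal (jtime \<omega> (Suc k))" using m by (auto simp: tau_eq)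
      then show ?thesis using \<open>s \<in> ?A\<close> S_jtime[of x "Suc k"] by force
    qed
    ultimately show ?thesis using m n by (auto simp: P_def)
  qed
  have "?A \<noteq> {}" 
  proof
    assume "?A = {}"
    then have "tau_yz x y z \<omega> = Inf (ereal ` {})" unfolding tau_yz_def by (rule arg_cong)
    with le show False by (simp add: top_ereal_def)
  qed
  then obtain n0 where n0: "P n0" using A by blast
  define n where "n = (LEAST n. P n)"
  have n: "P n" unfolding n_def using n0 by (rule LeastI)
  have least: "\<not> P m" if "m < n" for m using not_less_Least that unfolding n_def by blast
  have "ereal (jtime \<omega> (Suc n)) \<le> tau_yz x y z \<omega>"
    unfolding tau_yz_def
  proof (rule Inf_greatest, clarify)
    fix s assume s: "tau x \<omega> \<le> ereal s" "y = S x \<omega> s" "\<forall>u. tau x \<omega> \<le> ereal u \<and> u \<le> s \<longrightarrow> S x \<omega> u \<noteq> z"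
    then obtain m where "jtime \<omega> (Suc m) \<le> s" "P m" using A[of s] by auto
    moreover have "n \<le> m" using least[of m] \<open>P m\<close> by (meson not_less)
    ultimately show "ereal (jtime \<omega> (Suc n)) \<le> ereal s" using jtime_le_iff[of "Suc n" "Suc m"] by simp
  qed
  with le have "ereal (jtime \<omega> (Suc n)) \<le> ereal t" by (rule order_trans[rotated])
  moreover have "Fv y z n x \<omega>"
    unfolding Fv_def
  proof (intro conjI allI impI)
    fix m assume "m < n"
    then show "jpos x \<omega> (Suc m) \<notin> {y, z}" using least[of m] n unfolding P_def by auto
  qed (use n in \<open>auto simp: P_def\<close>)
  ultimately show "\<exists>n. jtime \<omega> (Suc n) \<le> t \<and> Fv y z n x \<omega>" by auto
qed

end

end

section \<open>Gaussian integrals\<close>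

text \<open>The change of variables theorem of HOL-Analysis is stated for well-ordered index types only, so
  an arbitrary finite index type is copied to a well-ordered one.\<close>

typedef 'a wo = "UNIV :: 'a set" by simp

definition wo_nat :: "'a::finite wo \<Rightarrow> nat" where "wo_nat x = (SOME f. inj f) (Rep_wo x)"

lemma inj_wo_nat: "inj (wo_nat :: 'a::finite wo \<Rightarrow> nat)"
proof -
  have "\<exists>f :: 'a \<Rightarrow> nat. inj f"
  proof -
    obtain f :: "'a \<Rightarrow> nat" and n where "f ` UNIV = {i. i < n} \<and> inj_on f UNIV"
      using finite_imp_inj_to_nat_seg[OF finite[of "UNIV :: 'a set"]] by blast
    then show ?thesis by (intro exI[of _ f]) simp
  qed
  then have *: "inj (SOME f :: 'a \<Rightarrow> nat. inj f)" by (rule someI_ex[of inj])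
  show ?thesis
  proof (rule injI)
    fix x y :: "'a wo" assume "wo_nat x = wo_nat y"
    then have "Rep_wo x = Rep_wo y" unfolding wo_nat_def by (rule injD[OF *])
    then show "x = y" by (simp only: Rep_wo_inject)
  qed
qed

lemma bij_Rep_wo: "bij Rep_wo" and bij_Abs_wo: "bij Abs_wo"
  by (rule bij_betw_byWitness[where f' = Abs_wo], auto simp: Rep_wo_inverse Abs_wo_inverse)
    (rule bij_betw_byWitness[where f' = Rep_wo], auto simp: Rep_wo_inverse Abs_wo_inverse)

instantiation wo :: (finite) wellorder
begin
definition less_eq_wo :: "'a wo \<Rightarrow> 'a wo \<Rightarrow> bool" where "less_eq_wo x y \<longleftrightarrow> wo_nat x \<le> wo_nat y"
definition less_wo :: "'a wo \<Rightarrow> 'a wo \<Rightarrow> bool" where "less_wo x y \<longleftrightarrow> wo_nat x < wo_nat y"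
instance
proof
  fix P :: "'a wo \<Rightarrow> bool" and c :: "'a wo"
  assume *: "\<And>x. (\<And>y. y < x \<Longrightarrow> P y) \<Longrightarrow> P x"
  show "P c" by (induction c rule: measure_induct_rule[of wo_nat]) (auto intro: * simp: less_wo_def)
qed (auto simp: less_eq_wo_def less_wo_def dest: injD[OF inj_wo_nat])
end

instance wo :: (finite) finite
proof
  have "(UNIV :: 'a wo set) = Abs_wo ` UNIV" by (rule bij_is_surj[OF bij_Abs_wo, symmetric])
  then show "finite (UNIV :: 'a wo set)" by (metis finite finite_imageI)
qed

lemma Rep_Abs_wo[simp]: "Rep_wo (Abs_wo x) = x" by (simp add: Abs_wo_inverse)

text \<open>Relabelling carries transpositions to transpositions and so preserves the parity of a
  permutation; this makes the determinant invariant in \<open>det_to_wo\<close>.\<close>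

lemma swapidseq_conj_wo: "swapidseq n q \<Longrightarrow> swapidseq n (Abs_wo \<circ> q \<circ> Rep_wo)"
proof (induction rule: swapidseq.induct)
  case id
  have e: "Abs_wo \<circ> id \<circ> Rep_wo = id" by (rule ext) (simp add: Rep_wo_inverse)
  show ?case unfolding e by (rule swapidseq.id)
next
  case (comp_Suc n q u v)
  have eq: "Abs_wo \<circ> (Transposition.transpose u v \<circ> q) \<circ> Rep_wo
    = Transposition.transpose (Abs_wo u) (Abs_wo v) \<circ> (Abs_wo \<circ> q \<circ> Rep_wo)"
    by (auto simp: fun_eq_iff Transposition.transpose_def inj_eq[OF bij_is_inj[OF bij_Abs_wo]])
  have neq: "Abs_wo u \<noteq> Abs_wo v" using comp_Suc by (simp add: inj_eq[OF bij_is_inj[OF bij_Abs_wo]])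
  show ?case unfolding eq by (rule swapidseq.comp_Suc[OF comp_Suc.IH neq])
qed

lemma sign_conj_wo:
  fixes q :: "'a::finite \<Rightarrow> 'a"
  assumes "q permutes UNIV"
  shows "sign (Abs_wo \<circ> q \<circ> Rep_wo) = sign q"
proof -
  obtain n where n: "swapidseq n q" using assms permutation_permutes permutation_def finite by metis
  show ?thesis using evenperm_unique[OF n refl] evenperm_unique[OF swapidseq_conj_wo[OF n] refl]
    by (simp add: sign_def)
qed

definition to_wo :: "'c^'n^'n \<Rightarrow> 'c^'n wo^'n wo" where "to_wo A = (\<chi> i j. A $ Rep_wo i $ Rep_wo j)"

lemma det_to_wo: "det (to_wo A) = det (A :: real^'n^'n)"
proof -
  let ?c = "\<lambda>p. Abs_wo \<circ> p \<circ> Rep_wo"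
  have "det A = (\<Sum>p | p permutes UNIV. of_int (sign (?c p)) * (\<Prod>i\<in>UNIV. to_wo A $ i $ ?c p i))"
    unfolding det_def
  proof (intro sum.cong refl)
    fix p :: "'n \<Rightarrow> 'n" assume "p \<in> {p. p permutes UNIV}"
    moreover have "(\<Prod>i\<in>UNIV. A $ i $ p i) = (\<Prod>i\<in>UNIV. A $ Rep_wo i $ p (Rep_wo i))"
      by (rule prod.reindex_bij_betw[OF bij_Rep_wo, symmetric])
    ultimately show "of_int (sign p) * (\<Prod>i\<in>UNIV. A $ i $ p i) = of_int (sign (?c p)) * (\<Prod>i\<in>UNIV. to_wo A $ i $ ?c p i)"
      by (simp add: sign_conj_wo to_wo_def)
  qed
  also have "\<dots> = det (to_wo A)"
    unfolding det_def
  proof (rule sum.reindex_bij_betw)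
    show "bij_betw ?c {p. p permutes (UNIV :: 'n set)} {p. p permutes (UNIV :: 'n wo set)}"
    proof (rule bij_betwI[where g = "\<lambda>p. Rep_wo \<circ> p \<circ> Abs_wo"])
      show "?c \<in> {p. p permutes UNIV} \<rightarrow> {p. p permutes UNIV}"
        using bij_Abs_wo bij_Rep_wo by (auto intro!: bij_imp_permutes bij_comp permutes_bij)
      show "(\<lambda>p. Rep_wo \<circ> p \<circ> Abs_wo) \<in> {p. p permutes (UNIV :: 'n wo set)} \<rightarrow> {p. p permutes (UNIV :: 'n set)}"
        using bij_Abs_wo bij_Rep_wo by (auto intro!: bij_imp_permutes bij_comp permutes_bij)
    qed (auto simp: fun_eq_iff Rep_wo_inverse)
  qed
  finally show ?thesis by simp
qed

definition vec_of_wo :: "real^'n wo \<Rightarrow> real^'n" where "vec_of_wo x = (\<chi> i. x $ Abs_wo i)"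

lemma prod_Basis_cart: "(\<Prod>b\<in>Basis. x \<bullet> b) = (\<Prod>i\<in>UNIV. x $ i)" for x :: "real^'n"
proof -
  have B: "(Basis :: (real^'n) set) = range (\<lambda>i. axis i 1)" by (auto simp: Basis_vec_def)
  have inj: "inj (\<lambda>i::'n. axis i (1::real))" by (auto simp: inj_def axis_eq_axis)
  show ?thesis unfolding B prod.reindex[OF inj] o_def by (simp add: inner_axis)
qed

lemma lborel_vec_of_wo: "lborel = distr lborel borel (vec_of_wo :: real^'n wo \<Rightarrow> real^'n)"
proof (rule lborel_eqI)
  have cont: "continuous_on UNIV (vec_of_wo :: real^'n wo \<Rightarrow> real^'n)" unfolding vec_of_wo_def by (intro continuous_intros)
  then have m: "(vec_of_wo :: real^'n wo \<Rightarrow> real^'n) \<in> borel_measurable borel" by (rule borel_measurable_continuous_onI)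
  fix l u :: "real^'n" assume le: "\<And>b. b \<in> Basis \<Longrightarrow> l \<bullet> b \<le> u \<bullet> b"
  then have le': "l $ i \<le> u $ i" for i using le[of "axis i 1"] by (simp add: inner_axis axis_in_Basis_iff)
  let ?l = "(\<chi> i. l $ Rep_wo i)" and ?u = "(\<chi> i. u $ Rep_wo i)"
  have "vec_of_wo -` box l u = box ?l ?u"
  proof (intro set_eqI)
    fix x :: "real^'n wo"
    have "(\<forall>i. P i) \<longleftrightarrow> (\<forall>i. P (Rep_wo i))" for P :: "'n \<Rightarrow> bool" by (metis Rep_Abs_wo)
    then show "x \<in> vec_of_wo -` box l u \<longleftrightarrow> x \<in> box ?l ?u"
      by (simp add: mem_box_cart vec_of_wo_def Rep_wo_inverse)
  qed
  then have "emeasure (distr lborel borel vec_of_wo) (box l u) = emeasure lborel (box ?l ?u)"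
    using m by (subst emeasure_distr) auto
  also have "\<dots> = (\<Prod>b\<in>Basis. (?u - ?l) \<bullet> b)"
    by (rule emeasure_lborel_box) (auto simp: Basis_vec_def inner_axis le')
  also have "(\<Prod>b\<in>Basis. (?u - ?l) \<bullet> b) = (\<Prod>i\<in>UNIV. (?u - ?l) $ i)"
    by (rule prod_Basis_cart)
  also have "\<dots> = (\<Prod>i\<in>UNIV. (u - l) $ Rep_wo i)" by simp
  also have "\<dots> = (\<Prod>i\<in>UNIV. (u - l) $ i)" by (rule prod.reindex_bij_betw[OF bij_Rep_wo])
  also have "\<dots> = (\<Prod>b\<in>Basis. (u - l) \<bullet> b)"
    by (rule prod_Basis_cart[symmetric])
  finally show "emeasure (distr lborel borel vec_of_wo) (box l u) = (\<Prod>b\<in>Basis. (u - l) \<bullet> b)" .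
qed simp

text \<open>Fubini for a product of functions of single coordinates. The values lie in a field so
  that real Gaussians and complex exponentials are both covered.\<close>

lemma has_bochner_integral_lborel_prod:
  fixes f :: "'a::euclidean_space \<Rightarrow> real \<Rightarrow> 'c::{real_normed_field,banach,second_countable_topology}"
  assumes "\<And>b. b \<in> Basis \<Longrightarrow> has_bochner_integral lborel (f b) (c b)"
  shows "has_bochner_integral lborel (\<lambda>x::'a. \<Prod>b\<in>Basis. f b (x \<bullet> b)) (\<Prod>b\<in>Basis. c b)"
proof -
  interpret product_sigma_finite "\<lambda>_::'a. lborel :: real measure" by unfold_locales
  have i: "integrable lborel (f b)" and [measurable]: "f b \<in> borel_measurable borel" if "b \<in> Basis" for b
    using assms[OF that] by (auto simp: has_bochner_integral_iff)
  have e: "(\<Prod>b\<in>Basis. f b ((\<Sum>b'\<in>Basis. x b' *\<^sub>R b') \<bullet> b)) = (\<Prod>b\<in>Basis. f b (x b))" for x :: "'a \<Rightarrow> real"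
    by (intro prod.cong refl) simp
  have m: "(\<lambda>x::'a. \<Prod>b\<in>Basis. f b (x \<bullet> b)) \<in> borel_measurable borel" by measurable
  have "has_bochner_integral (\<Pi>\<^sub>M b\<in>Basis. lborel) (\<lambda>x. \<Prod>b\<in>Basis. f b (x b)) (\<Prod>b\<in>(Basis::'a set). c b)"
    unfolding has_bochner_integral_iff
    using product_integrable_prod[OF finite_Basis, of f] product_integral_prod[OF finite_Basis, of f] i assms
    by (auto simp: has_bochner_integral_iff intro!: prod.cong)
  then show ?thesis
    by (subst lborel_eq, intro has_bochner_integral_distr) (use m e in simp_all)
qed

lemma has_bochner_integral_gauss:
  "has_bochner_integral lborel (\<lambda>x::'a::euclidean_space. exp (- (x \<bullet> x) / 2)) ((2 * pi) powr (DIM('a) / 2))"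
proof -
  have 1: "has_bochner_integral lborel (\<lambda>t. exp (- t\<^sup>2 / 2)) (sqrt (2 * pi))"
  proof -
    have "has_bochner_integral lborel (\<lambda>t. sqrt (2 * pi) * std_normal_density t) (sqrt (2 * pi) * 1)"
      by (intro has_bochner_integral_mult_right) (auto simp: has_bochner_integral_iff)
    then show ?thesis by (simp add: std_normal_density_def)
  qed
  have "has_bochner_integral lborel (\<lambda>x::'a. \<Prod>b\<in>Basis. exp (- (x \<bullet> b)\<^sup>2 / 2)) (\<Prod>b\<in>(Basis::'a set). sqrt (2 * pi))"
    using 1 by (intro has_bochner_integral_lborel_prod)
  also have "(\<lambda>x::'a. \<Prod>b\<in>Basis. exp (- (x \<bullet> b)\<^sup>2 / 2)) = (\<lambda>x. exp (- (x \<bullet> x) / 2))"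
  proof
    fix x :: 'a
    have "x \<bullet> x = (\<Sum>b\<in>Basis. (x \<bullet> b)\<^sup>2)" by (subst euclidean_inner) (simp add: power2_eq_square)
    then show "(\<Prod>b\<in>Basis. exp (- (x \<bullet> b)\<^sup>2 / 2)) = exp (- (x \<bullet> x) / 2)"
      by (simp add: exp_sum[symmetric] sum_negf sum_divide_distrib)
  qed
  also have "(\<Prod>b\<in>(Basis::'a set). sqrt (2 * pi)) = (2 * pi) powr (DIM('a) / 2)"
    using powr_powr[of "2 * pi" "1 / 2" "DIM('a)"] by (simp add: powr_half_sqrt powr_realpow)
  finally show ?thesis .
qed

text \<open>Gram-Schmidt for the scalar product defined by Q, one index at a time: fewer than
  \<open>CARD('n)\<close> vectors \<open>Q *v v i\<close> leave a nonzero vector orthogonal to all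
  of them, and positivity of Q allows it to be normalised.\<close>

lemma quadratic_orthonormal_basis:
  fixes Q :: "real^'n^'n"
  assumes sym: "\<And>x y. x \<bullet> (Q *v y) = y \<bullet> (Q *v x)" and pos: "\<And>x. x \<noteq> 0 \<Longrightarrow> x \<bullet> (Q *v x) > 0"
  shows "\<exists>V :: real^'n^'n. Finite_Cartesian_Product.transpose V ** Q ** V = mat 1"
proof -
  have "\<exists>v :: 'n \<Rightarrow> real^'n. \<forall>i\<in>F. \<forall>j\<in>F. v i \<bullet> (Q *v v j) = (if i = j then 1 else 0)" for F :: "'n set"
    using finite[of F]
  proof (induction F rule: finite_induct)
    case (insert k F)
    then obtain v :: "'n \<Rightarrow> real^'n" where v: "\<And>i j. i \<in> F \<Longrightarrow> j \<in> F \<Longrightarrow> v i \<bullet> (Q *v v j) = (if i = j then 1 else 0)" by blast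
    let ?B = "(\<lambda>i. Q *v v i) ` F"
    have "dim ?B \<le> card ?B" by (rule dim_le_card') (use insert in auto)
    also have "\<dots> \<le> card F" by (rule card_image_le) (use insert in auto)
    also have "\<dots> < card (UNIV :: 'n set)" by (rule psubset_card_mono) (use insert in auto)
    finally have "dim ?B < DIM(real^'n)" by simp
    then obtain x where x: "x \<noteq> 0" "\<And>y. y \<in> span ?B \<Longrightarrow> orthogonal x y"
      using orthogonal_to_subspace_exists by blast
    have xF: "x \<bullet> (Q *v v i) = 0" if "i \<in> F" for i
      using x(2)[OF span_base, of "Q *v v i"] that by (auto simp: orthogonal_def)
    define u where "u = (1 / sqrt (x \<bullet> (Q *v x))) *\<^sub>R x"
    have uu: "u \<bullet> (Q *v u) = 1"
      using pos[OF x(1)] by (simp add: u_def matrix_vector_mult_scaleR real_sqrt_mult_self flip: power2_eq_square)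
    have uF: "u \<bullet> (Q *v v i) = 0" "v i \<bullet> (Q *v u) = 0" if "i \<in> F" for i
      using xF[OF that] sym[of "v i" u] by (simp_all add: u_def)
    have "\<forall>i\<in>insert k F. \<forall>j\<in>insert k F. (v(k := u)) i \<bullet> (Q *v (v(k := u)) j) = (if i = j then 1 else 0)"
      using v uu uF insert(2) by auto
    then show ?case by blast
  qed simp
  from this[of UNIV] obtain v :: "'n \<Rightarrow> real^'n" where v: "\<And>i j. v i \<bullet> (Q *v v j) = (if i = j then 1 else 0)" by auto
  define V :: "real^'n^'n" where "V = (\<chi> i j. v j $ i)"
  have QV: "(Q ** V) $ k $ j = (Q *v v j) $ k" for k j
    by (simp add: V_def matrix_matrix_mult_def matrix_vector_mult_def)
  have mm: "(A ** B) $ i $ j = (\<Sum>k\<in>UNIV. A $ i $ k * B $ k $ j)" for A B :: "real^'n^'n" and i j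
    by (simp add: matrix_matrix_mult_def)
  have "(Finite_Cartesian_Product.transpose V ** Q ** V) $ i $ j = mat 1 $ i $ j" for i j
  proof -
    have "(Finite_Cartesian_Product.transpose V ** (Q ** V)) $ i $ j = (\<Sum>k\<in>UNIV. v i $ k * (Q ** V) $ k $ j)"
      unfolding mm by (simp add: V_def Finite_Cartesian_Product.transpose_def)
    also have "\<dots> = v i \<bullet> (Q *v v j)" by (simp add: QV inner_vec_def)
    finally show ?thesis by (simp add: v mat_def matrix_mul_assoc)
  qed
  then show ?thesis by (auto simp: vec_eq_iff)
qed

lemma quadratic_transpose: "(V *v \<xi>) \<bullet> (Q *v (V *v \<xi>)) = \<xi> \<bullet> ((Finite_Cartesian_Product.transpose V ** Q ** V) *v \<xi>)"
  for V Q :: "real^'n^'n"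
proof -
  have *: "(V *v \<xi>) \<bullet> w = \<xi> \<bullet> (Finite_Cartesian_Product.transpose V *v w)" for w
    by (metis dot_lmul_matrix inner_commute transpose_matrix_vector)
  show ?thesis unfolding * matrix_vector_mul_assoc matrix_mul_assoc ..
qed

text \<open>Translates between the Borel integral and absolute gauge integrability, in which the
  change of variables theorem is phrased.\<close>

lemma has_bochner_integral_lborel_iff:
  fixes f :: "'a::euclidean_space \<Rightarrow> 'b::euclidean_space"
  assumes m: "f \<in> borel_measurable borel"
  shows "has_bochner_integral lborel f c \<longleftrightarrow> f absolutely_integrable_on UNIV \<and> integral UNIV f = c"
proof -
  have m': "f \<in> borel_measurable lborel" using m by simp
  have 1: "f absolutely_integrable_on UNIV \<longleftrightarrow> integrable lborel f"
    by (simp add: set_integrable_def integrable_completion[OF m'])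
  have 2: "integral UNIV f = (LINT x|lborel. f x)" if "f absolutely_integrable_on UNIV"
    using set_lebesgue_integral_eq_integral(2)[OF that] by (simp add: set_lebesgue_integral_def integral_completion[OF m'])
  show ?thesis using 1 2 by (auto simp: has_bochner_integral_iff)
qed

text \<open>With \<open>transpose V ** Q ** V = mat 1\<close> the substitution x = V \<xi> reduces
  the integral to the standard Gaussian, and the same identity gives
  \<open>\<bar>det V\<bar> = 1 / sqrt (det Q)\<close>.\<close>

theorem gauss_quadratic:
  fixes Q :: "real^'n^'n"
  assumes sym: "\<And>x y. x \<bullet> (Q *v y) = y \<bullet> (Q *v x)" and pos: "\<And>x. x \<noteq> 0 \<Longrightarrow> x \<bullet> (Q *v x) > 0"
  shows "det Q > 0"
    and "has_bochner_integral lborel (\<lambda>x. exp (- (x \<bullet> (Q *v x)) / 2)) ((2 * pi) powr (CARD('n) / 2) / sqrt (det Q))"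
proof -
  let ?T = Finite_Cartesian_Product.transpose
  define W where "W = to_wo Q"
  have wQ: "vec_of_wo x \<bullet> (Q *v vec_of_wo y) = x \<bullet> (W *v y)" for x y
  proof -
    have "x \<bullet> (W *v y) = (\<Sum>i\<in>UNIV. \<Sum>j\<in>UNIV. x $ i * (Q $ Rep_wo i $ Rep_wo j * y $ j))"
      by (simp add: W_def to_wo_def inner_vec_def matrix_vector_mult_def sum_distrib_left)
    also have "\<dots> = (\<Sum>i\<in>UNIV. \<Sum>j\<in>UNIV. vec_of_wo x $ Rep_wo i * (Q $ Rep_wo i $ Rep_wo j * vec_of_wo y $ Rep_wo j))"
      by (simp add: vec_of_wo_def Rep_wo_inverse)
    also have "\<dots> = (\<Sum>i\<in>UNIV. \<Sum>j\<in>UNIV. vec_of_wo x $ Rep_wo i * (Q $ Rep_wo i $ j * vec_of_wo y $ j))"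
      by (intro sum.cong refl sum.reindex_bij_betw[OF bij_Rep_wo])
    also have "\<dots> = (\<Sum>i\<in>UNIV. \<Sum>j\<in>UNIV. vec_of_wo x $ i * (Q $ i $ j * vec_of_wo y $ j))"
      by (rule sum.reindex_bij_betw[OF bij_Rep_wo, of "\<lambda>i. \<Sum>j\<in>UNIV. vec_of_wo x $ i * (Q $ i $ j * vec_of_wo y $ j)"])
    finally show ?thesis by (simp add: inner_vec_def matrix_vector_mult_def sum_distrib_left)
  qed
  have nz: "vec_of_wo x \<noteq> 0" if "x \<noteq> 0" for x :: "real^'n wo"
  proof -
    have "\<exists>i. x $ i \<noteq> 0" using that by (simp add: vec_eq_iff)
    then obtain i where "x $ i \<noteq> 0" ..
    then have "vec_of_wo x $ Rep_wo i \<noteq> 0" by (simp add: vec_of_wo_def Rep_wo_inverse)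
    then show ?thesis by auto
  qed
  have "\<exists>V :: real^'n wo^'n wo. ?T V ** W ** V = mat 1"
    by (rule quadratic_orthonormal_basis) (use sym pos nz in \<open>auto simp: wQ[symmetric]\<close>)
  then obtain V :: "real^'n wo^'n wo" where V: "?T V ** W ** V = mat 1" by auto
  have "det (?T V ** W ** V) = 1" unfolding V by simp
  then have dV: "(det V)\<^sup>2 * det Q = 1" by (simp add: det_mul W_def det_to_wo power2_eq_square mult_ac)
  then have dVnz: "det V \<noteq> 0" by auto
  show dQ: "det Q > 0" using dV by (metis zero_less_mult_pos zero_less_one zero_less_power2 dVnz)
  have dVe: "\<bar>det V\<bar> = 1 / sqrt (det Q)"
  proof -
    have "(det V)\<^sup>2 = 1 / det Q" using dV dQ by (simp add: field_simps)
    then have "sqrt ((det V)\<^sup>2) = sqrt (1 / det Q)" by simp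
    then show ?thesis by (simp add: real_sqrt_divide)
  qed
  let ?f = "\<lambda>x. exp (- (x \<bullet> (W *v x)) / 2)"
  have lin: "linear ((*v) V)" by (rule matrix_vector_mul_linear)
  have surj: "range ((*v) V) = UNIV"
    using dVnz by (metis invertible_det_nz invertible_def matrix_right_invertible_surjective)
  have hb: "has_bochner_integral lborel (\<lambda>\<xi>. \<bar>det V\<bar> *\<^sub>R ?f (V *v \<xi>)) (\<bar>det V\<bar> *\<^sub>R (2 * pi) powr (CARD('n) / 2))"
  proof -
    have "(V *v \<xi>) \<bullet> (W *v (V *v \<xi>)) = \<xi> \<bullet> \<xi>" for \<xi> by (simp add: quadratic_transpose V)
    moreover have "CARD('n wo) = CARD('n)" by (rule bij_betw_same_card[OF bij_Rep_wo])
    ultimately show ?thesis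
      using has_bochner_integral_scaleR_right[OF has_bochner_integral_gauss[where 'a = "real^'n wo"]] by simp
  qed
  have m: "?f \<in> borel_measurable borel"
    by (intro borel_measurable_continuous_onI continuous_intros matrix_vector_mult_linear_continuous_on) auto
  \<comment> \<open>The integrand is wrapped into \<open>real^1\<close> because the change of
    variables theorem speaks of functions between Cartesian spaces.\<close>
  let ?vec = "vec :: real \<Rightarrow> real^1"
  have bl: "bounded_linear ?vec" by (simp add: linear_conv_bounded_linear[symmetric] linear_vec)
  have bc: "bounded_linear (\<lambda>x::real^1. x $ 1)" by (rule bounded_linear_vec_nth)
  have mV: "(\<lambda>x. ?f (V *v x)) \<in> borel_measurable borel"
    by (rule measurable_compose[OF borel_measurable_continuous_onI m]) (intro matrix_vector_mult_linear_continuous_on)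
  have mvec: "?vec \<in> borel_measurable borel" by (intro borel_measurable_continuous_onI linear_continuous_on bl)
  have "has_bochner_integral lborel (\<lambda>x. ?vec (\<bar>det V\<bar> *\<^sub>R ?f (V *v x))) (?vec (\<bar>det V\<bar> *\<^sub>R (2 * pi) powr (CARD('n) / 2)))"
    by (rule has_bochner_integral_bounded_linear[OF bl hb])
  then have "has_bochner_integral lborel (\<lambda>x. \<bar>det V\<bar> *\<^sub>R ?vec (?f (V *v x))) (?vec (\<bar>det V\<bar> *\<^sub>R (2 * pi) powr (CARD('n) / 2)))"
    
  proof -
    have "?vec (\<bar>det V\<bar> *\<^sub>R y) = \<bar>det V\<bar> *\<^sub>R ?vec y" for y by (simp add: vec_eq_iff)
    then show ?thesis using \<open>has_bochner_integral lborel (\<lambda>x. ?vec (\<bar>det V\<bar> *\<^sub>R ?f (V *v x))) _\<close> by (simp only:)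
  qed
  then have "(\<lambda>x. \<bar>det V\<bar> *\<^sub>R ?vec (?f (V *v x))) absolutely_integrable_on UNIV \<and>
     integral UNIV (\<lambda>x. \<bar>det V\<bar> *\<^sub>R ?vec (?f (V *v x))) = ?vec (\<bar>det V\<bar> *\<^sub>R (2 * pi) powr (CARD('n) / 2))"
    by (subst (asm) has_bochner_integral_lborel_iff) (use measurable_compose[OF mV mvec] in auto)
  then have "(\<lambda>x. ?vec (?f x)) absolutely_integrable_on UNIV \<and>
     integral UNIV (\<lambda>x. ?vec (?f x)) = ?vec (\<bar>det V\<bar> *\<^sub>R (2 * pi) powr (CARD('n) / 2))"
    by (rule has_absolute_integral_change_of_variables_linear[OF lin, of UNIV "\<lambda>x. ?vec (?f x)", unfolded surj matrix_of_matrix_vector_mul, THEN iffD1])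
  then have "has_bochner_integral lborel (\<lambda>x. ?vec (?f x)) (?vec (\<bar>det V\<bar> *\<^sub>R (2 * pi) powr (CARD('n) / 2)))"
    by (subst has_bochner_integral_lborel_iff) (use measurable_compose[OF m mvec] in auto)
  from has_bochner_integral_bounded_linear[OF bc this]
  have hbf: "has_bochner_integral lborel ?f (\<bar>det V\<bar> * (2 * pi) powr (CARD('n) / 2))" by simp
  have mQ: "(\<lambda>x. exp (- (x \<bullet> (Q *v x)) / 2)) \<in> borel_measurable borel"
    by (intro borel_measurable_continuous_onI continuous_intros matrix_vector_mult_linear_continuous_on) auto
  have "continuous_on UNIV (vec_of_wo :: real^'n wo \<Rightarrow> real^'n)" unfolding vec_of_wo_def by (intro continuous_intros)
  then have mw: "(vec_of_wo :: real^'n wo \<Rightarrow> real^'n) \<in> borel_measurable borel" by (rule borel_measurable_continuous_onI)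
  show "has_bochner_integral lborel (\<lambda>x. exp (- (x \<bullet> (Q *v x)) / 2)) ((2 * pi) powr (CARD('n) / 2) / sqrt (det Q))"
    by (subst lborel_vec_of_wo, rule has_bochner_integral_distr) (use mQ mw hbf in \<open>auto simp: wQ dVe mult.commute\<close>)
qed

section \<open>Poisson weights of the clock\<close>

context walk begin

definition pois :: "nat \<Rightarrow> real \<Rightarrow> real" where "pois k t = (r * t) ^ k * exp (- r * t) / fact k"

lemma pois_nonneg: "t \<ge> 0 \<Longrightarrow> pois k t \<ge> 0" using r_pos by (simp add: pois_def)

lemma pois_sums: "(\<lambda>k. pois k t) sums 1" unfolding pois_def by (rule poisson_sums)

lemma sum_pois_le: "t \<ge> 0 \<Longrightarrow> (\<Sum>k<n. pois k t) \<le> 1"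
  using sum_le_suminf[OF sums_summable[OF pois_sums], of "{..<n}" t] sums_unique[OF pois_sums, of t] pois_nonneg by auto

lemma Er_eq: "t \<ge> 0 \<Longrightarrow> Er n t = ennreal (1 - (\<Sum>k<n. pois k t))"
proof (cases n)
  case (Suc k)
  assume "t \<ge> 0"
  then show ?thesis using Er_Suc_eq[of t k] by (simp add: Suc pois_def lessThan_Suc_atMost)
qed (simp add: Er_def)

lemma hit_suminf_Fv:
  assumes "t \<ge> 0"
  shows "measure Om {\<omega>. jtime \<omega> (Suc n) \<le> t \<and> Fv y z n x \<omega>} = fh y z n x * (1 - (\<Sum>k\<le>n. pois k t))"
proof -
  have f: "0 \<le> fh y z n x" unfolding fh_def by (intro integral_nonneg_AE) (auto simp: hit_nonneg)
  have "emeasure Om {\<omega>. jtime \<omega> (Suc n) \<le> t \<and> Fv y z n x \<omega>} = ennreal ((1 - (\<Sum>k<Suc n. pois k t)) * fh y z n x)"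
    using sum_pois_le[OF assms, of "Suc n"] f
    by (subst emeasure_Fv, subst Er_eq[OF assms]) (simp add: ennreal_mult del: sum.lessThan_Suc)
  then show ?thesis using sum_pois_le[OF assms, of "Suc n"] f
    by (simp add: measure_def lessThan_Suc_atMost mult.commute del: sum.lessThan_Suc)
qed

lemma fh_nonneg: "0 \<le> fh y z n x"
  unfolding fh_def by (intro integral_nonneg_AE) (auto simp: hit_nonneg)

section \<open>Measurability of the hitting time event\<close>

text \<open>The product space is not complete, so the event \<open>tau_yz \<le> t\<close> must be measurable on the null set of
  degenerate paths as well. Every path is constant on some interval ending at a given time and
  starting at a rational, at a partial sum of the holding times, or at the explosion time; hence all
  quantifiers over times can be restricted to this countable family of measurable times.\<close>

definition expl :: "(nat \<Rightarrow> real \<times> (int^'n)) \<Rightarrow> real" where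
  "expl \<omega> = real_of_ereal (INF q\<in>\<rat>. if infinite {n. 1 \<le> n \<and> jtime \<omega> n \<le> q} then ereal q else \<infinity>)"

definition tm :: "nat \<Rightarrow> (nat \<Rightarrow> real \<times> (int^'n)) \<Rightarrow> real" where
  "tm i \<omega> = (if i = 0 then expl \<omega> else if even i then jtime \<omega> (i div 2) else real_of_rat (from_nat (i div 2)))"

lemma tm_expl: "tm 0 \<omega> = expl \<omega>" by (simp add: tm_def)
lemma tm_jtime: "n \<ge> 1 \<Longrightarrow> tm (2 * n) \<omega> = jtime \<omega> n" by (simp add: tm_def)
lemma tm_rat: "q \<in> \<rat> \<Longrightarrow> \<exists>i. \<forall>\<omega>. tm i \<omega> = q"
proof -
  assume "q \<in> \<rat>"
  then obtain c where "q = real_of_rat c" by (rule Rats_cases)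
  then have "tm (Suc (2 * to_nat c)) \<omega> = q" for \<omega> by (simp add: tm_def)
  then show ?thesis by blast
qed

lemma meas_expl[measurable]: "expl \<in> borel_measurable Om"
proof -
  have M: "(\<lambda>\<omega>. if infinite {n. 1 \<le> n \<and> jtime \<omega> n \<le> q} then ereal q else \<infinity>) \<in> borel_measurable Om" for q
  proof -
    have *: "infinite {n. 1 \<le> n \<and> jtime \<omega> n \<le> q} \<longleftrightarrow> (\<forall>m. \<exists>n. m < n \<and> 1 \<le> n \<and> jtime \<omega> n \<le> q)" for \<omega>
      by (auto simp: infinite_nat_iff_unbounded)
    have "Measurable.pred Om (\<lambda>\<omega>. \<forall>m. \<exists>n. m < n \<and> 1 \<le> n \<and> jtime \<omega> n \<le> q)"
    proof (intro pred_intros_countable)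
      fix m n :: nat
      have "Measurable.pred Om (\<lambda>\<omega>. jtime \<omega> n \<le> q)" by measurable
      then show "Measurable.pred Om (\<lambda>\<omega>. m < n \<and> 1 \<le> n \<and> jtime \<omega> n \<le> q)" by simp
    qed
    then show ?thesis unfolding * by (intro measurable_If) (auto simp: pred_def)
  qed
  show ?thesis unfolding expl_def[abs_def]
    by (rule borel_measurable_real_of_ereal[OF borel_measurable_INF[OF countable_rat M]])
qed

lemma meas_tm: "tm i \<in> borel_measurable Om"
proof -
  consider "tm i = expl" | "tm i = (\<lambda>\<omega>. jtime \<omega> (i div 2))" | "tm i = (\<lambda>\<omega>. real_of_rat (from_nat (i div 2)))"
    by (cases "i = 0"; cases "even i") (simp_all add: tm_def[abs_def])
  then show ?thesis
  proof cases
    case 1 show ?thesis unfolding 1 by (rule meas_expl)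
  next
    case 2 show ?thesis unfolding 2 by (rule meas_jtime)
  next
    case 3 show ?thesis unfolding 3 by (rule borel_measurable_const)
  qed
qed

lemma meas_njumps:
  assumes \<rho>: "\<rho> \<in> borel_measurable Om"
  shows "(\<lambda>\<omega>. njumps \<omega> (\<rho> \<omega>)) \<in> measurable Om (count_space UNIV)"
  unfolding njumps_def
proof (rule measurable_card[where S = "\<lambda>\<omega>. {n. 1 \<le> n \<and> jtime \<omega> n \<le> \<rho> \<omega>}"])
  fix i
  have "{\<omega> \<in> space Om. jtime \<omega> i \<le> \<rho> \<omega>} \<in> sets Om"
    by (rule borel_measurable_le[OF meas_jtime \<rho>])
  then show "{\<omega> \<in> space Om. i \<in> {n. 1 \<le> n \<and> jtime \<omega> n \<le> \<rho> \<omega>}} \<in> sets Om"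
    by (cases "1 \<le> i") simp_all
qed

lemma meas_S: "\<rho> \<in> borel_measurable Om \<Longrightarrow> (\<lambda>\<omega>. S x \<omega> (\<rho> \<omega>)) \<in> measurable Om (count_space UNIV)"
  unfolding S_def
  by (rule measurable_compose_countable[where f = "\<lambda>n \<omega>. jpos x \<omega> n" and g = "\<lambda>\<omega>. njumps \<omega> (\<rho> \<omega>)", OF meas_jpos meas_njumps])

lemma pred_S: "\<rho> \<in> borel_measurable Om \<Longrightarrow> Measurable.pred Om (\<lambda>\<omega>. S x \<omega> (\<rho> \<omega>) = y)"
  unfolding pred_def using measurable_sets[OF meas_S, of \<rho> "{y}" x] by (simp add: vimage_def Int_def conj_commute)

lemma Times_const: "\<exists>i. tm i \<omega> \<le> t \<and> (\<forall>u. tm i \<omega> \<le> u \<and> u \<le> t \<longrightarrow> S x \<omega> u = S x \<omega> t)"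
proof -
  define C where "C t = {n. 1 \<le> n \<and> jtime \<omega> n \<le> t}" for t
  have Cmono: "C u \<subseteq> C v" if "u \<le> v" for u v using that by (auto simp: C_def)
  have N: "njumps \<omega> u = card (C u)" for u by (simp add: njumps_def C_def)
  have wit: "\<exists>i. tm i \<omega> \<le> t \<and> (\<forall>u. tm i \<omega> \<le> u \<and> u \<le> t \<longrightarrow> njumps \<omega> u = njumps \<omega> t)"
    if "tm i \<omega> = \<rho>" "\<rho> \<le> t" "\<forall>u. \<rho> \<le> u \<and> u \<le> t \<longrightarrow> njumps \<omega> u = njumps \<omega> t" for i \<rho>
    using that by blast
  have "\<exists>i. tm i \<omega> \<le> t \<and> (\<forall>u. tm i \<omega> \<le> u \<and> u \<le> t \<longrightarrow> njumps \<omega> u = njumps \<omega> t)"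
  \<comment> \<open>\<open>card\<close> of an infinite set is 0: once the jump times have
    accumulated, \<open>njumps\<close> stays at this default value, and any rational between t' and
    t serves.\<close>
  proof (cases "\<exists>t'<t. infinite (C t')")
    case True
    then obtain t' where t': "t' < t" "infinite (C t')" by auto
    obtain q where q: "q \<in> \<rat>" "t' < q" "q < t" using Rats_dense_in_real[OF t'(1)] by auto
    have "infinite (C u)" if "q \<le> u" for u using t'(2) Cmono[of t' u] q that finite_subset by auto
    then have "\<forall>u. q \<le> u \<and> u \<le> t \<longrightarrow> njumps \<omega> u = njumps \<omega> t" using q by (auto simp: N)
    moreover obtain i where "tm i \<omega> = q" using tm_rat[OF q(1)] by blast
    ultimately show ?thesis using q(3) by (intro wit[of i q]) (assumption | simp only: less_imp_le)+
  next
    case False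
    show ?thesis
    proof (cases "finite (C t)")
      \<comment> \<open>Infinitely many jump times up to t, but finitely many up to any earlier
        time: then t is the explosion time itself.\<close>
      case inf: False
      have "(INF q\<in>\<rat>. if infinite (C q) then ereal q else \<infinity>) = ereal t"
      proof (rule antisym)
        show "(INF q\<in>\<rat>. if infinite (C q) then ereal q else \<infinity>) \<le> ereal t"
        proof (rule ereal_le_epsilon2)
          fix e :: real assume "0 < e"
          then obtain q where q: "q \<in> \<rat>" "t < q" "q < t + e" using Rats_dense_in_real[of t "t + e"] by auto
          have "infinite (C q)" using inf Cmono[of t q] q finite_subset by auto
          then have "(INF q\<in>\<rat>. if infinite (C q) then ereal q else \<infinity>) \<le> ereal q"
            using q by (intro INF_lower2[of q]) auto
          also have "\<dots> \<le> ereal t + ereal e" using q by simp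
          finally show "(INF q\<in>\<rat>. if infinite (C q) then ereal q else \<infinity>) \<le> ereal t + ereal e" .
        qed
        show "ereal t \<le> (INF q\<in>\<rat>. if infinite (C q) then ereal q else \<infinity>)"
          using False by (intro INF_greatest) (auto simp: not_less[symmetric])
      qed
      then have "expl \<omega> = t" by (simp add: expl_def C_def)
      then show ?thesis by (intro exI[of _ 0]) (auto simp: tm_expl dest: order.antisym)
    next
      case fin: True
      show ?thesis
      proof (cases "C t = {}")
        case True
        obtain q where q: "q \<in> \<rat>" "q < t" using Rats_dense_in_real[of "t - 1" t] by auto
        have "\<forall>u. q \<le> u \<and> u \<le> t \<longrightarrow> njumps \<omega> u = njumps \<omega> t" using Cmono[of _ t] True by (auto simp: N)
        moreover obtain i where "tm i \<omega> = q" using tm_rat[OF q(1)] by blast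
        ultimately show ?thesis using q(2) by (intro wit[of i q]) (assumption | simp only: less_imp_le)+
      next
        case ne: False
        \<comment> \<open>On degenerate paths \<open>jtime\<close> need not be monotone, so the last
          jump before t is chosen by its time and not by its index.\<close>
        obtain n where n: "n \<in> C t" "\<And>m. m \<in> C t \<Longrightarrow> jtime \<omega> m \<le> jtime \<omega> n"
        proof -
          have "Max (jtime \<omega> ` C t) \<in> jtime \<omega> ` C t" using fin ne by (intro Max_in) auto
          then obtain k where k: "Max (jtime \<omega> ` C t) = jtime \<omega> k" "k \<in> C t" by (rule imageE)
          have "jtime \<omega> m \<le> jtime \<omega> k" if "m \<in> C t" for m
            using Max_ge[OF finite_imageI[OF fin] imageI[OF that], of "jtime \<omega>"] k(1) by simp
          then show thesis by (rule that[OF k(2)])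
        qed
        have CC: "C u = C t" if u: "jtime \<omega> n \<le> u" "u \<le> t" for u
        proof (rule equalityI[OF Cmono[OF u(2)]], rule subsetI)
          fix m assume m: "m \<in> C t"
          then have "jtime \<omega> m \<le> u" using n(2)[OF m] u by simp
          with m show "m \<in> C u" by (simp add: C_def)
        qed
        have "\<forall>u. jtime \<omega> n \<le> u \<and> u \<le> t \<longrightarrow> njumps \<omega> u = njumps \<omega> t"
          unfolding N by (intro allI impI arg_cong[where f = card] CC) simp_all
        moreover have "jtime \<omega> n \<le> t" "n \<ge> 1" using n(1) unfolding C_def by simp_all
        ultimately show ?thesis by (intro wit[OF tm_jtime[of n \<omega>]])
      qed
    qed
  qed
  then obtain i where "tm i \<omega> \<le> t" "\<And>u. tm i \<omega> \<le> u \<Longrightarrow> u \<le> t \<Longrightarrow> njumps \<omega> u = njumps \<omega> t" by blast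
  then show ?thesis unfolding S_def by metis
qed

lemma tau_eq_INF: "tau x \<omega> = (INF i. if S x \<omega> (max 0 (tm i \<omega>)) \<noteq> S x \<omega> 0 then ereal (max 0 (tm i \<omega>)) else \<infinity>)"
  unfolding tau_def
proof (rule antisym)
  show "Inf (ereal ` {t. 0 \<le> t \<and> S x \<omega> t \<noteq> S x \<omega> 0}) \<le> (INF i. if S x \<omega> (max 0 (tm i \<omega>)) \<noteq> S x \<omega> 0 then ereal (max 0 (tm i \<omega>)) else \<infinity>)"
    by (intro INF_greatest) (auto intro!: Inf_lower simp del: ereal_max)
  show "(INF i. if S x \<omega> (max 0 (tm i \<omega>)) \<noteq> S x \<omega> 0 then ereal (max 0 (tm i \<omega>)) else \<infinity>) \<le> Inf (ereal ` {t. 0 \<le> t \<and> S x \<omega> t \<noteq> S x \<omega> 0})"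
  proof (rule Inf_greatest, clarify)
    fix t assume t: "0 \<le> t" "S x \<omega> t \<noteq> S x \<omega> 0"
    obtain i where i: "tm i \<omega> \<le> t" "\<And>u. tm i \<omega> \<le> u \<Longrightarrow> u \<le> t \<Longrightarrow> S x \<omega> u = S x \<omega> t"
      using Times_const[of \<omega> t x] by blast
    have "S x \<omega> (max 0 (tm i \<omega>)) = S x \<omega> t" by (rule i(2)) (use i(1) t in simp_all)
    then show "(INF i. if S x \<omega> (max 0 (tm i \<omega>)) \<noteq> S x \<omega> 0 then ereal (max 0 (tm i \<omega>)) else \<infinity>) \<le> ereal t"
      using t i(1) by (intro INF_lower2[OF UNIV_I[of i]]) (auto simp del: ereal_max)
  qed
qed

lemma meas_tau[measurable]: "tau x \<in> borel_measurable Om"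
proof -
  have M: "(\<lambda>\<omega>. if S x \<omega> (max 0 (tm i \<omega>)) \<noteq> S x \<omega> 0 then ereal (max 0 (tm i \<omega>)) else \<infinity>) \<in> borel_measurable Om" for i
  proof -
    have m: "(\<lambda>\<omega>. max 0 (tm i \<omega>)) \<in> borel_measurable Om" by (intro borel_measurable_max borel_measurable_const meas_tm)
    have m0: "(\<lambda>\<omega>. 0::real) \<in> borel_measurable Om" by simp
    have "Measurable.pred Om (\<lambda>\<omega>. S x \<omega> (max 0 (tm i \<omega>)) = S x \<omega> 0)"
    proof -
      have "Measurable.pred Om (\<lambda>\<omega>. \<exists>w. S x \<omega> (max 0 (tm i \<omega>)) = w \<and> S x \<omega> 0 = w)"
        by (rule pred_intros_countable(2)) (rule pred_intros_logic(3)[OF pred_S[OF m] pred_S[OF m0]])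
      moreover have "(\<lambda>\<omega>. \<exists>w. S x \<omega> (max 0 (tm i \<omega>)) = w \<and> S x \<omega> 0 = w) = (\<lambda>\<omega>. S x \<omega> (max 0 (tm i \<omega>)) = S x \<omega> 0)"
        by (intro ext) metis
      ultimately show ?thesis by (simp only:)
    qed
    from predE[OF pred_intros_logic(2)[OF this]]
    have "{\<omega> \<in> space Om. S x \<omega> (max 0 (tm i \<omega>)) \<noteq> S x \<omega> 0} \<in> sets Om" .
    then show ?thesis by (rule measurable_If[OF borel_measurable_ereal[OF m], rotated]) simp
  qed
  show ?thesis unfolding tau_eq_INF[abs_def] by (rule borel_measurable_INF[OF countableI_type M])
qed

lemma tau_nonneg: "0 \<le> tau x \<omega>"
  unfolding tau_def by (rule Inf_greatest) auto

text \<open>Clipping the countable family at \<open>tau\<close> loses nothing, since the path is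
  constant from some member up to the given time. The guard against an infinite \<open>tau\<close>
  is there because \<open>real_of_ereal\<close> sends \<infinity> to 0.\<close>

lemma tau_yz_eq_INF:
  fixes x y z \<omega>
  defines "v \<equiv> \<lambda>\<rho>. max (real_of_ereal (tau x \<omega>)) (tm \<rho> \<omega>)"
  shows "tau_yz x y z \<omega> = (INF \<rho>. if tau x \<omega> \<noteq> \<infinity> \<and> S x \<omega> (v \<rho>) = y \<and> (\<forall>\<sigma>. v \<sigma> \<le> v \<rho> \<longrightarrow> S x \<omega> (v \<sigma>) \<noteq> z) then ereal (v \<rho>) else \<infinity>)"
    (is "_ = (INF \<rho>. ?f \<rho>)")
proof (cases "tau x \<omega> = \<infinity>")
  case True
  then have "{t. tau x \<omega> \<le> ereal t \<and> S x \<omega> t = y \<and> (\<forall>u. tau x \<omega> \<le> ereal u \<and> u \<le> t \<longrightarrow> S x \<omega> u \<noteq> z)} = {}" by simp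
  then have "tau_yz x y z \<omega> = Inf {}" unfolding tau_yz_def by (simp only: image_empty)
  then have "tau_yz x y z \<omega> = \<infinity>" by (simp add: top_ereal_def)
  moreover have "(INF \<rho>. ?f \<rho>) = (INF \<rho>. \<infinity>)" using True by simp
  ultimately show ?thesis by simp
next
  case False
  define \<theta> where "\<theta> = real_of_ereal (tau x \<omega>)"
  have \<theta>: "tau x \<omega> = ereal \<theta>" using False tau_nonneg[of x \<omega>] unfolding \<theta>_def by (cases "tau x \<omega>") auto
  have v: "v \<rho> = max \<theta> (tm \<rho> \<omega>)" for \<rho> by (simp add: v_def \<theta>_def)
  let ?A = "{t. tau x \<omega> \<le> ereal t \<and> S x \<omega> t = y \<and> (\<forall>u. tau x \<omega> \<le> ereal u \<and> u \<le> t \<longrightarrow> S x \<omega> u \<noteq> z)}"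
  have cst: "\<exists>\<rho>. v \<rho> \<le> t \<and> S x \<omega> (v \<rho>) = S x \<omega> t" if "\<theta> \<le> t" for t
  proof -
    obtain \<rho> where \<rho>: "tm \<rho> \<omega> \<le> t" "\<And>u. tm \<rho> \<omega> \<le> u \<Longrightarrow> u \<le> t \<Longrightarrow> S x \<omega> u = S x \<omega> t"
      using Times_const[of \<omega> t x] by blast
    have "v \<rho> \<le> t" "S x \<omega> (v \<rho>) = S x \<omega> t" using \<rho>(1) that by (auto simp: v intro!: \<rho>(2))
    then show ?thesis by blast
  qed
  show ?thesis unfolding tau_yz_def
  proof (rule antisym)
    show "Inf (ereal ` ?A) \<le> (INF \<rho>. ?f \<rho>)"
    proof (rule INF_greatest)
      fix \<rho> :: nat
      show "Inf (ereal ` ?A) \<le> ?f \<rho>"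
      proof (cases "S x \<omega> (v \<rho>) = y \<and> (\<forall>\<sigma>. v \<sigma> \<le> v \<rho> \<longrightarrow> S x \<omega> (v \<sigma>) \<noteq> z)")
        case True
        have "S x \<omega> u \<noteq> z" if u: "\<theta> \<le> u" "u \<le> v \<rho>" for u
        proof -
          obtain \<sigma> where "v \<sigma> \<le> u" "S x \<omega> (v \<sigma>) = S x \<omega> u" using cst[OF u(1)] by blast
          then show ?thesis using True u by auto
        qed
        then have "v \<rho> \<in> ?A" using True by (auto simp: \<theta> v)
        then have "Inf (ereal ` ?A) \<le> ereal (v \<rho>)" by (intro Inf_lower) blast
        then show ?thesis using True False by simp
      qed auto
    qed
    show "(INF \<rho>. ?f \<rho>) \<le> Inf (ereal ` ?A)"
    proof (rule Inf_greatest)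
      fix s assume "s \<in> ereal ` ?A"
      then obtain t where t: "s = ereal t" "\<theta> \<le> t" "S x \<omega> t = y" "\<And>u. \<theta> \<le> u \<Longrightarrow> u \<le> t \<Longrightarrow> S x \<omega> u \<noteq> z"
        by (auto simp: \<theta>)
      obtain \<rho> where \<rho>: "v \<rho> \<le> t" "S x \<omega> (v \<rho>) = S x \<omega> t" using cst[OF t(2)] by blast
      have "S x \<omega> (v \<sigma>) \<noteq> z" if "v \<sigma> \<le> v \<rho>" for \<sigma>
      by (rule t(4)) (use that \<rho>(1) in \<open>simp_all add: v[of \<sigma>]\<close>)
      then have "?f \<rho> = ereal (v \<rho>)" using False \<rho> t by simp
      moreover have "(INF \<rho>. ?f \<rho>) \<le> ?f \<rho>" by (rule INF_lower[OF UNIV_I])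
      ultimately show "(INF \<rho>. ?f \<rho>) \<le> s" using \<rho>(1) t(1) by (simp add: order_trans[of _ "ereal (v \<rho>)"])
    qed
  qed
qed

lemma meas_tau_yz[measurable]: "tau_yz x y z \<in> borel_measurable Om"
proof -
  let ?v = "\<lambda>\<rho> \<omega>. max (real_of_ereal (tau x \<omega>)) (tm \<rho> \<omega>)"
  have v: "?v \<rho> \<in> borel_measurable Om" for \<rho>
    by (intro borel_measurable_max borel_measurable_real_of_ereal[OF meas_tau] meas_tm)
  have inner: "Measurable.pred Om (\<lambda>\<omega>. \<forall>\<sigma>. ?v \<sigma> \<omega> \<le> ?v \<rho> \<omega> \<longrightarrow> S x \<omega> (?v \<sigma> \<omega>) \<noteq> z)" for \<rho>
  proof (rule pred_intros_countable(1))
    fix \<sigma> :: nat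
    have "Measurable.pred Om (\<lambda>\<omega>. ?v \<sigma> \<omega> \<le> ?v \<rho> \<omega>)"
      unfolding pred_def by (rule borel_measurable_le[OF v v])
    then show "Measurable.pred Om (\<lambda>\<omega>. ?v \<sigma> \<omega> \<le> ?v \<rho> \<omega> \<longrightarrow> S x \<omega> (?v \<sigma> \<omega>) \<noteq> z)"
      by (rule pred_intros_logic(4)[OF _ pred_intros_logic(2)[OF pred_S[OF v]]])
  qed
  have fin: "Measurable.pred Om (\<lambda>\<omega>. tau x \<omega> \<noteq> \<infinity>)"
    by measurable
  have M: "(\<lambda>\<omega>. if tau x \<omega> \<noteq> \<infinity> \<and> S x \<omega> (?v \<rho> \<omega>) = y \<and> (\<forall>\<sigma>. ?v \<sigma> \<omega> \<le> ?v \<rho> \<omega> \<longrightarrow> S x \<omega> (?v \<sigma> \<omega>) \<noteq> z) then ereal (?v \<rho> \<omega>) else \<infinity>) \<in> borel_measurable Om" for \<rho>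
  proof (rule measurable_If)
    show "(\<lambda>\<omega>. ereal (?v \<rho> \<omega>)) \<in> borel_measurable Om" by (rule borel_measurable_ereal[OF v])
    have "Measurable.pred Om (\<lambda>\<omega>. tau x \<omega> \<noteq> \<infinity> \<and> S x \<omega> (?v \<rho> \<omega>) = y \<and> (\<forall>\<sigma>. ?v \<sigma> \<omega> \<le> ?v \<rho> \<omega> \<longrightarrow> S x \<omega> (?v \<sigma> \<omega>) \<noteq> z))"
      by (rule pred_intros_logic(3)[OF fin pred_intros_logic(3)[OF pred_S[OF v] inner]])
    then show "{\<omega> \<in> space Om. tau x \<omega> \<noteq> \<infinity> \<and> S x \<omega> (?v \<rho> \<omega>) = y \<and> (\<forall>\<sigma>. ?v \<sigma> \<omega> \<le> ?v \<rho> \<omega> \<longrightarrow> S x \<omega> (?v \<sigma> \<omega>) \<noteq> z)} \<in> sets Om"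
      by (simp only: pred_def)
  qed simp
  show ?thesis unfolding tau_yz_eq_INF[abs_def] by (rule borel_measurable_INF[OF countableI_type M])
qed

section \<open>Poissonised formulas for the transition and hitting probabilities\<close>

text \<open>On almost every path the event in \<open>H\<close> is the union over n of the
  \<open>Fv\<close> events with jump time at most t; these exclude one another, so their
  probabilities add up.\<close>

lemma H_sums:
  assumes "t \<ge> 0" "y \<noteq> z"
  shows "(\<lambda>n. fh y z n x * (1 - (\<Sum>k\<le>n. pois k t))) sums H a x y z t"
proof -
  let ?A = "\<lambda>n. {\<omega>. jtime \<omega> (Suc n) \<le> t \<and> Fv y z n x \<omega>}"
  have sets: "?A n \<in> sets Om" for n
  proof -
    have "{\<omega>\<in>space Om. jtime \<omega> (Suc n) \<le> t \<and> Fv y z n x \<omega>} \<in> sets Om" by measurable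
    then show ?thesis by simp
  qed
  have "disjoint_family ?A"
    unfolding disjoint_family_on_def
  proof (intro ballI impI, rule ccontr)
    fix m n :: nat assume mn: "m \<noteq> n" and "?A m \<inter> ?A n \<noteq> {}"
    then obtain \<omega> where "Fv y z m x \<omega>" "Fv y z n x \<omega>" by blast
    then show False using mn by (cases "m < n") (auto simp: Fv_def dest: linorder_neqE_nat)
  qed
  then have "(\<lambda>n. measure Om (?A n)) sums measure Om (\<Union>n. ?A n)"
    using sets by (intro om.finite_measure_UNION) auto
  also have "measure Om (\<Union>n. ?A n) = H a x y z t"
    unfolding H_def
  proof (rule om.finite_measure_eq_AE)
    show "AE \<omega> in Om. \<omega> \<in> (\<Union>n. ?A n) \<longleftrightarrow> \<omega> \<in> {\<omega> \<in> space Om. tau_yz x y z \<omega> \<le> ereal t}"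
      using AE_good
    proof eventually_elim
      case (elim \<omega>)
      show ?case using tau_yz_le_iff[OF elim assms(2), of x t] by simp
    qed
    show "{\<omega> \<in> space Om. tau_yz x y z \<omega> \<le> ereal t} \<in> sets Om" by measurable
  qed (use sets in auto)
  finally show ?thesis by (simp add: hit_suminf_Fv[OF assms(1)])
qed

lemma p_sums:
  assumes t: "t \<ge> 0"
  shows "(\<lambda>n. hit {} y n x * pois n t) sums p a t x y"
proof -
  let ?C = "\<lambda>n. {\<omega>. njumps \<omega> t = n \<and> jpos x \<omega> n = y}"
  note [measurable] = meas_njumps[of "\<lambda>_. t", simplified]
  have sets: "?C n \<in> sets Om" for n
  proof -
    have "{\<omega>\<in>space Om. njumps \<omega> t = n \<and> jpos x \<omega> n = y} \<in> sets Om" by measurable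
    then show ?thesis by simp
  qed
  have "(\<lambda>n. measure Om (?C n)) sums measure Om (\<Union>n. ?C n)"
    using sets by (intro om.finite_measure_UNION) (auto simp: disjoint_family_on_def)
  also have "(\<Union>n. ?C n) = {\<omega> \<in> space Om. S x \<omega> t = y}" by (auto simp: S_def)
  also have "measure Om \<dots> = p a t x y" by (simp add: p_def)
  also have "(\<lambda>n. measure Om (?C n)) = (\<lambda>n. hit {} y n x * pois n t)"
  proof
    fix n
    \<comment> \<open>\<open>njumps \<omega> t = n\<close> means that the clock has passed n but not
      n + 1; both sets carry the same position event at index n, so the probability is a difference
      of two values of \<open>emeasure_Ev\<close>.\<close>
    let ?D = "\<lambda>m. {\<omega>. jtime \<omega> m \<le> t \<and> Ev {} y n x \<omega>}"
    have D: "measure Om (?D m) = (1 - (\<Sum>k<m. pois k t)) * hit {} y n x" if "n \<le> m" for m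
    proof -
      have "emeasure Om (?D m) = ennreal ((1 - (\<Sum>k<m. pois k t)) * hit {} y n x)"
        using sum_pois_le[OF t, of m] by (simp add: emeasure_Ev[OF that] Er_eq[OF t] ennreal_mult hit_nonneg)
      then show ?thesis using sum_pois_le[OF t, of m] by (simp add: measure_def hit_nonneg)
    qed
    have "measure Om (?C n) = measure Om (?D n - ?D (Suc n))"
    proof (rule om.finite_measure_eq_AE)
      show "AE \<omega> in Om. \<omega> \<in> ?C n \<longleftrightarrow> \<omega> \<in> ?D n - ?D (Suc n)"
        using AE_good
      proof eventually_elim
        case (elim \<omega>)
        obtain k where k: "jtime \<omega> k \<le> t" "t < jtime \<omega> (Suc k)" using ex_interval[OF elim t] by blast
        have nk: "njumps \<omega> t = k" using njumps_eqI[OF elim k] .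
        have "jtime \<omega> n \<le> t \<and> \<not> jtime \<omega> (Suc n) \<le> t \<longleftrightarrow> k = n"
          using njumps_eqI[OF elim, of n t] nk k by auto
        then show ?case using nk by (auto simp: Ev_def)
      qed
    qed (use sets sets_EvT in auto)
    also have "\<dots> = measure Om (?D n) - measure Om (?D n \<inter> ?D (Suc n))"
      by (rule om.finite_measure_Diff') (use sets_EvT in auto)
    also have "measure Om (?D n \<inter> ?D (Suc n)) = measure Om (?D (Suc n))"
    proof (rule om.finite_measure_eq_AE)
      show "AE \<omega> in Om. \<omega> \<in> ?D n \<inter> ?D (Suc n) \<longleftrightarrow> \<omega> \<in> ?D (Suc n)"
        using AE_good
      proof eventually_elim
        case (elim \<omega>)
        show ?case using jtime_le_iff[OF elim, of n "Suc n"] by auto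
      qed
    qed (use sets_EvT in auto)
    finally show "measure Om (?C n) = hit {} y n x * pois n t"
      by (simp add: D algebra_simps)
  qed
  finally show ?thesis .
qed

end

section \<open>Fourier inversion\<close>

lemma ip_add: "ip (x + y) \<theta> = ip x \<theta> + ip y \<theta>" by (simp add: ip_def sum.distrib algebra_simps)
lemma ip_minus: "ip (- x) \<theta> = - ip x \<theta>" by (simp add: ip_def sum_negf)
lemma ip_0[simp]: "ip 0 \<theta> = 0" by (simp add: ip_def)
lemma ip_0_right[simp]: "ip x 0 = 0" by (simp add: ip_def)
lemma ip_scaleR: "ip x (c *\<^sub>R \<theta>) = c * ip x \<theta>" by (simp add: ip_def sum_distrib_left mult_ac)
lemma ip_add_right: "ip x (\<theta> + \<eta>) = ip x \<theta> + ip x \<eta>" by (simp add: ip_def sum.distrib algebra_simps)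
lemma ip_axis: "ip x (axis j 1) = real_of_int (x $ j)"
  by (simp add: ip_def axis_def if_distrib[of "\<lambda>c. _ * c"] cong: if_cong)
lemma axis_ip: "ip (axis i 1) \<theta> = \<theta> $ i"
proof -
  have "ip (axis i 1) \<theta> = (\<Sum>j\<in>UNIV. if j = i then \<theta> $ j else 0)"
    unfolding ip_def by (intro sum.cong refl) (simp add: axis_def)
  then show ?thesis by simp
qed
lemma continuous_on_ip[continuous_intros]: "continuous_on A (ip x)"
  unfolding ip_def by (intro continuous_intros)
lemma borel_measurable_ip[measurable]: "ip x \<in> borel_measurable borel"
  by (rule borel_measurable_continuous_onI) (rule continuous_on_ip)

lemma ip_sq_le:
  fixes z :: "int^'n"
  shows "(ip z \<theta>)\<^sup>2 \<le> sqn z * (norm \<theta>)\<^sup>2"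
proof -
  let ?z = "(\<chi> i. real_of_int (z $ i)) :: real^'n"
  have "ip z \<theta> = ?z \<bullet> \<theta>" by (simp add: ip_def inner_vec_def)
  moreover have "sqn z = ?z \<bullet> ?z" by (simp add: sqn_def inner_vec_def power2_eq_square)
  ultimately show ?thesis using Cauchy_Schwarz_ineq[of ?z \<theta>] by (simp add: power2_norm_eq_inner)
qed

section \<open>Inequalities for the cosine\<close>

lemma one_minus_cos_le: "1 - cos t \<le> t\<^sup>2 / 2" for t :: real
proof -
  have "1 - cos t = 2 * (sin (t / 2))\<^sup>2" using cos_double_sin[of "t / 2"] by simp
  also have "(sin (t / 2))\<^sup>2 \<le> (t / 2)\<^sup>2" by (subst abs_le_square_iff[symmetric]) (rule abs_sin_x_le_abs_x)
  finally show ?thesis by (simp add: power_divide)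
qed

text \<open>With s = |t| / 2 the bound \<open>s / 4 \<le> sin s\<close> holds on [0, pi / 2], by the
  mean value theorem up to pi / 3 and by monotonicity beyond; then
  \<open>1 - cos t = 2 * (sin s)\<^sup>2\<close> produces the constant 1 / 32.\<close>

lemma one_minus_cos_ge: "\<bar>t\<bar> \<le> pi \<Longrightarrow> t\<^sup>2 / 32 \<le> 1 - cos t" for t :: real
proof -
  assume t: "\<bar>t\<bar> \<le> pi"
  define s where "s = \<bar>t\<bar> / 2"
  have s: "0 \<le> s" "s \<le> pi / 2" using t by (auto simp: s_def)
  have "s / 4 \<le> sin s"
  proof (cases "s \<le> pi / 3")
    case True
    show ?thesis
    proof (cases "s = 0")
      case False
      then have "0 < s" using s by simp
      from MVT2[OF this, of sin cos] obtain \<xi> where \<xi>: "0 < \<xi>" "\<xi> < s" "sin s - sin 0 = (s - 0) * cos \<xi>"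
        by (auto intro: DERIV_sin)
      have "cos (pi / 3) \<le> cos \<xi>" using \<xi> True s by (intro cos_monotone_0_pi_le) auto
      then have "1 / 2 \<le> cos \<xi>" by (simp add: cos_60)
      then have "s * (1 / 4) \<le> s * cos \<xi>" using s by (intro mult_left_mono) auto
      then show ?thesis using \<xi> by simp
    qed simp
  next
    case False
    have "sin (pi / 6) \<le> sin s" using False s pi_gt_zero by (intro sin_monotone_2pi_le) auto
    then have "1 / 2 \<le> sin s" by (simp add: sin_30)
    moreover have "s \<le> 2" using s pi_less_4 by simp
    ultimately show ?thesis by simp
  qed
  then have "(s / 4)\<^sup>2 \<le> (sin s)\<^sup>2" using s by (intro power_mono) auto
  moreover have "1 - cos t = 2 * (sin s)\<^sup>2" using cos_double_sin[of s] by (simp add: s_def)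
  ultimately show ?thesis by (simp add: s_def power_divide)
qed

text \<open>The modulus of the sine is subadditive; squaring costs the factor 2. This lets a bound
  on \<open>1 - cos\<close> travel along a path of steps in \<open>cos_bound\<close>.\<close>

lemma one_minus_cos_add: "1 - cos (\<alpha> + \<beta>) \<le> 2 * (1 - cos \<alpha>) + 2 * (1 - cos \<beta>)" for \<alpha> \<beta> :: real
proof -
  have c: "1 - cos t = 2 * (sin (t / 2))\<^sup>2" for t :: real using cos_double_sin[of "t / 2"] by simp
  have "\<bar>sin ((\<alpha> + \<beta>) / 2)\<bar> \<le> \<bar>sin (\<alpha> / 2)\<bar> * \<bar>cos (\<beta> / 2)\<bar> + \<bar>cos (\<alpha> / 2)\<bar> * \<bar>sin (\<beta> / 2)\<bar>"
    unfolding add_divide_distrib sin_add abs_mult[symmetric] by (rule abs_triangle_ineq)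
  also have "\<dots> \<le> \<bar>sin (\<alpha> / 2)\<bar> * 1 + 1 * \<bar>sin (\<beta> / 2)\<bar>"
    by (intro add_mono mult_left_mono mult_right_mono) auto
  finally have "\<bar>sin ((\<alpha> + \<beta>) / 2)\<bar> \<le> \<bar>sin (\<alpha> / 2)\<bar> + \<bar>sin (\<beta> / 2)\<bar>" by simp
  then have "\<bar>sin ((\<alpha> + \<beta>) / 2)\<bar>\<^sup>2 \<le> (\<bar>sin (\<alpha> / 2)\<bar> + \<bar>sin (\<beta> / 2)\<bar>)\<^sup>2" by (intro power_mono) auto
  also have "\<dots> \<le> 2 * \<bar>sin (\<alpha> / 2)\<bar>\<^sup>2 + 2 * \<bar>sin (\<beta> / 2)\<bar>\<^sup>2"
    using zero_le_power2[of "\<bar>sin (\<alpha> / 2)\<bar> - \<bar>sin (\<beta> / 2)\<bar>"] by (simp only: power2_sum power2_diff)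
  finally show ?thesis unfolding c by simp
qed

section \<open>The uniform law on the torus and its characters\<close>

definition bx :: "(real^'n) set" where "bx = cbox (- (\<chi> i. pi)) (\<chi> i. pi)"

lemma mem_bx: "\<theta> \<in> bx \<longleftrightarrow> (\<forall>i. \<bar>\<theta> $ i\<bar> \<le> pi)"
  by (auto simp: bx_def mem_box_cart abs_le_iff minus_le_iff)

lemma bx_sets[measurable]: "bx \<in> sets borel" by (simp add: bx_def)

lemma emeasure_bx: "emeasure lborel (bx :: (real^'n) set) = ennreal ((2 * pi) ^ CARD('n))"
proof -
  have "emeasure lborel (bx :: (real^'n) set) = ennreal (\<Prod>b\<in>Basis. ((\<chi> i. pi) - - (\<chi> i. pi)) \<bullet> (b :: real^'n))"
    unfolding bx_def by (rule emeasure_lborel_cbox) (auto simp: Basis_vec_def inner_axis)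
  also have "(\<Prod>b\<in>Basis. ((\<chi> i. pi) - - (\<chi> i. pi)) \<bullet> (b :: real^'n)) = (2 * pi) ^ CARD('n)"
    unfolding prod_Basis_cart by simp
  finally show ?thesis .
qed

text \<open>Normalised Lebesgue measure on the box, so that the factor
  \<open>(2 * pi) ^ CARD('n)\<close> of Fourier inversion disappears and bounded measurable
  functions are integrable.\<close>

definition mu :: "(real^'n) measure" where "mu = uniform_measure lborel bx"

lemma sets_mu[measurable_cong, simp]: "sets mu = sets borel" by (simp add: mu_def)
lemma space_mu[simp]: "space mu = UNIV" by (simp add: mu_def)

lemma prob_mu: "prob_space (mu :: (real^'n) measure)"
  unfolding mu_def by (rule prob_space_uniform_measure) (auto simp: emeasure_bx zero_less_power)

interpretation mu: prob_space "mu :: (real^'n) measure" by (rule prob_mu)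

lemma AE_mu_bx: "AE \<theta> in mu. \<theta> \<in> bx"
  unfolding mu_def by (rule AE_uniform_measureI) auto

lemma mu_density: "(mu :: (real^'n) measure) = density lborel (\<lambda>\<theta>. ennreal (indicator bx \<theta> / (2 * pi) ^ CARD('n)))"
  unfolding mu_def uniform_measure_def emeasure_bx
  by (intro density_cong) (auto split: split_indicator simp: divide_ennreal[symmetric] ennreal_1[symmetric] simp del: ennreal_1)

lemma integral_mu:
  fixes f :: "real^'n \<Rightarrow> real"
  assumes [measurable]: "f \<in> borel_measurable borel"
  shows "(LINT \<theta>|mu. f \<theta>) = 1 / (2 * pi) ^ CARD('n) * (LINT \<theta>|lborel. indicator bx \<theta> * f \<theta>)"
proof -
  have "(LINT \<theta>|mu. f \<theta>) = (LINT \<theta>|lborel. (indicator bx \<theta> / (2 * pi) ^ CARD('n)) *\<^sub>R f \<theta>)"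
    unfolding mu_density by (rule integral_density) auto
  then show ?thesis by simp
qed

lemma integrable_mu_bounded:
  assumes [measurable]: "f \<in> borel_measurable borel" and B: "\<And>\<theta>. \<theta> \<in> bx \<Longrightarrow> \<bar>f \<theta>\<bar> \<le> B"
  shows "integrable mu (f :: real^'n \<Rightarrow> real)"
proof (rule mu.integrable_const_bound[where B = B])
  show "AE \<theta> in mu. norm (f \<theta>) \<le> B" using AE_mu_bx by eventually_elim (use B in auto)
qed simp

lemma AE_mu_nonzero: "AE \<theta> in (mu :: (real^'n) measure). \<theta> \<noteq> 0"
proof -
  have "AE \<theta> in lborel. \<theta> \<noteq> (0 :: real^'n)" by (rule AE_lborel_singleton)
  then show ?thesis unfolding mu_density by (subst AE_density) auto
qed

text \<open>\<open>rho\<close> is defined by a gauge integral; this is the bridge to the Lebesgue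
  integral over \<open>mu\<close>.\<close>

lemma integral_mu_HK:
  fixes f :: "real^'n \<Rightarrow> real"
  assumes m[measurable]: "f \<in> borel_measurable borel" and B: "\<And>\<theta>. \<theta> \<in> bx \<Longrightarrow> \<bar>f \<theta>\<bar> \<le> B"
  shows "integral bx f / (2 * pi) ^ CARD('n) = (LINT \<theta>|mu. f \<theta>)"
proof -
  have "integrable lborel (\<lambda>\<theta>. indicator bx \<theta> * B)"
    by (intro integrable_mult_left integrable_real_indicator) (auto simp: emeasure_bx)
  then have "integrable lborel (\<lambda>\<theta>. indicator bx \<theta> *\<^sub>R f \<theta>)"
    by (rule Bochner_Integration.integrable_bound) (use B in \<open>auto intro!: AE_I2 split: split_indicator intro: order_trans[OF _ abs_ge_self]\<close>)
  then have s: "set_integrable lborel bx f" unfolding set_integrable_def .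
  have "integral bx f = (LINT \<theta>|lborel. indicator bx \<theta> *\<^sub>R f \<theta>)"
    using set_borel_integral_eq_integral(2)[OF s] by (simp add: set_lebesgue_integral_def)
  then show ?thesis unfolding integral_mu[OF m] by simp
qed

lemma integral_cis_period:
  fixes m :: int
  shows "has_bochner_integral lborel (\<lambda>t. indicator {- pi..pi} t *\<^sub>R exp (\<i> * complex_of_real (real_of_int m * t))) (if m = 0 then complex_of_real (2 * pi) else 0)"
proof (cases "m = 0")
  case True
  have "has_bochner_integral lborel (\<lambda>t. indicator {- pi..pi} t *\<^sub>R (1::complex)) (measure lborel {-pi..pi} *\<^sub>R 1)"
    by (rule has_bochner_integral_scaleR_left[OF has_bochner_integral_real_indicator]) (auto simp: emeasure_lborel_Icc_eq)
  then show ?thesis using True by (simp add: scaleR_conv_of_real)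
next
  case False
  let ?F = "\<lambda>t::real. exp (\<i> * complex_of_real (real_of_int m * t)) / (\<i> * complex_of_real (real_of_int m))"
  have "has_bochner_integral lborel (\<lambda>t. indicator {- pi..pi} t *\<^sub>R exp (\<i> * complex_of_real (real_of_int m * t))) (?F pi - ?F (- pi))"
  proof (rule has_bochner_integral_FTC_Icc)
    fix t assume "- pi \<le> t" "t \<le> pi"
    show "(?F has_vector_derivative exp (\<i> * complex_of_real (real_of_int m * t))) (at t within {- pi..pi})"
      using False by (auto intro!: derivative_eq_intros has_vector_derivative_real_field simp: field_simps)
  qed (auto intro!: continuous_intros)
  moreover have "exp (\<i> * complex_of_real (real_of_int m * pi)) = exp (\<i> * complex_of_real (real_of_int m * (- pi)))"
    by (rule exp_eq[THEN iffD2]) (auto intro!: exI[of _ m] simp: algebra_simps)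
  ultimately show ?thesis using False by simp
qed

lemma integral_mu_cos: "(LINT \<theta>|mu. cos (ip x \<theta>)) = (if x = 0 then 1 else 0)" for x :: "int^'n"
proof -
  \<comment> \<open>The product formula runs over basis vectors b and not over indices;
    \<open>\<lfloor>ip x b\<rfloor>\<close> recovers the integer coordinate of x along b.\<close>
  let ?f = "\<lambda>b t. indicator {- pi..pi} t *\<^sub>R exp (\<i> * complex_of_real (real_of_int \<lfloor>ip x b\<rfloor> * t))"
  let ?c = "\<lambda>b. if \<lfloor>ip x b\<rfloor> = 0 then complex_of_real (2 * pi) else 0"
  have "has_bochner_integral lborel (\<lambda>\<theta>::real^'n. \<Prod>b\<in>Basis. ?f b (\<theta> \<bullet> b)) (\<Prod>b\<in>Basis. ?c b)"
    by (intro has_bochner_integral_lborel_prod integral_cis_period)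
  also have "(\<lambda>\<theta>::real^'n. \<Prod>b\<in>Basis. ?f b (\<theta> \<bullet> b)) = (\<lambda>\<theta>. indicator bx \<theta> *\<^sub>R exp (\<i> * complex_of_real (ip x \<theta>)))"
  proof
    fix \<theta> :: "real^'n"
    have B: "(Basis :: (real^'n) set) = range (\<lambda>i. axis i 1)" by (auto simp: Basis_vec_def)
    have inj: "inj (\<lambda>i::'n. axis i (1::real))" by (auto simp: inj_def axis_eq_axis)
    have "(\<Prod>b\<in>Basis. ?f b (\<theta> \<bullet> b)) = (\<Prod>i\<in>UNIV. indicator {- pi..pi} (\<theta> $ i) *\<^sub>R exp (\<i> * complex_of_real (real_of_int (x $ i) * \<theta> $ i)))"
      unfolding B prod.reindex[OF inj] o_def by (simp add: inner_axis ip_axis)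
    also have "\<dots> = (\<Prod>i\<in>UNIV. complex_of_real (indicator {- pi..pi} (\<theta> $ i))) * (\<Prod>i\<in>UNIV. exp (\<i> * complex_of_real (real_of_int (x $ i) * \<theta> $ i)))"
      by (simp add: scaleR_conv_of_real prod.distrib)
    also have "(\<Prod>i\<in>UNIV. complex_of_real (indicator {- pi..pi} (\<theta> $ i))) = complex_of_real (indicator bx \<theta>)"
    proof (cases "\<theta> \<in> bx")
      case True
      then have "indicator {- pi..pi} (\<theta> $ i) = (1::real)" for i by (auto simp: mem_bx abs_le_iff minus_le_iff)
      then show ?thesis using True by simp
    next
      case False
      then obtain i where "\<not> \<bar>\<theta> $ i\<bar> \<le> pi" unfolding mem_bx by blast
      then have "indicator {- pi..pi} (\<theta> $ i) = (0::real)" by (auto simp: indicator_def)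
      then have "(\<Prod>i\<in>UNIV. complex_of_real (indicator {- pi..pi} (\<theta> $ i))) = 0" by (intro prod_zero) auto
      then show ?thesis using False by simp
    qed
    also have "(\<Prod>i\<in>UNIV. exp (\<i> * complex_of_real (real_of_int (x $ i) * \<theta> $ i))) = exp (\<i> * complex_of_real (ip x \<theta>))"
      by (simp add: exp_sum[symmetric] ip_def sum_distrib_left)
    finally show "(\<Prod>b\<in>Basis. ?f b (\<theta> \<bullet> b)) = indicator bx \<theta> *\<^sub>R exp (\<i> * complex_of_real (ip x \<theta>))"
      by (simp add: scaleR_conv_of_real)
  qed
  finally have "has_bochner_integral lborel (\<lambda>\<theta>::real^'n. Re (indicator bx \<theta> *\<^sub>R exp (\<i> * complex_of_real (ip x \<theta>)))) (Re (\<Prod>b\<in>(Basis :: (real^'n) set). ?c b))"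
    by (rule has_bochner_integral_bounded_linear[OF bounded_linear_Re])
  then have i: "(LINT \<theta>|lborel. indicator bx \<theta> * cos (ip x \<theta>)) = Re (\<Prod>b\<in>(Basis :: (real^'n) set). ?c b)"
    by (simp add: has_bochner_integral_iff Re_exp)
  have "(\<Prod>b\<in>(Basis :: (real^'n) set). ?c b) = complex_of_real (if x = 0 then (2 * pi) ^ CARD('n) else 0)"
  proof (cases "x = 0")
    case False
    then obtain i where "x $ i \<noteq> 0" by (auto simp: vec_eq_iff)
    then have "?c (axis i 1) = 0" by (simp add: ip_axis)
    then have "\<exists>b\<in>(Basis :: (real^'n) set). ?c b = 0"
      by (rule bexI[of _ "axis i 1"]) (simp add: axis_in_Basis_iff)
    then have "(\<Prod>b\<in>(Basis :: (real^'n) set). ?c b) = 0" by (rule prod_zero[OF finite_Basis])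
    then show ?thesis using False by simp
  qed simp
  then show ?thesis using i by (subst integral_mu) auto
qed

context walk begin

text \<open>Characteristic function of one jump; the cosine alone suffices because the jump law is
  symmetric.\<close>

definition ch :: "real^'n \<Rightarrow> real" where "ch \<theta> = measure_pmf.expectation J (\<lambda>v. cos (ip v \<theta>))"

sublocale Jmu: pair_prob_space "measure_pmf J" "mu :: (real^'n) measure" ..

lemma expectation_J_infsum:
  assumes "\<And>v. \<bar>f v\<bar> \<le> B"
  shows "measure_pmf.expectation J f = (\<Sum>\<^sub>\<infinity>v. b v * f v)" "(\<lambda>v. b v * f v) summable_on UNIV"
proof -
  have "integrable (measure_pmf J) f" using assms by (rule integrable_J_bounded)
  then have "integrable (count_space UNIV) (\<lambda>v. b v * f v)"
    unfolding measure_pmf_eq_density by (subst (asm) integrable_density) (auto simp: pmf_J b_nonneg)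
  then have s: "Infinite_Set_Sum.abs_summable_on (\<lambda>v. b v * f v) UNIV" by (simp add: Infinite_Set_Sum.abs_summable_on_def)
  then show "measure_pmf.expectation J f = (\<Sum>\<^sub>\<infinity>v. b v * f v)"
    unfolding pmf_expectation_eq_infsetsum pmf_J by (rule infsetsum_infsum)
  show "(\<lambda>v. b v * f v) summable_on UNIV"
    using s by (simp add: abs_summable_equivalent[symmetric] abs_summable_summable)
qed

lemma phi_eq: "phi a \<theta> = r * (ch \<theta> - 1)"
proof -
  have bd: "\<bar>cos (ip v \<theta>)\<bar> \<le> 1" for v by simp
  have "((\<lambda>v. b v * cos (ip v \<theta>)) has_sum ch \<theta>) UNIV"
    using expectation_J_infsum[OF bd] by (simp add: ch_def has_sum_infsum)
  moreover have "((\<lambda>v. if v \<in> {0} then - 1 else 0) has_sum (- 1)) (UNIV :: (int^'n) set)"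
    by (rule has_sum_finite_neutralI[where B = "{0}"]) auto
  ultimately have "((\<lambda>v. b v * cos (ip v \<theta>) + (if v \<in> {0} then - 1 else 0)) has_sum (ch \<theta> + - 1)) UNIV"
    by (rule has_sum_add)
  then have "((\<lambda>v. r * (b v * cos (ip v \<theta>) + (if v \<in> {0} then - 1 else 0))) has_sum (r * (ch \<theta> + - 1))) UNIV"
    by (rule has_sum_cmult_right)
  also have "(\<lambda>v. r * (b v * cos (ip v \<theta>) + (if v \<in> {0} then - 1 else 0))) = (\<lambda>v. a v * cos (ip v \<theta>))"
    using r_pos by (auto simp: fun_eq_iff b_def rate_def)
  finally show ?thesis unfolding phi_def by (simp add: infsumI)
qed

lemma measurable_J_mu:
  fixes f :: "int^'n \<Rightarrow> real^'n \<Rightarrow> real"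
  assumes "\<And>v. f v \<in> borel_measurable borel"
  shows "(\<lambda>(v, \<theta>). f v \<theta>) \<in> borel_measurable (measure_pmf J \<Otimes>\<^sub>M (mu :: (real^'n) measure))"
proof -
  have "case_prod f \<in> borel_measurable (count_space UNIV \<Otimes>\<^sub>M (mu :: (real^'n) measure))"
    by (rule measurable_pair_measure_countable1) (use assms in auto)
  then show ?thesis by (simp cong: measurable_cong_sets sets_pair_measure_cong)
qed

lemma swap_J_mu:
  fixes f :: "int^'n \<Rightarrow> real^'n \<Rightarrow> real"
  assumes m: "\<And>v. f v \<in> borel_measurable borel" and B: "\<And>v \<theta>. \<bar>f v \<theta>\<bar> \<le> B"
  shows "measure_pmf.expectation J (\<lambda>v. LINT \<theta>|mu. f v \<theta>) = (LINT \<theta>|mu. measure_pmf.expectation J (\<lambda>v. f v \<theta>))"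
    and "(\<lambda>\<theta>. measure_pmf.expectation J (\<lambda>v. f v \<theta>)) \<in> borel_measurable borel"
proof -
  have mm: "(\<lambda>(v, \<theta>). f v \<theta>) \<in> borel_measurable (measure_pmf J \<Otimes>\<^sub>M mu)" by (rule measurable_J_mu[OF m])
  have "integrable (measure_pmf J \<Otimes>\<^sub>M mu) (\<lambda>(v, \<theta>). f v \<theta>)"
    using mm B by (intro Jmu.integrable_const_bound[where B = B]) auto
  from Jmu.Fubini_integral[OF this]
  show "measure_pmf.expectation J (\<lambda>v. LINT \<theta>|mu. f v \<theta>) = (LINT \<theta>|mu. measure_pmf.expectation J (\<lambda>v. f v \<theta>))" by simp
  have "(\<lambda>(\<theta>, v). f v \<theta>) \<in> borel_measurable (mu \<Otimes>\<^sub>M measure_pmf J)"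
    using measurable_compose[OF measurable_pair_swap' mm] by (simp add: case_prod_unfold)
  then have "(\<lambda>\<theta>. measure_pmf.expectation J (\<lambda>v. f v \<theta>)) \<in> borel_measurable mu"
    by (rule measure_pmf.borel_measurable_lebesgue_integral)
  then show "(\<lambda>\<theta>. measure_pmf.expectation J (\<lambda>v. f v \<theta>)) \<in> borel_measurable borel" by (simp cong: measurable_cong_sets)
qed

lemma ch_meas[measurable]: "ch \<in> borel_measurable borel"
  unfolding ch_def[abs_def] by (rule swap_J_mu(2)[where B = 1]) auto

lemma phi_meas[measurable]: "phi a \<in> borel_measurable borel"
  unfolding phi_eq[abs_def] by measurable

lemma abs_ch: "\<bar>ch \<theta>\<bar> \<le> 1"
proof -
  have "\<bar>ch \<theta>\<bar> \<le> measure_pmf.expectation J (\<lambda>v. \<bar>cos (ip v \<theta>)\<bar>)"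
    unfolding ch_def by (rule integral_abs_bound)
  also have "\<dots> \<le> 1"
    by (intro measure_pmf.integral_le_const integrable_J_bounded[where B = 1]) auto
  finally show ?thesis .
qed

lemma ch_le_1: "ch \<theta> \<le> 1" and ch_ge: "- 1 \<le> ch \<theta>" using abs_ch[of \<theta>] by auto
lemma phi_le_0: "phi a \<theta> \<le> 0" using ch_le_1[of \<theta>] r_pos by (simp add: phi_eq mult_le_0_iff)

lemma expectation_J_neg: "measure_pmf.expectation J (\<lambda>v. f (- v)) = measure_pmf.expectation J f" for f :: "int^'n \<Rightarrow> real"
proof -
  have "map_pmf uminus J = J"
  proof (rule pmf_eqI)
    fix i :: "int^'n"
    have "pmf (map_pmf uminus J) (- (- i)) = pmf J (- i)" by (rule pmf_map_inj') (simp add: inj_def)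
    then show "pmf (map_pmf uminus J) i = pmf J i" by (simp add: pmf_J b_sym)
  qed
  then show ?thesis using integral_map_pmf[of uminus J f] by (simp add: comp_def)
qed

text \<open>The sine part has mean zero by symmetry of the jump law, so one more jump multiplies a
  cosine by \<open>ch \<theta>\<close>.\<close>

lemma expectation_cos_shift: "measure_pmf.expectation J (\<lambda>v. cos (\<alpha> + ip v \<theta>)) = cos \<alpha> * ch \<theta>"
proof -
  have s: "measure_pmf.expectation J (\<lambda>v. sin (ip v \<theta>)) = 0"
    using expectation_J_neg[of "\<lambda>v. sin (ip v \<theta>)"] by (simp add: ip_minus)
  have i: "integrable (measure_pmf J) (\<lambda>v. cos (ip v \<theta>))" "integrable (measure_pmf J) (\<lambda>v. sin (ip v \<theta>))"
    by (rule integrable_J_bounded[where B = 1], simp)+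
  have "measure_pmf.expectation J (\<lambda>v. cos (\<alpha> + ip v \<theta>)) = measure_pmf.expectation J (\<lambda>v. cos \<alpha> * cos (ip v \<theta>) - sin \<alpha> * sin (ip v \<theta>))"
    by (simp add: cos_add)
  also have "\<dots> = cos \<alpha> * ch \<theta> - sin \<alpha> * measure_pmf.expectation J (\<lambda>v. sin (ip v \<theta>))"
    using i by (subst Bochner_Integration.integral_diff) (auto simp: ch_def)
  finally show ?thesis by (simp add: s)
qed

definition q :: "nat \<Rightarrow> int^'n \<Rightarrow> real" where "q n x = hit {} 0 n x"

lemma hit_eq_q: "hit {} y n x = q n (x - y)"
proof -
  have "hit {} y n x = hit {} 0 n (x - y)"
    by (induction n arbitrary: x) (auto simp: add_diff_eq diff_add_eq)
  then show ?thesis by (simp add: q_def)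
qed

lemma q_fourier: "q n x = (LINT \<theta>|mu. cos (ip x \<theta>) * ch \<theta> ^ n)"
proof (induction n arbitrary: x)
  case 0
  then show ?case by (simp add: q_def integral_mu_cos)
next
  case (Suc n)
  have bd: "\<bar>cos (ip (x + v) \<theta>) * ch \<theta> ^ n\<bar> \<le> 1" for v \<theta>
    using abs_ch[of \<theta>] by (simp add: abs_mult power_abs mult_le_one power_le_one)
  have "q (Suc n) x = measure_pmf.expectation J (\<lambda>v. q n (x + v))" by (simp add: q_def)
  also have "\<dots> = measure_pmf.expectation J (\<lambda>v. LINT \<theta>|mu. cos (ip (x + v) \<theta>) * ch \<theta> ^ n)"
    by (simp add: Suc)
  also have "\<dots> = (LINT \<theta>|mu. measure_pmf.expectation J (\<lambda>v. cos (ip (x + v) \<theta>) * ch \<theta> ^ n))"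
    by (rule swap_J_mu(1)[OF _ bd]) simp
  also have "\<dots> = (LINT \<theta>|mu. cos (ip x \<theta>) * ch \<theta> ^ Suc n)"
    by (simp add: ip_add expectation_cos_shift mult_ac)
  finally show ?case .
qed

lemma q_sym: "q n (- x) = q n x" by (simp add: q_fourier ip_minus)
lemma q_nonneg: "0 \<le> q n x" and q_le_1: "q n x \<le> 1" by (simp_all add: q_def hit_nonneg hit_le_1)

text \<open>Summation passes under the integral since |ch| \<le> 1 and the weights are summable.
  Geometric weights give \<open>Qs\<close>, Poisson weights give \<open>P\<close>.\<close>

lemma fourier_sums:
  assumes c: "\<And>n. 0 \<le> c n" and s: "summable c"
  shows "(\<lambda>n. c n * q n x) sums (LINT \<theta>|mu. cos (ip x \<theta>) * (\<Sum>n. c n * ch \<theta> ^ n))"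
proof -
  let ?f = "\<lambda>n \<theta>. c n * (cos (ip x \<theta>) * ch \<theta> ^ n)"
  have bd: "\<bar>?f n \<theta>\<bar> \<le> c n" for n \<theta>
    using abs_ch[of \<theta>] c[of n] by (simp add: abs_mult power_abs mult_le_one power_le_one mult_left_le)
  have i: "integrable mu (?f n)" for n by (rule integrable_mu_bounded[OF _ bd]) simp
  have s1: "summable (\<lambda>n. norm (?f n \<theta>))" for \<theta>
    by (rule summable_comparison_test'[OF s, of 0]) (use bd in auto)
  have "(\<lambda>n. LINT \<theta>|mu. ?f n \<theta>) sums (LINT \<theta>|mu. (\<Sum>n. ?f n \<theta>))"
  proof (rule sums_integral[OF i])
    show "AE \<theta> in mu. summable (\<lambda>n. norm (?f n \<theta>))" using s1 by simp
    have "(LINT \<theta>|mu. norm (?f n \<theta>)) \<le> c n" for n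
      using bd by (intro mu.integral_le_const integrable_norm i) auto
    then show "summable (\<lambda>n. LINT \<theta>|mu. norm (?f n \<theta>))"
      by (intro summable_comparison_test'[OF s, of 0]) (auto simp: integral_nonneg_AE)
  qed
  moreover have "(\<lambda>n. LINT \<theta>|mu. ?f n \<theta>) = (\<lambda>n. c n * q n x)" by (simp add: q_fourier)
  moreover have "(\<Sum>n. ?f n \<theta>) = cos (ip x \<theta>) * (\<Sum>n. c n * ch \<theta> ^ n)" for \<theta>
  proof -
    have "summable (\<lambda>n. c n * ch \<theta> ^ n)"
    proof (rule summable_comparison_test'[OF s, of 0])
      fix n show "norm (c n * ch \<theta> ^ n) \<le> c n"
        using abs_ch[of \<theta>] c[of n] by (simp add: abs_mult power_abs power_le_one mult_left_le)
    qed
    then show ?thesis by (subst suminf_mult[symmetric]) (auto simp: mult_ac)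
  qed
  ultimately show ?thesis by (simp only:)
qed

text \<open>The transition probability at time t over the displacement x, as \<open>p_eq_P\<close>
  shows. \<open>Qs\<close> below is its counterpart for the jump chain: the generating function of
  \<open>q n x\<close>, by \<open>Qs_sums\<close>.\<close>

definition P :: "int^'n \<Rightarrow> real \<Rightarrow> real" where "P x t = (LINT \<theta>|mu. cos (ip x \<theta>) * exp (t * phi a \<theta>))"

definition Qs :: "real \<Rightarrow> int^'n \<Rightarrow> real" where "Qs s x = (LINT \<theta>|mu. cos (ip x \<theta>) / (1 - s * ch \<theta>))"

lemma Qs_sums: "0 \<le> s \<Longrightarrow> s < 1 \<Longrightarrow> (\<lambda>n. s ^ n * q n x) sums Qs s x"
proof -
  assume s: "0 \<le> s" "s < 1"
  have "(\<Sum>n. s ^ n * ch \<theta> ^ n) = 1 / (1 - s * ch \<theta>)" for \<theta>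
  proof -
    have "\<bar>s * ch \<theta>\<bar> \<le> s * 1" unfolding abs_mult using s abs_ch[of \<theta>] by (intro mult_mono) auto
    then have "norm (s * ch \<theta>) < 1" using s by simp
    from suminf_geometric[OF this] show ?thesis by (simp add: power_mult_distrib)
  qed
  then show ?thesis using fourier_sums[of "\<lambda>n. s ^ n" x] s by (simp add: Qs_def summable_geometric)
qed

end

section \<open>The local limit theorem\<close>

lemma lborel_integral_scale:
  fixes f :: "'a::euclidean_space \<Rightarrow> real"
  assumes [measurable]: "f \<in> borel_measurable borel" and c: "c > 0"
  shows "(LINT x|lborel. f x) = c ^ DIM('a) * (LINT x|lborel. f (c *\<^sub>R x))"
proof -
  have "(LINT x|lborel. f x) = (LINT x|density (distr lborel borel (\<lambda>x. 0 + c *\<^sub>R x)) (\<lambda>_. \<bar>c\<bar> ^ DIM('a)). f x)"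
    using lborel_affine[of c "0::'a"] c by simp
  also have "\<dots> = (LINT x|distr lborel borel (\<lambda>x. 0 + c *\<^sub>R x). \<bar>c\<bar> ^ DIM('a) *\<^sub>R f x)"
    by (rule integral_density) auto
  also have "\<dots> = (LINT x|lborel. \<bar>c\<bar> ^ DIM('a) *\<^sub>R f (0 + c *\<^sub>R x))"
    by (rule integral_distr) auto
  finally show ?thesis using c by simp
qed

lemma tendsto_one_minus_cos: "((\<lambda>h::real. (1 - cos (h * s)) / h\<^sup>2) \<longlongrightarrow> s\<^sup>2 / 2) (at 0)"
proof (cases "s = 0")
  case False
  have "((\<lambda>x::real. (1 - cos x) / x\<^sup>2) \<longlongrightarrow> 1 / 2) (at 0)" by real_asymp
  moreover have "filterlim (\<lambda>h. h * s) (at 0) (at 0)"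
    using False by (auto simp: filterlim_at eventually_at_filter intro!: tendsto_eq_intros)
  ultimately have "((\<lambda>h. (1 - cos (h * s)) / (h * s)\<^sup>2) \<longlongrightarrow> 1 / 2) (at 0)" by (rule filterlim_compose)
  then have "((\<lambda>h. s\<^sup>2 * ((1 - cos (h * s)) / (h * s)\<^sup>2)) \<longlongrightarrow> s\<^sup>2 * (1 / 2)) (at 0)" by (intro tendsto_mult tendsto_const)
  moreover have "(\<lambda>h. s\<^sup>2 * ((1 - cos (h * s)) / (h * s)\<^sup>2)) = (\<lambda>h. (1 - cos (h * s)) / h\<^sup>2)"
  proof
    fix h show "s\<^sup>2 * ((1 - cos (h * s)) / (h * s)\<^sup>2) = (1 - cos (h * s)) / h\<^sup>2"
      using False by (cases "h = 0") (simp_all add: power_mult_distrib field_simps)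
  qed
  ultimately show ?thesis by simp
qed simp

lemma integral_tendsto_at:
  fixes f :: "real \<Rightarrow> 'a \<Rightarrow> real"
  assumes lim: "\<And>v. v \<in> space M \<Longrightarrow> ((\<lambda>h. f h v) \<longlongrightarrow> g v) (at 0)"
    and m: "\<And>h. f h \<in> borel_measurable M" "g \<in> borel_measurable M"
    and bd: "\<And>h v. h \<noteq> 0 \<Longrightarrow> \<bar>f h v\<bar> \<le> B v" and B: "integrable M B"
  shows "((\<lambda>h. LINT v|M. f h v) \<longlongrightarrow> (LINT v|M. g v)) (at 0)"
  unfolding tendsto_at_iff_sequentially comp_def
proof (intro allI impI)
  fix X :: "nat \<Rightarrow> real" assume X: "\<forall>i. X i \<in> UNIV - {0}" "X \<longlonglongrightarrow> 0"
  show "(\<lambda>i. LINT v|M. f (X i) v) \<longlonglongrightarrow> (LINT v|M. g v)"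
  proof (rule integral_dominated_convergence[where w = B])
    show "AE v in M. (\<lambda>i. f (X i) v) \<longlonglongrightarrow> g v"
      using lim X unfolding tendsto_at_iff_sequentially comp_def by auto
    show "\<And>i. AE v in M. norm (f (X i) v) \<le> B v" using bd X by auto
  qed (use m B in auto)
qed

lemma integral_has_derivative_at_0:
  fixes f f' :: "real \<Rightarrow> 'a \<Rightarrow> real"
  assumes d: "\<And>v. v \<in> space M \<Longrightarrow> ((\<lambda>h. f h v) has_real_derivative g v) (at 0)"
    and m: "\<And>h. f h \<in> borel_measurable M" "g \<in> borel_measurable M"
    and bd: "\<And>h v. \<bar>f h v - f 0 v\<bar> \<le> B v * \<bar>h\<bar>" and B: "integrable M B"
    and i: "\<And>h. integrable M (f h)"
  shows "((\<lambda>h. LINT v|M. f h v) has_real_derivative (LINT v|M. g v)) (at 0)"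
  unfolding DERIV_def
proof -
  have "((\<lambda>h. LINT v|M. (f (0 + h) v - f 0 v) / h) \<longlongrightarrow> (LINT v|M. g v)) (at 0)"
  proof (rule integral_tendsto_at[where B = B])
    show "((\<lambda>h. (f (0 + h) v - f 0 v) / h) \<longlongrightarrow> g v) (at 0)" if "v \<in> space M" for v using d[OF that] unfolding DERIV_def .
    show "\<bar>(f (0 + h) v - f 0 v) / h\<bar> \<le> B v" if "h \<noteq> 0" for h v
      using bd[of h v] that by (simp add: abs_divide divide_le_eq)
  qed (use m B in auto)
  then show "((\<lambda>h. ((LINT v|M. f (0 + h) v) - (LINT v|M. f 0 v)) / h) \<longlongrightarrow> (LINT v|M. g v)) (at 0)"
    using i by (simp add: Bochner_Integration.integral_diff)
qed

section \<open>Irreducibility, second moments and the behaviour of \<open>ch\<close> near 0\<close>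

context walk begin

lemma ex_hit_pos_step:
  assumes "0 < measure_pmf.expectation J (\<lambda>v. hit Z y n (x + v))"
  shows "\<exists>v. b v > 0 \<and> hit Z y n (x + v) > 0"
proof (rule ccontr)
  assume *: "\<not> ?thesis"
  have "AE v in measure_pmf J. hit Z y n (x + v) = 0"
  proof (rule AE_pmfI)
    fix v assume "v \<in> set_pmf J"
    then have "b v > 0" using b_nonneg[of v] by (simp add: set_pmf_iff pmf_J)
    then show "hit Z y n (x + v) = 0" using * hit_nonneg[of Z y n "x + v"] by (metis order_le_less)
  qed
  then have "measure_pmf.expectation J (\<lambda>v. hit Z y n (x + v)) = 0" by (rule integral_eq_zero_AE)
  then show False using assms by simp
qed

text \<open>Irreducibility passes from the walk to its jump chain, because \<open>p\<close> is a
  Poisson mixture of the \<open>q n\<close>.\<close>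

lemma ex_q_pos: "\<exists>n. q n x > 0"
proof (rule ccontr)
  assume *: "\<nexists>n. q n x > 0"
  obtain t where t: "t > 0" "p a t x 0 > 0" using adm unfolding admissible_def by blast
  have "q n x = 0" for n using * q_nonneg[of n x] by (metis order_le_less)
  then have "p a t x 0 = 0" using p_sums[of t 0 x] t by (simp add: hit_eq_q sums_iff)
  then show False using t by simp
qed

lemma pmf_le_expectation:
  assumes "\<And>v. 0 \<le> f v" "\<And>v. f v \<le> B"
  shows "b v * f v \<le> measure_pmf.expectation J f"
proof -
  have "b v * f v = measure_pmf.expectation J (\<lambda>w. f v * indicator {v} w)"
    by (simp add: measure_pmf_single pmf_J mult.commute)
  also have "\<dots> \<le> measure_pmf.expectation J f"
    using assms by (intro integral_mono integrable_J_bounded[where B = B])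
      (auto simp: indicator_def abs_of_nonneg intro: order_trans)
  finally show ?thesis .
qed

lemma one_minus_ch: "1 - ch \<theta> = measure_pmf.expectation J (\<lambda>v. 1 - cos (ip v \<theta>))"
  unfolding ch_def by (subst Bochner_Integration.integral_diff) (auto intro: integrable_J_bounded[where B = 1])

text \<open>For a possible step v it suffices to keep the single term v of \<open>1 - ch\<close>. A
  general u is reached by walking: if u + v already has a bound and v is a step, then
  \<open>one_minus_cos_add\<close> bounds u = (u + v) - v.\<close>

lemma cos_bound: "\<exists>C\<ge>0. \<forall>\<theta>. 1 - cos (ip u \<theta>) \<le> C * (1 - ch \<theta>)"
proof -
  have gen: "\<exists>C\<ge>0. \<forall>\<theta>. 1 - cos (ip v \<theta>) \<le> C * (1 - ch \<theta>)" if "b v > 0" for v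
  proof (intro exI[of _ "1 / b v"] conjI allI)
    fix \<theta>
    have "b v * (1 - cos (ip v \<theta>)) \<le> 1 - ch \<theta>" unfolding one_minus_ch
    proof (rule pmf_le_expectation[where B = 2])
      show "1 - cos (ip w \<theta>) \<le> 2" for w using cos_ge_minus_one[of "ip w \<theta>"] by simp
    qed simp
    then show "1 - cos (ip v \<theta>) \<le> 1 / b v * (1 - ch \<theta>)" using that by (simp add: field_simps)
  qed (use that in simp)
  have "\<exists>C\<ge>0. \<forall>\<theta>. 1 - cos (ip u \<theta>) \<le> C * (1 - ch \<theta>)" if "q n u > 0" for n u
    using that
  proof (induction n arbitrary: u)
    case 0
    then have "u = 0" by (auto simp: q_def split: if_splits)
    then show ?case by (intro exI[of _ 0]) simp
  next
    case (Suc n)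
    then have "0 < measure_pmf.expectation J (\<lambda>v. hit {} 0 n (u + v))" by (simp add: q_def)
    then obtain v where v: "b v > 0" "q n (u + v) > 0" using ex_hit_pos_step unfolding q_def by blast
    obtain C1 where C1: "C1 \<ge> 0" "\<And>\<theta>. 1 - cos (ip (u + v) \<theta>) \<le> C1 * (1 - ch \<theta>)" using Suc.IH[OF v(2)] by blast
    obtain C2 where C2: "C2 \<ge> 0" "\<And>\<theta>. 1 - cos (ip v \<theta>) \<le> C2 * (1 - ch \<theta>)" using gen[OF v(1)] by blast
    show ?case
    proof (intro exI[of _ "2 * C1 + 2 * C2"] conjI allI)
      fix \<theta>
      have "1 - cos (ip u \<theta>) \<le> 2 * (1 - cos (ip (u + v) \<theta>)) + 2 * (1 - cos (ip (- v) \<theta>))"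
        using one_minus_cos_add[of "ip (u + v) \<theta>" "ip (- v) \<theta>"] by (simp add: ip_add ip_minus)
      also have "\<dots> \<le> 2 * (C1 * (1 - ch \<theta>)) + 2 * (C2 * (1 - ch \<theta>))"
        using C1(2)[of \<theta>] C2(2)[of \<theta>] by (simp add: ip_minus)
      finally show "1 - cos (ip u \<theta>) \<le> (2 * C1 + 2 * C2) * (1 - ch \<theta>)" by (simp add: algebra_simps)
    qed (use C1 C2 in simp)
  qed
  then show ?thesis using ex_q_pos[of u] by blast
qed

text \<open>Coordinate directions suffice, and on the box each \<open>1 - cos (\<theta> $ i)\<close>
  is at least quadratic. This is the source of the Gaussian majorant in \<open>local_clt\<close> and
  of the positive definiteness of \<open>Qm\<close>.\<close>

lemma ch_lower: "\<exists>c>0. \<forall>\<theta>\<in>bx. c * (norm \<theta>)\<^sup>2 \<le> 1 - ch \<theta>"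
proof -
  have "\<forall>i. \<exists>C\<ge>0. \<forall>\<theta>. 1 - cos (ip (axis i 1) \<theta>) \<le> C * (1 - ch \<theta>)" using cos_bound by blast
  then obtain C where C: "\<And>i. C i \<ge> 0" "\<And>i \<theta>. 1 - cos (\<theta> $ i) \<le> C i * (1 - ch \<theta>)" unfolding axis_ip by metis
  define K where "K = 32 * (\<Sum>i\<in>UNIV. C i) + 1"
  have K: "K > 0" unfolding K_def using sum_nonneg[of UNIV C] C(1) by (simp add: add_nonneg_pos)
  show ?thesis
  proof (intro exI[of _ "1 / K"] conjI ballI)
    fix \<theta> :: "real^'n" assume "\<theta> \<in> bx"
    have "(norm \<theta>)\<^sup>2 = (\<Sum>i\<in>UNIV. (\<theta> $ i)\<^sup>2)" by (simp only: power2_norm_eq_inner inner_vec_def inner_real_def power2_eq_square[of "_ $ _"])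
    also have "\<dots> \<le> (\<Sum>i\<in>UNIV. 32 * (C i * (1 - ch \<theta>)))"
    proof (intro sum_mono)
      fix i
      have "(\<theta> $ i)\<^sup>2 / 32 \<le> 1 - cos (\<theta> $ i)" using \<open>\<theta> \<in> bx\<close> by (intro one_minus_cos_ge) (simp add: mem_bx)
      also note C(2)[of \<theta> i]
      finally show "(\<theta> $ i)\<^sup>2 \<le> 32 * (C i * (1 - ch \<theta>))" by simp
    qed
    also have "\<dots> = (K - 1) * (1 - ch \<theta>)" by (simp add: K_def sum_distrib_left sum_distrib_right mult_ac)
    also have "\<dots> \<le> K * (1 - ch \<theta>)" using ch_le_1[of \<theta>] by (intro mult_right_mono) auto
    finally show "1 / K * (norm \<theta>)\<^sup>2 \<le> 1 - ch \<theta>" using K by (simp add: field_simps)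
  qed (use K in simp)
qed

definition cl :: real where "cl = (SOME c. c > 0 \<and> (\<forall>\<theta>\<in>bx. c * (norm \<theta>)\<^sup>2 \<le> 1 - ch \<theta>))"

lemma cl_pos: "cl > 0" and cl_bound: "\<theta> \<in> bx \<Longrightarrow> cl * (norm \<theta>)\<^sup>2 \<le> 1 - ch \<theta>"
proof -
  have "cl > 0 \<and> (\<forall>\<theta>\<in>bx. cl * (norm \<theta>)\<^sup>2 \<le> 1 - ch \<theta>)" unfolding cl_def by (rule someI_ex) (use ch_lower in blast)
  then show "cl > 0" "\<theta> \<in> bx \<Longrightarrow> cl * (norm \<theta>)\<^sup>2 \<le> 1 - ch \<theta>" by auto
qed

lemma ch_less_1: "\<theta> \<in> bx \<Longrightarrow> \<theta> \<noteq> 0 \<Longrightarrow> ch \<theta> < 1"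
proof -
  assume "\<theta> \<in> bx" "\<theta> \<noteq> 0"
  then have "cl * (norm \<theta>)\<^sup>2 \<le> 1 - ch \<theta>" "0 < cl * (norm \<theta>)\<^sup>2" using cl_bound cl_pos by auto
  then show ?thesis by simp
qed

lemma sqn_nonneg: "sqn z \<ge> 0" unfolding sqn_def by (intro sum_nonneg) auto

lemma integrable_sqn: "integrable (measure_pmf J) sqn"
proof -
  have "(\<lambda>z. sqn z * a z) summable_on UNIV" using adm by (simp add: admissible_def)
  then have "(\<lambda>z. (1 / r) * (sqn z * a z)) summable_on UNIV" by (rule summable_on_cmult_right)
  also have "(\<lambda>z. (1 / r) * (sqn z * a z)) = (\<lambda>z. b z * sqn z)" by (auto simp: b_def sqn_def)
  finally have "Infinite_Sum.abs_summable_on (\<lambda>z. b z * sqn z) UNIV"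
    by (simp add: abs_mult abs_of_nonneg b_nonneg sqn_nonneg)
  then have "integrable (count_space UNIV) (\<lambda>z. b z * sqn z)"
    unfolding abs_summable_equivalent Infinite_Set_Sum.abs_summable_on_def .
  then show ?thesis unfolding measure_pmf_eq_density by (subst integrable_density) (auto simp: pmf_J b_nonneg)
qed

lemma abs_coord_le_sqn: "\<bar>real_of_int (v $ i) * real_of_int (v $ j)\<bar> \<le> sqn v"
proof -
  have "\<bar>real_of_int (v $ i)\<bar> * \<bar>real_of_int (v $ j)\<bar> \<le> ((real_of_int (v $ i))\<^sup>2 + (real_of_int (v $ j))\<^sup>2) / 2"
    using sum_squares_bound[of "\<bar>real_of_int (v $ i)\<bar>" "\<bar>real_of_int (v $ j)\<bar>"] by simp
  also have "\<dots> \<le> (sqn v + sqn v) / 2"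
    unfolding sqn_def by (intro divide_right_mono add_mono member_le_sum) auto
  finally show ?thesis by (simp add: abs_mult)
qed

lemma integrable_coord: "integrable (measure_pmf J) (\<lambda>v. real_of_int (v $ i) * real_of_int (v $ j))"
  by (rule Bochner_Integration.integrable_bound[OF integrable_sqn]) (auto simp: abs_of_nonneg sqn_nonneg abs_coord_le_sqn)

text \<open>Covariance matrix of the displacement per unit time: the jump rate times the second
  moments of one jump.\<close>

definition Qm :: "real^'n^'n" where
  "Qm = (\<chi> i j. r * measure_pmf.expectation J (\<lambda>v. real_of_int (v $ i) * real_of_int (v $ j)))"

lemma Qm_form: "x \<bullet> (Qm *v y) = r * measure_pmf.expectation J (\<lambda>v. ip v x * ip v y)"
proof -
  have "measure_pmf.expectation J (\<lambda>v. ip v x * ip v y)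
     = measure_pmf.expectation J (\<lambda>v. \<Sum>i\<in>UNIV. \<Sum>j\<in>UNIV. (x $ i * y $ j) * (real_of_int (v $ i) * real_of_int (v $ j)))"
    by (simp add: ip_def sum_product mult_ac)
  also have "\<dots> = (\<Sum>i\<in>UNIV. \<Sum>j\<in>UNIV. (x $ i * y $ j) * measure_pmf.expectation J (\<lambda>v. real_of_int (v $ i) * real_of_int (v $ j)))"
    using integrable_coord by (subst Bochner_Integration.integral_sum) (auto intro!: sum.cong Bochner_Integration.integral_sum)
  finally show ?thesis
    by (simp add: Qm_def inner_vec_def matrix_vector_mult_def sum_distrib_left mult_ac)
qed

lemma ip_sq_integrable: "integrable (measure_pmf J) (\<lambda>v. (ip v \<eta>)\<^sup>2)"
  by (rule Bochner_Integration.integrable_bound[OF integrable_mult_left[OF integrable_sqn, of "(norm \<eta>)\<^sup>2"]])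
    (auto intro!: AE_I2 order_trans[OF ip_sq_le abs_ge_self])

text \<open>Dominated convergence with majorant \<open>(ip v \<eta>)\<^sup>2 / 2\<close>, integrable
  by the second moment assumption.\<close>

lemma ch_quadratic_limit: "((\<lambda>h. (1 - ch (h *\<^sub>R \<eta>)) / h\<^sup>2) \<longlongrightarrow> (\<eta> \<bullet> (Qm *v \<eta>)) / (2 * r)) (at 0)"
proof -
  have "((\<lambda>h. measure_pmf.expectation J (\<lambda>v. (1 - cos (h * ip v \<eta>)) / h\<^sup>2)) \<longlongrightarrow> measure_pmf.expectation J (\<lambda>v. (ip v \<eta>)\<^sup>2 / 2)) (at 0)"
  proof (rule integral_tendsto_at[where B = "\<lambda>v. (ip v \<eta>)\<^sup>2 / 2"])
    fix h :: real and v assume "h \<noteq> 0"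
    then show "\<bar>(1 - cos (h * ip v \<eta>)) / h\<^sup>2\<bar> \<le> (ip v \<eta>)\<^sup>2 / 2"
      using one_minus_cos_le[of "h * ip v \<eta>"] by (simp add: abs_divide divide_le_eq power_mult_distrib mult_ac)
  qed (use tendsto_one_minus_cos ip_sq_integrable in auto)
  moreover have "measure_pmf.expectation J (\<lambda>v. (ip v \<eta>)\<^sup>2 / 2) = (\<eta> \<bullet> (Qm *v \<eta>)) / (2 * r)"
    using r_pos by (simp add: Qm_form power2_eq_square)
  moreover have "(1 - ch (h *\<^sub>R \<eta>)) / h\<^sup>2 = measure_pmf.expectation J (\<lambda>v. (1 - cos (h * ip v \<eta>)) / h\<^sup>2)" for h
    by (simp add: one_minus_ch ip_scaleR)
  ultimately show ?thesis by (simp only:)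
qed

lemma Qm_sym: "x \<bullet> (Qm *v y) = y \<bullet> (Qm *v x)" by (simp add: Qm_form mult.commute)

lemma bx_nhds: "eventually (\<lambda>h. h *\<^sub>R \<eta> \<in> bx) (at (0::real))"
proof -
  have "eventually (\<lambda>h. norm (h *\<^sub>R \<eta>) < pi) (at (0::real))"
  proof (rule order_tendstoD(2))
    show "((\<lambda>h. norm (h *\<^sub>R \<eta>)) \<longlongrightarrow> norm (0 *\<^sub>R \<eta>)) (at (0::real))" by (intro tendsto_intros)
  qed (use pi_gt_zero in simp)
  then show ?thesis
  proof eventually_elim
    case (elim h)
    show ?case unfolding mem_bx using elim component_le_norm_cart[of "h *\<^sub>R \<eta>"] by (meson less_imp_le order_trans)
  qed
qed

text \<open>The lower bound on \<open>1 - ch\<close> is restricted to a ray, which lies in the box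
  near 0, and passes to the quadratic limit.\<close>

lemma Qm_lower: "2 * r * cl * (norm \<eta>)\<^sup>2 \<le> \<eta> \<bullet> (Qm *v \<eta>)"
proof -
  have "eventually (\<lambda>h. cl * (norm \<eta>)\<^sup>2 \<le> (1 - ch (h *\<^sub>R \<eta>)) / h\<^sup>2) (at (0::real))"
    using bx_nhds[of \<eta>] eventually_neq_at_within[of 0 0 UNIV]
  proof eventually_elim
    case (elim h)
    have "cl * (norm (h *\<^sub>R \<eta>))\<^sup>2 \<le> 1 - ch (h *\<^sub>R \<eta>)" using elim by (intro cl_bound)
    then show ?case using elim by (simp add: le_divide_eq power_mult_distrib mult_ac)
  qed
  then have "cl * (norm \<eta>)\<^sup>2 \<le> (\<eta> \<bullet> (Qm *v \<eta>)) / (2 * r)"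
    by (intro tendsto_lowerbound[OF ch_quadratic_limit]) auto
  then show ?thesis using r_pos by (simp add: field_simps)
qed

lemma Qm_pos: "\<eta> \<noteq> 0 \<Longrightarrow> 0 < \<eta> \<bullet> (Qm *v \<eta>)"
proof -
  assume "\<eta> \<noteq> 0"
  then have "0 < 2 * r * cl * (norm \<eta>)\<^sup>2" using r_pos cl_pos by simp
  then show ?thesis using Qm_lower[of \<eta>] by simp
qed

lemma phi_line: "phi a (t *\<^sub>R axis i 1 + s *\<^sub>R axis j 1) = r * (measure_pmf.expectation J (\<lambda>v. cos (t * real_of_int (v $ i) + s * real_of_int (v $ j))) - 1)"
  by (simp add: phi_eq ch_def ip_add_right ip_scaleR ip_axis)

lemma integrable_abs_coord: "integrable (measure_pmf J) (\<lambda>v. \<bar>real_of_int (v $ i)\<bar>)"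
proof (rule Bochner_Integration.integrable_bound)
  show "integrable (measure_pmf J) (\<lambda>v. 1 + sqn v)" using integrable_sqn by simp
  have "\<bar>real_of_int (v $ i)\<bar> \<le> 1 + sqn v" for v
  proof -
    have "\<bar>real_of_int (v $ i)\<bar> \<le> 1 + \<bar>real_of_int (v $ i)\<bar>\<^sup>2"
      using sum_squares_bound[of 1 "\<bar>real_of_int (v $ i)\<bar>"] by (simp add: power2_eq_square)
    then show ?thesis using abs_coord_le_sqn[of v i i] by (simp add: abs_mult power2_eq_square)
  qed
  then show "AE v in measure_pmf J. norm \<bar>real_of_int (v $ i)\<bar> \<le> norm (1 + sqn v)"
    by (auto intro!: AE_I2 intro: order_trans[OF _ abs_ge_self])
qed simp

lemma abs_cos_diff_le: "\<bar>cos x - cos y\<bar> \<le> \<bar>x - y\<bar>" and abs_sin_diff_le: "\<bar>sin x - sin y\<bar> \<le> \<bar>x - y\<bar>" for x y :: real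
proof -
  have "\<bar>sin ((x + y) / 2)\<bar> * \<bar>sin ((y - x) / 2)\<bar> \<le> 1 * \<bar>(y - x) / 2\<bar>"
    by (intro mult_mono abs_sin_x_le_abs_x) auto
  then show "\<bar>cos x - cos y\<bar> \<le> \<bar>x - y\<bar>" by (simp add: cos_diff_cos abs_mult abs_minus_commute)
  have "\<bar>sin ((x - y) / 2)\<bar> * \<bar>cos ((x + y) / 2)\<bar> \<le> \<bar>(x - y) / 2\<bar> * 1"
    by (intro mult_mono abs_sin_x_le_abs_x) auto
  then show "\<bar>sin x - sin y\<bar> \<le> \<bar>x - y\<bar>" by (simp add: sin_diff_sin abs_mult)
qed

text \<open>\<open>hess\<close> nests two one-dimensional derivatives; each passes under the
  expectation, with Lipschitz bounds \<open>\<bar>v $ i\<bar>\<close> for the first and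
  \<open>sqn v\<close> for the second.\<close>

lemma hess_eq: "hess a = - Qm"
proof -
  have 1: "deriv (\<lambda>t. phi a (t *\<^sub>R axis i 1 + s *\<^sub>R axis j 1)) 0 = r * measure_pmf.expectation J (\<lambda>v. - (real_of_int (v $ i) * sin (s * real_of_int (v $ j))))" for s i j
  proof (rule DERIV_imp_deriv)
    have "((\<lambda>t. measure_pmf.expectation J (\<lambda>v. cos (t * real_of_int (v $ i) + s * real_of_int (v $ j)))) has_real_derivative
        measure_pmf.expectation J (\<lambda>v. - (real_of_int (v $ i) * sin (s * real_of_int (v $ j))))) (at 0)"
    proof (rule integral_has_derivative_at_0[where B = "\<lambda>v. \<bar>real_of_int (v $ i)\<bar>"])
      show "\<bar>cos (h * real_of_int (v $ i) + s * real_of_int (v $ j)) - cos (0 * real_of_int (v $ i) + s * real_of_int (v $ j))\<bar> \<le> \<bar>real_of_int (v $ i)\<bar> * \<bar>h\<bar>" for h v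
        by (rule order_trans[OF abs_cos_diff_le]) (simp add: abs_mult)
      show "integrable (measure_pmf J) (\<lambda>v. cos (h * real_of_int (v $ i) + s * real_of_int (v $ j)))" for h
        by (rule integrable_J_bounded[where B = 1]) simp
    qed (auto intro!: derivative_eq_intros integrable_abs_coord)
    then show "((\<lambda>t. phi a (t *\<^sub>R axis i 1 + s *\<^sub>R axis j 1)) has_real_derivative r * measure_pmf.expectation J (\<lambda>v. - (real_of_int (v $ i) * sin (s * real_of_int (v $ j))))) (at 0)"
    proof -
      assume *: "((\<lambda>t. measure_pmf.expectation J (\<lambda>v. cos (t * real_of_int (v $ i) + s * real_of_int (v $ j)))) has_real_derivative
        measure_pmf.expectation J (\<lambda>v. - (real_of_int (v $ i) * sin (s * real_of_int (v $ j))))) (at 0)"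
      have eq: "(\<lambda>t. phi a (t *\<^sub>R axis i 1 + s *\<^sub>R axis j 1)) = (\<lambda>t. r * (measure_pmf.expectation J (\<lambda>v. cos (t * real_of_int (v $ i) + s * real_of_int (v $ j))) - 1))"
        by (rule ext) (rule phi_line)
      show ?thesis unfolding eq using DERIV_cmult[OF DERIV_diff[OF * DERIV_const[of 1]], of r] by simp
    qed
  qed
  have 2: "deriv (\<lambda>s. r * measure_pmf.expectation J (\<lambda>v. - (real_of_int (v $ i) * sin (s * real_of_int (v $ j))))) 0 = - Qm $ i $ j" for i j
  proof (rule DERIV_imp_deriv)
    have "((\<lambda>s. measure_pmf.expectation J (\<lambda>v. - (real_of_int (v $ i) * sin (s * real_of_int (v $ j))))) has_real_derivative
        measure_pmf.expectation J (\<lambda>v. - (real_of_int (v $ i) * real_of_int (v $ j)))) (at 0)"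
    proof (rule integral_has_derivative_at_0[where B = "\<lambda>v. sqn v"])
      fix h v
      have "\<bar>- (real_of_int (v $ i) * sin (h * real_of_int (v $ j))) - - (real_of_int (v $ i) * sin (0 * real_of_int (v $ j)))\<bar> = \<bar>real_of_int (v $ i)\<bar> * \<bar>sin (h * real_of_int (v $ j))\<bar>"
        by (simp add: abs_mult)
      also have "\<dots> \<le> \<bar>real_of_int (v $ i)\<bar> * \<bar>h * real_of_int (v $ j)\<bar>" by (intro mult_left_mono abs_sin_x_le_abs_x) simp
      also have "\<dots> = \<bar>real_of_int (v $ i) * real_of_int (v $ j)\<bar> * \<bar>h\<bar>" by (simp add: abs_mult)
      also have "\<dots> \<le> sqn v * \<bar>h\<bar>" by (intro mult_right_mono abs_coord_le_sqn) simp
      finally show "\<bar>- (real_of_int (v $ i) * sin (h * real_of_int (v $ j))) - - (real_of_int (v $ i) * sin (0 * real_of_int (v $ j)))\<bar> \<le> sqn v * \<bar>h\<bar>" .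
    next
      show "integrable (measure_pmf J) (\<lambda>v. - (real_of_int (v $ i) * sin (h * real_of_int (v $ j))))" for h
        by (rule Bochner_Integration.integrable_bound[OF integrable_abs_coord[of i]]) (auto simp: abs_mult mult_left_le)
    qed (auto intro!: derivative_eq_intros integrable_sqn)
    then show "((\<lambda>s. r * measure_pmf.expectation J (\<lambda>v. - (real_of_int (v $ i) * sin (s * real_of_int (v $ j))))) has_real_derivative - Qm $ i $ j) (at 0)"
      by (drule_tac DERIV_cmult[where c = r]) (simp add: Qm_def)
  qed
  show ?thesis unfolding vec_eq_iff hess_def vec_lambda_beta 1 2 by simp
qed

lemma det_Qm_pos: "det Qm > 0" using gauss_quadratic(1)[of Qm] Qm_sym Qm_pos by blast

lemma gamma_eq: "gamma_d a = 1 / ((2 * pi) powr (CARD('n) / 2) * sqrt (det Qm))"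
proof -
  have "det (- Qm) * det (- Qm) = det Qm * det Qm"
  proof -
    have "(- Qm) ** (- Qm) = Qm ** Qm" by (simp add: matrix_matrix_mult_def vec_eq_iff)
    then show ?thesis unfolding det_mul[symmetric] by simp
  qed
  then have "\<bar>det (- Qm)\<bar> = \<bar>det Qm\<bar>" by (simp add: abs_eq_iff square_eq_iff)
  then show ?thesis using det_Qm_pos by (simp add: gamma_d_def hess_eq)
qed

lemma gamma_pos: "gamma_d a > 0" using det_Qm_pos by (simp add: gamma_eq)

text \<open>Substituting \<theta> = \<eta> / sqrt t turns the exponent into the quadratic form of
  \<open>Qm\<close> in the limit, with a Gaussian majorant from \<open>cl_bound\<close>. The extra
  factor \<open>B\<close> contributes only its limit at 0, which covers the constant 1, the cosines
  and \<open>Bu\<close> in one statement.\<close>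

theorem local_clt:
  fixes B :: "real^'n \<Rightarrow> real"
  assumes m[measurable]: "B \<in> borel_measurable borel" and bd: "\<And>\<theta>. \<bar>B \<theta>\<bar> \<le> K" and lim: "(B \<longlongrightarrow> B0) (at 0)"
  shows "((\<lambda>t. t powr (CARD('n) / 2) * (LINT \<theta>|mu. B \<theta> * exp (t * phi a \<theta>))) \<longlongrightarrow> B0 * gamma_d a) at_top"
proof -
  let ?d = "CARD('n)"
  let ?F = "\<lambda>t \<eta>. indicator bx ((1 / sqrt t) *\<^sub>R \<eta>) * (B ((1 / sqrt t) *\<^sub>R \<eta>) * exp (t * phi a ((1 / sqrt t) *\<^sub>R \<eta>)))"
  have K: "K \<ge> 0" using bd[of 0] by simp
  let ?Q = "2 * r * cl"
  have dominated: "integrable lborel (\<lambda>\<eta>::real^'n. K * exp (- (r * cl * (norm \<eta>)\<^sup>2)))"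
  proof (rule integrable_mult_right)
    have s: "sqrt ?Q > 0" using r_pos cl_pos by simp
    have gi: "integrable lborel (\<lambda>x::real^'n. exp (- (x \<bullet> x) / 2))" using has_bochner_integral_gauss by (auto simp: has_bochner_integral_iff)
    have "integrable (distr lborel borel (\<lambda>x::real^'n. (1 / sqrt ?Q) *\<^sub>R x)) (\<lambda>\<eta>. exp (- (r * cl * (norm \<eta>)\<^sup>2)))"
    proof (subst integrable_distr_eq)
      have "- (r * cl * (norm ((1 / sqrt ?Q) *\<^sub>R x))\<^sup>2) = - (x \<bullet> x) / 2" for x :: "real^'n"
        using r_pos cl_pos by (simp add: power_mult_distrib power_divide power2_norm_eq_inner[symmetric] real_sqrt_mult)
      then show "integrable lborel (\<lambda>x::real^'n. exp (- (r * cl * (norm ((1 / sqrt ?Q) *\<^sub>R x))\<^sup>2)))" using gi by (simp only:)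
    qed auto
    then have "integrable (density (distr lborel borel (\<lambda>x::real^'n. 0 + (1 / sqrt ?Q) *\<^sub>R x)) (\<lambda>_. \<bar>1 / sqrt ?Q\<bar> ^ DIM(real^'n))) (\<lambda>\<eta>. exp (- (r * cl * (norm \<eta>)\<^sup>2)))"
      by (subst integrable_density) auto
    then show "integrable lborel (\<lambda>\<eta>::real^'n. exp (- (r * cl * (norm \<eta>)\<^sup>2)))"
      by (subst lborel_affine[of "1 / sqrt ?Q" "0::real^'n"]) (use s r_pos cl_pos in simp_all)
  qed
  have lim_h: "filterlim (\<lambda>t. 1 / sqrt t) (at 0) at_top"
    unfolding filterlim_at
  proof
    show "((\<lambda>t. 1 / sqrt t) \<longlongrightarrow> 0) at_top" by real_asymp
    show "eventually (\<lambda>t. 1 / sqrt t \<in> UNIV \<and> 1 / sqrt t \<noteq> 0) at_top" using eventually_gt_at_top[of "0::real"] by eventually_elim simp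
  qed
  have L: "((\<lambda>t. LINT \<eta>|lborel. ?F t \<eta>) \<longlongrightarrow> (LINT \<eta>|lborel. B0 * exp (- (\<eta> \<bullet> (Qm *v \<eta>)) / 2))) at_top"
  proof (rule integral_dominated_convergence_at_top[where w = "\<lambda>\<eta>. K * exp (- (r * cl * (norm \<eta>)\<^sup>2))"])
    show "(\<lambda>\<eta>. B0 * exp (- (\<eta> \<bullet> (Qm *v \<eta>)) / 2)) \<in> borel_measurable lborel"
      using gauss_quadratic(2)[of Qm] Qm_sym Qm_pos by (auto simp: has_bochner_integral_iff)
    show "eventually (\<lambda>t. AE \<eta> in lborel. norm (?F t \<eta>) \<le> K * exp (- (r * cl * (norm \<eta>)\<^sup>2))) at_top"
      using eventually_gt_at_top[of 0]
    proof eventually_elim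
      case (elim t)
      have "norm (?F t \<eta>) \<le> K * exp (- (r * cl * (norm \<eta>)\<^sup>2))" for \<eta>
      proof (cases "(1 / sqrt t) *\<^sub>R \<eta> \<in> bx")
        case True
        have "cl * (norm ((1 / sqrt t) *\<^sub>R \<eta>))\<^sup>2 \<le> 1 - ch ((1 / sqrt t) *\<^sub>R \<eta>)" by (rule cl_bound[OF True])
        then have "cl * (norm \<eta>)\<^sup>2 / t \<le> 1 - ch ((1 / sqrt t) *\<^sub>R \<eta>)" using elim by (simp add: power_divide)
        then have "r * (cl * (norm \<eta>)\<^sup>2) \<le> r * (t * (1 - ch ((1 / sqrt t) *\<^sub>R \<eta>)))"
          using elim r_pos by (intro mult_left_mono) (auto simp: field_simps)
        then have "t * phi a ((1 / sqrt t) *\<^sub>R \<eta>) \<le> - (r * cl * (norm \<eta>)\<^sup>2)" by (simp add: phi_eq algebra_simps)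
        then have "\<bar>B ((1 / sqrt t) *\<^sub>R \<eta>)\<bar> * exp (t * phi a ((1 / sqrt t) *\<^sub>R \<eta>)) \<le> K * exp (- (r * cl * (norm \<eta>)\<^sup>2))"
          using bd K by (intro mult_mono) auto
        then show ?thesis using True by (simp add: abs_mult)
      next
        case False then show ?thesis using K by simp
      qed
      then show ?case by simp
    qed
    show "AE \<eta> in lborel. ((\<lambda>t. ?F t \<eta>) \<longlongrightarrow> B0 * exp (- (\<eta> \<bullet> (Qm *v \<eta>)) / 2)) at_top"
      using AE_lborel_singleton[of "0 :: real^'n"]
    proof eventually_elim
      case (elim \<eta>)
      have 1: "((\<lambda>t. indicator bx ((1 / sqrt t) *\<^sub>R \<eta>)) \<longlongrightarrow> (1::real)) at_top"
        by (rule tendsto_eventually) (use filterlim_iff[THEN iffD1, OF lim_h, rule_format, OF bx_nhds[of \<eta>]] in eventually_elim, simp)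
      have "filterlim (\<lambda>h. h *\<^sub>R \<eta>) (at 0) (at (0::real))"
        using elim by (auto simp: filterlim_at eventually_at_filter intro!: tendsto_eq_intros)
      from filterlim_compose[OF lim filterlim_compose[OF this lim_h]]
      have 2: "((\<lambda>t. B ((1 / sqrt t) *\<^sub>R \<eta>)) \<longlongrightarrow> B0) at_top" .
      have "((\<lambda>t. - r * ((1 - ch ((1 / sqrt t) *\<^sub>R \<eta>)) / (1 / sqrt t)\<^sup>2)) \<longlongrightarrow> - r * ((\<eta> \<bullet> (Qm *v \<eta>)) / (2 * r))) at_top"
        by (intro tendsto_mult tendsto_const filterlim_compose[OF ch_quadratic_limit lim_h])
      moreover have "eventually (\<lambda>t. - r * ((1 - ch ((1 / sqrt t) *\<^sub>R \<eta>)) / (1 / sqrt t)\<^sup>2) = t * phi a ((1 / sqrt t) *\<^sub>R \<eta>)) at_top"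
        using eventually_gt_at_top[of 0] by eventually_elim (simp add: phi_eq power_divide algebra_simps)
      ultimately have "((\<lambda>t. t * phi a ((1 / sqrt t) *\<^sub>R \<eta>)) \<longlongrightarrow> - r * ((\<eta> \<bullet> (Qm *v \<eta>)) / (2 * r))) at_top"
        by (rule Lim_transform_eventually)
      then have 3: "((\<lambda>t. t * phi a ((1 / sqrt t) *\<^sub>R \<eta>)) \<longlongrightarrow> - (\<eta> \<bullet> (Qm *v \<eta>)) / 2) at_top" using r_pos by simp
      show ?case using tendsto_mult[OF 1 tendsto_mult[OF 2 tendsto_exp[OF 3]]] by simp
    qed
  qed (use dominated in auto)
  have R: "(LINT \<eta>|lborel. B0 * exp (- (\<eta> \<bullet> (Qm *v \<eta>)) / 2)) = B0 * ((2 * pi) powr (?d / 2) / sqrt (det Qm))"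
    using gauss_quadratic(2)[of Qm] Qm_sym Qm_pos by (auto simp: has_bochner_integral_iff)
  have "eventually (\<lambda>t. 1 / (2 * pi) ^ ?d * (LINT \<eta>|lborel. ?F t \<eta>) = t powr (?d / 2) * (LINT \<theta>|mu. B \<theta> * exp (t * phi a \<theta>))) at_top"
    using eventually_gt_at_top[of 0]
  proof eventually_elim
    case (elim t)
    have "(LINT \<theta>|mu. B \<theta> * exp (t * phi a \<theta>)) = 1 / (2 * pi) ^ ?d * (LINT \<theta>|lborel. indicator bx \<theta> * (B \<theta> * exp (t * phi a \<theta>)))"
      by (rule integral_mu) measurable
    also have "(LINT \<theta>|lborel. indicator bx \<theta> * (B \<theta> * exp (t * phi a \<theta>))) = (1 / sqrt t) ^ ?d * (LINT \<eta>|lborel. ?F t \<eta>)"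
      using elim by (subst lborel_integral_scale[of _ "1 / sqrt t"]) auto
    also have "(1 / sqrt t) ^ ?d = 1 / t powr (?d / 2)"
      using elim by (simp add: power_one_over powr_half_sqrt[symmetric] powr_realpow[symmetric] powr_powr)
    finally show ?case using elim by simp
  qed
  moreover have "((\<lambda>t. 1 / (2 * pi) ^ ?d * (LINT \<eta>|lborel. ?F t \<eta>)) \<longlongrightarrow> 1 / (2 * pi) ^ ?d * (B0 * ((2 * pi) powr (?d / 2) / sqrt (det Qm)))) at_top"
    using L unfolding R by (intro tendsto_mult tendsto_const)
  moreover have "1 / (2 * pi) ^ ?d * (B0 * ((2 * pi) powr (?d / 2) / sqrt (det Qm))) = B0 * gamma_d a"
  proof -
    have "(2 * pi) ^ ?d = (2 * pi) powr (?d / 2) * (2 * pi) powr (?d / 2)"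
      by (simp add: powr_add[symmetric] powr_realpow)
    then show ?thesis by (simp add: gamma_eq)
  qed
  ultimately show ?thesis by (simp add: Lim_transform_eventually)
qed

text \<open>The integrand of \<open>rho\<close> up to the factor r, bounded by
  \<open>cos_bound\<close>. Where \<open>1 - ch \<theta>\<close> vanishes, as at \<theta> = 0, its
  value is 0 by the convention for division by zero.\<close>

definition Bu :: "int^'n \<Rightarrow> real^'n \<Rightarrow> real" where "Bu u \<theta> = (1 - cos (ip u \<theta>)) / (1 - ch \<theta>)"

lemma Bu_meas[measurable]: "Bu u \<in> borel_measurable borel" unfolding Bu_def[abs_def] by measurable
lemma Bu_nonneg: "0 \<le> Bu u \<theta>" using ch_le_1[of \<theta>] by (simp add: Bu_def)
lemma Bu_bounded: "\<exists>C. \<forall>\<theta>. Bu u \<theta> \<le> C"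
proof -
  obtain C where C: "C \<ge> 0" "\<And>\<theta>. 1 - cos (ip u \<theta>) \<le> C * (1 - ch \<theta>)" using cos_bound by blast
  have "Bu u \<theta> \<le> C" for \<theta>
    using C(2)[of \<theta>] C(1) ch_le_1[of \<theta>] by (cases "ch \<theta> = 1") (auto simp: Bu_def divide_le_eq)
  then show ?thesis by blast
qed

lemma Bu_integrable: "integrable mu (Bu u)"
proof -
  obtain C where "\<And>\<theta>. Bu u \<theta> \<le> C" using Bu_bounded by blast
  then show ?thesis by (intro integrable_mu_bounded[where B = C]) (auto simp: abs_of_nonneg Bu_nonneg)
qed

lemma rho_eq: "u \<noteq> 0 \<Longrightarrow> rho a u = (LINT \<theta>|mu. Bu u \<theta>)"
proof -
  assume u: "u \<noteq> 0"
  obtain C where C: "\<And>\<theta>. Bu u \<theta> \<le> C" using Bu_bounded by blast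
  have eq: "(cos (ip u \<theta>) - 1) / phi a \<theta> = Bu u \<theta> / r" for \<theta>
    using r_pos by (cases "ch \<theta> = 1") (auto simp: phi_eq Bu_def field_simps)
  have "integral bx (Bu u) / (2 * pi) ^ CARD('n) = (LINT \<theta>|mu. Bu u \<theta>)"
    by (rule integral_mu_HK[where B = C]) (use C Bu_nonneg in \<open>auto simp: abs_of_nonneg\<close>)
  moreover have "integral bx (\<lambda>\<theta>. Bu u \<theta> / r) = integral bx (Bu u) / r" by (rule integral_divide)
  ultimately show ?thesis using u r_pos by (simp add: rho_def bx_def[symmetric] eq)
qed

end

section \<open>Renewal equations\<close>

context walk begin

lemma expectation_J_sum:
  assumes "\<And>i v. i \<in> A \<Longrightarrow> \<bar>f i v\<bar> \<le> (B :: real)"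
  shows "measure_pmf.expectation J (\<lambda>v. \<Sum>i\<in>A. f i v) = (\<Sum>i\<in>A. measure_pmf.expectation J (f i))"
  using assms by (intro Bochner_Integration.integral_sum integrable_J_bounded[where B = B]) auto

lemma q_Suc: "q (Suc n) x = measure_pmf.expectation J (\<lambda>v. q n (x + v))" by (simp add: q_def)

lemma hit_stopped:
  assumes "w \<in> Z"
  shows "hit Z u j w = (if j = 0 \<and> w = u then 1 else 0)"
  using assms by (cases j) auto

lemma sum_only_0: "(\<And>j. j \<noteq> 0 \<Longrightarrow> f j = 0) \<Longrightarrow> (\<Sum>j\<le>n. f j) = f 0" for f :: "nat \<Rightarrow> real"
  by (induction n) auto

text \<open>Decomposition at the first visit to {y, z}, from which the chain starts afresh at y or
  at z. The induction conditions on the first jump.\<close>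

lemma renewal_hit:
  assumes yz: "y \<noteq> z"
  shows "q n (w - y) = (\<Sum>j\<le>n. hit {y, z} y j w * q (n - j) 0 + hit {y, z} z j w * q (n - j) (z - y))"
proof (induction n arbitrary: w)
  case 0
  show ?case using yz by (auto simp: q_def)
next
  case (Suc n)
  show ?case
  proof (cases "w \<in> {y, z}")
    case True
    then show ?thesis
      using yz by (subst sum_only_0) (auto simp: hit_stopped)
  next
    case False
    have bd: "\<bar>hit {y, z} y j (w + v) * q (n - j) 0 + hit {y, z} z j (w + v) * q (n - j) (z - y)\<bar> \<le> 2" for j v
    proof -
      have "hit {y, z} y j (w + v) * q (n - j) 0 \<le> 1 * 1" "hit {y, z} z j (w + v) * q (n - j) (z - y) \<le> 1 * 1"
        by (intro mult_mono hit_le_1 q_le_1 q_nonneg; simp)+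
      then show ?thesis by (simp add: abs_of_nonneg hit_nonneg q_nonneg)
    qed
    have int: "integrable (measure_pmf J) (\<lambda>v. hit {y, z} u j (w + v) * c)" for u j c
      by (intro integrable_mult_left integrable_J_bounded[where B = 1]) (simp add: abs_of_nonneg hit_nonneg hit_le_1)
    have "q (Suc n) (w - y) = measure_pmf.expectation J (\<lambda>v. \<Sum>j\<le>n. hit {y, z} y j (w + v) * q (n - j) 0 + hit {y, z} z j (w + v) * q (n - j) (z - y))"
      using Suc[of "w + _"] by (simp add: q_Suc diff_add_eq)
    also have "\<dots> = (\<Sum>j\<le>n. measure_pmf.expectation J (\<lambda>v. hit {y, z} y j (w + v) * q (n - j) 0 + hit {y, z} z j (w + v) * q (n - j) (z - y)))"
      by (rule expectation_J_sum[where B = 2]) (rule bd)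
    also have "\<dots> = (\<Sum>j\<le>n. hit {y, z} y (Suc j) w * q (n - j) 0 + hit {y, z} z (Suc j) w * q (n - j) (z - y))"
      using False int by (intro sum.cong refl) (subst Bochner_Integration.integral_add, auto)
    also have "\<dots> = (\<Sum>j\<le>Suc n. hit {y, z} y j w * q (Suc n - j) 0 + hit {y, z} z j w * q (Suc n - j) (z - y))"
      using False by (subst sum.atMost_Suc_shift) auto
    finally show ?thesis .
  qed
qed

text \<open>One unrestricted jump precedes the decomposition, because \<open>fh\<close> disregards
  the starting point; therefore time n + 1 on the left faces n - j on the right.\<close>

lemma renewal_fh:
  assumes yz: "y \<noteq> z"
  shows "q (Suc n) (x - y) = (\<Sum>j\<le>n. fh y z j x * q (n - j) 0 + fh z y j x * q (n - j) (z - y))"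
proof -
  have bd: "\<bar>hit {y, z} y j (x + v) * q (n - j) 0 + hit {y, z} z j (x + v) * q (n - j) (z - y)\<bar> \<le> 2" for j v
  proof -
    have "hit {y, z} y j (x + v) * q (n - j) 0 \<le> 1 * 1" "hit {y, z} z j (x + v) * q (n - j) (z - y) \<le> 1 * 1"
      by (intro mult_mono hit_le_1 q_le_1 q_nonneg; simp)+
    then show ?thesis by (simp add: abs_of_nonneg hit_nonneg q_nonneg)
  qed
  have int: "integrable (measure_pmf J) (\<lambda>v. hit {y, z} u j (x + v) * c)" for u j c
    by (intro integrable_mult_left integrable_J_bounded[where B = 1]) (simp add: abs_of_nonneg hit_nonneg hit_le_1)
  have "q (Suc n) (x - y) = measure_pmf.expectation J (\<lambda>v. \<Sum>j\<le>n. hit {y, z} y j (x + v) * q (n - j) 0 + hit {y, z} z j (x + v) * q (n - j) (z - y))"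
    using renewal_hit[OF yz, of n "x + _"] by (simp add: q_Suc diff_add_eq)
  also have "\<dots> = (\<Sum>j\<le>n. measure_pmf.expectation J (\<lambda>v. hit {y, z} y j (x + v) * q (n - j) 0 + hit {y, z} z j (x + v) * q (n - j) (z - y)))"
    by (rule expectation_J_sum[where B = 2]) (rule bd)
  also have "\<dots> = (\<Sum>j\<le>n. fh y z j x * q (n - j) 0 + fh z y j x * q (n - j) (z - y))"
    using int by (intro sum.cong refl) (subst Bochner_Integration.integral_add, auto simp: fh_def insert_commute)
  finally show ?thesis .
qed

text \<open>First visits at different times or points exclude one another; inductively, the bound is
  averaged over the first jump.\<close>

lemma sum_hit_le: "y \<noteq> z \<Longrightarrow> (\<Sum>j<n. hit {y, z} y j w + hit {y, z} z j w) \<le> 1"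
proof (induction n arbitrary: w)
  case (Suc n)
  show ?case
  proof (cases "w \<in> {y, z}")
    case True
    have "(\<Sum>j<Suc n. hit {y, z} y j w + hit {y, z} z j w) = hit {y, z} y 0 w + hit {y, z} z 0 w"
      unfolding lessThan_Suc_atMost by (rule sum_only_0) (use True in \<open>auto simp: hit_stopped\<close>)
    then show ?thesis using Suc.prems by auto
  next
    case False
    have int: "integrable (measure_pmf J) (\<lambda>v. hit {y, z} u j (w + v))" for u j
      by (intro integrable_J_bounded[where B = 1]) (simp add: abs_of_nonneg hit_nonneg hit_le_1)
    have "(\<Sum>j<Suc n. hit {y, z} y j w + hit {y, z} z j w) = (\<Sum>j<n. hit {y, z} y (Suc j) w + hit {y, z} z (Suc j) w)"
      using False by (subst sum.lessThan_Suc_shift) auto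
    also have "\<dots> = (\<Sum>j<n. measure_pmf.expectation J (\<lambda>v. hit {y, z} y j (w + v) + hit {y, z} z j (w + v)))"
      using False int by (intro sum.cong refl) (subst Bochner_Integration.integral_add, auto)
    also have "\<dots> = measure_pmf.expectation J (\<lambda>v. \<Sum>j<n. hit {y, z} y j (w + v) + hit {y, z} z j (w + v))"
      using int by (subst Bochner_Integration.integral_sum) auto
    also have "\<dots> \<le> 1"
      using Suc.IH[OF Suc.prems] int by (intro measure_pmf.integral_le_const) auto
    finally show ?thesis .
  qed
qed simp

lemma sum_fh_le: "y \<noteq> z \<Longrightarrow> (\<Sum>j<n. fh y z j x + fh z y j x) \<le> 1"
proof -
  assume yz: "y \<noteq> z"
  have int: "integrable (measure_pmf J) (\<lambda>v. hit {y, z} u j (x + v))" for u j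
    by (intro integrable_J_bounded[where B = 1]) (simp add: abs_of_nonneg hit_nonneg hit_le_1)
  have "(\<Sum>j<n. fh y z j x + fh z y j x) = (\<Sum>j<n. measure_pmf.expectation J (\<lambda>v. hit {y, z} y j (x + v) + hit {y, z} z j (x + v)))"
    using int by (intro sum.cong refl) (subst Bochner_Integration.integral_add, auto simp: fh_def insert_commute)
  also have "\<dots> = measure_pmf.expectation J (\<lambda>v. \<Sum>j<n. hit {y, z} y j (x + v) + hit {y, z} z j (x + v))"
    using int by (subst Bochner_Integration.integral_sum) auto
  also have "\<dots> \<le> 1"
    using sum_hit_le[OF yz] int by (intro measure_pmf.integral_le_const) auto
  finally show ?thesis .
qed

lemma summable_fh: "y \<noteq> z \<Longrightarrow> summable (\<lambda>n. fh y z n x)"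
proof (rule summableI_nonneg_bounded[where x = 1])
  fix n assume yz: "y \<noteq> z"
  have "(\<Sum>j<n. fh y z j x) \<le> (\<Sum>j<n. fh y z j x + fh z y j x)" by (intro sum_mono) (simp add: fh_nonneg)
  then show "(\<Sum>j<n. fh y z j x) \<le> 1" using sum_fh_le[OF yz, of x n] by simp
qed (simp add: fh_nonneg)

text \<open>\<open>F1\<close> is the total hitting probability and turns out to be
  \<open>Hinf\<close>. The exponent \<open>Suc n\<close> in \<open>Fs\<close> counts jumps, matching
  the shifted index of \<open>fh\<close>.\<close>

definition F1 :: "int^'n \<Rightarrow> int^'n \<Rightarrow> int^'n \<Rightarrow> real" where "F1 x y z = (\<Sum>n. fh y z n x)"
definition Fs :: "int^'n \<Rightarrow> int^'n \<Rightarrow> int^'n \<Rightarrow> real \<Rightarrow> real" where "Fs x y z s = (\<Sum>n. fh y z n x * s ^ Suc n)"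

lemma F1_add_le: "y \<noteq> z \<Longrightarrow> F1 x y z + F1 x z y \<le> 1"
proof -
  assume yz: "y \<noteq> z"
  have "F1 x y z + F1 x z y = (\<Sum>n. fh y z n x + fh z y n x)"
    unfolding F1_def using yz summable_fh by (intro suminf_add) auto
  also have "\<dots> \<le> 1"
    using yz summable_fh sum_fh_le by (intro suminf_le_const summable_add) auto
  finally show ?thesis .
qed

lemma summable_fh_power: "y \<noteq> z \<Longrightarrow> 0 \<le> s \<Longrightarrow> s \<le> 1 \<Longrightarrow> summable (\<lambda>n. fh y z n x * s ^ n)"
  by (rule summable_comparison_test'[OF summable_fh[of y z x], of 0])
    (auto simp: abs_mult fh_nonneg abs_of_nonneg power_le_one mult_left_le)

text \<open>Cauchy products of the renewal equation. The subtracted term removes the visit at time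
  0, which \<open>fh\<close> does not see.\<close>

lemma generating_eq:
  assumes yz: "y \<noteq> z" and s: "0 \<le> s" "s < 1"
  shows "Qs s (x - y) - (if x = y then 1 else 0) = Fs x y z s * Qs s 0 + Fs x z y s * Qs s (y - z)"
proof -
  have sm: "summable (\<lambda>n. norm (fh u v n x * s ^ n))" if "u \<noteq> v" for u v
    using summable_fh_power[OF that, of s x] s by (simp add: abs_mult fh_nonneg)
  have sq: "summable (\<lambda>n. norm (s ^ n * q n u))" for u
    using Qs_sums[OF s, of u] s by (simp add: abs_mult q_nonneg sums_iff)
  have c: "(\<lambda>n. \<Sum>j\<le>n. (fh u v j x * s ^ j) * (s ^ (n - j) * q (n - j) w)) sums ((\<Sum>n. fh u v n x * s ^ n) * Qs s w)" if "u \<noteq> v" for u v w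
    using Cauchy_product_sums[OF sm[OF that] sq[of w]] Qs_sums[OF s, of w] by (simp add: sums_iff)
  have "q n (z - y) = q n (y - z)" for n using q_sym[of n "y - z"] by simp
  then have eq: "s ^ Suc n * q (Suc n) (x - y) = s * ((\<Sum>j\<le>n. (fh y z j x * s ^ j) * (s ^ (n - j) * q (n - j) 0)) + (\<Sum>j\<le>n. (fh z y j x * s ^ j) * (s ^ (n - j) * q (n - j) (y - z))))" for n
    unfolding renewal_fh[OF yz] sum_distrib_left sum.distrib[symmetric]
  proof (intro sum.cong refl)
    fix j assume "j \<in> {..n}"
    then have pw: "s ^ n = s ^ j * s ^ (n - j)" by (simp add: power_add[symmetric])
    show "s ^ Suc n * (fh y z j x * q (n - j) 0 + fh z y j x * q (n - j) (z - y)) = s * (fh y z j x * s ^ j * (s ^ (n - j) * q (n - j) 0) + fh z y j x * s ^ j * (s ^ (n - j) * q (n - j) (y - z)))"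
      unfolding power_Suc pw \<open>\<And>n. q n (z - y) = q n (y - z)\<close> by (simp add: algebra_simps)
  qed
  have "(\<lambda>n. s ^ Suc n * q (Suc n) (x - y)) sums (s * ((\<Sum>n. fh y z n x * s ^ n) * Qs s 0 + (\<Sum>n. fh z y n x * s ^ n) * Qs s (y - z)))"
    unfolding eq using yz by (intro sums_mult sums_add c) auto
  then have "(\<lambda>n. s ^ n * q n (x - y)) sums (s * ((\<Sum>n. fh y z n x * s ^ n) * Qs s 0 + (\<Sum>n. fh z y n x * s ^ n) * Qs s (y - z)) + s ^ 0 * q 0 (x - y))"
    by (rule sums_Suc)
  then have "Qs s (x - y) = s * ((\<Sum>n. fh y z n x * s ^ n) * Qs s 0 + (\<Sum>n. fh z y n x * s ^ n) * Qs s (y - z)) + q 0 (x - y)"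
    using Qs_sums[OF s, of "x - y"] by (simp add: sums_iff)
  moreover have "Fs x u v s = s * (\<Sum>n. fh u v n x * s ^ n)" if "u \<noteq> v" for u v
    unfolding Fs_def using summable_fh_power[OF that, of s x] s by (subst suminf_mult[symmetric]) (auto simp: mult_ac)
  ultimately show ?thesis using yz by (auto simp: q_def algebra_simps)
qed

text \<open>The summand at \<open>u = 0\<close> mirrors the convention \<open>rho a 0 = 1\<close>.\<close>

definition Rs :: "real \<Rightarrow> int^'n \<Rightarrow> real" where
  "Rs s u = (LINT \<theta>|mu. (1 - cos (ip u \<theta>)) / (1 - s * ch \<theta>)) + (if u = 0 then 1 else 0)"

lemma s_ch_less: "0 \<le> s \<Longrightarrow> s < 1 \<Longrightarrow> s * ch \<theta> \<le> s" "0 \<le> s \<Longrightarrow> s < 1 \<Longrightarrow> - s \<le> s * ch \<theta>"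
  using mult_left_mono[OF ch_le_1[of \<theta>], of s] mult_left_mono[OF ch_ge[of \<theta>], of s] by auto

lemma integrable_Qs:
  assumes s: "0 \<le> s" "s < 1" and m: "f \<in> borel_measurable borel" and B: "\<And>\<theta>. \<bar>f \<theta>\<bar> \<le> B"
  shows "integrable mu (\<lambda>\<theta>. f \<theta> / (1 - s * ch \<theta>))"
proof (rule integrable_mu_bounded[where B = "B / (1 - s)"])
  fix \<theta>
  have "1 - s \<le> 1 - s * ch \<theta>" using s_ch_less(1)[OF s, of \<theta>] by simp
  then show "\<bar>f \<theta> / (1 - s * ch \<theta>)\<bar> \<le> B / (1 - s)"
    using s B[of \<theta>] by (simp add: abs_divide frac_le)
qed (use m in measurable)

lemma Rs_eq: "0 \<le> s \<Longrightarrow> s < 1 \<Longrightarrow> Rs s u = Qs s 0 - (Qs s u - (if u = 0 then 1 else 0))"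
proof -
  assume s: "0 \<le> s" "s < 1"
  have "(LINT \<theta>|mu. (1 - cos (ip u \<theta>)) / (1 - s * ch \<theta>)) = (LINT \<theta>|mu. 1 / (1 - s * ch \<theta>) - cos (ip u \<theta>) / (1 - s * ch \<theta>))"
    by (simp add: diff_divide_distrib)
  also have "\<dots> = Qs s 0 - Qs s u"
    unfolding Qs_def using integrable_Qs[OF s, of "\<lambda>_. 1" 1] integrable_Qs[OF s, of "\<lambda>\<theta>. cos (ip u \<theta>)" 1]
    by (subst Bochner_Integration.integral_diff) auto
  finally show ?thesis by (simp add: Rs_def)
qed

text \<open>\<open>1 - s * ch \<theta>\<close> is at most 2 and
  \<open>1 + c * cos (ip u \<theta>)\<close> has mean 1 for u \<noteq> 0; the cases c = -1 and c = 1
  give the two bounds. They keep the denominator in \<open>Fs_formula\<close> positive.\<close>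

lemma Rs_pos:
  assumes s: "0 \<le> s" "s < 1" and u: "u \<noteq> 0"
  shows "1 / 2 \<le> Rs s u" "Rs s u \<le> 2 * Qs s 0 - 1 / 2"
proof -
  have i: "integrable mu (\<lambda>\<theta>. cos (ip u \<theta>))" by (rule integrable_mu_bounded[where B = 1]) auto
  have half: "1 / 2 \<le> (LINT \<theta>|mu. (1 + c * cos (ip u \<theta>)) / (1 - s * ch \<theta>))" if c: "\<bar>c\<bar> \<le> 1" for c
  proof -
    have nn: "0 \<le> 1 + c * cos (ip u \<theta>)" "1 + c * cos (ip u \<theta>) \<le> 2" for \<theta>
    proof -
      have "\<bar>c * cos (ip u \<theta>)\<bar> \<le> 1 * 1" unfolding abs_mult by (intro mult_mono c) auto
      then show "0 \<le> 1 + c * cos (ip u \<theta>)" "1 + c * cos (ip u \<theta>) \<le> 2" by auto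
    qed
    have "1 / 2 = (LINT \<theta>|mu. (1 + c * cos (ip u \<theta>)) / 2)"
      using integral_mu_cos[of u] u i mu.prob_space by simp
    also have "\<dots> \<le> (LINT \<theta>|mu. (1 + c * cos (ip u \<theta>)) / (1 - s * ch \<theta>))"
    proof (rule integral_mono)
      show "integrable mu (\<lambda>\<theta>. (1 + c * cos (ip u \<theta>)) / 2)" using i by simp
      show "integrable mu (\<lambda>\<theta>. (1 + c * cos (ip u \<theta>)) / (1 - s * ch \<theta>))"
        by (rule integrable_Qs[OF s, where B = 2]) (use nn in auto)
      fix \<theta>
      have "0 < 1 - s * ch \<theta>" "1 - s * ch \<theta> \<le> 2" using s_ch_less[OF s, of \<theta>] s by auto
      then show "(1 + c * cos (ip u \<theta>)) / 2 \<le> (1 + c * cos (ip u \<theta>)) / (1 - s * ch \<theta>)"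
        using nn(1)[of \<theta>] by (intro divide_left_mono) auto
    qed
    finally show ?thesis .
  qed
  show "1 / 2 \<le> Rs s u" using half[of "-1"] u by (simp add: Rs_def)
  have "(LINT \<theta>|mu. (1 + cos (ip u \<theta>)) / (1 - s * ch \<theta>)) = Qs s 0 + Qs s u"
    unfolding Qs_def add_divide_distrib using integrable_Qs[OF s, of "\<lambda>_. 1" 1] integrable_Qs[OF s, of "\<lambda>\<theta>. cos (ip u \<theta>)" 1]
    by (subst Bochner_Integration.integral_add) auto
  then show "Rs s u \<le> 2 * Qs s 0 - 1 / 2" using half[of 1] Rs_eq[OF s, of u] u by simp
qed

lemma Rs_sym: "Rs s (- u) = Rs s u" by (simp add: Rs_def ip_minus)

text \<open>The generating equations for the targets y and z form a linear system in the unknowns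
  \<open>Fs x y z s\<close> and \<open>Fs x z y s\<close>. Passing from \<open>Qs\<close> to
  \<open>Rs\<close> absorbs the visit at time 0, so x = y and x = z need no separate cases; it also
  isolates \<open>Qs s 0\<close>, the one quantity that diverges in the recurrent case.\<close>

lemma Fs_formula:
  assumes yz: "y \<noteq> z" and s: "0 \<le> s" "s < 1"
  shows "Fs x y z s = (Qs s 0 * (Rs s (x - z) + Rs s (y - z) - Rs s (x - y)) - Rs s (x - z) * Rs s (y - z)) / (Rs s (y - z) * (2 * Qs s 0 - Rs s (y - z)))"
proof -
  define Q R A B F F' where defs: "Q = Qs s 0" "R = Rs s (y - z)" "A = Rs s (x - y)" "B = Rs s (x - z)" "F = Fs x y z s" "F' = Fs x z y s"
  have R: "R > 0" "2 * Q - R > 0" using Rs_pos[OF s, of "y - z"] yz by (auto simp: defs)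
  have qy: "Qs s (y - z) = Q - R" "Qs s (z - y) = Q - R" using Rs_eq[OF s, of "y - z"] Rs_eq[OF s, of "z - y"] Rs_sym[of s "y - z"] yz by (auto simp: defs)
  have e1: "Q - A = F * Q + F' * (Q - R)"
    using generating_eq[OF yz s, of x] Rs_eq[OF s, of "x - y"] qy by (simp add: defs)
  have e2: "Q - B = F' * Q + F * (Q - R)"
    using generating_eq[OF yz[symmetric] s, of x] Rs_eq[OF s, of "x - z"] qy by (simp add: defs)
  have "F * (R * (2 * Q - R)) = Q * (B + R - A) - B * R"
    using e1 e2 by algebra
  then show ?thesis using R unfolding defs[symmetric] by (simp add: eq_divide_eq)
qed

lemma filterlim_resolvent_parameter: "filterlim (\<lambda>l. r / (r + l)) (at_left 1) (at_right 0)"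
  unfolding filterlim_at
proof
  show "((\<lambda>l. r / (r + l)) \<longlongrightarrow> 1) (at_right 0)" using r_pos by (auto intro!: tendsto_eq_intros)
  show "eventually (\<lambda>l. r / (r + l) \<in> {..<1} \<and> r / (r + l) \<noteq> 1) (at_right 0)"
    using eventually_at_right_less[of "0::real"] by eventually_elim (use r_pos in auto)
qed

lemma eventually_unit_interval_at_left: "eventually (\<lambda>s. 0 \<le> s \<and> s < (1::real)) (at_left 1)"
  by (rule eventually_mono[OF eventually_at_left_real[OF zero_less_one]]) auto

text \<open>Dominated convergence with majorant \<open>2 * Bu u\<close>: for s in [0, 1) the
  denominator \<open>1 - s * ch \<theta>\<close> is at least half of \<open>1 - ch \<theta>\<close>,
  whatever the sign of \<open>ch \<theta>\<close>.\<close>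

lemma Rs_tendsto: "((\<lambda>s. Rs s u) \<longlongrightarrow> rho a u) (at_left 1)"
proof (cases "u = 0")
  case True
  then show ?thesis by (simp add: Rs_def rho_def)
next
  case False
  have "((\<lambda>s. LINT \<theta>|mu. (1 - cos (ip u \<theta>)) / (1 - s * ch \<theta>)) \<longlongrightarrow> (LINT \<theta>|mu. Bu u \<theta>)) (at_left 1)"
    unfolding tendsto_at_iff_sequentially comp_def
  proof (intro allI impI)
    fix X :: "nat \<Rightarrow> real" assume X: "\<forall>i. X i \<in> {..<1} - {1}" "X \<longlonglongrightarrow> 1"
    then have "eventually (\<lambda>i. X i > 0) sequentially" by (intro order_tendstoD) auto
    \<comment> \<open>A sequence that approaches 1 from below is positive only from some index on,
      hence the shift by N.\<close>
    then obtain N where N: "\<And>i. i \<ge> N \<Longrightarrow> X i > 0" by (auto simp: eventually_sequentially)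
    have "(\<lambda>i. LINT \<theta>|mu. (1 - cos (ip u \<theta>)) / (1 - X (i + N) * ch \<theta>)) \<longlonglongrightarrow> (LINT \<theta>|mu. Bu u \<theta>)"
    proof (rule integral_dominated_convergence[where w = "\<lambda>\<theta>. 2 * Bu u \<theta>"])
      show "AE \<theta> in mu. (\<lambda>i. (1 - cos (ip u \<theta>)) / (1 - X (i + N) * ch \<theta>)) \<longlonglongrightarrow> Bu u \<theta>"
        using AE_mu_bx AE_mu_nonzero
      proof eventually_elim
        case (elim \<theta>)
        have "ch \<theta> < 1" using ch_less_1 elim by auto
        moreover have "(\<lambda>i. X (i + N)) \<longlonglongrightarrow> 1" by (rule LIMSEQ_ignore_initial_segment[OF X(2)])
        ultimately show ?case unfolding Bu_def by (auto intro!: tendsto_eq_intros)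
      qed
      show "AE \<theta> in mu. norm ((1 - cos (ip u \<theta>)) / (1 - X (i + N) * ch \<theta>)) \<le> 2 * Bu u \<theta>" for i
        using AE_mu_bx AE_mu_nonzero
      proof eventually_elim
        case (elim \<theta>)
        let ?s = "X (i + N)"
        have s: "0 \<le> ?s" "?s < 1" using N[of "i + N"] X(1) by (auto simp: less_imp_le)
        have c: "ch \<theta> < 1" using ch_less_1 elim by auto
        have "(1 - ch \<theta>) / 2 \<le> 1 - ?s * ch \<theta>"
        proof (cases "ch \<theta> \<ge> 0")
          case True
          then have "?s * ch \<theta> \<le> 1 * ch \<theta>" using s by (intro mult_right_mono) auto
          then show ?thesis using c by simp
        next
          case False
          then have "?s * ch \<theta> \<le> 0" using s by (simp add: mult_nonneg_nonpos)
          then show ?thesis using ch_ge[of \<theta>] by simp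
        qed
        then have "(1 - cos (ip u \<theta>)) / (1 - ?s * ch \<theta>) \<le> (1 - cos (ip u \<theta>)) / ((1 - ch \<theta>) / 2)"
          using c by (intro divide_left_mono) auto
        moreover have "0 < 1 - ?s * ch \<theta>" using \<open>(1 - ch \<theta>) / 2 \<le> 1 - ?s * ch \<theta>\<close> c by simp
        ultimately show ?case by (simp add: Bu_def mult.commute[of _ 2])
      qed
    qed (use Bu_integrable in auto)
    then show "(\<lambda>i. LINT \<theta>|mu. (1 - cos (ip u \<theta>)) / (1 - X i * ch \<theta>)) \<longlonglongrightarrow> (LINT \<theta>|mu. Bu u \<theta>)"
      by (rule LIMSEQ_offset)
  qed
  then show ?thesis using False by (simp add: Rs_def rho_eq)
qed

lemma rho_pos: "rho a u > 0"
proof (cases "u = 0")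
  case False
  have "1 / 2 \<le> rho a u"
    by (rule tendsto_lowerbound[OF Rs_tendsto]) (use eventually_unit_interval_at_left Rs_pos(1)[OF _ _ False] in \<open>auto elim: eventually_mono\<close>)
  then show ?thesis by simp
qed (simp add: rho_def)

lemma rho_sym: "rho a (- u) = rho a u" by (cases "u = 0") (auto simp: rho_eq Bu_def ip_minus)

lemma Fs_tendsto:
  assumes yz: "y \<noteq> z"
  shows "((\<lambda>s. Fs x y z s) \<longlongrightarrow> F1 x y z) (at_left 1)"
proof -
  have "uniform_limit {0..1} (\<lambda>n s. \<Sum>i<n. fh y z i x * s ^ Suc i) (\<lambda>s. \<Sum>i. fh y z i x * s ^ Suc i) sequentially"
  proof (rule Weierstrass_m_test[OF _ summable_fh[OF yz, of x]])
    fix n and s :: real assume "s \<in> {0..1}"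
    then show "norm (fh y z n x * s ^ Suc n) \<le> fh y z n x"
      using power_le_one[of s "Suc n"] by (simp add: abs_mult fh_nonneg mult_left_le del: power_Suc)
  qed
  then have "continuous_on {0..1} (\<lambda>s. \<Sum>i. fh y z i x * s ^ Suc i)"
    by (rule uniform_limit_theorem[rotated]) (auto intro!: always_eventually continuous_intros)
  then have "((\<lambda>s. Fs x y z s) \<longlongrightarrow> Fs x y z 1) (at 1 within {0..1})"
    unfolding continuous_on_def Fs_def by (rule bspec) simp
  then have "((\<lambda>s. Fs x y z s) \<longlongrightarrow> Fs x y z 1) (at_left 1)"
    using at_within_Icc_at_left[of 0 "1::real"] by simp
  then show ?thesis by (simp add: Fs_def F1_def)
qed

lemma H_tail_sums:
  assumes t: "t \<ge> 0" and yz: "y \<noteq> z"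
  shows "(\<lambda>n. fh y z n x * (\<Sum>k\<le>n. pois k t)) sums (F1 x y z - H a x y z t)"
proof -
  have "(\<lambda>n. fh y z n x - fh y z n x * (1 - (\<Sum>k\<le>n. pois k t))) sums (F1 x y z - H a x y z t)"
    unfolding F1_def by (intro sums_diff summable_sums summable_fh yz H_sums t)
  then show ?thesis by (simp add: algebra_simps)
qed

lemma pois_tendsto: "((\<lambda>t. pois k t) \<longlongrightarrow> 0) at_top"
proof -
  have "((\<lambda>t. t ^ k / exp t) \<longlongrightarrow> (0::real)) at_top" by (rule tendsto_power_div_exp_0)
  moreover have "filterlim (\<lambda>t. r * t) at_top at_top"
    using r_pos by (intro filterlim_tendsto_pos_mult_at_top[OF tendsto_const]) (auto intro: filterlim_ident)
  ultimately have "((\<lambda>t. (r * t) ^ k / exp (r * t)) \<longlongrightarrow> 0) at_top" by (rule filterlim_compose)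
  then have "((\<lambda>t. (r * t) ^ k / exp (r * t) / fact k) \<longlongrightarrow> 0 / fact k) at_top" by (intro tendsto_divide) auto
  then show ?thesis by (simp add: pois_def exp_minus divide_inverse)
qed

text \<open>Dominated convergence on the series: every Poisson weight dies out as t grows, while the
  coefficients \<open>fh\<close> form a summable majorant.\<close>

lemma H_tendsto:
  assumes yz: "y \<noteq> z"
  shows "(H a x y z \<longlongrightarrow> F1 x y z) at_top"
proof -
  have "((\<lambda>t. LINT n|count_space UNIV. fh y z n x * (1 - (\<Sum>k\<le>n. pois k t))) \<longlongrightarrow> (LINT n|count_space UNIV. fh y z n x)) at_top"
  proof (rule integral_dominated_convergence_at_top[where w = "\<lambda>n. fh y z n x"])
    show "integrable (count_space UNIV) (\<lambda>n. fh y z n x)"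
      using summable_fh[OF yz, of x] by (simp add: integrable_count_space_nat_iff fh_nonneg)
    show "eventually (\<lambda>t. AE n in count_space UNIV. norm (fh y z n x * (1 - (\<Sum>k\<le>n. pois k t))) \<le> fh y z n x) at_top"
      using eventually_ge_at_top[of 0]
    proof eventually_elim
      case (elim t)
      have "0 \<le> 1 - (\<Sum>k\<le>n. pois k t)" "1 - (\<Sum>k\<le>n. pois k t) \<le> 1" for n
        using sum_pois_le[OF elim, of "Suc n"] sum_nonneg[of "{..n}" "\<lambda>k. pois k t"] pois_nonneg[OF elim] by (auto simp: lessThan_Suc_atMost)
      then show ?case by (auto simp: abs_mult fh_nonneg mult_left_le)
    qed
    show "AE n in count_space UNIV. ((\<lambda>t. fh y z n x * (1 - (\<Sum>k\<le>n. pois k t))) \<longlongrightarrow> fh y z n x) at_top"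
    proof (rule AE_I2)
      fix n
      have "((\<lambda>t. fh y z n x * (1 - (\<Sum>k\<le>n. pois k t))) \<longlongrightarrow> fh y z n x * (1 - (\<Sum>k\<le>n. 0))) at_top"
        by (intro tendsto_intros pois_tendsto)
      then show "((\<lambda>t. fh y z n x * (1 - (\<Sum>k\<le>n. pois k t))) \<longlongrightarrow> fh y z n x) at_top" by simp
    qed
  qed auto
  moreover have "(LINT n|count_space UNIV. fh y z n x) = F1 x y z"
    unfolding F1_def using summable_fh[OF yz, of x]
    by (intro integral_count_space_nat) (simp add: integrable_count_space_nat_iff fh_nonneg)
  moreover have "eventually (\<lambda>t. (LINT n|count_space UNIV. fh y z n x * (1 - (\<Sum>k\<le>n. pois k t))) = H a x y z t) at_top"
    using eventually_ge_at_top[of 0]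
  proof eventually_elim
    case (elim t)
    have nn: "0 \<le> 1 - (\<Sum>k\<le>n. pois k t)" for n using sum_pois_le[OF elim, of "Suc n"] by (simp add: lessThan_Suc_atMost)
    have "summable (\<lambda>n. norm (fh y z n x * (1 - (\<Sum>k\<le>n. pois k t))))"
      using H_sums[OF elim yz, of x] nn by (simp add: abs_mult fh_nonneg sums_iff)
    then have "(LINT n|count_space UNIV. fh y z n x * (1 - (\<Sum>k\<le>n. pois k t))) = (\<Sum>n. fh y z n x * (1 - (\<Sum>k\<le>n. pois k t)))"
      by (intro integral_count_space_nat) (simp add: integrable_count_space_nat_iff)
    then show ?case using H_sums[OF elim yz, of x] by (simp add: sums_iff)
  qed
  ultimately show ?thesis by (auto elim: Lim_transform_eventually)
qed

lemma Hinf_eq: "y \<noteq> z \<Longrightarrow> Hinf a x y z = F1 x y z"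
  unfolding Hinf_def using H_tendsto by (intro tendsto_Lim) auto

subsection \<open>Strict positivity for walks other than the simple random walk\<close>

lemma b_pos_nonzero: "b v > 0 \<Longrightarrow> v \<noteq> 0" by (auto simp: b_def)

lemma span_of_single_step:
  assumes g: "\<And>v. b v > 0 \<Longrightarrow> v = g \<or> v = - g" and "q n x > 0"
  shows "\<exists>m::int. \<forall>i. x $ i = m * g $ i"
  using assms(2)
proof (induction n arbitrary: x)
  case 0
  then have "x = 0" by (auto simp: q_def split: if_splits)
  then show ?case by (intro exI[of _ 0]) simp
next
  case (Suc n)
  then have "0 < measure_pmf.expectation J (\<lambda>v. hit {} 0 n (x + v))" by (simp add: q_def)
  then obtain v where v: "b v > 0" "q n (x + v) > 0" using ex_hit_pos_step unfolding q_def by blast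
  obtain m :: int where m: "\<And>i. (x + v) $ i = m * g $ i" using Suc.IH[OF v(2)] by blast
  from g[OF v(1)] show ?case
  proof
    assume "v = g"
    then show ?thesis using m by (intro exI[of _ "m - 1"]) (simp add: algebra_simps eq_diff_eq)
  next
    assume "v = - g"
    then show ?thesis using m by (intro exI[of _ "m + 1"]) (simp add: algebra_simps diff_eq_eq)
  qed
qed

lemma ex_step: "\<exists>g. b g > 0"
proof (rule ccontr)
  assume "\<not> ?thesis"
  then have "b v = 0" for v using b_nonneg[of v] by (metis order_le_less)
  then have "b = (\<lambda>_. 0)" by (rule ext)
  then show False using b_has_sum has_sum_unique[of "\<lambda>_. 0" UNIV "1::real" 0] by simp
qed

text \<open>If all steps were g and -g, irreducibility would make every lattice point a multiple of
  g; this forces a single coordinate with g = 1 or g = -1, and symmetry gives each the probability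
  1/2, which is the simple random walk.\<close>

lemma not_srw_steps:
  assumes "\<not> is_srw a"
  shows "\<exists>g h. b g > 0 \<and> b h > 0 \<and> h \<noteq> g \<and> h \<noteq> - g"
proof (rule ccontr)
  assume *: "\<not> ?thesis"
  obtain g where g: "b g > 0" using ex_step by blast
  have only: "v = g \<or> v = - g" if "b v > 0" for v using * g that by blast
  have span: "\<exists>m::int. \<forall>i. x $ i = m * g $ i" for x
    using ex_q_pos[of x] span_of_single_step[OF only] by blast
  obtain i where i: "g $ i \<noteq> 0" using b_pos_nonzero[OF g] by (auto simp: vec_eq_iff)
  have all_i: "j = i" for j
  proof (rule ccontr)
    assume "j \<noteq> i"
    obtain m :: int where m: "\<And>k. (axis j 1 :: int^'n) $ k = m * g $ k" using span by blast
    have "m * g $ i = 0" using m[of i] \<open>j \<noteq> i\<close> by (simp add: axis_def)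
    then have "m = 0" using i by simp
    then show False using m[of j] by (simp add: axis_def)
  qed
  then have U: "(UNIV :: 'n set) = {i}" by auto
  have card: "CARD('n) = 1" unfolding U by simp
  obtain m :: int where m: "\<And>k. (axis i 1 :: int^'n) $ k = m * g $ k" using span by blast
  have "m * g $ i = 1" using m[of i] by (simp add: axis_def)
  then have gi: "g $ i = 1 \<or> g $ i = - 1" by (metis mult.commute zmult_eq_1_iff)
  have vec1: "v = w \<longleftrightarrow> v $ i = w $ i" for v w :: "int^'n"
  proof
    assume eq: "v $ i = w $ i"
    have "v $ j = w $ j" for j using eq by (subst (1 2) all_i[of j])
    then show "v = w" by (simp add: vec_eq_iff)
  qed simp
  define e :: "int^'n" where "e = (\<chi> i. 1)"
  have me: "(\<chi> i. (- 1 :: int)) = - e" by (simp add: e_def vec_eq_iff)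
  have ge: "g = e \<or> g = - e" using gi by (auto simp: vec1 e_def)
  have only_e: "b v = 0" if "v \<noteq> e" "v \<noteq> - e" for v
    using only[of v] ge that b_nonneg[of v] by (auto simp: order_le_less)
  have "e \<noteq> - e" by (simp add: vec1 e_def)
  have "(b has_sum (\<Sum>v\<in>{e, - e}. b v)) UNIV"
    by (rule has_sum_finite_neutralI) (use only_e in auto)
  then have "(\<Sum>v\<in>{e, - e}. b v) = 1" using b_has_sum has_sum_unique by blast
  then have "b e = 1 / 2" using \<open>e \<noteq> - e\<close> b_sym[of e] by simp
  moreover have "e \<noteq> 0" by (simp add: vec1 e_def)
  ultimately have ae: "a e = r / 2" using r_pos by (simp add: b_def field_simps)
  have "is_srw a"
    unfolding is_srw_def
  proof (intro conjI allI impI card)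
    show "a (\<chi> i. 1) = r / 2" using ae by (simp add: e_def)
    show "a (\<chi> i. - 1) = r / 2" using ae a_sym[of e] by (simp add: me)
    fix k :: "int^'n" assume k: "\<bar>sc k\<bar> > 1"
    have "k \<noteq> e" "k \<noteq> - e" "k \<noteq> 0" using k by (auto simp: sc_def U e_def)
    then show "a k = 0" using only_e[of k] r_pos by (simp add: b_def)
  qed
  then show False using assms by simp
qed

text \<open>A path to y may run through z. It has to be rerouted around z, and a second pair of
  steps makes that possible.\<close>

lemma F1_pos:
  assumes ns: "\<not> is_srw a" and yz: "y \<noteq> z"
  shows "F1 x y z > 0"
proof -
  define Pos where "Pos w \<longleftrightarrow> (\<exists>n. hit {y, z} y n w > 0)" for w
  have Py: "Pos y" unfolding Pos_def by (intro exI[of _ 0]) simp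
  have step: "Pos w" if st: "w \<noteq> z" "b v > 0" "Pos (w + v)" for w v
  proof (cases "w = y")
    case False
    obtain n where n: "hit {y, z} y n (w + v) > 0" using st(3) by (auto simp: Pos_def)
    have "0 < b v * hit {y, z} y n (w + v)" using n st by simp
    also have "\<dots> \<le> measure_pmf.expectation J (\<lambda>v. hit {y, z} y n (w + v))"
      by (rule pmf_le_expectation[where B = 1]) (auto simp: hit_nonneg hit_le_1)
    finally have "hit {y, z} y (Suc n) w > 0" using False st by simp
    then show ?thesis unfolding Pos_def by blast
  qed (simp add: Py)
  obtain g h where gh: "b g > 0" "b h > 0" "h \<noteq> g" "h \<noteq> - g" using not_srw_steps[OF ns] by blast
  \<comment> \<open>Exchange the order of two steps: from z + v' go by v and then by -v' to z + v.
    The corner z + v + v' differs from z unless v' = -v.\<close>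
  have nb1: "Pos (z + v')" if v: "b v > 0" "b v' > 0" "Pos (z + v)" "v' \<noteq> - v" for v v'
  proof -
    have "Pos (z + v + v')"
    proof (rule step[of _ "- v'"])
      show "z + v + v' \<noteq> z" using v(4) by (metis add.assoc add_cancel_right_right eq_neg_iff_add_eq_0 add.commute)
    qed (use v b_sym in auto)
    then show ?thesis
      using step[of "z + v'" v] v b_pos_nonzero[of v'] by (simp add: ac_simps)
  qed
  have nb: "Pos (z + v')" if v: "b v > 0" "b v' > 0" "Pos (z + v)" for v v'
  proof (cases "v' = - v")
    case True
    \<comment> \<open>For the opposite step a third direction k, taken from g and h, serves as an
      intermediate stop.\<close>
    obtain k where k: "b k > 0" "k \<noteq> v" "k \<noteq> - v"
    proof (cases "g = v \<or> g = - v")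
      case True then show thesis using gh by (intro that[of h]) auto
    next
      case False then show thesis using gh by (intro that[of g]) auto
    qed
    have "Pos (z + k)" by (rule nb1[OF v(1) k(1) v(3)]) (use k in simp)
    then show ?thesis by (rule nb1[OF k(1) v(2)]) (use k True in auto)
  qed (use nb1 v in blast)
  \<comment> \<open>Induction along an unrestricted path from w to y. At w = z the claim is replaced
    by one about all neighbours of z, so that the induction survives a passage through z.\<close>
  have main: "(w \<noteq> z \<longrightarrow> Pos w) \<and> (w = z \<longrightarrow> (\<forall>v. b v > 0 \<longrightarrow> Pos (z + v)))" if "q n (w - y) > 0" for n w
    using that
  proof (induction n arbitrary: w)
    case 0
    then have "w = y" by (auto simp: q_def split: if_splits)
    then show ?case using Py yz by auto
  next
    case (Suc n)
    then have "0 < measure_pmf.expectation J (\<lambda>v. hit {} 0 n (w - y + v))" by (simp add: q_def)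
    then obtain v where v: "b v > 0" "q n (w - y + v) > 0" using ex_hit_pos_step unfolding q_def by blast
    have IH: "(w + v \<noteq> z \<longrightarrow> Pos (w + v)) \<and> (w + v = z \<longrightarrow> (\<forall>v. b v > 0 \<longrightarrow> Pos (z + v)))"
      by (rule Suc.IH) (use v(2) in \<open>simp add: diff_add_eq\<close>)
    show ?case
    proof (cases "w = z")
      case True
      then have "Pos (z + v)" using IH b_pos_nonzero[OF v(1)] by auto
      then show ?thesis using True nb[OF v(1)] by blast
    next
      case False
      show ?thesis
      proof (cases "w + v = z")
        case True
        then have "\<forall>u. b u > 0 \<longrightarrow> Pos (z + u)" using IH by blast
        moreover have "b (- v) > 0" using v(1) b_sym[of v] by simp
        ultimately have "Pos (z + - v)" by blast
        moreover have "z + - v = w" using True by (simp add: algebra_simps)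
        ultimately show ?thesis using False by simp
      next
        case nz: False
        then have "Pos (w + v)" using IH by blast
        then show ?thesis using step[OF False v(1)] False by simp
      qed
    qed
  qed
  have allPos: "Pos w" if "w \<noteq> z" for w using ex_q_pos[of "w - y"] main that by blast
  obtain v where v: "b v > 0" "x + v \<noteq> z"
  proof (cases "x + g = z")
    case True then show thesis using gh by (intro that[of h]) auto
  qed (use gh that in blast)
  obtain n where n: "hit {y, z} y n (x + v) > 0" using allPos[OF v(2)] by (auto simp: Pos_def)
  have "0 < b v * hit {y, z} y n (x + v)" using n v by simp
  also have "\<dots> \<le> fh y z n x"
    unfolding fh_def by (rule pmf_le_expectation[where B = 1]) (auto simp: hit_nonneg hit_le_1)
  finally show ?thesis unfolding F1_def
    by (intro suminf_pos2[OF summable_fh[OF yz], of _ n]) (auto simp: fh_nonneg)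
qed

lemma F1_less_1: "\<not> is_srw a \<Longrightarrow> y \<noteq> z \<Longrightarrow> F1 x y z < 1"
  using F1_pos[of z y x] F1_add_le[of y z x] by simp

end

section \<open>Tails in dimensions one and two\<close>

lemma filterlim_one_divide_at_right: "filterlim (\<lambda>l::real. 1 / l) at_top (at_right 0)"
  using filterlim_inverse_at_top_right by (simp add: inverse_eq_divide)

text \<open>After the substitution s = l * t the integrand is a gamma density times
  \<open>t powr (1 - \<delta>) * f t\<close> taken at t = s / l, a bounded factor with limit g;
  dominated convergence applies.\<close>

lemma abel_laplace_power:
  fixes f :: "real \<Rightarrow> real"
  assumes [measurable]: "f \<in> borel_measurable borel" and \<delta>: "\<delta> > 0"
    and bd: "\<And>t. t > 0 \<Longrightarrow> \<bar>f t\<bar> \<le> C * t powr (\<delta> - 1)"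
    and lim: "((\<lambda>t. t powr (1 - \<delta>) * f t) \<longlongrightarrow> g) at_top"
  shows "((\<lambda>l. l powr \<delta> * (LINT t|lborel. exp (- (l * t)) * (indicator {0..} t * f t))) \<longlongrightarrow> g * Gamma \<delta>) (at_right 0)"
proof -
  let ?G = "\<lambda>s. exp (- s) * gamma_dens \<delta> s"
  have hb: "has_bochner_integral lborel ?G 1"
    using has_bochner_integral_gamma_dens[of 1 \<delta>] \<delta> by simp
  have G: "Gamma \<delta> > 0" using \<delta> by simp
  have eq: "l powr \<delta> * (LINT t|lborel. exp (- (l * t)) * (indicator {0..} t * f t))
      = Gamma \<delta> * (LINT s|lborel. ?G s * ((s / l) powr (1 - \<delta>) * f (s / l)))" if l: "l > 0" for l
  proof -
    have "(LINT t|lborel. exp (- (l * t)) * (indicator {0..} t * f t)) = \<bar>1 / l\<bar> *\<^sub>R (LINT s|lborel. exp (- (l * (0 + 1 / l * s))) * (indicator {0..} (0 + 1 / l * s) * f (0 + 1 / l * s)))"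
      using l by (intro lborel_integral_real_affine) auto
    also have "\<dots> = (1 / l) * (LINT s|lborel. l powr (1 - \<delta>) * Gamma \<delta> * (?G s * ((s / l) powr (1 - \<delta>) * f (s / l))))"
    proof -
      have "AE s in lborel. s \<noteq> (0::real)" by (rule AE_lborel_singleton)
      then have "AE s in lborel. exp (- (l * (0 + 1 / l * s))) * (indicator {0..} (0 + 1 / l * s) * f (0 + 1 / l * s)) = l powr (1 - \<delta>) * Gamma \<delta> * (?G s * ((s / l) powr (1 - \<delta>) * f (s / l)))"
      proof eventually_elim
        case (elim s)
        show ?case
        proof (cases "s > 0")
          case True
          have "s powr (\<delta> - 1) * s powr (1 - \<delta>) = 1" using True by (simp add: powr_add[symmetric])
          then have "l powr (1 - \<delta>) * (s powr (\<delta> - 1) * (s / l) powr (1 - \<delta>)) = 1"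
            using True l by (simp add: powr_divide)
          then have "l powr (1 - \<delta>) * Gamma \<delta> * (exp (- s) * (s powr (\<delta> - 1) / Gamma \<delta>) * ((s / l) powr (1 - \<delta>) * f (s / l))) = exp (- s) * f (s / l)"
            using G by (simp add: field_simps)
          then show ?thesis using True l by (simp add: gamma_dens_def)
        next
          case False
          then show ?thesis using elim l by (auto simp: gamma_dens_def indicator_def zero_le_divide_iff)
        qed
      qed
      then have "(LINT s|lborel. exp (- (l * (0 + 1 / l * s))) * (indicator {0..} (0 + 1 / l * s) * f (0 + 1 / l * s))) = (LINT s|lborel. l powr (1 - \<delta>) * Gamma \<delta> * (?G s * ((s / l) powr (1 - \<delta>) * f (s / l))))"
        by (intro integral_cong_AE) measurable
      then show ?thesis using l by (simp only: abs_of_pos real_scaleR_def zero_less_divide_iff zero_less_one) simp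
    qed
    also have "\<dots> = (1 / l) * (l powr (1 - \<delta>) * Gamma \<delta> * (LINT s|lborel. ?G s * ((s / l) powr (1 - \<delta>) * f (s / l))))"
      by (subst integral_mult_right_zero) simp
    finally have "l powr \<delta> * (LINT t|lborel. exp (- (l * t)) * (indicator {0..} t * f t)) = (l powr \<delta> * l powr (1 - \<delta>) / l) * (Gamma \<delta> * (LINT s|lborel. ?G s * ((s / l) powr (1 - \<delta>) * f (s / l))))"
      by simp
    also have "l powr \<delta> * l powr (1 - \<delta>) / l = 1" using l by (simp add: powr_add[symmetric])
    finally show ?thesis by simp
  qed
  have "((\<lambda>L. LINT s|lborel. ?G s * ((s * L) powr (1 - \<delta>) * f (s * L))) \<longlongrightarrow> (LINT s|lborel. ?G s * g)) at_top"
  proof (rule integral_dominated_convergence_at_top[where w = "\<lambda>s. ?G s * C"])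
    show "eventually (\<lambda>L. AE s in lborel. norm (?G s * ((s * L) powr (1 - \<delta>) * f (s * L))) \<le> ?G s * C) at_top"
      using eventually_gt_at_top[of 0]
    proof eventually_elim
      case (elim L)
      have "norm (?G s * ((s * L) powr (1 - \<delta>) * f (s * L))) \<le> ?G s * C" if "s \<noteq> 0" for s
      proof (cases "s > 0")
        case True
        then have sL: "s * L > 0" using elim by simp
        have "(s * L) powr (1 - \<delta>) * \<bar>f (s * L)\<bar> \<le> (s * L) powr (1 - \<delta>) * (C * (s * L) powr (\<delta> - 1))"
          by (intro mult_left_mono bd sL) simp
        also have "\<dots> = C" using sL True elim by (simp add: powr_add[symmetric])
        finally show ?thesis using gamma_dens_nonneg[OF \<delta>, of s] by (simp add: abs_mult mult_left_mono mult.assoc)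
      next
        case False then show ?thesis using that by (simp add: gamma_dens_def)
      qed
      then show ?case using AE_lborel_singleton[of "0::real"] by (auto elim: eventually_mono)
    qed
    show "AE s in lborel. ((\<lambda>L. ?G s * ((s * L) powr (1 - \<delta>) * f (s * L))) \<longlongrightarrow> ?G s * g) at_top"
      using AE_lborel_singleton[of "0::real"]
    proof eventually_elim
      case (elim s)
      show ?case
      proof (cases "s > 0")
        case True
        then have "filterlim (\<lambda>L. s * L) at_top at_top" by (intro filterlim_tendsto_pos_mult_at_top[OF tendsto_const]) (auto intro: filterlim_ident)
        from filterlim_compose[OF lim this] show ?thesis by (intro tendsto_intros)
      next
        case False
        then have "gamma_dens \<delta> s = 0" using elim by (simp add: gamma_dens_def)
        then show ?thesis by simp
      qed
    qed
  qed (use hb in \<open>auto simp: has_bochner_integral_iff intro!: integrable_mult_left\<close>)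
  moreover have "(LINT s|lborel. ?G s * g) = g" using hb by (simp add: has_bochner_integral_iff)
  ultimately have "((\<lambda>L. LINT s|lborel. ?G s * ((s * L) powr (1 - \<delta>) * f (s * L))) \<longlongrightarrow> g) at_top" by (simp only:)
  from filterlim_compose[OF this filterlim_one_divide_at_right]
  have "((\<lambda>l. Gamma \<delta> * (LINT s|lborel. ?G s * ((s / l) powr (1 - \<delta>) * f (s / l)))) \<longlongrightarrow> Gamma \<delta> * g) (at_right 0)"
    by (intro tendsto_mult tendsto_const) simp
  moreover have "eventually (\<lambda>l. Gamma \<delta> * (LINT s|lborel. ?G s * ((s / l) powr (1 - \<delta>) * f (s / l))) = l powr \<delta> * (LINT t|lborel. exp (- (l * t)) * (indicator {0..} t * f t))) (at_right 0)"
    using eventually_at_right_less[of "0::real"] by eventually_elim (simp add: eq)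
  ultimately show ?thesis by (simp add: mult.commute Lim_transform_eventually)
qed

lemma has_bochner_integral_exp: 
  assumes "k > (0::real)"
  shows "has_bochner_integral lborel (\<lambda>t. exp (- (k * t)) * indicator {0..} t) (1 / k)"
proof -
  have "has_bochner_integral lborel (\<lambda>t. exp (- (k * t)) * gamma_dens 1 t) (1 / k)"
    using has_bochner_integral_gamma_dens[OF assms, of 1] assms by (simp add: powr_minus_divide)
  moreover have "AE t in lborel. exp (- (k * t)) * gamma_dens 1 t = exp (- (k * t)) * indicator {0..} t"
    using AE_lborel_singleton[of "0::real"] by eventually_elim (auto simp: gamma_dens_def indicator_def)
  ultimately show ?thesis by (subst has_bochner_integral_cong_AE[symmetric, rotated 2]) auto
qed

text \<open>The integral is \<open>ln (1 / l)\<close> up to an error of at most 1: cut at t = 1 / l,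
  use \<open>1 - l * t \<le> exp (- (l * t)) \<le> 1\<close> before the cut and
  \<open>1 / t \<le> l\<close> after it.\<close>

lemma exp_integral_log:
  defines "E \<equiv> \<lambda>l::real. LINT t|lborel. exp (- (l * t)) * (indicator {1..} t / t)"
  shows "\<And>l::real. l > 0 \<Longrightarrow> integrable lborel (\<lambda>t. exp (- (l * t)) * (indicator {1..} t / t))"
    and "((\<lambda>l. E l / ln (1 / l)) \<longlongrightarrow> 1) (at_right 0)"
proof -
  let ?e = "\<lambda>(l::real) t. exp (- (l * t)) * (indicator {1..} t / t)"
  have i: "integrable lborel (?e l)" if "l > 0" for l :: real
  proof (rule Bochner_Integration.integrable_bound)
    show "integrable lborel (\<lambda>t. exp (- (l * t)) * indicator {0..} t)" using has_bochner_integral_exp[OF that] by (simp add: has_bochner_integral_iff)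
  qed (auto split: split_indicator simp: divide_le_eq intro!: AE_I2 mult_left_le)
  then show "\<And>l::real. l > 0 \<Longrightarrow> integrable lborel (?e l)" .
  have bounds: "ln (1 / l) - 1 \<le> E l" "E l \<le> ln (1 / l) + 1" if l: "0 < l" "l < 1" for l
  proof -
    have l1: "1 \<le> 1 / l" using l by simp
    have hb1: "has_bochner_integral lborel (\<lambda>t. indicator {1..1/l} t *\<^sub>R (1 / t)) (ln (1 / l) - ln 1)"
      by (rule has_bochner_integral_FTC_Icc) (use l1 l in \<open>auto intro!: derivative_eq_intros continuous_intros has_real_derivative_iff_has_vector_derivative[THEN iffD1] simp: divide_inverse\<close>)
    have hb2: "has_bochner_integral lborel (\<lambda>t. indicator {1..1/l} t *\<^sub>R l) ((1 / l) * l - 1 * l)"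
      by (rule has_bochner_integral_FTC_Icc) (use l1 l in \<open>auto intro!: derivative_eq_intros continuous_intros has_real_derivative_iff_has_vector_derivative[THEN iffD1]\<close>)
    have "(LINT t|lborel. indicator {1..1/l} t *\<^sub>R (1 / t) - indicator {1..1/l} t *\<^sub>R l) \<le> E l"
      unfolding E_def
    proof (rule integral_mono)
      fix t :: real
      have "1 - l * t \<le> exp (- (l * t))" using exp_ge_add_one_self[of "- (l * t)"] by simp
      then have "(1 - l * t) / t \<le> exp (- (l * t)) / t" if "t \<ge> 1" using that by (intro divide_right_mono) auto
      then show "indicator {1..1/l} t *\<^sub>R (1 / t) - indicator {1..1/l} t *\<^sub>R l \<le> ?e l t"
        by (auto simp: indicator_def diff_divide_distrib)
    qed (use hb1 hb2 i[OF l(1)] in \<open>auto simp: has_bochner_integral_iff\<close>)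
    moreover have "(LINT t|lborel. indicator {1..1/l} t *\<^sub>R (1 / t) - indicator {1..1/l} t *\<^sub>R l) = ln (1 / l) - (1 - l)"
      using hb1 hb2 l by (subst Bochner_Integration.integral_diff) (auto simp: has_bochner_integral_iff)
    ultimately show "ln (1 / l) - 1 \<le> E l" using l by simp
    have hb3: "has_bochner_integral lborel (\<lambda>t. l * (exp (- (l * t)) * indicator {0..} t)) (l * (1 / l))"
      by (intro has_bochner_integral_mult_right has_bochner_integral_exp l)
    have "E l \<le> (LINT t|lborel. indicator {1..1/l} t *\<^sub>R (1 / t) + l * (exp (- (l * t)) * indicator {0..} t))"
      unfolding E_def
    proof (rule integral_mono)
      fix t :: real
      show "?e l t \<le> indicator {1..1/l} t *\<^sub>R (1 / t) + l * (exp (- (l * t)) * indicator {0..} t)"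
      proof (cases "1 \<le> t")
        case True
        show ?thesis
        proof (cases "t \<le> 1 / l")
          case True
          have "exp (- (l * t)) \<le> 1" using l \<open>1 \<le> t\<close> by simp
          then have "exp (- (l * t)) / t \<le> 1 / t" using \<open>1 \<le> t\<close> by (intro divide_right_mono) auto
          moreover have "0 \<le> l * exp (- (l * t))" using l by simp
          ultimately show ?thesis using True \<open>1 \<le> t\<close> by simp
        next
          case False
          then have "1 / t \<le> l" using l \<open>1 \<le> t\<close> by (simp add: field_simps)
          then have "exp (- (l * t)) * (1 / t) \<le> exp (- (l * t)) * l" by (intro mult_left_mono) auto
          then show ?thesis using False \<open>1 \<le> t\<close> by (simp add: mult.commute)
        qed
      qed (use l in \<open>simp add: indicator_def\<close>)
    qed (use hb1 hb3 i[OF l(1)] in \<open>auto simp: has_bochner_integral_iff\<close>)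
    also have "\<dots> = ln (1 / l) + 1"
      using hb1 hb3 l by (subst Bochner_Integration.integral_add) (auto simp: has_bochner_integral_iff)
    finally show "E l \<le> ln (1 / l) + 1" .
  qed
  have ev: "eventually (\<lambda>l. l \<in> {0<..<1}) (at_right (0::real))" by (rule eventually_at_right_real) simp
  show "((\<lambda>l. E l / ln (1 / l)) \<longlongrightarrow> 1) (at_right 0)"
  proof (rule tendsto_sandwich)
    show "eventually (\<lambda>l. (ln (1 / l) - 1) / ln (1 / l) \<le> E l / ln (1 / l)) (at_right 0)"
      using ev by eventually_elim (intro divide_right_mono bounds, auto)
    show "eventually (\<lambda>l. E l / ln (1 / l) \<le> (ln (1 / l) + 1) / ln (1 / l)) (at_right 0)"
      using ev by eventually_elim (intro divide_right_mono bounds, auto)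
    show "((\<lambda>l. (ln (1 / l) - 1) / ln (1 / l)) \<longlongrightarrow> 1) (at_right (0::real))" by real_asymp
    show "((\<lambda>l. (ln (1 / l) + 1) / ln (1 / l)) \<longlongrightarrow> 1) (at_right (0::real))" by real_asymp
  qed
qed

text \<open>The borderline case \<delta> = 0, where scaling gives no integrable limit. Here f is
  compared with g / t on [1, \<infinity>); the discrepancy is a constant plus \<epsilon> times the
  transform of 1 / t, and the logarithm outgrows the constant.\<close>

lemma abel_laplace_log:
  fixes f :: "real \<Rightarrow> real"
  assumes m[measurable]: "f \<in> borel_measurable borel"
    and bd: "\<And>t. \<bar>f t\<bar> \<le> C" and lim: "((\<lambda>t. t * f t) \<longlongrightarrow> g) at_top"
  shows "((\<lambda>l. (LINT t|lborel. exp (- (l * t)) * (indicator {0..} t * f t)) / ln (1 / l)) \<longlongrightarrow> g) (at_right 0)"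
proof -
  let ?D = "\<lambda>l. LINT t|lborel. exp (- (l * t)) * (indicator {0..} t * f t)"
  let ?E = "\<lambda>l. LINT t|lborel. exp (- (l * t)) * (indicator {1..} t / t)"
  have C: "C \<ge> 0" using bd[of 0] by simp
  have key: "\<exists>K. \<forall>l\<in>{0<..<1}. \<bar>?D l - g * ?E l\<bar> \<le> K + \<epsilon> * ?E l" if \<epsilon>: "\<epsilon> > 0" for \<epsilon>
  proof -
    from tendstoD[OF lim \<epsilon>] obtain T0 where T0: "\<And>t. t \<ge> T0 \<Longrightarrow> \<bar>t * f t - g\<bar> < \<epsilon>"
      by (auto simp: eventually_at_top_linorder dist_real_def)
    define T where "T = max T0 1"
    have T: "T \<ge> 1" "\<And>t. t \<ge> T \<Longrightarrow> \<bar>t * f t - g\<bar> < \<epsilon>" using T0 by (auto simp: T_def)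
    show ?thesis
    proof (intro exI[of _ "(C + \<bar>g\<bar>) * T"] ballI)
      fix l :: real assume "l \<in> {0<..<1}"
      then have l: "0 < l" "l < 1" by auto
      have i1: "integrable lborel (\<lambda>t. exp (- (l * t)) * (indicator {0..} t * f t))"
      proof (rule Bochner_Integration.integrable_bound)
        show "integrable lborel (\<lambda>t. C * (exp (- (l * t)) * indicator {0..} t))"
          using has_bochner_integral_exp[OF l(1)] by (auto simp: has_bochner_integral_iff)
      qed (use bd C in \<open>auto simp: abs_mult mult.commute[of C] intro!: AE_I2 mult_left_mono split: split_indicator\<close>)
      note i2 = exp_integral_log(1)[OF l(1)]
      have i3: "integrable lborel (\<lambda>t. (C + \<bar>g\<bar>) * indicator {0..T} t)"
        using T by (intro integrable_mult_right integrable_real_indicator) (auto simp: emeasure_lborel_Icc_eq)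
      have "\<bar>?D l - g * ?E l\<bar> = \<bar>LINT t|lborel. exp (- (l * t)) * (indicator {0..} t * f t) - g * (exp (- (l * t)) * (indicator {1..} t / t))\<bar>"
        unfolding Bochner_Integration.integral_diff[OF i1 integrable_mult_right[OF i2, of g]] by (simp only: integral_mult_right_zero)
      also have "\<dots> \<le> (LINT t|lborel. \<bar>exp (- (l * t)) * (indicator {0..} t * f t) - g * (exp (- (l * t)) * (indicator {1..} t / t))\<bar>)"
        by (rule integral_abs_bound)
      also have "\<dots> \<le> (LINT t|lborel. (C + \<bar>g\<bar>) * indicator {0..T} t + \<epsilon> * (exp (- (l * t)) * (indicator {1..} t / t)))"
      proof (rule integral_mono)
        fix t :: real
        let ?e = "exp (- (l * t))"
        show "\<bar>?e * (indicator {0..} t * f t) - g * (?e * (indicator {1..} t / t))\<bar> \<le> (C + \<bar>g\<bar>) * indicator {0..T} t + \<epsilon> * (?e * (indicator {1..} t / t))"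
        proof (cases "t < 0")
          case True then show ?thesis by simp
        next
          case False
          then have e: "0 < ?e" "?e \<le> 1" using l by auto
          show ?thesis
          proof (cases "t \<le> T")
            case True
            have "\<bar>?e * (indicator {0..} t * f t)\<bar> \<le> 1 * C"
              unfolding abs_mult using e False bd by (intro mult_mono) auto
            moreover have "\<bar>g * (?e * (indicator {1..} t / t))\<bar> \<le> \<bar>g\<bar> * (1 * 1)"
              unfolding abs_mult using e False by (intro mult_mono) (auto simp: indicator_def)
            moreover have "0 \<le> \<epsilon> * (?e * (indicator {1..} t / t))" using \<epsilon> False by simp
            moreover have "\<bar>?e * (indicator {0..} t * f t) - g * (?e * (indicator {1..} t / t))\<bar> \<le> \<bar>?e * (indicator {0..} t * f t)\<bar> + \<bar>g * (?e * (indicator {1..} t / t))\<bar>"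
              by (rule abs_triangle_ineq4)
            moreover have "(C + \<bar>g\<bar>) * indicator {0..T} t = C + \<bar>g\<bar>" using True False by simp
            ultimately show ?thesis by linarith
          next
            case gt: False
            then have t: "t > T" "t \<ge> 1" using T by auto
            have "?e * (indicator {0..} t * f t) - g * (?e * (indicator {1..} t / t)) = ?e * ((t * f t - g) / t)"
              using t by (simp add: field_simps)
            then have "\<bar>?e * (indicator {0..} t * f t) - g * (?e * (indicator {1..} t / t))\<bar> = ?e * (\<bar>t * f t - g\<bar> / t)"
              using t by (simp add: abs_mult abs_divide)
            also have "\<dots> \<le> ?e * (\<epsilon> / t)" using T(2)[of t] t by (intro mult_left_mono divide_right_mono) auto
            finally show ?thesis using t gt by (simp add: mult_ac)
          qed
        qed
      qed (rule Bochner_Integration.integrable_abs[OF Bochner_Integration.integrable_diff[OF i1 integrable_mult_right[OF i2]]],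
          rule Bochner_Integration.integrable_add[OF i3 integrable_mult_right[OF i2]])
      also have "\<dots> = (C + \<bar>g\<bar>) * T + \<epsilon> * ?E l"
        unfolding Bochner_Integration.integral_add[OF i3 integrable_mult_right[OF i2, of \<epsilon>]] using T
        by (simp only: integral_mult_right_zero) simp
      finally show "\<bar>?D l - g * ?E l\<bar> \<le> (C + \<bar>g\<bar>) * T + \<epsilon> * ?E l" .
    qed
  qed
  note El = exp_integral_log(2)
  have "((\<lambda>l. (?D l - g * ?E l) / ln (1 / l)) \<longlongrightarrow> 0) (at_right 0)"
  proof (rule tendstoI)
    fix e :: real assume e: "e > 0"
    have e4: "e / 4 > 0" using e by simp
    obtain K where K': "\<forall>l\<in>{0<..<1}. \<bar>?D l - g * ?E l\<bar> \<le> K + (e/4) * ?E l" using key[OF e4] by (rule exE)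
    note K = bspec[OF K']
    have "((\<lambda>l. K / ln (1 / l)) \<longlongrightarrow> 0) (at_right (0::real))" by real_asymp
    then have "((\<lambda>l. K / ln (1 / l) + e / 4 * (?E l / ln (1 / l))) \<longlongrightarrow> 0 + e / 4 * 1) (at_right 0)"
      by (intro tendsto_intros El)
    then have "eventually (\<lambda>l. K / ln (1 / l) + e / 4 * (?E l / ln (1 / l)) < e) (at_right 0)"
      by (rule order_tendstoD(2)) (use e in simp)
    moreover have "eventually (\<lambda>l. l \<in> {0<..<1}) (at_right (0::real))" by (rule eventually_at_right_real) simp
    ultimately show "eventually (\<lambda>l. dist ((?D l - g * ?E l) / ln (1 / l)) 0 < e) (at_right 0)"
    proof eventually_elim
      case (elim l)
      have ln: "ln (1 / l) > 0" using elim by simp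
      have "\<bar>?D l - g * ?E l\<bar> / ln (1 / l) \<le> (K + (e/4) * ?E l) / ln (1 / l)"
        using K[OF elim(2)] ln by (intro divide_right_mono) auto
      also have "\<dots> = K / ln (1 / l) + e / 4 * (?E l / ln (1 / l))" by (simp add: add_divide_distrib)
      finally show ?case using elim(1) ln by (simp add: abs_divide)
    qed
  qed
  from tendsto_add[OF this tendsto_mult[OF tendsto_const[of g] El]]
  show ?thesis by (simp add: diff_divide_distrib)
qed

context walk begin

text \<open>The integral over t of \<open>exp (- ((l - phi a \<theta>) * t))\<close> is evaluated
  inside; nonnegativity of B admits Tonelli's theorem.\<close>

lemma laplace_fourier:
  assumes m[measurable]: "B \<in> borel_measurable borel" and B: "\<And>\<theta>. 0 \<le> B \<theta>" "\<And>\<theta>. B \<theta> \<le> K" and l: "l > 0"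
  shows "has_bochner_integral lborel (\<lambda>t. exp (- (l * t)) * (indicator {0..} t * (LINT \<theta>|mu. B \<theta> * exp (t * phi a \<theta>)))) (LINT \<theta>|mu. B \<theta> / (l - phi a \<theta>))"
proof -
  have K: "K \<ge> 0" using B[of 0] by simp
  have pos: "0 < l - phi a \<theta>" "l \<le> l - phi a \<theta>" for \<theta> using phi_le_0[of \<theta>] l by auto
  have bdt: "\<bar>B \<theta> * exp (t * phi a \<theta>)\<bar> \<le> K" if "t \<ge> 0" for t \<theta>
  proof -
    have "B \<theta> * exp (t * phi a \<theta>) \<le> K * 1"
      using B K that phi_le_0[of \<theta>] by (intro mult_mono) (auto simp: mult_nonneg_nonpos)
    then show ?thesis using B(1)[of \<theta>] by simp
  qed
  have bdl: "\<bar>B \<theta> / (l - phi a \<theta>)\<bar> \<le> K / l" for \<theta>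
    using B[of \<theta>] pos[of \<theta>] l by (simp add: abs_divide frac_le)
  have meas_t: "(\<lambda>t. LINT \<theta>|mu. B \<theta> * exp (t * phi a \<theta>)) \<in> borel_measurable borel"
    by (rule mu.borel_measurable_lebesgue_integral) (simp add: case_prod_unfold)
  have inner: "ennreal (exp (- (l * t)) * (indicator {0..} t * (LINT \<theta>|mu. B \<theta> * exp (t * phi a \<theta>))))
     = (\<integral>\<^sup>+\<theta>. ennreal (B \<theta>) * ennreal (exp (- ((l - phi a \<theta>) * t)) * indicator {0..} t) \<partial>mu)" for t
  proof (cases "t \<ge> 0")
    case True
    have "ennreal (LINT \<theta>|mu. B \<theta> * exp (t * phi a \<theta>)) = (\<integral>\<^sup>+\<theta>. ennreal (B \<theta> * exp (t * phi a \<theta>)) \<partial>mu)"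
      using B by (intro nn_integral_eq_integral[symmetric] integrable_mu_bounded[where B = K] bdt[OF True]) auto
    then have "ennreal (exp (- (l * t)) * (indicator {0..} t * (LINT \<theta>|mu. B \<theta> * exp (t * phi a \<theta>))))
      = ennreal (exp (- (l * t))) * (\<integral>\<^sup>+\<theta>. ennreal (B \<theta> * exp (t * phi a \<theta>)) \<partial>mu)"
      using True B by (simp add: ennreal_mult integral_nonneg_AE)
    also have "\<dots> = (\<integral>\<^sup>+\<theta>. ennreal (exp (- (l * t))) * ennreal (B \<theta> * exp (t * phi a \<theta>)) \<partial>mu)"
      by (rule nn_integral_cmult[symmetric]) simp
    also have "\<dots> = (\<integral>\<^sup>+\<theta>. ennreal (B \<theta>) * ennreal (exp (- ((l - phi a \<theta>) * t)) * indicator {0..} t) \<partial>mu)"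
    proof (rule nn_integral_cong)
      fix \<theta>
      have "exp (- (l * t)) * exp (t * phi a \<theta>) = exp (- ((l - phi a \<theta>) * t))" by (simp add: exp_add[symmetric] algebra_simps)
      then have "exp (- (l * t)) * (B \<theta> * exp (t * phi a \<theta>)) = B \<theta> * exp (- ((l - phi a \<theta>) * t))" by simp
      then show "ennreal (exp (- (l * t))) * ennreal (B \<theta> * exp (t * phi a \<theta>)) = ennreal (B \<theta>) * ennreal (exp (- ((l - phi a \<theta>) * t)) * indicator {0..} t)"
        using True B by (simp add: ennreal_mult[symmetric])
    qed
    finally show ?thesis .
  qed simp
  have "(\<integral>\<^sup>+t. ennreal (exp (- (l * t)) * (indicator {0..} t * (LINT \<theta>|mu. B \<theta> * exp (t * phi a \<theta>)))) \<partial>lborel)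
    = (\<integral>\<^sup>+t. \<integral>\<^sup>+\<theta>. ennreal (B \<theta>) * ennreal (exp (- ((l - phi a \<theta>) * t)) * indicator {0..} t) \<partial>mu \<partial>lborel)"
    by (simp add: inner)
  also have "\<dots> = (\<integral>\<^sup>+\<theta>. \<integral>\<^sup>+t. ennreal (B \<theta>) * ennreal (exp (- ((l - phi a \<theta>) * t)) * indicator {0..} t) \<partial>lborel \<partial>mu)"
  proof -
    interpret ps: pair_sigma_finite lborel "mu :: (real^'n) measure" ..
    show ?thesis by (rule ps.Fubini'[symmetric]) measurable
  qed
  also have "\<dots> = (\<integral>\<^sup>+\<theta>. ennreal (B \<theta> / (l - phi a \<theta>)) \<partial>mu)"
  proof (rule nn_integral_cong)
    fix \<theta>
    have "(\<integral>\<^sup>+t. ennreal (exp (- ((l - phi a \<theta>) * t)) * indicator {0..} t) \<partial>lborel) = ennreal (1 / (l - phi a \<theta>))"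
      using has_bochner_integral_exp[OF pos(1)[of \<theta>]] by (subst nn_integral_eq_integral) (auto simp: has_bochner_integral_iff)
    moreover have "(\<integral>\<^sup>+t. ennreal (B \<theta>) * ennreal (exp (- ((l - phi a \<theta>) * t)) * indicator {0..} t) \<partial>lborel)
      = ennreal (B \<theta>) * (\<integral>\<^sup>+t. ennreal (exp (- ((l - phi a \<theta>) * t)) * indicator {0..} t) \<partial>lborel)"
      by (rule nn_integral_cmult) simp
    moreover have "ennreal (B \<theta>) * ennreal (1 / (l - phi a \<theta>)) = ennreal (B \<theta> / (l - phi a \<theta>))"
      using B[of \<theta>] pos[of \<theta>] by (subst ennreal_mult'[symmetric]) auto
    ultimately show "(\<integral>\<^sup>+t. ennreal (B \<theta>) * ennreal (exp (- ((l - phi a \<theta>) * t)) * indicator {0..} t) \<partial>lborel) = ennreal (B \<theta> / (l - phi a \<theta>))"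
      by (simp only:)
  qed
  also have "\<dots> = ennreal (LINT \<theta>|mu. B \<theta> / (l - phi a \<theta>))"
  proof (rule nn_integral_eq_integral)
    show "integrable mu (\<lambda>\<theta>. B \<theta> / (l - phi a \<theta>))" by (rule integrable_mu_bounded[OF _ bdl]) simp
  qed (use B pos in \<open>auto intro!: AE_I2 divide_nonneg_pos\<close>)
  finally show ?thesis
    using meas_t B pos by (intro has_bochner_integral_nn_integral) (auto intro!: integral_nonneg_AE AE_I2 divide_nonneg_pos mult_nonneg_nonneg)
qed

end

section \<open>Laplace transform of the hitting time tail\<close>

context walk begin

lemma H_mono: "mono (H a x y z)"
proof (rule monoI)
  fix t t' :: real assume "t \<le> t'"
  show "H a x y z t \<le> H a x y z t'" unfolding H_def
  proof (rule om.finite_measure_mono)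
    show "{\<omega> \<in> space Om. tau_yz x y z \<omega> \<le> ereal t} \<subseteq> {\<omega> \<in> space Om. tau_yz x y z \<omega> \<le> ereal t'}"
      using \<open>t \<le> t'\<close> by (auto intro: order_trans)
    show "{\<omega> \<in> space Om. tau_yz x y z \<omega> \<le> ereal t'} \<in> sets Om" by measurable
  qed
qed

lemma H_meas[measurable]: "H a x y z \<in> borel_measurable borel" by (rule borel_measurable_mono[OF H_mono])

text \<open>Up to a constant the integrand is an Erlang density of rate r + l, whose mass is
  1.\<close>

lemma laplace_pois:
  assumes l: "l > 0"
  shows "has_bochner_integral lborel (\<lambda>t. exp (- (l * t)) * (indicator {0..} t * pois k t)) ((r / (r + l)) ^ Suc k / r)"
proof -
  have rl: "r + l > 0" using l r_pos by simp
  have e: "has_bochner_integral lborel (\<lambda>t. erlang_density k (r + l) t) 1"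
  proof (rule has_bochner_integral_nn_integral)
    show "(\<integral>\<^sup>+ t. ennreal (erlang_density k (r + l) t) \<partial>lborel) = ennreal 1"
      using nn_integral_erlang_ith_moment[OF rl, of k 0] by simp
  qed (use rl in auto)
  have "exp (- (l * t)) * (indicator {0..} t * pois k t) = (r / (r + l)) ^ Suc k / r * erlang_density k (r + l) t" for t
  proof (cases "t < 0")
    case False
    have "exp (- (l * t)) * exp (- r * t) = exp (- (r + l) * t)" by (simp add: exp_add[symmetric] algebra_simps)
    then have "exp (- (l * t)) * (indicator {0..} t * pois k t) = (r * t) ^ k * exp (- (r + l) * t) / fact k"
      using False by (simp add: pois_def)
    also have "\<dots> = (r / (r + l)) ^ Suc k / r * ((r + l) ^ Suc k * t ^ k * exp (- (r + l) * t) / fact k)"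
      using r_pos rl by (simp add: power_divide power_mult_distrib)
    finally show ?thesis using False by (simp add: erlang_density_def)
  qed (simp add: erlang_density_def)
  then show ?thesis using has_bochner_integral_mult_right[OF e, of "(r / (r + l)) ^ Suc k / r"] by simp
qed

lemma geom_pois: "l > 0 \<Longrightarrow> (\<Sum>k\<le>n. (r / (r + l)) ^ Suc k / r) = (1 - (r / (r + l)) ^ Suc n) / l"
proof (induction n)
  case 0
  then have "1 - r / (r + l) = l / (r + l)" using r_pos by (simp add: field_simps)
  then have "(1 - r / (r + l)) / l = 1 / (r + l)" using 0 by simp
  then show ?case using r_pos by simp
next
  case (Suc n)
  define s where "s = r / (r + l)"
  have "1 - s = l / (r + l)" using Suc.prems r_pos by (simp add: s_def field_simps)
  then have "(1 - s) / l = 1 / (r + l)" using Suc.prems by simp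
  moreover have "s / r = 1 / (r + l)" using r_pos by (simp add: s_def)
  ultimately have s: "s / r = (1 - s) / l" by (rule trans[OF _ sym, rotated])
  have "(\<Sum>k\<le>Suc n. s ^ Suc k / r) = (1 - s ^ Suc n) / l + s ^ Suc n * (s / r)"
    using Suc by (simp add: s_def)
  also have "\<dots> = (1 - s ^ Suc (Suc n)) / l" unfolding s by (simp add: diff_divide_distrib algebra_simps)
  finally show ?case by (simp add: s_def)
qed

lemma Fs_le_F1:
  assumes yz: "y \<noteq> z" and s: "0 \<le> s" "s \<le> 1"
  shows "Fs x y z s \<le> F1 x y z"
  unfolding F1_def Fs_def
proof (rule suminf_le)
  show "summable (\<lambda>n. fh y z n x * s ^ Suc n)"
    using summable_mult[OF summable_fh_power[OF yz s], of s] by (simp add: mult_ac)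
qed (use power_le_one[OF s] summable_fh[OF yz] in \<open>auto intro!: mult_left_le fh_nonneg simp del: power_Suc\<close>)

text \<open>Termwise transform of \<open>H_tail_sums\<close>, in which the partial Poisson sums
  become geometric sums. This is where the behaviour of \<open>Fs\<close> near s = 1 meets the tail
  of \<open>H\<close>.\<close>

lemma laplace_tail:
  assumes yz: "y \<noteq> z" and l: "l > 0"
  shows "has_bochner_integral lborel (\<lambda>t. exp (- (l * t)) * (indicator {0..} t * (F1 x y z - H a x y z t))) ((F1 x y z - Fs x y z (r / (r + l))) / l)"
proof -
  let ?s = "r / (r + l)"
  let ?c = "\<lambda>k t. exp (- (l * t)) * (indicator {0..} t * pois k t)"
  have s: "0 \<le> ?s" "?s \<le> 1" using l r_pos by auto
  have cn: "0 \<le> ?c k t" for k t using pois_nonneg[of t k] by (simp add: indicator_def)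
  have nn: "0 \<le> fh y z n x * (\<Sum>k\<le>n. ?c k t)" for n t
    by (intro mult_nonneg_nonneg fh_nonneg sum_nonneg cn)
  have sums: "(\<lambda>n. fh y z n x * (\<Sum>k\<le>n. ?c k t)) sums (exp (- (l * t)) * (indicator {0..} t * (F1 x y z - H a x y z t)))" for t
  proof (cases "t \<ge> 0")
    case True
    have "(\<lambda>n. exp (- (l * t)) * (fh y z n x * (\<Sum>k\<le>n. pois k t))) sums (exp (- (l * t)) * (F1 x y z - H a x y z t))"
      by (intro sums_mult H_tail_sums True yz)
    then show ?thesis using True by (simp add: sum_distrib_left mult_ac)
  qed simp
  have hb: "has_bochner_integral lborel (\<lambda>t. fh y z n x * (\<Sum>k\<le>n. ?c k t)) (fh y z n x * ((1 - ?s ^ Suc n) / l))" for n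
    unfolding geom_pois[OF l, symmetric]
    by (intro has_bochner_integral_mult_right has_bochner_integral_sum laplace_pois l)
  have "(\<integral>\<^sup>+t. ennreal (exp (- (l * t)) * (indicator {0..} t * (F1 x y z - H a x y z t))) \<partial>lborel)
    = (\<integral>\<^sup>+t. (\<Sum>n. ennreal (fh y z n x * (\<Sum>k\<le>n. ?c k t))) \<partial>lborel)"
    by (intro nn_integral_cong) (subst suminf_ennreal_eq[OF nn sums], simp)
  also have "\<dots> = (\<Sum>n. \<integral>\<^sup>+t. ennreal (fh y z n x * (\<Sum>k\<le>n. ?c k t)) \<partial>lborel)"
  proof (rule nn_integral_suminf)
    fix n show "(\<lambda>t. ennreal (fh y z n x * (\<Sum>k\<le>n. ?c k t))) \<in> borel_measurable lborel"
      using borel_measurable_has_bochner_integral[OF hb[of n]] by (rule measurable_compose) simp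
  qed
  also have "\<dots> = (\<Sum>n. ennreal (fh y z n x * ((1 - ?s ^ Suc n) / l)))"
    using hb nn by (intro suminf_cong) (subst nn_integral_eq_integral, auto simp: has_bochner_integral_iff simp del: power_Suc)
  also have "\<dots> = ennreal ((F1 x y z - Fs x y z ?s) / l)"
  proof (rule suminf_ennreal_eq)
    show "0 \<le> fh y z n x * ((1 - ?s ^ Suc n) / l)" for n
      using power_le_one[OF s, of "Suc n"] l by (intro mult_nonneg_nonneg fh_nonneg divide_nonneg_nonneg) (simp_all del: power_Suc)
    have "summable (\<lambda>n. ?s * (fh y z n x * ?s ^ n))" by (rule summable_mult[OF summable_fh_power[OF yz s]])
    then have "summable (\<lambda>n. fh y z n x * ?s ^ Suc n)" by (simp add: mult_ac)
    then have "(\<lambda>n. (fh y z n x - fh y z n x * ?s ^ Suc n) / l) sums ((F1 x y z - Fs x y z ?s) / l)"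
      unfolding F1_def Fs_def by (intro sums_divide sums_diff summable_sums summable_fh yz)
    then show "(\<lambda>n. fh y z n x * ((1 - ?s ^ Suc n) / l)) sums ((F1 x y z - Fs x y z ?s) / l)"
      by (simp only: right_diff_distrib mult_1_right times_divide_eq_right)
  qed
  finally have nni: "(\<integral>\<^sup>+t. ennreal (exp (- (l * t)) * (indicator {0..} t * (F1 x y z - H a x y z t))) \<partial>lborel) = ennreal ((F1 x y z - Fs x y z ?s) / l)" .
  have pos: "0 \<le> exp (- (l * t)) * (indicator {0..} t * (F1 x y z - H a x y z t))" for t
    using sums_le[OF nn sums_zero sums] by simp
  have "((F1 x y z - Fs x y z ?s) / l) \<ge> 0"
  proof -
    have "Fs x y z ?s \<le> F1 x y z" by (rule Fs_le_F1[OF yz s])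
    then show ?thesis using l by simp
  qed
  then show ?thesis
    using nni pos by (intro has_bochner_integral_nn_integral AE_I2) auto
qed

text \<open>The local limit theorem for large t, the trivial bound 1 for the rest. The dominated
  convergence arguments need one bound for all t > 0.\<close>

lemma heat_bound: "\<exists>C\<ge>0. \<forall>t>0. (LINT \<theta>|mu. exp (t * phi a \<theta>)) \<le> C * t powr (- (CARD('n) / 2))"
proof -
  let ?d = "CARD('n) / 2"
  let ?h = "\<lambda>t. LINT \<theta>|mu. exp (t * phi a \<theta>)"
  have lim: "((\<lambda>t. t powr ?d * ?h t) \<longlongrightarrow> gamma_d a) at_top"
    using local_clt[of "\<lambda>_. 1" 1 1] by simp
  from order_tendstoD(2)[OF this, of "gamma_d a + 1"] obtain T where T: "\<And>t. t \<ge> T \<Longrightarrow> t powr ?d * ?h t < gamma_d a + 1"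
    by (auto simp: eventually_at_top_linorder)
  define C where "C = max (gamma_d a + 1) (\<bar>T\<bar> powr ?d)"
  have h1: "?h t \<le> 1" if "t > 0" for t
    by (rule mu.integral_le_const) (use that phi_le_0 in \<open>auto intro!: integrable_mu_bounded[where B = 1] AE_I2 simp: mult_nonneg_nonpos\<close>)
  have "?h t \<le> C * t powr - ?d" if t: "t > 0" for t
  proof -
    have "t powr ?d * ?h t \<le> C"
    proof (cases "t \<ge> T")
      case True then show ?thesis using T[of t] by (simp add: C_def)
    next
      case False
      then have "t powr ?d * ?h t \<le> \<bar>T\<bar> powr ?d * 1" using t h1[OF t] by (intro mult_mono powr_mono2) (auto intro!: integral_nonneg_AE)
      then show ?thesis by (simp add: C_def)
    qed
    then show ?thesis using t by (simp add: powr_minus field_simps)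
  qed
  then show ?thesis by (intro exI[of _ C]) (use gamma_pos in \<open>auto simp: C_def\<close>)
qed

lemma fourier_meas: "B \<in> borel_measurable borel \<Longrightarrow> (\<lambda>t. LINT \<theta>|mu. B \<theta> * exp (t * phi a \<theta>)) \<in> borel_measurable borel"
  by (rule mu.borel_measurable_lebesgue_integral) (simp add: case_prod_unfold)

lemma fourier_bound:
  assumes [measurable]: "B \<in> borel_measurable borel" and B: "\<And>\<theta>. \<bar>B \<theta>\<bar> \<le> K" and t: "t \<ge> 0"
  shows "\<bar>LINT \<theta>|mu. B \<theta> * exp (t * phi a \<theta>)\<bar> \<le> K * (LINT \<theta>|mu. exp (t * phi a \<theta>))"
proof -
  have e: "exp (t * phi a \<theta>) \<le> 1" for \<theta> using t phi_le_0[of \<theta>] by (simp add: mult_nonneg_nonpos)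
  have K: "K \<ge> 0" using B[of 0] by simp
  have "\<bar>LINT \<theta>|mu. B \<theta> * exp (t * phi a \<theta>)\<bar> \<le> (LINT \<theta>|mu. \<bar>B \<theta> * exp (t * phi a \<theta>)\<bar>)" by (rule integral_abs_bound)
  also have "\<dots> \<le> (LINT \<theta>|mu. K * exp (t * phi a \<theta>))"
  proof (rule integral_mono)
    have b: "\<bar>B \<theta> * exp (t * phi a \<theta>)\<bar> \<le> K * 1" for \<theta> unfolding abs_mult using B e K by (intro mult_mono) auto
    show "integrable mu (\<lambda>\<theta>. \<bar>B \<theta> * exp (t * phi a \<theta>)\<bar>)"
      by (rule integrable_mu_bounded[where B = K]) (use b in auto)
    show "integrable mu (\<lambda>\<theta>. K * exp (t * phi a \<theta>))"
      by (rule integrable_mult_right, rule integrable_mu_bounded[where B = 1]) (use e in auto)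
    fix \<theta> show "\<bar>B \<theta> * exp (t * phi a \<theta>)\<bar> \<le> K * exp (t * phi a \<theta>)"
      using mult_right_mono[OF B[of \<theta>], of "exp (t * phi a \<theta>)"] by (simp add: abs_mult)
  qed
  finally show ?thesis by simp
qed

lemma Qs_resolvent: "l > 0 \<Longrightarrow> Qs (r / (r + l)) 0 = (r + l) * (LINT \<theta>|mu. 1 / (l - phi a \<theta>))"
proof -
  assume l: "l > 0"
  have e: "1 / (1 - r / (r + l) * ch \<theta>) = (r + l) * (1 / (l - phi a \<theta>))" for \<theta>
  proof -
    have "0 < l - phi a \<theta>" using phi_le_0[of \<theta>] l by simp
    moreover have "1 - r / (r + l) * ch \<theta> = (l - phi a \<theta>) / (r + l)" using l r_pos by (simp add: phi_eq field_simps)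
    ultimately show ?thesis using l r_pos by simp
  qed
  show ?thesis unfolding Qs_def ip_0 cos_zero e by (rule integral_mult_right_zero)
qed

text \<open>The identity \<open>1 - s * ch \<theta> = (l - phi a \<theta>) / (r + l)\<close>
  rewrites the difference of the integrands. The first term on the right has the shape to which the
  Abelian theorems apply; the second is of order l and negligible against \<open>sqrt l\<close> and
  \<open>1 / ln (1 / l)\<close>.\<close>

lemma rho_minus_Rs:
  assumes l: "l > 0" and u: "u \<noteq> 0"
  shows "rho a u - Rs (r / (r + l)) u = l * (LINT \<theta>|mu. Bu u \<theta> / (l - phi a \<theta>)) - l / (r + l) * Rs (r / (r + l)) u"
proof -
  let ?s = "r / (r + l)"
  have s: "0 \<le> ?s" "?s < 1" using l r_pos by auto
  obtain C where C: "\<And>\<theta>. Bu u \<theta> \<le> C" using Bu_bounded by blast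
  have pos: "0 < l - phi a \<theta>" "l \<le> l - phi a \<theta>" for \<theta> using phi_le_0[of \<theta>] l by auto
  have i1: "integrable mu (\<lambda>\<theta>. Bu u \<theta> / (l - phi a \<theta>))"
    by (rule integrable_mu_bounded[where B = "C / l"]) (use C Bu_nonneg pos l in \<open>auto simp: abs_divide abs_of_nonneg intro!: frac_le order_trans[OF Bu_nonneg] order_trans[OF pos(2) abs_ge_self]\<close>)
  have c2: "\<bar>1 - cos \<eta>\<bar> \<le> 2" for \<eta> :: real using cos_le_one[of \<eta>] cos_ge_minus_one[of \<eta>] by linarith
  have i2: "integrable mu (\<lambda>\<theta>. (1 - cos (ip u \<theta>)) / (1 - ?s * ch \<theta>))"
    by (rule integrable_Qs[OF s, where B = 2]) (use c2 in auto)
  have "(LINT \<theta>|mu. Bu u \<theta>) = (LINT \<theta>|mu. l * (Bu u \<theta> / (l - phi a \<theta>)) + (1 - l / (r + l)) * ((1 - cos (ip u \<theta>)) / (1 - ?s * ch \<theta>)))"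
  proof (rule integral_cong_AE)
    show "AE \<theta> in mu. Bu u \<theta> = l * (Bu u \<theta> / (l - phi a \<theta>)) + (1 - l / (r + l)) * ((1 - cos (ip u \<theta>)) / (1 - ?s * ch \<theta>))"
      using AE_mu_bx AE_mu_nonzero
    proof eventually_elim
      case (elim \<theta>)
      have c: "1 - ch \<theta> > 0" using ch_less_1 elim by auto
      have e1: "1 - ?s * ch \<theta> = (l - phi a \<theta>) / (r + l)" using l r_pos by (simp add: phi_eq field_simps)
      have e2: "1 - l / (r + l) = r / (r + l)" using l r_pos by (simp add: field_simps)
      have "1 - cos (ip u \<theta>) = Bu u \<theta> * (1 - ch \<theta>)" using c by (simp add: Bu_def)
      then have "(1 - l / (r + l)) * ((1 - cos (ip u \<theta>)) / (1 - ?s * ch \<theta>)) = Bu u \<theta> * (r * (1 - ch \<theta>)) / (l - phi a \<theta>)"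
        unfolding e1 e2 using l r_pos by simp
      also have "r * (1 - ch \<theta>) = (l - phi a \<theta>) - l" by (simp add: phi_eq algebra_simps)
      finally show ?case using pos(1)[of \<theta>] by (simp add: field_simps)
    qed
  qed auto
  also have "\<dots> = l * (LINT \<theta>|mu. Bu u \<theta> / (l - phi a \<theta>)) + (1 - l / (r + l)) * Rs ?s u"
    unfolding Bochner_Integration.integral_add[OF integrable_mult_right[OF i1] integrable_mult_right[OF i2]] integral_mult_right_zero
    using u by (simp add: Rs_def)
  finally show ?thesis using u by (simp add: rho_eq algebra_simps)
qed

text \<open>\<open>Qs\<close> tends to infinity, so numerator and denominator of
  \<open>Fs_formula\<close> are divided by it.\<close>

lemma F1_recurrent:
  assumes yz: "y \<noteq> z" and Q: "((\<lambda>l. 1 / Qs (r / (r + l)) 0) \<longlongrightarrow> 0) (at_right 0)"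
  shows "F1 x y z = (rho a (x - z) + rho a (y - z) - rho a (x - y)) / (2 * rho a (y - z))"
proof -
  have R: "((\<lambda>l. Rs (r / (r + l)) u) \<longlongrightarrow> rho a u) (at_right 0)" for u by (rule filterlim_compose[OF Rs_tendsto filterlim_resolvent_parameter])
  have rp: "rho a (y - z) > 0" by (rule rho_pos)
  have "((\<lambda>l. (Rs (r / (r + l)) (x - z) + Rs (r / (r + l)) (y - z) - Rs (r / (r + l)) (x - y) - Rs (r / (r + l)) (x - z) * Rs (r / (r + l)) (y - z) * (1 / Qs (r / (r + l)) 0))
     / (Rs (r / (r + l)) (y - z) * (2 - Rs (r / (r + l)) (y - z) * (1 / Qs (r / (r + l)) 0)))) \<longlongrightarrow>
     (rho a (x - z) + rho a (y - z) - rho a (x - y) - rho a (x - z) * rho a (y - z) * 0) / (rho a (y - z) * (2 - rho a (y - z) * 0))) (at_right 0)"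
    using rp by (intro tendsto_intros R Q) auto
  moreover have "eventually (\<lambda>l. (Rs (r / (r + l)) (x - z) + Rs (r / (r + l)) (y - z) - Rs (r / (r + l)) (x - y) - Rs (r / (r + l)) (x - z) * Rs (r / (r + l)) (y - z) * (1 / Qs (r / (r + l)) 0))
     / (Rs (r / (r + l)) (y - z) * (2 - Rs (r / (r + l)) (y - z) * (1 / Qs (r / (r + l)) 0))) = Fs x y z (r / (r + l))) (at_right 0)"
    using eventually_at_right_less[of "0::real"]
  proof eventually_elim
    case (elim l)
    have s: "0 \<le> r / (r + l)" "r / (r + l) < 1" using elim r_pos by auto
    have Q: "Qs (r / (r + l)) 0 > 0" using Rs_pos[OF s, of "y - z"] yz by simp
    have num: "B + R - A - B * R * (1 / Q) = (Q * (B + R - A) - B * R) / Q"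
      and den: "R * (2 - R * (1 / Q)) = R * (2 * Q - R) / Q" if "Q > 0" for A B R Q :: real
      using that by (simp_all add: field_simps)
    show ?case unfolding Fs_formula[OF yz s] num[OF Q] den[OF Q] using Q by simp
  qed
  ultimately have "((\<lambda>l. Fs x y z (r / (r + l))) \<longlongrightarrow> (rho a (x - z) + rho a (y - z) - rho a (x - y)) / (2 * rho a (y - z))) (at_right 0)"
    by (simp add: Lim_transform_eventually mult.commute[of _ 2])
  from tendsto_unique[OF _ filterlim_compose[OF Fs_tendsto[OF yz] filterlim_resolvent_parameter] this] show ?thesis by simp
qed

text \<open>Both recurrent dimensions at once: \<epsilon> is the scale, \<open>sqrt l\<close> with
  \<beta> = 1/2 or \<open>1 / ln (1 / l)\<close> with \<beta> = 0. On this scale \<kappa> measures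
  the defect of \<open>Rs\<close> from \<open>rho\<close> and g the decay of \<open>1 / Qs\<close>;
  L is the resulting first-order coefficient of \<open>F1 - Fs\<close>, found by linearising
  \<open>Fs_formula\<close>.\<close>

theorem recurrent_tail:
  fixes \<epsilon> :: "real \<Rightarrow> real" and \<kappa> :: "int^'n \<Rightarrow> real" and g \<beta> :: real and x y z :: "int^'n"
  assumes yz: "y \<noteq> z"
    and \<kappa>: "\<And>u. ((\<lambda>l. (rho a u - Rs (r / (r + l)) u) / \<epsilon> l) \<longlongrightarrow> \<kappa> u) (at_right 0)"
    and g: "((\<lambda>l. 1 / (Qs (r / (r + l)) 0 * \<epsilon> l)) \<longlongrightarrow> g) (at_right 0)"
    and \<epsilon>0: "(\<epsilon> \<longlongrightarrow> 0) (at_right 0)" and \<epsilon>pos: "eventually (\<lambda>l. \<epsilon> l > 0) (at_right 0)"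
    and \<beta>: "0 \<le> \<beta>" "\<beta> < 1" and rv: "\<And>k. k > 0 \<Longrightarrow> ((\<lambda>l. \<epsilon> (k * l) / \<epsilon> l) \<longlongrightarrow> k powr \<beta>) (at_right 0)"
  defines "h \<equiv> (rho a (x - z) + rho a (y - z) - rho a (x - y)) / (2 * rho a (y - z))"
  defines "L \<equiv> (\<kappa> (x - z) + \<kappa> (y - z) - \<kappa> (x - y) - 2 * h * \<kappa> (y - z) + g * (rho a (y - z) * (rho a (x - z) - h * rho a (y - z)))) / (2 * rho a (y - z))"
  shows "F1 x y z = h" and "L \<ge> 0" and "L > 0 \<Longrightarrow> ((\<lambda>t. (F1 x y z - H a x y z t) / \<epsilon> (1 / t)) \<longlongrightarrow> L / Gamma (1 - \<beta>)) at_top"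
proof -
  let ?R = "\<lambda>l u. Rs (r / (r + l)) u"
  let ?Q = "\<lambda>l. Qs (r / (r + l)) 0"
  have "((\<lambda>l. 1 / (?Q l * \<epsilon> l) * \<epsilon> l) \<longlongrightarrow> g * 0) (at_right 0)" by (intro tendsto_mult g \<epsilon>0)
  moreover have "eventually (\<lambda>l. 1 / (?Q l * \<epsilon> l) * \<epsilon> l = 1 / ?Q l) (at_right 0)" using \<epsilon>pos by eventually_elim simp
  ultimately have Q0: "((\<lambda>l. 1 / ?Q l) \<longlongrightarrow> 0) (at_right 0)" by (simp add: Lim_transform_eventually)
  show h: "F1 x y z = h" unfolding h_def by (rule F1_recurrent[OF yz Q0])
  have R: "((\<lambda>l. ?R l u) \<longlongrightarrow> rho a u) (at_right 0)" for u by (rule filterlim_compose[OF Rs_tendsto filterlim_resolvent_parameter])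
  have rp: "rho a (y - z) > 0" by (rule rho_pos)
  \<comment> \<open>This identity makes the terms of order one cancel in the difference of h and
    \<open>Fs\<close>, leaving terms of order \<open>\<epsilon> l\<close>.\<close>
  have hh: "2 * h * rho a (y - z) = rho a (x - z) + rho a (y - z) - rho a (x - y)" using rp by (simp add: h_def)
  have "((\<lambda>l. (- 2 * h * ((rho a (y - z) - ?R l (y - z)) / \<epsilon> l) + (rho a (x - z) - ?R l (x - z)) / \<epsilon> l + (rho a (y - z) - ?R l (y - z)) / \<epsilon> l - (rho a (x - y) - ?R l (x - y)) / \<epsilon> l
     + (?R l (x - z) * ?R l (y - z) - h * (?R l (y - z))\<^sup>2) * (1 / (?Q l * \<epsilon> l))) / (?R l (y - z) * (2 - ?R l (y - z) * (1 / ?Q l)))) \<longlongrightarrow>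
     (- 2 * h * \<kappa> (y - z) + \<kappa> (x - z) + \<kappa> (y - z) - \<kappa> (x - y) + (rho a (x - z) * rho a (y - z) - h * (rho a (y - z))\<^sup>2) * g) / (rho a (y - z) * (2 - rho a (y - z) * 0))) (at_right 0)"
    using rp by (intro tendsto_intros \<kappa> g R Q0) auto
  also have "(- 2 * h * \<kappa> (y - z) + \<kappa> (x - z) + \<kappa> (y - z) - \<kappa> (x - y) + (rho a (x - z) * rho a (y - z) - h * (rho a (y - z))\<^sup>2) * g) / (rho a (y - z) * (2 - rho a (y - z) * 0)) = L"
    unfolding L_def using rp by (simp add: field_simps power2_eq_square)
  finally have l1: "((\<lambda>l. (- 2 * h * ((rho a (y - z) - ?R l (y - z)) / \<epsilon> l) + (rho a (x - z) - ?R l (x - z)) / \<epsilon> l + (rho a (y - z) - ?R l (y - z)) / \<epsilon> l - (rho a (x - y) - ?R l (x - y)) / \<epsilon> l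
     + (?R l (x - z) * ?R l (y - z) - h * (?R l (y - z))\<^sup>2) * (1 / (?Q l * \<epsilon> l))) / (?R l (y - z) * (2 - ?R l (y - z) * (1 / ?Q l)))) \<longlongrightarrow> L) (at_right 0)" .
  have "eventually (\<lambda>l. (- 2 * h * ((rho a (y - z) - ?R l (y - z)) / \<epsilon> l) + (rho a (x - z) - ?R l (x - z)) / \<epsilon> l + (rho a (y - z) - ?R l (y - z)) / \<epsilon> l - (rho a (x - y) - ?R l (x - y)) / \<epsilon> l
     + (?R l (x - z) * ?R l (y - z) - h * (?R l (y - z))\<^sup>2) * (1 / (?Q l * \<epsilon> l))) / (?R l (y - z) * (2 - ?R l (y - z) * (1 / ?Q l))) = (F1 x y z - Fs x y z (r / (r + l))) / \<epsilon> l) (at_right 0)"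
    using eventually_at_right_less[of "0::real"] \<epsilon>pos
  proof eventually_elim
    case (elim l)
    have s: "0 \<le> r / (r + l)" "r / (r + l) < 1" using elim r_pos by auto
    define A B R Q e where defs: "A = ?R l (x - y)" "B = ?R l (x - z)" "R = ?R l (y - z)" "Q = ?Q l" "e = \<epsilon> l"
    have RR: "R > 0" "2 * Q - R > 0" "Q > 0" using Rs_pos[OF s, of "y - z"] yz by (auto simp: defs)
    have D: "R * (2 - R * (1 / Q)) = R * (2 * Q - R) / Q" using RR by (simp add: field_simps)
    have "(- 2 * h * ((rho a (y - z) - R) / e) + (rho a (x - z) - B) / e + (rho a (y - z) - R) / e - (rho a (x - y) - A) / e + (B * R - h * R\<^sup>2) * (1 / (Q * e)))
       = ((rho a (x - z) + rho a (y - z) - rho a (x - y) - 2 * h * rho a (y - z)) + 2 * h * R - B - R + A + (B * R - h * R\<^sup>2) / Q) / e"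
      using RR elim(2) by (simp add: defs(5) field_simps)
    also have "\<dots> = (h * (R * (2 * Q - R)) - (Q * (B + R - A) - B * R)) / Q / e"
      unfolding hh using RR by (simp add: field_simps power2_eq_square)
    finally have N: "(- 2 * h * ((rho a (y - z) - R) / e) + (rho a (x - z) - B) / e + (rho a (y - z) - R) / e - (rho a (x - y) - A) / e + (B * R - h * R\<^sup>2) * (1 / (Q * e)))
       = (h * (R * (2 * Q - R)) - (Q * (B + R - A) - B * R)) / Q / e" .
    have "(h * (R * (2 * Q - R)) - (Q * (B + R - A) - B * R)) / Q / e / (R * (2 * Q - R) / Q) = (h - (Q * (B + R - A) - B * R) / (R * (2 * Q - R))) / e"
      using RR elim(2) by (simp add: defs(5) field_simps)
    then show ?case unfolding Fs_formula[OF yz s] h defs[symmetric] N D .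
  qed
  with l1 have lim: "((\<lambda>l. (F1 x y z - Fs x y z (r / (r + l))) / \<epsilon> l) \<longlongrightarrow> L) (at_right 0)"
    by (rule Lim_transform_eventually)
  \<comment> \<open>The sign comes from \<open>Fs \<le> F1\<close> and not from the formula for L;
    in dimension one it is the source of \<open>C1_nonneg\<close>.\<close>
  show "L \<ge> 0"
  proof (rule tendsto_lowerbound[OF lim])
    show "\<forall>\<^sub>F l in at_right 0. 0 \<le> (F1 x y z - Fs x y z (r / (r + l))) / \<epsilon> l"
      using \<epsilon>pos eventually_at_right_less[of "0::real"]
    proof eventually_elim
      case (elim l)
      have "Fs x y z (r / (r + l)) \<le> F1 x y z" by (rule Fs_le_F1[OF yz]) (use elim r_pos in auto)
      then show ?case using elim by simp
    qed
  qed simp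
  assume Lpos: "L > 0"
  \<comment> \<open>\<open>laplace_tail\<close> divides by l, which turns the index \<beta> of
    \<epsilon> into the index \<open>\<beta> - 1\<close> of w; hence the Tauberian theorem is used
    with exponent \<open>1 - \<beta>\<close>.\<close>
  define w where "w l = L * \<epsilon> l / l" for l
  interpret K: karamata "\<lambda>t. F1 x y z - H a x y z t" w "1 - \<beta>"
  proof
    show "(\<lambda>t. F1 x y z - H a x y z t) \<in> borel_measurable borel" by measurable
    show "F1 x y z - H a x y z t \<le> F1 x y z - H a x y z s" if "s \<le> t" for s t using monoD[OF H_mono that] by simp
    show "0 \<le> F1 x y z - H a x y z t" if "0 \<le> t" for t
      by (rule sums_le[OF _ sums_zero H_tail_sums[OF that yz, of x]]) (intro mult_nonneg_nonneg fh_nonneg sum_nonneg pois_nonneg that)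
    show "0 < 1 - \<beta>" "1 - \<beta> \<le> 1" using \<beta> by auto
    show "integrable lborel (\<lambda>t. exp (- (l * t)) * (indicator {0..} t * (F1 x y z - H a x y z t)))" if "l > 0" for l
      using laplace_tail[OF yz that] by (simp add: has_bochner_integral_iff)
    show "eventually (\<lambda>l. w l > 0) (at_right 0)"
      using \<epsilon>pos eventually_at_right_less[of "0::real"] by eventually_elim (use Lpos in \<open>simp add: w_def\<close>)
    show "((\<lambda>l. (LINT t|lborel. exp (- (l * t)) * (indicator {0..} t * (F1 x y z - H a x y z t))) / w l) \<longlongrightarrow> 1) (at_right 0)"
    proof (rule Lim_transform_eventually)
      show "((\<lambda>l. (F1 x y z - Fs x y z (r / (r + l))) / \<epsilon> l / L) \<longlongrightarrow> 1) (at_right 0)"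
        using tendsto_divide[OF lim tendsto_const[of L]] Lpos by simp
      show "eventually (\<lambda>l. (F1 x y z - Fs x y z (r / (r + l))) / \<epsilon> l / L = (LINT t|lborel. exp (- (l * t)) * (indicator {0..} t * (F1 x y z - H a x y z t))) / w l) (at_right 0)"
        using \<epsilon>pos eventually_at_right_less[of "0::real"]
      proof eventually_elim
        case (elim l)
        show ?case using has_bochner_integral_integral_eq[OF laplace_tail[OF yz elim(2), of x]] elim Lpos
          by (simp add: w_def field_simps)
      qed
    qed
    show "((\<lambda>l. w (k * l) / w l) \<longlongrightarrow> k powr - (1 - \<beta>)) (at_right 0)" if k: "k > 0" for k
    proof (rule Lim_transform_eventually)
      show "((\<lambda>l. \<epsilon> (k * l) / \<epsilon> l / k) \<longlongrightarrow> k powr - (1 - \<beta>)) (at_right 0)"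
        using tendsto_divide[OF rv[OF k] tendsto_const[of k]] k by (simp add: powr_diff)
      show "eventually (\<lambda>l. \<epsilon> (k * l) / \<epsilon> l / k = w (k * l) / w l) (at_right 0)"
        using eventually_at_right_less[of "0::real"] by eventually_elim (use k Lpos in \<open>simp add: w_def field_simps\<close>)
    qed
  qed
  have "((\<lambda>t. L * (t * (F1 x y z - H a x y z t) / w (1 / t))) \<longlongrightarrow> L * (1 / Gamma (1 - \<beta>))) at_top"
    by (intro tendsto_mult tendsto_const K.tauberian)
  moreover have "eventually (\<lambda>t. L * (t * (F1 x y z - H a x y z t) / w (1 / t)) = (F1 x y z - H a x y z t) / \<epsilon> (1 / t)) at_top"
    using eventually_gt_at_top[of "0::real"] 
  proof eventually_elim
    case (elim t)
    have "L * (t * X / (L * e / (1 / t))) = X / e" for X e :: real using elim Lpos by (cases "e = 0") auto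
    then show ?case by (simp only: w_def)
  qed
  ultimately show "((\<lambda>t. (F1 x y z - H a x y z t) / \<epsilon> (1 / t)) \<longlongrightarrow> L / Gamma (1 - \<beta>)) at_top"
    by (simp add: Lim_transform_eventually)
qed

end

section \<open>The constants in dimensions one and two\<close>

context walk begin

lemma dim_one_coordinate:
  assumes "CARD('n) = 1"
  obtains i :: 'n where "\<And>\<theta> :: real^'n. \<theta> = (\<theta> $ i) *\<^sub>R axis i 1" "\<And>f :: 'n \<Rightarrow> real. sum f UNIV = f i" "\<And>f :: 'n \<Rightarrow> real. prod f UNIV = f i"
    "\<And>j. j = i"
proof -
  obtain i :: 'n where U: "UNIV = {i}" using assms by (metis card_1_singletonE)
  then have eq: "j = i" for j by auto
  show ?thesis
  proof (rule that[of i])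
    fix \<theta> :: "real^'n"
    have "\<theta> $ j = \<theta> $ i" "axis i 1 $ j = (1::real)" for j using eq[of j] by (simp_all add: axis_def)
    then show "\<theta> = (\<theta> $ i) *\<^sub>R axis i 1" by (simp add: vec_eq_iff)
    show "sum f UNIV = f i" "prod f UNIV = f i" for f :: "'n \<Rightarrow> real" unfolding U by simp_all
  qed (rule eq)
qed

lemma det_Qm_one:
  assumes "CARD('n) = 1" shows "det Qm = 1 / (2 * pi * (gamma_d a)\<^sup>2)"
proof -
  have "(gamma_d a)\<^sup>2 = 1 / (2 * pi * det Qm)"
    using det_Qm_pos by (simp add: gamma_eq assms power_mult_distrib powr_half_sqrt power_divide)
  then show ?thesis using det_Qm_pos by simp
qed

text \<open>Quotient of two quadratic limits along the axis, \<open>(sc u)\<^sup>2 / 2\<close> over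
  \<open>det Qm / (2 * r)\<close>, with \<open>det Qm\<close> expressed through
  \<open>gamma_d a\<close>.\<close>

lemma Bu_limit_one:
  assumes c1: "CARD('n) = 1"
  shows "(Bu u \<longlongrightarrow> 2 * pi * r * (gamma_d a)\<^sup>2 * (sc u)\<^sup>2) (at 0)"
proof -
  obtain i :: 'n where i: "\<And>\<theta> :: real^'n. \<theta> = (\<theta> $ i) *\<^sub>R axis i 1" "\<And>f :: 'n \<Rightarrow> real. sum f UNIV = f i" "\<And>f :: 'n \<Rightarrow> real. prod f UNIV = f i"
    and eq: "\<And>j. j = i"
    using dim_one_coordinate[OF c1] by blast
  have dQ: "det Qm = Qm $ i $ i"
    using det_diagonal[of Qm] eq i(3)[of "\<lambda>j. Qm $ j $ j"] by (metis (mono_tags))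
  have Qf: "axis i 1 \<bullet> (Qm *v axis i 1) = det Qm"
    unfolding dQ by (simp add: inner_vec_def matrix_vector_mult_def i(2) axis_def)
  have scu: "sc u = real_of_int (u $ i)" by (simp add: sc_def i(2))
  have "((\<lambda>h. ((1 - cos (h * sc u)) / h\<^sup>2) / ((1 - ch (h *\<^sub>R axis i 1)) / h\<^sup>2)) \<longlongrightarrow> ((sc u)\<^sup>2 / 2) / (det Qm / (2 * r))) (at 0)"
    unfolding Qf[symmetric] by (intro tendsto_divide tendsto_one_minus_cos ch_quadratic_limit) (use Qf det_Qm_pos r_pos in auto)
  moreover have "filterlim (\<lambda>\<theta>::real^'n. \<theta> $ i) (at 0) (at 0)"
  proof (unfold filterlim_at, intro conjI)
    have "eventually (\<lambda>\<theta>::real^'n. \<theta> \<noteq> 0) (at 0)" by (rule eventually_neq_at_within)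
    then show "eventually (\<lambda>\<theta>::real^'n. \<theta> $ i \<in> UNIV \<and> \<theta> $ i \<noteq> 0) (at 0)"
    proof eventually_elim
      case (elim \<theta>) then show ?case using i(1)[of \<theta>] by auto
    qed
    show "((\<lambda>\<theta>::real^'n. \<theta> $ i) \<longlongrightarrow> 0) (at 0)" using tendsto_vec_nth[OF tendsto_ident_at[of 0 UNIV], of i] by simp
  qed
  ultimately have l: "((\<lambda>\<theta>::real^'n. ((1 - cos (\<theta> $ i * sc u)) / (\<theta> $ i)\<^sup>2) / ((1 - ch ((\<theta> $ i) *\<^sub>R axis i 1)) / (\<theta> $ i)\<^sup>2)) \<longlongrightarrow> ((sc u)\<^sup>2 / 2) / (det Qm / (2 * r))) (at 0)"
    by (rule filterlim_compose)
  have "((sc u)\<^sup>2 / 2) / (det Qm / (2 * r)) = 2 * pi * r * (gamma_d a)\<^sup>2 * (sc u)\<^sup>2"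
    using r_pos by (simp add: det_Qm_one[OF c1])
  with l have l: "((\<lambda>\<theta>::real^'n. ((1 - cos (\<theta> $ i * sc u)) / (\<theta> $ i)\<^sup>2) / ((1 - ch ((\<theta> $ i) *\<^sub>R axis i 1)) / (\<theta> $ i)\<^sup>2)) \<longlongrightarrow> 2 * pi * r * (gamma_d a)\<^sup>2 * (sc u)\<^sup>2) (at 0)" by (simp only:)
  have "eventually (\<lambda>\<theta>::real^'n. \<theta> \<noteq> 0) (at 0)" by (rule eventually_neq_at_within)
  then have "eventually (\<lambda>\<theta>::real^'n. ((1 - cos (\<theta> $ i * sc u)) / (\<theta> $ i)\<^sup>2) / ((1 - ch ((\<theta> $ i) *\<^sub>R axis i 1)) / (\<theta> $ i)\<^sup>2) = Bu u \<theta>) (at 0)"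
  proof eventually_elim
    case (elim \<theta>)
    have n0: "\<theta> $ i \<noteq> 0" using i(1)[of \<theta>] elim by auto
    have "ip u \<theta> = \<theta> $ i * sc u" by (simp add: ip_def i(2) scu mult.commute)
    then show ?case using n0 i(1)[of \<theta>, symmetric] by (simp add: Bu_def)
  qed
  with l show ?thesis by (rule Lim_transform_eventually)
qed

text \<open>\<open>local_clt\<close> gives decay of order \<open>1 / sqrt t\<close>, so the Abelian
  theorem applies with exponent 1/2 and contributes \<open>Gamma (1/2) = sqrt pi\<close>.\<close>

lemma abel_resolvent_one:
  assumes c1: "CARD('n) = 1" and m: "B \<in> borel_measurable borel" and B: "\<And>\<theta>. 0 \<le> B \<theta>" "\<And>\<theta>. B \<theta> \<le> K" and lim: "(B \<longlongrightarrow> B0) (at 0)"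
  shows "((\<lambda>l. sqrt l * (LINT \<theta>|mu. B \<theta> / (l - phi a \<theta>))) \<longlongrightarrow> B0 * gamma_d a * sqrt pi) (at_right 0)"
proof -
  obtain C where C: "C \<ge> 0" "\<And>t. t > 0 \<Longrightarrow> (LINT \<theta>|mu. exp (t * phi a \<theta>)) \<le> C * t powr (- (1 / 2))"
    using heat_bound c1 by auto
  have Bb: "\<bar>B \<theta>\<bar> \<le> K" for \<theta> using B[of \<theta>] by simp
  have K: "K \<ge> 0" using Bb[of 0] by simp
  have "((\<lambda>l. l powr (1/2) * (LINT t|lborel. exp (- (l * t)) * (indicator {0..} t * (LINT \<theta>|mu. B \<theta> * exp (t * phi a \<theta>))))) \<longlongrightarrow> (B0 * gamma_d a) * Gamma (1/2)) (at_right 0)"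
  proof (rule abel_laplace_power)
    show "(\<lambda>t. LINT \<theta>|mu. B \<theta> * exp (t * phi a \<theta>)) \<in> borel_measurable borel" by (rule fourier_meas[OF m])
    fix t :: real assume t: "t > 0"
    show "\<bar>LINT \<theta>|mu. B \<theta> * exp (t * phi a \<theta>)\<bar> \<le> K * C * t powr (1 / 2 - 1)"
      using order_trans[OF fourier_bound[OF m Bb, of t] mult_left_mono[OF C(2)[OF t] K]] t by (simp add: mult.assoc)
  qed (use local_clt[OF m Bb lim] c1 in auto)
  then have "((\<lambda>l. l powr (1/2) * (LINT t|lborel. exp (- (l * t)) * (indicator {0..} t * (LINT \<theta>|mu. B \<theta> * exp (t * phi a \<theta>))))) \<longlongrightarrow> B0 * gamma_d a * sqrt pi) (at_right 0)"
    by (simp only: Gamma_one_half_real)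
  then show ?thesis
  proof (rule Lim_transform_eventually)
    show "\<forall>\<^sub>F l in at_right 0. l powr (1/2) * (LINT t|lborel. exp (- (l * t)) * (indicator {0..} t * (LINT \<theta>|mu. B \<theta> * exp (t * phi a \<theta>)))) = sqrt l * (LINT \<theta>|mu. B \<theta> / (l - phi a \<theta>))"
      using eventually_at_right_less[of "0::real"]
    proof eventually_elim
      case (elim l) show ?case unfolding has_bochner_integral_integral_eq[OF laplace_fourier[OF m B elim]] using elim by (simp add: powr_half_sqrt)
    qed
  qed
qed

lemma tail_one:
  assumes c1: "CARD('n) = 1" and yz: "y \<noteq> z"
  shows "F1 x y z = (rho a (x - z) + rho a (y - z) - rho a (y - x)) / (2 * rho a (y - z))"
    and "C1 a (x - z) (y - z) \<ge> 0"
    and "C1 a (x - z) (y - z) > 0 \<Longrightarrow> ((\<lambda>t. (F1 x y z - H a x y z t) * sqrt t) \<longlongrightarrow> C1 a (x - z) (y - z)) at_top"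
proof -
  \<comment> \<open>c is the limit of \<open>Bu\<close> without \<open>(sc u)\<^sup>2\<close>, times
    \<open>gamma_d a * sqrt pi\<close> from \<open>abel_resolvent_one\<close>; g is the reciprocal
    of the limit of \<open>sqrt l * Qs\<close>. The roots of pi combine with the final division by
    \<open>Gamma (1/2) = sqrt pi\<close>.\<close>
  define c where "c = 2 * pi * r * (gamma_d a)\<^sup>2 * gamma_d a * sqrt pi"
  define \<kappa> where "\<kappa> u = c * (sc u)\<^sup>2" for u :: "int^'n"
  define g where "g = 1 / (r * gamma_d a * sqrt pi)"
  have D: "((\<lambda>l. sqrt l * (LINT \<theta>|mu. 1 / (l - phi a \<theta>))) \<longlongrightarrow> gamma_d a * sqrt pi) (at_right 0)"
    using abel_resolvent_one[OF c1, of "\<lambda>_. 1" 1 1] by simp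
  have R: "((\<lambda>l. Rs (r / (r + l)) u) \<longlongrightarrow> rho a u) (at_right 0)" for u by (rule filterlim_compose[OF Rs_tendsto filterlim_resolvent_parameter])
  have kap: "((\<lambda>l. (rho a u - Rs (r / (r + l)) u) / sqrt l) \<longlongrightarrow> \<kappa> u) (at_right 0)" for u
  proof (cases "u = 0")
    case True
    then show ?thesis by (simp add: \<kappa>_def rho_def Rs_def sc_def)
  next
    case False
    obtain K where K: "\<And>\<theta>. Bu u \<theta> \<le> K" using Bu_bounded by blast
    have "((\<lambda>l. sqrt l / (r + l)) \<longlongrightarrow> sqrt 0 / (r + 0)) (at_right 0)" using r_pos by (intro tendsto_intros) auto
    then have "((\<lambda>l. sqrt l / (r + l)) \<longlongrightarrow> 0) (at_right 0)" by simp
    then have "((\<lambda>l. sqrt l * (LINT \<theta>|mu. Bu u \<theta> / (l - phi a \<theta>)) - sqrt l / (r + l) * Rs (r / (r + l)) u) \<longlongrightarrow>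
        2 * pi * r * (gamma_d a)\<^sup>2 * (sc u)\<^sup>2 * gamma_d a * sqrt pi - 0 * rho a u) (at_right 0)"
      by (intro tendsto_diff tendsto_mult R abel_resolvent_one[OF c1 Bu_meas Bu_nonneg K Bu_limit_one[OF c1]])
    moreover have "\<forall>\<^sub>F l in at_right 0. sqrt l * (LINT \<theta>|mu. Bu u \<theta> / (l - phi a \<theta>)) - sqrt l / (r + l) * Rs (r / (r + l)) u = (rho a u - Rs (r / (r + l)) u) / sqrt l"
      using eventually_at_right_less[of "0::real"]
    proof eventually_elim
      case (elim l)
      have "sqrt l * X - sqrt l / (r + l) * Y = (l * X - l / (r + l) * Y) / sqrt l" for X Y
      proof -
        have "(l * X - l / (r + l) * Y) / sqrt l = (l / sqrt l) * X - (l / sqrt l) / (r + l) * Y" by (simp add: diff_divide_distrib)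
        also have "l / sqrt l = sqrt l" using elim by (simp add: real_div_sqrt)
        finally show ?thesis by simp
      qed
      then show ?case unfolding rho_minus_Rs[OF elim False] .
    qed
    ultimately have "((\<lambda>l. (rho a u - Rs (r / (r + l)) u) / sqrt l) \<longlongrightarrow> 2 * pi * r * (gamma_d a)\<^sup>2 * (sc u)\<^sup>2 * gamma_d a * sqrt pi - 0 * rho a u) (at_right 0)"
      by (rule Lim_transform_eventually)
    then show ?thesis by (simp add: \<kappa>_def c_def mult_ac)
  qed
  have gl: "((\<lambda>l. 1 / (Qs (r / (r + l)) 0 * sqrt l)) \<longlongrightarrow> g) (at_right 0)"
  proof (rule Lim_transform_eventually)
    have "((\<lambda>l. 1 / ((r + l) * (sqrt l * (LINT \<theta>|mu. 1 / (l - phi a \<theta>))))) \<longlongrightarrow> 1 / ((r + 0) * (gamma_d a * sqrt pi))) (at_right 0)"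
      by (intro tendsto_intros D) (use r_pos gamma_pos in auto)
    then show "((\<lambda>l. 1 / ((r + l) * (sqrt l * (LINT \<theta>|mu. 1 / (l - phi a \<theta>))))) \<longlongrightarrow> g) (at_right 0)" by (simp add: g_def mult.assoc)
    show "\<forall>\<^sub>F l in at_right 0. 1 / ((r + l) * (sqrt l * (LINT \<theta>|mu. 1 / (l - phi a \<theta>)))) = 1 / (Qs (r / (r + l)) 0 * sqrt l)"
      using eventually_at_right_less[of "0::real"] by eventually_elim (simp only: Qs_resolvent mult_ac)
  qed
  have Rp: "rho a (y - z) > 0" by (rule rho_pos)
  have sym: "rho a (x - y) = rho a (y - x)" using rho_sym[of "y - x"] by simp
  have scd: "sc (x - y) = sc (x - z) - sc (y - z)" by (simp add: sc_def sum_subtractf)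
  let ?h = "(rho a (x - z) + rho a (y - z) - rho a (x - y)) / (2 * rho a (y - z))"
  let ?L = "(\<kappa> (x - z) + \<kappa> (y - z) - \<kappa> (x - y) - 2 * ?h * \<kappa> (y - z) + g * (rho a (y - z) * (rho a (x - z) - ?h * rho a (y - z)))) / (2 * rho a (y - z))"
  have L: "?L / sqrt pi = C1 a (x - z) (y - z)"
  proof -
    have "(c * u\<^sup>2 + c * v\<^sup>2 - c * (u - v)\<^sup>2 - 2 * ((B + R - A) / (2 * R)) * (c * v\<^sup>2) + g * (R * (B - (B + R - A) / (2 * R) * R))) / (2 * R) / sqrt pi
      = (A + B - R) / (4 * r * pi * \<gamma>) + r * pi * v\<^sup>2 * \<gamma> ^ 3 * (A - B - R) / R\<^sup>2 + 2 * r * pi * u * v * \<gamma> ^ 3 / R"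
      if "\<gamma> > 0" "R > 0" "c = 2 * pi * r * \<gamma>\<^sup>2 * \<gamma> * sqrt pi" "g = 1 / (r * \<gamma> * sqrt pi)" for u v A B R \<gamma> :: real
    proof -
      have g: "g / sqrt pi = 1 / (r * pi * \<gamma>)" by (simp add: that)
      have c: "c / sqrt pi = 2 * pi * r * \<gamma> ^ 3" by (simp add: that power3_eq_cube power2_eq_square)
      have "(c * u\<^sup>2 + c * v\<^sup>2 - c * (u - v)\<^sup>2 - 2 * ((B + R - A) / (2 * R)) * (c * v\<^sup>2) + g * (R * (B - (B + R - A) / (2 * R) * R))) / (2 * R) / sqrt pi
        = (c / sqrt pi) * (u\<^sup>2 + v\<^sup>2 - (u - v)\<^sup>2 - 2 * ((B + R - A) / (2 * R)) * v\<^sup>2) / (2 * R) + (g / sqrt pi) * (R * (B - (B + R - A) / (2 * R) * R)) / (2 * R)"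
        by (simp add: add_divide_distrib diff_divide_distrib algebra_simps)
      also have "\<dots> = (c / sqrt pi) * (2 * u * v * R - v\<^sup>2 * (B + R - A)) / (2 * R\<^sup>2) + (g / sqrt pi) * (A + B - R) / 4"
        using that(2) by (simp add: field_simps power2_eq_square)
      also have "\<dots> = (A + B - R) / (4 * r * pi * \<gamma>) + r * pi * v\<^sup>2 * \<gamma> ^ 3 * (A - B - R) / R\<^sup>2 + 2 * r * pi * u * v * \<gamma> ^ 3 / R"
        unfolding g c using that(1,2) r_pos by (simp add: field_simps power2_eq_square)
      finally show ?thesis .
    qed
    from this[OF gamma_pos Rp c_def g_def, of "sc (x - z)" "sc (y - z)" "rho a (x - z)" "rho a (y - x)"]
    show ?thesis unfolding \<kappa>_def scd sym C1_def by simp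
  qed
  have rv: "((\<lambda>l. sqrt (k * l) / sqrt l) \<longlongrightarrow> k powr (1/2)) (at_right 0)" if "k > 0" for k
  proof (rule tendsto_eventually)
    show "\<forall>\<^sub>F l in at_right 0. sqrt (k * l) / sqrt l = k powr (1 / 2)"
      using eventually_at_right_less[of "0::real"] by eventually_elim (use that in \<open>simp add: powr_half_sqrt real_sqrt_mult\<close>)
  qed
  have s0: "((\<lambda>l. sqrt l) \<longlongrightarrow> 0) (at_right 0)" and spos: "\<forall>\<^sub>F l in at_right 0. sqrt l > 0"
    by real_asymp+
  note T = recurrent_tail[where x = x and y = y and z = z and \<epsilon> = sqrt and \<kappa> = \<kappa> and g = g and \<beta> = "1/2", OF yz kap gl s0 spos _ _ rv]
  show "F1 x y z = (rho a (x - z) + rho a (y - z) - rho a (y - x)) / (2 * rho a (y - z))"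
    using T(1) unfolding sym by simp
  have "?L / sqrt pi \<ge> 0" by (intro divide_nonneg_pos T(2)) auto
  then show "C1 a (x - z) (y - z) \<ge> 0" unfolding L .
  assume C: "C1 a (x - z) (y - z) > 0"
  have p0: "w > 0" if "w / sqrt pi > 0" for w using that by (simp add: zero_less_divide_iff)
  have Lp: "?L > 0" by (rule p0, unfold L, rule C)
  have "((\<lambda>t. (F1 x y z - H a x y z t) / sqrt (1 / t)) \<longlongrightarrow> ?L / Gamma (1 - 1/2)) at_top" by (rule T(3), simp, simp, assumption, rule Lp)
  also have "Gamma (1 - 1/2 :: real) = sqrt pi" by (simp add: Gamma_one_half_real)
  finally show "((\<lambda>t. (F1 x y z - H a x y z t) * sqrt t) \<longlongrightarrow> C1 a (x - z) (y - z)) at_top"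
    unfolding L by (simp add: real_sqrt_divide)
qed

text \<open>Here the defect of \<open>Rs\<close> from \<open>rho\<close> is of smaller order than
  \<open>1 / ln (1 / l)\<close>, so \<kappa> = 0 and only the term with \<open>1 / Qs\<close>
  contributes; this is why \<open>C2\<close> is so much simpler than \<open>C1\<close>.\<close>

lemma tail_two:
  assumes c2: "CARD('n) = 2" and yz: "y \<noteq> z"
  shows "F1 x y z = (rho a (x - z) + rho a (y - z) - rho a (y - x)) / (2 * rho a (y - z))"
    and "C2 a (x - z) (y - z) > 0 \<Longrightarrow> ((\<lambda>t. (F1 x y z - H a x y z t) * ln t) \<longlongrightarrow> C2 a (x - z) (y - z)) at_top"
proof -
  define g where "g = 1 / (r * gamma_d a)"
  let ?E = "\<lambda>t. LINT \<theta>|mu. exp (t * phi a \<theta>)" and ?D = "\<lambda>l. LINT \<theta>|mu. 1 / (l - phi a \<theta>)"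
  have D: "((\<lambda>l. ?D l / ln (1 / l)) \<longlongrightarrow> gamma_d a) (at_right 0)"
  proof -
    have [measurable]: "(\<lambda>t. ?E t) \<in> borel_measurable borel" using fourier_meas[of "\<lambda>_. 1"] by simp
    have "((\<lambda>l. (LINT t|lborel. exp (- (l * t)) * (indicator {0..} t * (indicator {0..} t * ?E t))) / ln (1 / l)) \<longlongrightarrow> gamma_d a) (at_right 0)"
    proof (rule abel_laplace_log)
      show "(\<lambda>t. indicator {0..} t * ?E t) \<in> borel_measurable borel" by measurable
      have b: "\<bar>LINT \<theta>|mu. exp (t * phi a \<theta>)\<bar> \<le> 1" if "t \<ge> 0" for t
      proof -
        have "\<bar>LINT \<theta>|mu. exp (t * phi a \<theta>)\<bar> \<le> (LINT \<theta>|mu. \<bar>exp (t * phi a \<theta>)\<bar>)" by (rule integral_abs_bound)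
        also have "\<dots> \<le> 1"
          by (rule mu.integral_le_const) (use that phi_le_0 in \<open>auto intro!: integrable_mu_bounded[where B = 1] AE_I2 simp: mult_nonneg_nonpos\<close>)
        finally show ?thesis .
      qed
      show "\<bar>indicator {0..} t * ?E t\<bar> \<le> 1" for t using b[of t] by (cases "t \<ge> 0") auto
      have "((\<lambda>t. t powr 1 * ?E t) \<longlongrightarrow> gamma_d a) at_top" using local_clt[of "\<lambda>_. 1" 1 1] c2 by simp
      then show "((\<lambda>t. t * (indicator {0..} t * ?E t)) \<longlongrightarrow> gamma_d a) at_top"
      proof (rule Lim_transform_eventually)
        show "\<forall>\<^sub>F t in at_top. t powr 1 * ?E t = t * (indicator {0..} t * ?E t)"
          using eventually_gt_at_top[of "0::real"] by eventually_elim simp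
      qed
    qed
    then show ?thesis
    proof (rule Lim_transform_eventually)
      show "\<forall>\<^sub>F l in at_right 0. (LINT t|lborel. exp (- (l * t)) * (indicator {0..} t * (indicator {0..} t * ?E t))) / ln (1 / l) = ?D l / ln (1 / l)"
        using eventually_at_right_less[of "0::real"]
      proof eventually_elim
        case (elim l)
        have i: "indicator {0..} t * (indicator {0..} t * X) = indicator {0..} t * X" for t X :: real by (simp add: indicator_def)
        show ?case unfolding i
          using has_bochner_integral_integral_eq[OF laplace_fourier[of "\<lambda>_. 1" 1, OF _ _ _ elim]] by simp
      qed
    qed
  qed
  have R: "((\<lambda>l. Rs (r / (r + l)) u) \<longlongrightarrow> rho a u) (at_right 0)" for u by (rule filterlim_compose[OF Rs_tendsto filterlim_resolvent_parameter])
  have kap: "((\<lambda>l. (rho a u - Rs (r / (r + l)) u) / (1 / ln (1 / l))) \<longlongrightarrow> 0) (at_right 0)" for u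
  proof (cases "u = 0")
    case True
    then show ?thesis by (simp add: rho_def Rs_def)
  next
    case False
    obtain K where K: "\<And>\<theta>. Bu u \<theta> \<le> K" using Bu_bounded by blast
    have K0: "K \<ge> 0" using order_trans[OF Bu_nonneg K] .
    let ?I = "\<lambda>l. LINT \<theta>|mu. Bu u \<theta> / (l - phi a \<theta>)"
    \<comment> \<open>Bounding \<open>Bu\<close> by K leaves \<open>?D l\<close>, of order
      \<open>ln (1 / l)\<close>; the defect multiplied by \<open>ln (1 / l)\<close> is then at most
      of order \<open>l * (ln (1 / l))\<^sup>2\<close>.\<close>
    have l0: "((\<lambda>l::real. l * (ln (1 / l))\<^sup>2) \<longlongrightarrow> 0) (at_right 0)" by real_asymp
    have "((\<lambda>l::real. l * ln (1 / l)) \<longlongrightarrow> 0) (at_right 0)" by real_asymp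
    then have "((\<lambda>l. l * ln (1 / l) / (r + l)) \<longlongrightarrow> 0 / (r + 0)) (at_right 0)" using r_pos by (intro tendsto_intros) auto
    then have l1: "((\<lambda>l. l * ln (1 / l) / (r + l)) \<longlongrightarrow> 0) (at_right 0)" by simp
    have "((\<lambda>l. K * (l * (ln (1 / l))\<^sup>2) * (?D l / ln (1 / l))) \<longlongrightarrow> K * 0 * gamma_d a) (at_right 0)"
      by (intro tendsto_mult tendsto_const l0 D)
    then have up: "((\<lambda>l. K * (l * (ln (1 / l))\<^sup>2) * (?D l / ln (1 / l))) \<longlongrightarrow> 0) (at_right 0)" by simp
    have ev: "\<forall>\<^sub>F l in at_right 0. l \<in> {0<..<1::real}" by (rule eventually_at_right_real) simp
    have I: "((\<lambda>l. l * ln (1 / l) * ?I l) \<longlongrightarrow> 0) (at_right 0)"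
    proof (rule tendsto_sandwich[OF _ _ tendsto_const up])
      have pos: "0 < l - phi a \<theta>" "l \<le> \<bar>l - phi a \<theta>\<bar>" if "l > 0" for l \<theta> using phi_le_0[of \<theta>] that by auto
      show "\<forall>\<^sub>F l in at_right 0. 0 \<le> l * ln (1 / l) * ?I l"
        using ev by eventually_elim (use Bu_nonneg pos in \<open>auto intro!: mult_nonneg_nonneg integral_nonneg_AE AE_I2 divide_nonneg_pos\<close>)
      show "\<forall>\<^sub>F l in at_right 0. l * ln (1 / l) * ?I l \<le> K * (l * (ln (1 / l))\<^sup>2) * (?D l / ln (1 / l))"
        using ev
      proof eventually_elim
        case (elim l)
        then have l: "l > 0" and ln: "ln (1 / l) > 0" by auto
        have "?I l \<le> (LINT \<theta>|mu. K * (1 / (l - phi a \<theta>)))"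
        proof (rule integral_mono)
          show "integrable mu (\<lambda>\<theta>. Bu u \<theta> / (l - phi a \<theta>))"
            by (rule integrable_mu_bounded[where B = "K / l"]) (use K Bu_nonneg pos[OF l] l K0 in \<open>auto simp: abs_divide abs_of_nonneg intro!: frac_le\<close>)
          show "integrable mu (\<lambda>\<theta>. K * (1 / (l - phi a \<theta>)))"
            by (rule integrable_mult_right, rule integrable_mu_bounded[where B = "1 / l"]) (use pos[OF l] l in \<open>auto simp: abs_divide intro!: frac_le\<close>)
          show "Bu u \<theta> / (l - phi a \<theta>) \<le> K * (1 / (l - phi a \<theta>))" for \<theta>
            using divide_right_mono[OF K[of \<theta>], of "l - phi a \<theta>"] pos(1)[OF l, of \<theta>] by simp
        qed
        then have "?I l \<le> K * ?D l" unfolding integral_mult_right_zero .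
        then have "l * ln (1 / l) * ?I l \<le> l * ln (1 / l) * (K * ?D l)" using l ln by (intro mult_left_mono) auto
        also have "\<dots> = K * (l * (ln (1 / l))\<^sup>2) * (?D l / ln (1 / l))" using ln by (simp add: power2_eq_square)
        finally show ?case .
      qed
    qed
    have "((\<lambda>l. l * ln (1 / l) * ?I l - l * ln (1 / l) / (r + l) * Rs (r / (r + l)) u) \<longlongrightarrow> 0 - 0 * rho a u) (at_right 0)"
      by (intro tendsto_diff tendsto_mult R I l1)
    moreover have "\<forall>\<^sub>F l in at_right 0. l * ln (1 / l) * ?I l - l * ln (1 / l) / (r + l) * Rs (r / (r + l)) u = (rho a u - Rs (r / (r + l)) u) / (1 / ln (1 / l))"
      using eventually_at_right_less[of "0::real"]
    proof eventually_elim
      case (elim l)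
      have "l * L * X - l * L / (r + l) * Y = (l * X - l / (r + l) * Y) / (1 / L)" for X Y L
        by (simp add: algebra_simps)
      then show ?case unfolding rho_minus_Rs[OF elim False] .
    qed
    ultimately have "((\<lambda>l. (rho a u - Rs (r / (r + l)) u) / (1 / ln (1 / l))) \<longlongrightarrow> 0 - 0 * rho a u) (at_right 0)"
      by (rule Lim_transform_eventually)
    then show ?thesis by simp
  qed
  have gl: "((\<lambda>l. 1 / (Qs (r / (r + l)) 0 * (1 / ln (1 / l)))) \<longlongrightarrow> g) (at_right 0)"
  proof (rule Lim_transform_eventually)
    have "((\<lambda>l. 1 / ((r + l) * (?D l / ln (1 / l)))) \<longlongrightarrow> 1 / ((r + 0) * gamma_d a)) (at_right 0)"
      by (intro tendsto_intros D) (use r_pos gamma_pos in auto)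
    then show "((\<lambda>l. 1 / ((r + l) * (?D l / ln (1 / l)))) \<longlongrightarrow> g) (at_right 0)" by (simp add: g_def)
    show "\<forall>\<^sub>F l in at_right 0. 1 / ((r + l) * (?D l / ln (1 / l))) = 1 / (Qs (r / (r + l)) 0 * (1 / ln (1 / l)))"
      using eventually_at_right_less[of "0::real"] by eventually_elim (simp add: Qs_resolvent)
  qed
  have Rp: "rho a (y - z) > 0" by (rule rho_pos)
  have sym: "rho a (x - y) = rho a (y - x)" using rho_sym[of "y - x"] by simp
  let ?h = "(rho a (x - z) + rho a (y - z) - rho a (x - y)) / (2 * rho a (y - z))"
  let ?L = "(0 + 0 - 0 - 2 * ?h * 0 + g * (rho a (y - z) * (rho a (x - z) - ?h * rho a (y - z)))) / (2 * rho a (y - z))"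
  have L: "?L = C2 a (x - z) (y - z)"
  proof -
    have "(0 + 0 - 0 - 2 * ((B + R - A) / (2 * R)) * 0 + g * (R * (B - (B + R - A) / (2 * R) * R))) / (2 * R) = (A + B - R) / (4 * r * gamma_d a)"
      if "R > 0" for A B R :: real
    proof -
      have "(0 + 0 - 0 - 2 * ((B + R - A) / (2 * R)) * 0 + g * (R * (B - (B + R - A) / (2 * R) * R))) / (2 * R) = g * ((A + B - R) / 4)"
        using that by (simp add: field_simps)
      then show ?thesis by (simp add: g_def)
    qed
    from this[OF Rp, of "rho a (x - z)" "rho a (y - x)"] show ?thesis unfolding sym C2_def by simp
  qed
  have rv: "((\<lambda>l. 1 / ln (1 / (k * l)) / (1 / ln (1 / l))) \<longlongrightarrow> k powr 0) (at_right 0)" if "k > 0" for k :: real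
  proof (rule Lim_transform_eventually)
    have "((\<lambda>l. 1 / (ln (1 / l) - c) / (1 / ln (1 / l))) \<longlongrightarrow> 1) (at_right 0)" for c :: real
      by real_asymp
    from this[of "ln k"] show "((\<lambda>l. 1 / (ln (1 / l) - ln k) / (1 / ln (1 / l))) \<longlongrightarrow> k powr 0) (at_right 0)" using that by simp
    show "\<forall>\<^sub>F l in at_right 0. 1 / (ln (1 / l) - ln k) / (1 / ln (1 / l)) = 1 / ln (1 / (k * l)) / (1 / ln (1 / l))"
      using eventually_at_right_less[of "0::real"] by eventually_elim (use that in \<open>simp add: ln_mult ln_div\<close>)
  qed
  have s0: "((\<lambda>l::real. 1 / ln (1 / l)) \<longlongrightarrow> 0) (at_right 0)" and spos: "\<forall>\<^sub>F l in at_right 0. 1 / ln (1 / l :: real) > 0"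
    by real_asymp+
  note T = recurrent_tail[where x = x and y = y and z = z and \<epsilon> = "\<lambda>l. 1 / ln (1 / l)" and \<kappa> = "\<lambda>_. 0" and g = g and \<beta> = 0, OF yz kap gl s0 spos _ _ rv]
  show "F1 x y z = (rho a (x - z) + rho a (y - z) - rho a (y - x)) / (2 * rho a (y - z))"
    using T(1) unfolding sym by simp
  assume C: "C2 a (x - z) (y - z) > 0"
  have Lp: "?L > 0" unfolding L by (rule C)
  have "((\<lambda>t. (F1 x y z - H a x y z t) / (1 / ln (1 / (1 / t)))) \<longlongrightarrow> ?L / Gamma (1 - 0)) at_top" by (rule T(3), simp, simp, assumption, rule Lp)
  then show "((\<lambda>t. (F1 x y z - H a x y z t) * ln t) \<longlongrightarrow> C2 a (x - z) (y - z)) at_top"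
    unfolding L by simp
qed

end

section \<open>Positivity of the constants\<close>

context walk begin

text \<open>A strict triangle inequality for \<open>rho\<close>. \<open>Fs_formula\<close> for the
  walk from u - v with target u and forbidden point 0 contains the combination B + R - A in
  question; since the hitting probability stays above some c > 0, that combination is bounded below
  uniformly in s. So strictness survives the limit, whether \<open>Qs s 0\<close> stays bounded or
  not.\<close>

lemma rho_strict:
  assumes ns: "\<not> is_srw a" and v: "v \<noteq> 0"
  shows "rho a (v - u) + rho a u - rho a v > 0"
proof (cases "u = 0")
  case True
  then show ?thesis by (simp add: rho_def[of a 0])
next
  case u: False
  let ?x = "u - v" and ?z = "0 :: int^'n"
  have F: "F1 ?x u ?z > 0" by (rule F1_pos[OF ns u])
  define c where "c = F1 ?x u ?z / 2"
  have c: "c > 0" "c < F1 ?x u ?z" using F by (auto simp: c_def)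
  \<comment> \<open>1/2 serves the case Q \<le> R, where the product B * R alone is large enough; c
    / 2 serves Q > R, where \<open>R * (2 * Q - R) \<ge> Q / 2\<close>.\<close>
  define m where "m = min (1 / 2) (c / 2)"
  have m: "m > 0" using c by (simp add: m_def)
  have "((\<lambda>s. Rs s (u - v) + Rs s u - Rs s v) \<longlongrightarrow> rho a (u - v) + rho a u - rho a v) (at_left 1)"
    by (intro tendsto_intros Rs_tendsto)
  moreover have "\<forall>\<^sub>F s in at_left 1. m \<le> Rs s (u - v) + Rs s u - Rs s v"
    using eventually_unit_interval_at_left order_tendstoD(1)[OF Fs_tendsto[OF u] c(2)]
  proof eventually_elim
    case (elim s)
    then have s: "0 \<le> s" "s < 1" by auto
    define A B R Q where defs: "A = Rs s v" "B = Rs s (u - v)" "R = Rs s u" "Q = Qs s 0"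
    have R: "1 / 2 \<le> R" "R \<le> 2 * Q - 1 / 2" using Rs_pos[OF s u] by (auto simp: defs)
    have B: "1 / 2 \<le> B" using Rs_pos(1)[OF s, of "u - v"] by (cases "u = v") (auto simp: defs Rs_def)
    have sym: "Rs s (u - v - u) = A" using Rs_sym[of s v] by (simp add: defs)
    have "c < (Q * (B + R - A) - B * R) / (R * (2 * Q - R))"
      using elim(2) unfolding Fs_formula[OF u s] sym by (simp add: defs)
    moreover have D: "0 < R * (2 * Q - R)" using R by (intro mult_pos_pos) auto
    ultimately have ineq: "c * (R * (2 * Q - R)) < Q * (B + R - A) - B * R" by (simp add: pos_less_divide_eq)
    have "Q * m \<le> Q * (B + R - A)"
    proof (cases "Q \<le> R")
      case True
      have "Q * (1/2) \<le> R * B" using True B R by (intro mult_mono) auto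
      moreover have "Q * m \<le> Q * (1 / 2)" using R by (intro mult_left_mono) (auto simp: m_def)
      moreover have "0 < c * (R * (2 * Q - R))" using c D by simp
      ultimately show ?thesis using ineq by (simp only: mult.commute[of R B])
    next
      case False
      have "c / 2 * Q \<le> c * (R * (2 * Q - R))"
      proof -
        have "1 / 2 * Q \<le> R * (2 * Q - R)" using False R by (intro mult_mono) auto
        then have "c * (1 / 2 * Q) \<le> c * (R * (2 * Q - R))" using c by (intro mult_left_mono) auto
        then show ?thesis by simp
      qed
      moreover have "Q * m \<le> Q * (c / 2)" using R by (intro mult_left_mono) (auto simp: m_def)
      moreover have "0 \<le> B * R" using B R by simp
      ultimately show ?thesis using ineq by (simp only: mult.commute[of Q "c / 2"])
    qed
    moreover have "Q > 0" using R by simp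
    ultimately show ?case by (simp add: defs)
  qed
  ultimately have "m \<le> rho a (u - v) + rho a u - rho a v" by (rule tendsto_lowerbound) simp
  then show ?thesis using m rho_sym[of "v - u"] by simp
qed

lemma C2_pos: "\<not> is_srw a \<Longrightarrow> v \<noteq> 0 \<Longrightarrow> C2 a u v > 0"
  using rho_strict[of v u] r_pos gamma_pos by (simp add: C2_def)

text \<open>The potential kernel with its natural value 0 at the origin, where \<open>rho\<close>
  has the conventional value 1.\<close>

definition rho0 :: "int^'n \<Rightarrow> real" where "rho0 x = (LINT \<theta>|mu. Bu x \<theta>)"

lemma rho0_0: "rho0 0 = 0" by (simp add: rho0_def Bu_def)
lemma rho0_eq: "x \<noteq> 0 \<Longrightarrow> rho0 x = rho a x" by (simp add: rho0_def rho_eq)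
lemma rho_eq_rho0: "rho a x = rho0 x + (if x = 0 then 1 else 0)" by (simp add: rho0_eq rho0_0 rho_def[of a 0])
lemma rho0_sym: "rho0 (- x) = rho0 x" by (simp add: rho0_def Bu_def ip_minus)
lemma rho0_nonneg: "rho0 x \<ge> 0" unfolding rho0_def by (intro integral_nonneg_AE AE_I2 Bu_nonneg)

text \<open>Averaging over one jump adds \<open>cos (ip x \<theta>)\<close> to the integrand
  \<open>Bu x \<theta>\<close>, and the mean of this cosine is 1 at x = 0 and 0 elsewhere. The
  convention \<open>rho a 0 = 1\<close> is precisely what makes the identity hold at the origin
  too.\<close>

lemma rho0_harmonic: "has_bochner_integral (measure_pmf J) (\<lambda>w. rho0 (x + w)) (rho a x)"
proof (rule has_bochner_integral_nn_integral)
  have m: "(\<lambda>(w, \<theta>). ennreal (Bu (x + w) \<theta>)) \<in> borel_measurable (measure_pmf J \<Otimes>\<^sub>M mu)"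
    using measurable_compose[OF measurable_J_mu[of "\<lambda>w. Bu (x + w)"] measurable_ennreal] by (simp add: case_prod_unfold)
  have q0: "(LINT \<theta>|mu. cos (ip x \<theta>)) = (if x = 0 then 1 else 0)"
    using q_fourier[of 0 x] by (simp add: q_def)
  have ci: "integrable mu (\<lambda>\<theta>. cos (ip x \<theta>))" by (rule integrable_mu_bounded[where B = 1]) auto
  have "(\<integral>\<^sup>+ w. ennreal (rho0 (x + w)) \<partial>measure_pmf J) = (\<integral>\<^sup>+ w. \<integral>\<^sup>+ \<theta>. ennreal (Bu (x + w) \<theta>) \<partial>mu \<partial>measure_pmf J)"
    unfolding rho0_def by (intro nn_integral_cong nn_integral_eq_integral[symmetric] Bu_integrable AE_I2 Bu_nonneg)
  also have "\<dots> = (\<integral>\<^sup>+ \<theta>. \<integral>\<^sup>+ w. ennreal (Bu (x + w) \<theta>) \<partial>measure_pmf J \<partial>mu)"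
    using Jmu.Fubini[OF m[unfolded case_prod_unfold]] Jmu.Fubini'[OF m] by simp
  also have "\<dots> = (\<integral>\<^sup>+ \<theta>. ennreal (Bu x \<theta> + cos (ip x \<theta>)) \<partial>mu)"
  proof (rule nn_integral_cong_AE)
    show "AE \<theta> in mu. (\<integral>\<^sup>+ w. ennreal (Bu (x + w) \<theta>) \<partial>measure_pmf J) = ennreal (Bu x \<theta> + cos (ip x \<theta>))"
      using AE_mu_bx AE_mu_nonzero
    proof eventually_elim
      case (elim \<theta>)
      have c: "1 - ch \<theta> > 0" using ch_less_1 elim by auto
      have i: "integrable (measure_pmf J) (\<lambda>w. cos (ip x \<theta> + ip w \<theta>))" by (rule integrable_J_bounded[where B = 1]) simp
      have "(\<integral>\<^sup>+ w. ennreal (Bu (x + w) \<theta>) \<partial>measure_pmf J) = ennreal (measure_pmf.expectation J (\<lambda>w. (1 - cos (ip x \<theta> + ip w \<theta>)) / (1 - ch \<theta>)))"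
        unfolding Bu_def ip_add
        by (rule nn_integral_eq_integral) (use i c in \<open>auto intro!: integrable_divide\<close>)
      also have "measure_pmf.expectation J (\<lambda>w. (1 - cos (ip x \<theta> + ip w \<theta>)) / (1 - ch \<theta>)) = (1 - cos (ip x \<theta>) * ch \<theta>) / (1 - ch \<theta>)"
        using i by (simp add: expectation_cos_shift)
      also have "\<dots> = Bu x \<theta> + cos (ip x \<theta>)" using c by (simp add: Bu_def field_simps)
      finally show ?case .
    qed
  qed
  also have "\<dots> = ennreal (LINT \<theta>|mu. Bu x \<theta> + cos (ip x \<theta>))"
  proof (rule nn_integral_eq_integral)
    show "AE \<theta> in mu. 0 \<le> Bu x \<theta> + cos (ip x \<theta>)"
      using AE_mu_bx AE_mu_nonzero
    proof eventually_elim
      case (elim \<theta>)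
      have c: "1 - ch \<theta> > 0" using ch_less_1 elim by auto
      have "\<bar>cos (ip x \<theta>) * ch \<theta>\<bar> \<le> 1 * 1" unfolding abs_mult by (intro mult_mono abs_ch) auto
      then have "0 \<le> (1 - cos (ip x \<theta>) * ch \<theta>) / (1 - ch \<theta>)" using c by (intro divide_nonneg_pos) auto
      also have "\<dots> = Bu x \<theta> + cos (ip x \<theta>)" using c by (simp add: Bu_def field_simps)
      finally show ?case .
    qed
  qed (use Bu_integrable ci in auto)
  also have "\<dots> = ennreal (rho a x)" using Bu_integrable ci by (simp add: q0 rho_eq_rho0 rho0_def)
  finally show "(\<integral>\<^sup>+ w. ennreal (rho0 (x + w)) \<partial>measure_pmf J) = ennreal (rho a x)" .
qed (use rho_pos rho0_nonneg in \<open>auto intro: less_imp_le\<close>)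

lemma rho0_harmonic_minus: "has_bochner_integral (measure_pmf J) (\<lambda>w. rho0 (x - w)) (rho a x)"
  using rho0_harmonic[of "- x"] rho0_sym[of "x - w" for w] by (simp add: rho_sym)

text \<open>Up to the factor \<open>4 r \<pi> \<gamma>\<close>, the constant \<open>C1 a u v\<close> is the mean over one jump from \<open>u\<close> of the
  function \<open>D\<close>, which is harmonic off \<open>{0, v}\<close>, vanishes on \<open>{0, v}\<close> and tends to infinity.
  Nonnegativity of \<open>C1\<close> comes for free from the tail being nonnegative. If \<open>C1\<close> vanished, the finite
  zero set of \<open>D\<close> would be closed under the steps \<open>\<plusminus>g\<close>, \<open>\<plusminus>h\<close> away from \<open>0\<close> and \<open>v\<close>; its second
  largest element is then taken to its largest one by both \<open>g\<close> and \<open>h\<close>.\<close>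

lemma no_finite_step_closed:
  fixes Z :: "int set"
  assumes fin: "finite Z" and gh: "0 < g" "0 < h" "g \<noteq> h"
    and u: "u + g \<in> Z" "u - g \<in> Z" "u + h \<in> Z" "u - h \<in> Z"
    and cl: "\<And>z. z \<in> Z \<Longrightarrow> z \<notin> {0, v} \<Longrightarrow> z + g \<in> Z \<and> z - g \<in> Z \<and> z + h \<in> Z \<and> z - h \<in> Z"
  shows False
proof -
  have ne: "Z \<noteq> {}" using u by auto
  define M m where "M = Max Z" and "m = Min Z"
  have MZ: "M \<in> Z" "m \<in> Z" and bd: "\<And>z. z \<in> Z \<Longrightarrow> z \<le> M \<and> m \<le> z"
    using fin ne by (auto simp: M_def m_def)
  \<comment> \<open>An extreme element of Z must be exceptional, since otherwise a step would lead
    beyond it inside Z. Hence 0 and v are the two extremes, and every other point of Z admits all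
    four steps.\<close>
  have M: "M \<in> {0, v}" using cl[OF MZ(1)] bd[of "M + g"] gh by fastforce
  have m: "m \<in> {0, v}" using cl[OF MZ(2)] bd[of "m - g"] gh by fastforce
  have mM: "m < M" using bd[OF u(1)] bd[OF u(2)] gh by linarith
  then have eq: "{0, v} = {m, M}" using M m by auto
  define Z' where "Z' = Z - {m, M}"
  \<comment> \<open>The shorter of the two steps from u ends strictly between the extremes, because
    the longer one stays in Z in both directions.\<close>
  have "\<exists>z. z \<in> Z'"
  proof (cases "g < h")
    case True
    then have "u + g \<in> Z'" using u bd[OF u(3)] bd[OF u(4)] gh unfolding Z'_def by auto
    then show ?thesis ..
  next
    case False
    then have "u + h \<in> Z'" using u bd[OF u(1)] bd[OF u(2)] gh unfolding Z'_def by auto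
    then show ?thesis ..
  qed
  then have ne': "Z' \<noteq> {}" by auto
  have fin': "finite Z'" using fin by (simp add: Z'_def)
  define s where "s = Max Z'"
  have sZ': "s \<in> Z'" and top: "\<And>z. z \<in> Z' \<Longrightarrow> z \<le> s" using fin' ne' by (auto simp: s_def)
  have sZ: "s \<in> Z" and sn: "s \<notin> {0, v}" using sZ' unfolding eq Z'_def by auto
  have step: "s + k = M" if "k > 0" "s + k \<in> Z" for k
  proof (rule ccontr)
    assume "s + k \<noteq> M"
    moreover have "s + k \<noteq> m" using bd[OF sZ] that by auto
    ultimately have "s + k \<in> Z'" using that by (simp add: Z'_def)
    then show False using top[of "s + k"] that by simp
  qed
  have "s + g = M" "s + h = M" using cl[OF sZ sn] step[OF gh(1)] step[OF gh(2)] by simp_all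
  then show False using gh by simp
qed

lemma C1_nonneg: "CARD('n) = 1 \<Longrightarrow> v \<noteq> 0 \<Longrightarrow> C1 a u v \<ge> 0"
  using tail_one(2)[of v 0 u] by simp

lemma C1_pos:
  assumes c1: "CARD('n) = 1" and ns: "\<not> is_srw a" and v: "v \<noteq> 0"
  shows "C1 a u v > 0"
proof -
  obtain i :: 'n where "\<And>\<theta> :: real^'n. \<theta> = (\<theta> $ i) *\<^sub>R axis i 1" and i: "\<And>f :: 'n \<Rightarrow> real. sum f UNIV = f i"
    and "\<And>f :: 'n \<Rightarrow> real. prod f UNIV = f i" and eq: "\<And>j. j = i"
    using dim_one_coordinate[OF c1] by blast
  have sc: "sc x = real_of_int (x $ i)" for x :: "int^'n" by (simp add: sc_def i)
  have vec: "x = (\<chi> j. x $ i)" for x :: "int^'n"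
  proof -
    have "x $ j = x $ i" for j using eq[of j] by simp
    then show ?thesis by (simp add: vec_eq_iff)
  qed
  have vec0: "x $ i \<noteq> 0" if "x \<noteq> 0" for x :: "int^'n"
  proof
    assume "x $ i = 0"
    then have "x = 0" using vec[of x] by (simp add: vec_eq_iff)
    then show False using that by simp
  qed
  \<comment> \<open>\<open>k\<close> is the reciprocal of the variance of one jump; it is the slope
    of the linear lower bound \<open>lin\<close> on \<open>rho\<close>.\<close>
  define k where "k = 2 * pi * r * (gamma_d a)\<^sup>2"
  have k: "k > 0" using r_pos gamma_pos by (simp add: k_def)
  \<comment> \<open>\<open>C1\<close> cleared of its denominator and grouped by the ratio
    \<open>k * sc v / rho a v\<close>, whose modulus is below 1 by \<open>lin\<close>. The parameter
    v stays variable because \<open>lin\<close> uses the instance v = x, u = -x.\<close>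
  define PD where "PD v u = (1 + (k * sc v / rho a v)\<^sup>2) * (rho a (v - u) - rho a v) + (1 - (k * sc v / rho a v)\<^sup>2) * rho a u + 2 * k * sc u * (k * sc v / rho a v)" for v u :: "int^'n"
  have PD: "C1 a u v * (4 * r * pi * gamma_d a) = PD v u" for u v :: "int^'n"
  proof -
    have "((A + B - R) / (4 * r * pi * \<gamma>) + r * pi * v\<^sup>2 * \<gamma> ^ 3 * (A - B - R) / R\<^sup>2 + 2 * r * pi * u * v * \<gamma> ^ 3 / R) * (4 * r * pi * \<gamma>)
      = (1 + (2 * pi * r * \<gamma>\<^sup>2 * v / R)\<^sup>2) * (A - R) + (1 - (2 * pi * r * \<gamma>\<^sup>2 * v / R)\<^sup>2) * B + 2 * (2 * pi * r * \<gamma>\<^sup>2) * u * ((2 * pi * r * \<gamma>\<^sup>2) * v / R)"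
      if "\<gamma> > 0" "R > 0" for A B R u v \<gamma> :: real
    proof -
      have "(A + B - R) / (4 * r * pi * \<gamma>) * (4 * r * pi * \<gamma>) = A + B - R" using that r_pos by simp
      moreover have "2 * r * pi * u * v * \<gamma> ^ 3 / R * (4 * r * pi * \<gamma>) = 2 * (2 * pi * r * \<gamma>\<^sup>2) * u * ((2 * pi * r * \<gamma>\<^sup>2) * v / R)"
        by (simp add: power2_eq_square power3_eq_cube)
      moreover have "r * pi * v\<^sup>2 * \<gamma> ^ 3 * (A - B - R) / R\<^sup>2 * (4 * r * pi * \<gamma>) = (2 * pi * r * \<gamma>\<^sup>2 * v / R)\<^sup>2 * (A - B - R)"
        by (simp add: power2_eq_square power3_eq_cube)
      ultimately show ?thesis by (simp only: distrib_right) (simp add: algebra_simps)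
    qed
    from this[OF gamma_pos rho_pos, of "rho a (v - u)" "rho a u" v "sc v" "sc u"]
    show ?thesis unfolding C1_def PD_def k_def by (simp add: mult.assoc)
  qed
  have cpos: "4 * r * pi * gamma_d a > 0" using r_pos gamma_pos by simp
  have PD_nonneg: "PD v u \<ge> 0" if "v \<noteq> 0" for v u
    unfolding PD[symmetric] by (rule mult_nonneg_nonneg[OF C1_nonneg[OF c1 that] less_imp_le[OF cpos]])
  \<comment> \<open>Nonnegativity at (x, -x) reads \<open>4 * \<beta>\<^sup>2 * rho a x \<le> (1 +
    \<beta>\<^sup>2) * rho a (x + x)\<close>; the strict triangle inequality
    \<open>rho a (x + x) < 2 * rho a x\<close> then forces
    \<open>\<beta>\<^sup>2 < 1\<close>.\<close>
  have lin: "k * \<bar>sc x\<bar> < rho a x" if x: "x \<noteq> 0" for x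
  proof -
    define \<beta> where "\<beta> = k * sc x / rho a x"
    have R: "rho a x > 0" by (rule rho_pos)
    have xx: "x + x \<noteq> 0" using vec0[OF x] by (auto simp: vec_eq_iff)
    have st: "rho a (x + x) < 2 * rho a x" using rho_strict[OF ns xx, of x] by simp
    have "0 \<le> PD x (- x)" by (rule PD_nonneg[OF x])
    also have "\<dots> = (1 + \<beta>\<^sup>2) * (rho a (x + x) - rho a x) + (1 - \<beta>\<^sup>2) * rho a x - 2 * (k * sc x) * \<beta>"
      by (simp add: PD_def \<beta>_def rho_sym sc)
    also have "k * sc x = \<beta> * rho a x" using R by (simp add: \<beta>_def)
    also have "(1 + \<beta>\<^sup>2) * (rho a (x + x) - rho a x) + (1 - \<beta>\<^sup>2) * rho a x - 2 * (\<beta> * rho a x) * \<beta> = (1 + \<beta>\<^sup>2) * rho a (x + x) - 4 * \<beta>\<^sup>2 * rho a x"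
      by (simp add: algebra_simps power2_eq_square)
    finally have "4 * \<beta>\<^sup>2 * rho a x \<le> (1 + \<beta>\<^sup>2) * rho a (x + x)" by simp
    also have "\<dots> < (1 + \<beta>\<^sup>2) * (2 * rho a x)" using st by (intro mult_strict_left_mono) (auto simp: add_pos_nonneg)
    finally have "(4 * \<beta>\<^sup>2) * rho a x < (2 + 2 * \<beta>\<^sup>2) * rho a x" by (simp add: algebra_simps)
    then have "\<beta>\<^sup>2 < 1" using R by simp
    then have "\<bar>\<beta>\<bar> < 1" by (simp add: abs_square_less_1)
    then show ?thesis using R k by (simp add: \<beta>_def abs_mult abs_divide divide_less_eq)
  qed
  have lin0: "k * \<bar>sc x\<bar> \<le> rho0 x" for x
    using lin[of x] by (cases "x = 0") (auto simp: rho0_0 sc rho0_eq less_imp_le)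
  define R where "R = rho a v"
  have R: "R > 0" by (simp add: R_def rho_pos)
  define \<beta> where "\<beta> = k * sc v / R"
  have \<beta>R: "k * sc v = \<beta> * R" using R by (simp add: \<beta>_def)
  have \<beta>1: "\<bar>\<beta>\<bar> < 1" using lin[OF v] R k by (simp add: \<beta>_def R_def abs_mult abs_divide)
  then have \<beta>2: "\<beta>\<^sup>2 < 1" by (simp add: abs_square_less_1)
  define D where "D x = (1 + \<beta>\<^sup>2) * (rho0 (v - x) - R) + (1 - \<beta>\<^sup>2) * rho0 x + 2 * k * sc x * \<beta>" for x
  have PDv: "PD v x = (1 + \<beta>\<^sup>2) * (rho a (v - x) - R) + (1 - \<beta>\<^sup>2) * rho a x + 2 * k * sc x * \<beta>" for x
    by (simp add: PD_def \<beta>_def R_def)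
  have D0: "D 0 = 0" using v by (simp add: D_def rho0_eq rho0_0 R_def sc)
  have Dv: "D v = 0"
  proof -
    have "D v = (1 + \<beta>\<^sup>2) * (0 - R) + (1 - \<beta>\<^sup>2) * R + 2 * (k * sc v) * \<beta>" using v by (simp add: D_def rho0_eq rho0_0 R_def)
    then show ?thesis unfolding \<beta>R by (simp add: algebra_simps power2_eq_square)
  qed
  have DPD: "D x = PD v x" if "x \<noteq> 0" "x \<noteq> v" for x using that by (simp add: D_def PDv rho0_eq)
  have D_nonneg: "D x \<ge> 0" for x using DPD[of x] D0 Dv PD_nonneg[OF v, of x] by (cases "x = 0 \<or> x = v") auto
  \<comment> \<open>Averaging over w and -w together cancels the variation of the linear part of
    \<open>D\<close>, so that only \<open>rho0_harmonic\<close> is needed.\<close>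
  have mean: "has_bochner_integral (measure_pmf J) (\<lambda>w. D (x + w) + D (x - w)) (2 * PD v x)" for x
  proof -
    have "has_bochner_integral (measure_pmf J) (\<lambda>w. (1 + \<beta>\<^sup>2) * (rho0 ((v - x) - w) + rho0 ((v - x) + w)) + (1 - \<beta>\<^sup>2) * (rho0 (x + w) + rho0 (x - w)) + (4 * k * sc x * \<beta> - 2 * (1 + \<beta>\<^sup>2) * R))
      ((1 + \<beta>\<^sup>2) * (rho a (v - x) + rho a (v - x)) + (1 - \<beta>\<^sup>2) * (rho a x + rho a x) + (4 * k * sc x * \<beta> - 2 * (1 + \<beta>\<^sup>2) * R))"
      by (intro has_bochner_integral_add has_bochner_integral_mult_right rho0_harmonic rho0_harmonic_minus)
        (simp add: has_bochner_integral_iff)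
    moreover have "D (x + w) + D (x - w) = (1 + \<beta>\<^sup>2) * (rho0 ((v - x) - w) + rho0 ((v - x) + w)) + (1 - \<beta>\<^sup>2) * (rho0 (x + w) + rho0 (x - w)) + (4 * k * sc x * \<beta> - 2 * (1 + \<beta>\<^sup>2) * R)" for w
      unfolding D_def sc by (simp add: algebra_simps)
    moreover have "2 * PD v x = (1 + \<beta>\<^sup>2) * (rho a (v - x) + rho a (v - x)) + (1 - \<beta>\<^sup>2) * (rho a x + rho a x) + (4 * k * sc x * \<beta> - 2 * (1 + \<beta>\<^sup>2) * R)"
      unfolding PDv by (simp add: algebra_simps)
    ultimately show ?thesis by simp
  qed
  have spread: "D (x + w) = 0 \<and> D (x - w) = 0" if P0: "PD v x = 0" and w: "b w > 0" for x w
  proof -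
    have "(LINT w|measure_pmf J. D (x + w) + D (x - w)) = 0" and int: "integrable (measure_pmf J) (\<lambda>w. D (x + w) + D (x - w))"
      using mean[of x] P0 by (auto simp: has_bochner_integral_iff)
    then have "AE w in measure_pmf J. D (x + w) + D (x - w) = 0"
      using integral_nonneg_eq_0_iff_AE[OF int] D_nonneg by (simp add: add_nonneg_nonneg)
    then have "D (x + w) + D (x - w) = 0"
      using w by (simp add: AE_measure_pmf_iff set_pmf_iff pmf_J)
    then show ?thesis using D_nonneg[of "x + w"] D_nonneg[of "x - w"] by linarith
  qed
  have "PD v u \<noteq> 0"
  proof
    assume P0: "PD v u = 0"
    obtain g h where gh: "b g > 0" "b h > 0" "h \<noteq> g" "h \<noteq> - g" using not_srw_steps[OF ns] by blast
    have nz: "g \<noteq> 0" "h \<noteq> 0" using gh by (auto simp: b_def)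
    define V :: "int \<Rightarrow> int^'n" where "V n = (\<chi> j. n)" for n
    have Vi: "V (x $ i) = x" for x :: "int^'n" using vec[of x] by (simp add: V_def)
    have Vadd: "V (m + n) = V m + V n" "V (m - n) = V m - V n" for m n by (simp_all add: V_def vec_eq_iff)
    have Vn: "V m $ i = m" for m by (simp add: V_def)
    define Z where "Z = {n. D (V n) = 0}"
    define g' h' where "g' = \<bar>g $ i\<bar>" and "h' = \<bar>h $ i\<bar>"
    have Vabs: "V \<bar>w $ i\<bar> = w \<or> V \<bar>w $ i\<bar> = - w" for w :: "int^'n"
      using Vi[of w] Vi[of "- w"] by (auto simp: abs_if)
    have st: "V m $ i + g' \<in> Z \<and> V m $ i - g' \<in> Z \<and> V m $ i + h' \<in> Z \<and> V m $ i - h' \<in> Z" if "PD v (V m) = 0" for m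
      using spread[OF that gh(1)] spread[OF that gh(2)] Vabs[of g] Vabs[of h]
      by (auto simp: Z_def g'_def h'_def Vn Vadd)
    have fin: "finite Z"
    proof -
      \<comment> \<open>\<open>D\<close> grows at least like
        \<open>2 * k * (1 - \<bar>\<beta>\<bar>) * \<bar>sc x\<bar>\<close> up to a constant: the
        weights \<open>1 + \<beta>\<^sup>2\<close> and \<open>1 - \<beta>\<^sup>2\<close> add up to
        2, and the linear term costs at most
        \<open>2 * k * \<bar>\<beta>\<bar> * \<bar>sc x\<bar>\<close>.\<close>
      have "\<bar>n\<bar> \<le> \<lceil>(1 + \<beta>\<^sup>2) * (k * \<bar>sc v\<bar> + R) / (2 * k * (1 - \<bar>\<beta>\<bar>))\<rceil>" if n: "n \<in> Z" for n
      proof -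
        let ?x = "V n"
        have scx: "sc ?x = real_of_int n" by (simp add: sc Vn)
        have "k * (\<bar>sc ?x\<bar> - \<bar>sc v\<bar>) \<le> k * \<bar>sc (v - ?x)\<bar>" using k by (intro mult_left_mono) (auto simp: sc)
        then have "k * \<bar>sc ?x\<bar> - k * \<bar>sc v\<bar> \<le> rho0 (v - ?x)" using lin0[of "v - ?x"] by (simp add: right_diff_distrib)
        then have "(1 + \<beta>\<^sup>2) * (k * \<bar>sc ?x\<bar> - k * \<bar>sc v\<bar> - R) \<le> (1 + \<beta>\<^sup>2) * (rho0 (v - ?x) - R)" by (intro mult_left_mono) auto
        moreover have "(1 - \<beta>\<^sup>2) * (k * \<bar>sc ?x\<bar>) \<le> (1 - \<beta>\<^sup>2) * rho0 ?x" using \<beta>2 lin0 by (intro mult_left_mono) auto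
        moreover have "- (2 * k * (\<bar>sc ?x\<bar> * \<bar>\<beta>\<bar>)) \<le> 2 * k * sc ?x * \<beta>"
        proof -
          have "- (\<bar>sc ?x\<bar> * \<bar>\<beta>\<bar>) \<le> sc ?x * \<beta>" unfolding abs_mult[symmetric] by simp
          then have "2 * k * (- (\<bar>sc ?x\<bar> * \<bar>\<beta>\<bar>)) \<le> 2 * k * (sc ?x * \<beta>)" using k by (intro mult_left_mono) auto
          then show ?thesis by (simp add: mult.assoc)
        qed
        moreover have "D ?x = 0" using n by (simp add: Z_def)
        ultimately have "(1 + \<beta>\<^sup>2) * (k * \<bar>sc ?x\<bar> - k * \<bar>sc v\<bar> - R) + (1 - \<beta>\<^sup>2) * (k * \<bar>sc ?x\<bar>) - 2 * k * (\<bar>sc ?x\<bar> * \<bar>\<beta>\<bar>) \<le> 0"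
          unfolding D_def by linarith
        then have "\<bar>sc ?x\<bar> * (2 * k * (1 - \<bar>\<beta>\<bar>)) \<le> (1 + \<beta>\<^sup>2) * (k * \<bar>sc v\<bar> + R)" by (simp add: algebra_simps)
        then have "\<bar>real_of_int n\<bar> \<le> (1 + \<beta>\<^sup>2) * (k * \<bar>sc v\<bar> + R) / (2 * k * (1 - \<bar>\<beta>\<bar>))"
          using k \<beta>1 by (simp add: pos_le_divide_eq scx)
        then show ?thesis by linarith
      qed
      then show ?thesis
        by (intro finite_subset[of Z "{- \<lceil>(1 + \<beta>\<^sup>2) * (k * \<bar>sc v\<bar> + R) / (2 * k * (1 - \<bar>\<beta>\<bar>))\<rceil> .. \<lceil>(1 + \<beta>\<^sup>2) * (k * \<bar>sc v\<bar> + R) / (2 * k * (1 - \<bar>\<beta>\<bar>))\<rceil>}"])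
          (auto simp: abs_le_iff minus_le_iff)
    qed
    show False
    proof (rule no_finite_step_closed[OF fin, of g' h' "u $ i" "v $ i"])
      show "0 < g'" "0 < h'" using vec0 nz by (auto simp: g'_def h'_def)
      show "g' \<noteq> h'"
      proof
        assume "g' = h'"
        then have "V (h $ i) = V (g $ i) \<or> V (h $ i) = V (- (g $ i))" unfolding g'_def h'_def by (metis abs_eq_iff)
        then show False using gh(3,4) Vi[of g] Vi[of h] Vi[of "- g"] by auto
      qed
      show "u $ i + g' \<in> Z" "u $ i - g' \<in> Z" "u $ i + h' \<in> Z" "u $ i - h' \<in> Z"
        using st[of "u $ i"] P0 by (auto simp: Vi Vn)
      fix z assume z: "z \<in> Z" "z \<notin> {0, v $ i}"
      have "V z \<noteq> 0" "V z \<noteq> v" using z Vn[of z] by auto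
      then have "PD v (V z) = 0" using DPD[of "V z"] z by (simp add: Z_def)
      from st[OF this] show "z + g' \<in> Z \<and> z - g' \<in> Z \<and> z + h' \<in> Z \<and> z - h' \<in> Z" by (simp add: Vn)
    qed
  qed
  then have "C1 a u v \<noteq> 0" using PD[of u v] by auto
  then show ?thesis using C1_nonneg[OF c1 v, of u] by simp
qed

end

section \<open>Tails in dimension at least three\<close>

lemma sums_integral_nonneg:
  fixes f :: "nat \<Rightarrow> 'a \<Rightarrow> real"
  assumes m: "\<And>n. f n \<in> borel_measurable M" and nn: "\<And>n s. 0 \<le> f n s"
    and s: "\<And>s. (\<lambda>n. f n s) sums F s" and F: "integrable M F"
  shows "(\<lambda>n. LINT s|M. f n s) sums (LINT s|M. F s)" and "\<And>n. integrable M (f n)"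
proof -
  have part: "(\<Sum>i<n. f i t) \<le> F t" for n t
    using sum_le_suminf[OF sums_summable[OF s[of t]], of "{..<n}"] nn sums_unique[OF s[of t]] by simp
  have F0: "0 \<le> F t" for t using part[where n = 0] by simp
  have le: "f n t \<le> F t" for n t
  proof -
    have "f n t \<le> (\<Sum>i<Suc n. f i t)" using nn by (simp add: sum_nonneg)
    also have "\<dots> \<le> F t" by (rule part)
    finally show ?thesis .
  qed
  show int: "integrable M (f n)" for n
    by (rule Bochner_Integration.integrable_bound[OF F m]) (use le nn F0 in auto)
  have "summable (\<lambda>n. LINT s|M. f n s)"
  proof (rule summableI_nonneg_bounded)
    show "0 \<le> (LINT s|M. f n s)" for n by (intro integral_nonneg_AE AE_I2 nn)
    fix n
    have "(\<Sum>i<n. (LINT s|M. f i s)) = (LINT s|M. (\<Sum>i<n. f i s))" using int by simp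
    also have "\<dots> \<le> (LINT s|M. F s)" using int F part by (intro integral_mono) auto
    finally show "(\<Sum>i<n. (LINT s|M. f i s)) \<le> (LINT s|M. F s)" .
  qed
  then have "(\<lambda>n. LINT s|M. f n s) sums (LINT s|M. (\<Sum>n. f n s))"
    using nn sums_summable[OF s] by (intro sums_integral int) auto
  then show "(\<lambda>n. LINT s|M. f n s) sums (LINT s|M. F s)" using sums_unique[OF s] by simp
qed

text \<open>All terms are nonnegative, so rows and antidiagonals give the same total; unordered
  summation makes this a reindexing.\<close>

lemma sums_diagonal:
  fixes A :: "nat \<Rightarrow> nat \<Rightarrow> real"
  assumes nn: "\<And>j m. 0 \<le> A j m" and row: "\<And>j. A j sums B j" and col: "B sums T"
  shows "(\<lambda>n. \<Sum>j\<le>n. A j (n - j)) sums T"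
proof -
  have B0: "0 \<le> B j" for j using sums_le[OF nn sums_zero row] .
  have rowh: "(A j has_sum B j) UNIV" for j by (rule sums_nonneg_imp_has_sum[OF row nn])
  have colh: "(B has_sum T) UNIV" by (rule sums_nonneg_imp_has_sum[OF col B0])
  have summ: "(\<lambda>(j, m). A j m) summable_on (UNIV \<times> UNIV)"
    by (rule summable_on_SigmaI[where g = B]) (use rowh colh nn in \<open>auto intro: has_sum_imp_summable\<close>)
  have "((\<lambda>(j, m). A j m) has_sum T) (UNIV \<times> UNIV)"
    by (rule has_sum_SigmaI[where g = B]) (use rowh colh summ in auto)
  moreover have "bij_betw (\<lambda>(n, j). (j, n - j)) (Sigma UNIV (\<lambda>n. {..n})) (UNIV \<times> (UNIV :: nat set))"
    by (rule bij_betw_byWitness[where f' = "\<lambda>(j, m). (j + m, j)"]) auto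
  ultimately have "((\<lambda>z. case (case z of (n, j) \<Rightarrow> (j, n - j)) of (j, m) \<Rightarrow> A j m) has_sum T) (Sigma UNIV (\<lambda>n. {..n}))"
    by (simp only: has_sum_reindex_bij_betw[of "\<lambda>(n, j). (j, n - j)" _ _ "\<lambda>(j, m). A j m"])
  then have "((\<lambda>n. \<Sum>j\<le>n. A j (n - j)) has_sum T) UNIV"
    by (rule has_sum_SigmaD) (auto intro!: has_sum_finiteI)
  then show ?thesis by (rule has_sum_imp_sums)
qed

lemma has_bochner_integral_powr_tail:
  fixes \<beta> t :: real
  assumes \<beta>: "\<beta> > 0" and t: "t > 0"
  shows "has_bochner_integral lborel (\<lambda>s. indicator {t..} s * s powr (- (\<beta> + 1))) (t powr (- \<beta>) / \<beta>)"
proof (rule has_bochner_integral_nn_integral)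
  have "(\<integral>\<^sup>+ s. ennreal (indicator {t..} s * s powr (- (\<beta> + 1))) \<partial>lborel) = (\<integral>\<^sup>+ s. ennreal (s powr (- (\<beta> + 1))) * indicator {t..} s \<partial>lborel)"
    by (intro nn_integral_cong) (simp add: indicator_def)
  also have "\<dots> = ennreal (0 - (- (t powr (- \<beta>) / \<beta>)))"
  proof (rule nn_integral_FTC_atLeast)
    show "((\<lambda>s. - (s powr (- \<beta>) / \<beta>)) \<longlongrightarrow> 0) at_top"
      using tendsto_minus[OF tendsto_divide_zero[OF tendsto_neg_powr[OF _ filterlim_ident, of "- \<beta>"], of \<beta>]] \<beta> by simp
    show "DERIV (\<lambda>s. - (s powr (- \<beta>) / \<beta>)) s :> s powr (- (\<beta> + 1))" if "t \<le> s" for s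
      using that t \<beta> by (auto intro!: derivative_eq_intros simp: powr_diff powr_minus field_simps powr_add)
  qed auto
  finally show "(\<integral>\<^sup>+ s. ennreal (indicator {t..} s * s powr (- (\<beta> + 1))) \<partial>lborel) = ennreal (t powr (- \<beta>) / \<beta>)" by simp
qed (use \<beta> in auto)

text \<open>The kernel is lighter than W by a full power. On s \<le> t / 2 the factor
  \<open>W (t - s)\<close> behaves like \<open>W t\<close>, and dominated convergence gives c * F;
  on s > t / 2 the kernel is of order \<open>t powr (- (\<beta> + 1))\<close>, and the integral of W
  over an interval of length t / 2 is o(t) because W tends to 0.\<close>

lemma tendsto_convolution:
  fixes k W :: "real \<Rightarrow> real"
  assumes \<beta>: "\<beta> > 0"
    and km[measurable]: "k \<in> borel_measurable borel" and Wm[measurable]: "W \<in> borel_measurable borel"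
    and k0: "\<And>s. s \<ge> 0 \<Longrightarrow> 0 \<le> k s" and kA: "\<And>s. s > 0 \<Longrightarrow> k s \<le> A * s powr (- (\<beta> + 1))"
    and kF: "has_bochner_integral lborel (\<lambda>s. indicator {0..} s * k s) F"
    and W0: "\<And>s. s \<ge> 0 \<Longrightarrow> 0 \<le> W s" and Wb: "\<And>s. s \<ge> 0 \<Longrightarrow> W s \<le> G" and WK: "\<And>s. s > 0 \<Longrightarrow> W s \<le> K * s powr (- \<beta>)"
    and lim: "((\<lambda>t. t powr \<beta> * W t) \<longlongrightarrow> c) at_top"
  shows "((\<lambda>t. t powr \<beta> * (LINT s|lborel. indicator {0..t} s * (k s * W (t - s)))) \<longlongrightarrow> c * F) at_top"
proof -
  have G0: "G \<ge> 0" using W0[of 0] Wb[of 0] by simp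
  have K0: "K \<ge> 0" using W0[of 1] WK[of 1] by simp
  have A0: "A \<ge> 0" using k0[of 1] kA[of 1] by simp
  have kint: "integrable lborel (\<lambda>s. indicator {0..} s * k s)" using kF by (simp add: has_bochner_integral_iff)
  have int_ind: "integrable lborel (indicator {u..v} :: real \<Rightarrow> real)" for u v :: real
    by (rule integrable_real_indicator) (auto simp: emeasure_lborel_Icc_eq)
  have Wlim: "(W \<longlongrightarrow> 0) at_top"
  proof (rule tendsto_sandwich[OF _ _ tendsto_const])
    show "\<forall>\<^sub>F s in at_top. 0 \<le> W s" using eventually_ge_at_top[of "0::real"] by eventually_elim (rule W0)
    show "\<forall>\<^sub>F s in at_top. W s \<le> K * s powr (- \<beta>)" using eventually_gt_at_top[of "0::real"] by eventually_elim (rule WK)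
    show "((\<lambda>s. K * s powr (- \<beta>)) \<longlongrightarrow> 0) at_top"
      using tendsto_mult_right_zero[OF tendsto_neg_powr[OF _ filterlim_ident, of "- \<beta>"], of K] \<beta> by simp
  qed
  have first: "((\<lambda>t. LINT s|lborel. indicator {0..t/2} s * k s * (t powr \<beta> * W (t - s))) \<longlongrightarrow> (LINT s|lborel. indicator {0..} s * k s * c)) at_top"
  proof (rule integral_dominated_convergence_at_top)
    show "integrable lborel (\<lambda>s. (K * 2 powr \<beta>) * (indicator {0..} s * k s))" by (intro integrable_mult_right kint)
    show "\<forall>\<^sub>F t in at_top. AE s in lborel. norm (indicator {0..t/2} s * k s * (t powr \<beta> * W (t - s))) \<le> (K * 2 powr \<beta>) * (indicator {0..} s * k s)"
      using eventually_gt_at_top[of "0::real"]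
    proof eventually_elim
      case (elim t)
      have "norm (indicator {0..t/2} s * k s * (t powr \<beta> * W (t - s))) \<le> (K * 2 powr \<beta>) * (indicator {0..} s * k s)" for s
      proof (cases "s \<in> {0..t/2}")
        case True
        then have ts: "t - s > 0" "t - s \<ge> t / 2" using elim by auto
        have "t powr \<beta> * W (t - s) \<le> t powr \<beta> * (K * (t - s) powr (- \<beta>))" by (intro mult_left_mono WK ts) simp
        also have "(t - s) powr (- \<beta>) \<le> (t / 2) powr (- \<beta>)" using ts elim \<beta> by (intro powr_mono2') auto
        then have "t powr \<beta> * (K * (t - s) powr (- \<beta>)) \<le> t powr \<beta> * (K * (t / 2) powr (- \<beta>))" using K0 by (intro mult_left_mono) auto
        also have "\<dots> = K * 2 powr \<beta>" using elim by (simp add: powr_divide powr_minus)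
        finally have "t powr \<beta> * W (t - s) \<le> K * 2 powr \<beta>" .
        moreover have "0 \<le> t powr \<beta> * W (t - s)" using W0[of "t - s"] ts by simp
        moreover have "0 \<le> k s" using k0 True by simp
        ultimately have "k s * (t powr \<beta> * W (t - s)) \<le> k s * (K * 2 powr \<beta>)" "0 \<le> k s * (t powr \<beta> * W (t - s))" by (auto intro: mult_left_mono)
        then show ?thesis using True by (simp add: mult.commute)
      next
        case False
        then have "norm (indicator {0..t/2} s * k s * (t powr \<beta> * W (t - s))) = 0" by simp
        also have "0 \<le> (K * 2 powr \<beta>) * (indicator {0..} s * k s)" using K0 k0[of s] by (simp add: indicator_def)
        finally show ?thesis .
      qed
      then show ?case by simp
    qed
    show "AE s in lborel. ((\<lambda>t. indicator {0..t/2} s * k s * (t powr \<beta> * W (t - s))) \<longlongrightarrow> indicator {0..} s * k s * c) at_top"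
    proof (rule AE_I2)
      fix s :: real
      show "((\<lambda>t. indicator {0..t/2} s * k s * (t powr \<beta> * W (t - s))) \<longlongrightarrow> indicator {0..} s * k s * c) at_top"
      proof (cases "s \<ge> 0")
        case True
        have sh: "filterlim (\<lambda>t. t - s) at_top at_top" by real_asymp
        have "((\<lambda>t. (t / (t - s)) powr \<beta>) \<longlongrightarrow> 1 powr \<beta>) at_top"
        proof (rule tendsto_powr[OF _ tendsto_const])
          show "((\<lambda>t. t / (t - s)) \<longlongrightarrow> 1) at_top" by real_asymp
        qed simp
        then have "((\<lambda>t. k s * ((t / (t - s)) powr \<beta> * ((t - s) powr \<beta> * W (t - s)))) \<longlongrightarrow> k s * (1 powr \<beta> * c)) at_top"
          by (intro tendsto_mult tendsto_const filterlim_compose[OF lim sh])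
        then have "((\<lambda>t. k s * ((t / (t - s)) powr \<beta> * ((t - s) powr \<beta> * W (t - s)))) \<longlongrightarrow> indicator {0..} s * k s * c) at_top"
          using True by simp
        then show ?thesis
        proof (rule Lim_transform_eventually)
          show "\<forall>\<^sub>F t in at_top. k s * ((t / (t - s)) powr \<beta> * ((t - s) powr \<beta> * W (t - s))) = indicator {0..t/2} s * k s * (t powr \<beta> * W (t - s))"
            using eventually_gt_at_top[of "2 * s"] eventually_gt_at_top[of 0]
          proof eventually_elim
            case (elim t)
            have "t - s > 0" using elim True by linarith
            then have "(t / (t - s)) powr \<beta> * (t - s) powr \<beta> = t powr \<beta>" using elim by (simp add: powr_divide)
            then have "k s * ((t / (t - s)) powr \<beta> * ((t - s) powr \<beta> * W (t - s))) = k s * (t powr \<beta> * W (t - s))"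
              by (simp only: mult.assoc[symmetric])
            then show ?case using elim True by simp
          qed
        qed
      qed simp
    qed
  qed auto
  \<comment> \<open>The integral of W over [0, t / 2], divided by t, in the rescaled variable w; the
    bound G makes pointwise convergence to 0 sufficient.\<close>
  have avg: "((\<lambda>t. LINT w|lborel. indicator {0..1/2} w * W (t * w)) \<longlongrightarrow> (LINT w|lborel. 0 * (w :: real))) at_top"
  proof (rule integral_dominated_convergence_at_top)
    show "integrable lborel (\<lambda>w. indicator {0..1/2::real} w * G)" by (intro integrable_mult_left int_ind)
    show "\<forall>\<^sub>F t in at_top. AE w in lborel. norm (indicator {0..1/2} w * W (t * w)) \<le> indicator {0..1/2} w * G"
      using eventually_gt_at_top[of "0::real"]
    proof eventually_elim
      case (elim t)
      have "norm (indicator {0..1/2} w * W (t * w)) \<le> indicator {0..1/2} w * G" for w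
        using W0[of "t * w"] Wb[of "t * w"] elim by (cases "w \<in> {0..1/2}") auto
      then show ?case by simp
    qed
    show "AE w in lborel. ((\<lambda>t. indicator {0..1/2} w * W (t * w)) \<longlongrightarrow> 0 * (w::real)) at_top"
      using AE_lborel_singleton[of "0::real"]
    proof eventually_elim
      case (elim w)
      show ?case
      proof (cases "w > 0")
        case True
        have "filterlim (\<lambda>t. t * w) at_top at_top"
          using filterlim_tendsto_pos_mult_at_top[OF tendsto_const True filterlim_ident] by (simp add: mult.commute)
        from filterlim_compose[OF Wlim this] show ?thesis by (auto intro: tendsto_mult_right_zero)
      next
        case False
        then have "indicator {0..1/2} w = (0::real)" using elim by auto
        then show ?thesis by simp
      qed
    qed
  qed auto
  define B where "B = A * 2 powr (\<beta> + 1)"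
  have kb: "k s \<le> B * t powr (- (\<beta> + 1))" if "s \<ge> t / 2" "t > 0" for s t
  proof -
    have "k s \<le> A * s powr (- (\<beta> + 1))" by (rule kA) (use that in simp)
    also have "\<dots> \<le> A * (t / 2) powr (- (\<beta> + 1))" using that \<beta> A0 by (intro mult_left_mono powr_mono2') auto
    also have "(t / 2) powr (- \<eta>) = 2 powr \<eta> * t powr (- \<eta>)" for \<eta>
      using that by (simp add: powr_divide powr_minus field_simps)
    also have "A * (2 powr (\<beta> + 1) * t powr (- (\<beta> + 1))) = B * t powr (- (\<beta> + 1))" by (simp add: B_def)
    finally show ?thesis .
  qed
  have B0: "B \<ge> 0" using A0 by (simp add: B_def)
  let ?S = "\<lambda>t. LINT s|lborel. indicator {t/2<..t} s * (k s * W (t - s))"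
  have i2: "integrable lborel (\<lambda>s. indicator {t/2<..t} s * (k s * W (t - s)))" if "t > 0" for t
  proof (rule Bochner_Integration.integrable_bound[of lborel "\<lambda>s. indicator {0..} s * k s * G"])
    show "AE s in lborel. norm (indicator {t/2<..t} s * (k s * W (t - s))) \<le> norm (indicator {0..} s * k s * G)"
    proof (rule AE_I2)
      fix s
      show "norm (indicator {t/2<..t} s * (k s * W (t - s))) \<le> norm (indicator {0..} s * k s * G)"
        using k0[of s] W0[of "t - s"] Wb[of "t - s"] G0 that by (cases "s \<in> {t/2<..t}") (auto simp: abs_mult intro!: mult_left_mono)
    qed
  qed (use kint in auto)
  have i1: "integrable lborel (\<lambda>s. indicator {0..t/2} s * (k s * W (t - s)))" if "t > 0" for t
  proof (rule Bochner_Integration.integrable_bound[of lborel "\<lambda>s. indicator {0..} s * k s * G"])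
    show "AE s in lborel. norm (indicator {0..t/2} s * (k s * W (t - s))) \<le> norm (indicator {0..} s * k s * G)"
    proof (rule AE_I2)
      fix s
      show "norm (indicator {0..t/2} s * (k s * W (t - s))) \<le> norm (indicator {0..} s * k s * G)"
        using k0[of s] W0[of "t - s"] Wb[of "t - s"] G0 that by (cases "s \<in> {0..t/2}") (auto simp: abs_mult intro!: mult_left_mono)
    qed
  qed (use kint in auto)
  have second: "((\<lambda>t. t powr \<beta> * ?S t) \<longlongrightarrow> 0) at_top"
  proof (rule tendsto_sandwich[OF _ _ tendsto_const])
    show "((\<lambda>t. B * (LINT w|lborel. indicator {0..1/2} w * W (t * w))) \<longlongrightarrow> 0) at_top"
      using tendsto_mult_right_zero[OF avg[simplified]] by simp
    show "\<forall>\<^sub>F t in at_top. 0 \<le> t powr \<beta> * ?S t"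
      using eventually_gt_at_top[of "0::real"]
    proof eventually_elim
      case (elim t)
      have "0 \<le> indicator {t/2<..t} s * (k s * W (t - s))" for s
        using k0[of s] W0[of "t - s"] elim by (cases "s \<in> {t/2<..t}") auto
      then have "0 \<le> ?S t" by (intro integral_nonneg_AE AE_I2)
      then show ?case by simp
    qed
    show "\<forall>\<^sub>F t in at_top. t powr \<beta> * ?S t \<le> B * (LINT w|lborel. indicator {0..1/2} w * W (t * w))"
      using eventually_gt_at_top[of "0::real"]
    proof eventually_elim
      case (elim t)
      have iW: "integrable lborel (\<lambda>s. indicator {t/2..t} s * W (t - s))"
      proof (rule Bochner_Integration.integrable_bound[of lborel "\<lambda>s. indicator {t/2..t} s * G"])
        show "AE s in lborel. norm (indicator {t/2..t} s * W (t - s)) \<le> norm (indicator {t/2..t} s * G)"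
        proof (rule AE_I2)
          fix s show "norm (indicator {t/2..t} s * W (t - s)) \<le> norm (indicator {t/2..t} s * G)"
            using W0[of "t - s"] Wb[of "t - s"] G0 by (cases "s \<in> {t/2..t}") auto
        qed
      qed (auto intro!: integrable_mult_left int_ind)
      have "?S t \<le> (LINT s|lborel. (B * t powr (- (\<beta> + 1))) * (indicator {t/2..t} s * W (t - s)))"
      proof (rule integral_mono[OF i2[OF elim] integrable_mult_right[OF iW]])
        fix s
        show "indicator {t/2<..t} s * (k s * W (t - s)) \<le> (B * t powr (- (\<beta> + 1))) * (indicator {t/2..t} s * W (t - s))"
        proof (cases "s \<in> {t/2<..t}")
          case True
          then show ?thesis using mult_right_mono[OF kb[of t s] W0[of "t - s"]] elim by simp
        next
          case False
          then show ?thesis using B0 W0[of "t - s"] by (auto simp: indicator_def)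
        qed
      qed
      also have "\<dots> = (B * t powr (- (\<beta> + 1))) * (LINT s|lborel. indicator {t/2..t} s * W (t - s))"
        by (rule integral_mult_right_zero)
      also have "(LINT s|lborel. indicator {t/2..t} s * W (t - s)) = t * (LINT w|lborel. indicator {0..1/2} w * W (t * w))"
      proof -
        have ind: "indicator {t/2..t} (t + (- t) * w) = (indicator {0..1/2} w :: real)" for w
          using elim by (auto simp: indicator_def field_simps zero_le_mult_iff)
        have "(LINT s|lborel. indicator {t/2..t} s * W (t - s)) = \<bar>- t\<bar> *\<^sub>R (LINT w|lborel. indicator {t/2..t} (t + (- t) * w) * W (t - (t + (- t) * w)))"
          by (rule lborel_integral_real_affine) (use elim in simp)
        then show ?thesis unfolding ind using elim by simp
      qed
      finally have "t powr \<beta> * ?S t \<le> t powr \<beta> * ((B * t powr (- (\<beta> + 1))) * (t * (LINT w|lborel. indicator {0..1/2} w * W (t * w))))"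
        by (intro mult_left_mono) auto
      also have "\<dots> = (t powr \<beta> * t powr (- (\<beta> + 1)) * t powr 1) * B * (LINT w|lborel. indicator {0..1/2} w * W (t * w))" using elim by simp
      also have "t powr \<beta> * t powr (- (\<beta> + 1)) * t powr 1 = 1" using elim by (simp only: powr_add[symmetric]) simp
      finally show ?case by simp
    qed
  qed
  have "((\<lambda>t. (LINT s|lborel. indicator {0..t/2} s * k s * (t powr \<beta> * W (t - s))) + t powr \<beta> * ?S t) \<longlongrightarrow> (LINT s|lborel. indicator {0..} s * k s * c) + 0) at_top"
    by (intro tendsto_add first second)
  also have "(LINT s|lborel. indicator {0..} s * k s * c) + 0 = c * F"
    using kF by (simp add: has_bochner_integral_iff mult.commute)
  finally show ?thesis
  proof (rule Lim_transform_eventually)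
    show "\<forall>\<^sub>F t in at_top. (LINT s|lborel. indicator {0..t/2} s * k s * (t powr \<beta> * W (t - s))) + t powr \<beta> * ?S t = t powr \<beta> * (LINT s|lborel. indicator {0..t} s * (k s * W (t - s)))"
      using eventually_gt_at_top[of "0::real"]
    proof eventually_elim
      case (elim t)
      have "indicator {0..t} s * (k s * W (t - s)) = indicator {0..t/2} s * (k s * W (t - s)) + indicator {t/2<..t} s * (k s * W (t - s))" for s
        using elim by (auto simp: indicator_def)
      then have "(LINT s|lborel. indicator {0..t} s * (k s * W (t - s))) = (LINT s|lborel. indicator {0..t/2} s * (k s * W (t - s))) + ?S t"
        using i1[OF elim] i2[OF elim] by simp
      moreover have "(LINT s|lborel. indicator {0..t/2} s * k s * (t powr \<beta> * W (t - s))) = (LINT s|lborel. t powr \<beta> * (indicator {0..t/2} s * (k s * W (t - s))))"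
        by (intro Bochner_Integration.integral_cong) auto
      ultimately show ?case by (simp only: integral_mult_right_zero distrib_left)
    qed
  qed
qed

section \<open>Poisson and Erlang identities\<close>

context walk begin

lemma exp_sums: "(\<lambda>n. pois n t * ch \<theta> ^ n) sums exp (t * phi a \<theta>)"
proof -
  have "(\<lambda>n. (r * t * ch \<theta>) ^ n /\<^sub>R fact n) sums exp (r * t * ch \<theta>)" by (rule exp_converges)
  then have "(\<lambda>n. exp (- r * t) * ((r * t * ch \<theta>) ^ n /\<^sub>R fact n)) sums (exp (- r * t) * exp (r * t * ch \<theta>))" by (rule sums_mult)
  moreover have "exp (- r * t) * exp (r * t * ch \<theta>) = exp (t * phi a \<theta>)" by (simp add: phi_eq exp_add[symmetric] algebra_simps)
  moreover have "exp (- r * t) * ((r * t * ch \<theta>) ^ n /\<^sub>R fact n) = pois n t * ch \<theta> ^ n" for n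
    by (simp add: pois_def power_mult_distrib divide_inverse mult_ac)
  ultimately show ?thesis by simp
qed

lemma P_sums: "t \<ge> 0 \<Longrightarrow> (\<lambda>n. pois n t * q n u) sums P u t"
  using fourier_sums[of "\<lambda>n. pois n t" u] pois_nonneg sums_summable[OF pois_sums] sums_unique[OF exp_sums, symmetric]
  by (simp add: P_def)

lemma p_eq_P:
  assumes t: "t \<ge> 0"
  shows "p a t x y = P (x - y) t"
proof (rule sums_unique2[OF p_sums[OF t]])
  show "(\<lambda>n. hit {} y n x * pois n t) sums P (x - y) t"
    using P_sums[OF t, of "x - y"] by (simp add: hit_eq_q mult.commute)
qed

text \<open>The shift to \<open>q (Suc n)\<close> costs one factor \<open>ch\<close>. By
  \<open>fh_le_q\<close> this sum dominates the hitting density in \<open>kd_bound\<close>.\<close>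

lemma P_shift_sums: "t \<ge> 0 \<Longrightarrow> (\<lambda>n. pois n t * q (Suc n) u) sums (LINT \<theta>|mu. (cos (ip u \<theta>) * ch \<theta>) * exp (t * phi a \<theta>))"
proof -
  assume t: "t \<ge> 0"
  define c where "c n = (case n of 0 \<Rightarrow> 0 | Suc m \<Rightarrow> pois m t)" for n
  have c0: "0 \<le> c n" for n by (cases n) (auto simp: c_def pois_nonneg[OF t])
  have cs: "summable c" using sums_summable[OF pois_sums[of t]] summable_Suc_iff[of c] by (simp add: c_def)
  have "(\<lambda>n. pois n t * ch \<theta> ^ n * ch \<theta>) sums (exp (t * phi a \<theta>) * ch \<theta>)" for \<theta> by (intro sums_mult2 exp_sums)
  then have "(\<lambda>n. c (Suc n) * ch \<theta> ^ Suc n) sums (exp (t * phi a \<theta>) * ch \<theta>)" for \<theta> by (simp add: c_def mult_ac)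
  then have "(\<lambda>n. c n * ch \<theta> ^ n) sums (exp (t * phi a \<theta>) * ch \<theta>)" for \<theta>
    using sums_Suc_iff[of "\<lambda>n. c n * ch \<theta> ^ n" "exp (t * phi a \<theta>) * ch \<theta>"] by (simp add: c_def)
  then have e: "(\<Sum>n. c n * ch \<theta> ^ n) = exp (t * phi a \<theta>) * ch \<theta>" for \<theta> by (rule sums_unique[symmetric])
  have "(\<lambda>n. c n * q n u) sums (LINT \<theta>|mu. cos (ip u \<theta>) * (\<Sum>n. c n * ch \<theta> ^ n))" by (rule fourier_sums[OF c0 cs])
  then have "(\<lambda>n. c (Suc n) * q (Suc n) u) sums (LINT \<theta>|mu. cos (ip u \<theta>) * (\<Sum>n. c n * ch \<theta> ^ n))"
    using sums_Suc_iff[of "\<lambda>n. c n * q n u"] by (simp add: c_def)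
  then show ?thesis unfolding e by (simp add: c_def mult_ac)
qed

lemma P_nonneg: "t \<ge> 0 \<Longrightarrow> 0 \<le> P u t"
  by (rule sums_le[OF _ sums_zero P_sums]) (auto intro: mult_nonneg_nonneg pois_nonneg q_nonneg)

lemma P_le_1: "t \<ge> 0 \<Longrightarrow> P u t \<le> 1"
  by (rule sums_le[OF _ P_sums pois_sums]) (auto intro: mult_left_le q_le_1 pois_nonneg)

lemma P_meas[measurable]: "P u \<in> borel_measurable borel"
  unfolding P_def[abs_def] by (rule fourier_meas) simp

lemma pois_meas[measurable]: "pois k \<in> borel_measurable borel" unfolding pois_def[abs_def] by measurable

lemma DERIV_pois_tail: "((\<lambda>t. \<Sum>j\<le>k. pois j t) has_real_derivative - (r * pois k t)) (at t)"
proof (induction k)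
  case 0
  show ?case unfolding pois_def by (auto intro!: derivative_eq_intros)
next
  case (Suc k)
  have d: "((\<lambda>t. pois (Suc k) t) has_real_derivative (r * pois k t - r * pois (Suc k) t)) (at t)"
  proof -
    have "((\<lambda>t. (r * t) ^ Suc k * exp (- r * t) / fact (Suc k)) has_real_derivative
        (real (Suc k) * (r * t) ^ k * r * exp (- r * t) + (r * t) ^ Suc k * (- r * exp (- r * t))) / fact (Suc k)) (at t)"
      by (auto intro!: derivative_eq_intros simp del: fact_Suc power_Suc of_nat_Suc)
    moreover have "real (Suc k) / fact (Suc k) = 1 / fact k" by simp
    then have "real (Suc k) * (r * t) ^ k * r * exp (- r * t) / fact (Suc k) = (1 / fact k) * ((r * t) ^ k * r * exp (- r * t))" by (metis (no_types, lifting) mult.assoc times_divide_eq_left)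
    then have "(real (Suc k) * (r * t) ^ k * r * exp (- r * t) + (r * t) ^ Suc k * (- r * exp (- r * t))) / fact (Suc k) = r * pois k t - r * pois (Suc k) t"
      unfolding add_divide_distrib by (simp add: pois_def mult_ac del: fact_Suc power_Suc)
    ultimately show ?thesis unfolding pois_def by (simp only:)
  qed
  show ?case using DERIV_add[OF Suc.IH d] by simp
qed

text \<open>The partial sum is the probability that jump number k + 1 comes after t, and
  \<open>r * pois k\<close> is the density of that jump time.\<close>

lemma has_bochner_integral_pois_tail:
  assumes t: "t \<ge> 0"
  shows "has_bochner_integral lborel (\<lambda>s. indicator {t..} s * (r * pois k s)) (\<Sum>j\<le>k. pois j t)"
proof (rule has_bochner_integral_nn_integral)
  have "(\<integral>\<^sup>+ s. ennreal (indicator {t..} s * (r * pois k s)) \<partial>lborel) = (\<integral>\<^sup>+ s. ennreal (r * pois k s) * indicator {t..} s \<partial>lborel)"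
    by (intro nn_integral_cong) (simp add: indicator_def)
  also have "\<dots> = ennreal (0 - (- (\<Sum>j\<le>k. pois j t)))"
  proof (rule nn_integral_FTC_atLeast)
    show "DERIV (\<lambda>t. - (\<Sum>j\<le>k. pois j t)) s :> r * pois k s" for s
      using DERIV_minus[OF DERIV_pois_tail[of k s]] by simp
    show "((\<lambda>t. - (\<Sum>j\<le>k. pois j t)) \<longlongrightarrow> 0) at_top"
      using tendsto_minus[OF tendsto_sum[of "{..k}" "\<lambda>j t. pois j t" "\<lambda>_. 0" at_top]] pois_tendsto by simp
  qed (use r_pos t pois_nonneg in auto)
  finally show "(\<integral>\<^sup>+ s. ennreal (indicator {t..} s * (r * pois k s)) \<partial>lborel) = ennreal (\<Sum>j\<le>k. pois j t)" by simp
  show "AE s in lborel. 0 \<le> indicator {t..} s * (r * pois k s)"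
    using r_pos t pois_nonneg by (intro AE_I2) (auto simp: indicator_def)
qed (use t in \<open>auto intro!: sum_nonneg pois_nonneg\<close>)

text \<open>Waiting for j + 1 jumps and then for m + 1 more is waiting for j + m + 2 jumps, a time
  with density \<open>r * pois (j + m + 1)\<close>.\<close>

lemma pois_convolution:
  assumes t: "t \<ge> 0"
  shows "has_bochner_integral lborel (\<lambda>s. indicator {0..t} s * (r * pois j s * pois m (t - s))) (pois (j + m + 1) t)"
proof (rule has_bochner_integral_nn_integral)
  have e: "erlang_density k r s = r * (indicator {0..} s * pois k s)" for k s
    by (simp add: erlang_density_def pois_def indicator_def power_mult_distrib)
  have pr: "0 \<le> indicator {0..} s * pois k s" for k s using pois_nonneg by (simp add: indicator_def)
  have "ennreal r * (\<integral>\<^sup>+ s. ennreal (indicator {0..t} s * (r * pois j s * pois m (t - s))) \<partial>lborel)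
     = (\<integral>\<^sup>+ s. ennreal (erlang_density m r (t - s)) * ennreal (erlang_density j r s) \<partial>lborel)"
  proof (subst nn_integral_cmult[symmetric])
    show "(\<integral>\<^sup>+ s. ennreal r * ennreal (indicator {0..t} s * (r * pois j s * pois m (t - s))) \<partial>lborel) = (\<integral>\<^sup>+ s. ennreal (erlang_density m r (t - s)) * ennreal (erlang_density j r s) \<partial>lborel)"
    proof (rule nn_integral_cong)
      fix s
      have "ennreal (erlang_density m r (t - s)) * ennreal (erlang_density j r s) = ennreal (erlang_density m r (t - s) * erlang_density j r s)"
        by (rule ennreal_mult'[symmetric]) (use r_pos pr[of "t - s" m] in \<open>simp add: e\<close>)
      also have "erlang_density m r (t - s) * erlang_density j r s = r * (indicator {0..t} s * (r * pois j s * pois m (t - s)))"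
        unfolding e by (auto simp: indicator_def)
      also have "ennreal \<dots> = ennreal r * ennreal (indicator {0..t} s * (r * pois j s * pois m (t - s)))"
        using r_pos by (intro ennreal_mult') simp
      finally show "ennreal r * ennreal (indicator {0..t} s * (r * pois j s * pois m (t - s))) = ennreal (erlang_density m r (t - s)) * ennreal (erlang_density j r s)" by simp
    qed
  qed auto
  also have "\<dots> = ennreal (erlang_density (Suc m + Suc j - 1) r t)" using fun_cong[OF convolution_erlang_density[OF r_pos, of m j], of t] by simp
  also have "\<dots> = ennreal r * ennreal (pois (j + m + 1) t)"
    using t r_pos by (simp add: e ennreal_mult' add.commute)
  finally show "(\<integral>\<^sup>+ s. ennreal (indicator {0..t} s * (r * pois j s * pois m (t - s))) \<partial>lborel) = ennreal (pois (j + m + 1) t)"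
    using r_pos by (simp add: ennreal_mult_cancel_left)
  show "AE s in lborel. 0 \<le> indicator {0..t} s * (r * pois j s * pois m (t - s))"
    using r_pos pois_nonneg by (intro AE_I2) (auto simp: indicator_def)
qed (use t pois_nonneg in auto)

text \<open>Both sides are the probability that jump j + 1 has happened by time t and jump j + m + 2
  has not.\<close>

lemma pois_tail_convolution:
  assumes t: "t \<ge> 0"
  shows "has_bochner_integral lborel (\<lambda>s. indicator {0..t} s * (r * pois j s * (\<Sum>k\<le>m. pois k (t - s)))) ((\<Sum>k\<le>j + m + 1. pois k t) - (\<Sum>k\<le>j. pois k t))"
proof (induction m)
  case 0
  show ?case using pois_convolution[OF t, of j 0] by simp
next
  case (Suc m)
  have "(\<lambda>s. indicator {0..t} s * (r * pois j s * (\<Sum>k\<le>Suc m. pois k (t - s)))) = (\<lambda>s. indicator {0..t} s * (r * pois j s * (\<Sum>k\<le>m. pois k (t - s))) + indicator {0..t} s * (r * pois j s * pois (Suc m) (t - s)))"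
    by (simp add: fun_eq_iff algebra_simps)
  then show ?case using has_bochner_integral_add[OF Suc.IH pois_convolution[OF t, of j "Suc m"]] by (simp add: algebra_simps)
qed

end

text \<open>\<beta> is the decay exponent of the tail; transition probabilities decay with exponent
  \<open>\<beta> + 1\<close>.\<close>

locale transient_walk = walk a for a :: "int^'n \<Rightarrow> real" +
  fixes \<beta> :: real
  assumes dim: "CARD('n) \<ge> 3" and \<beta>: "\<beta> = real CARD('n) / 2 - 1"
begin

lemma \<beta>_pos: "\<beta> > 0" using dim by (simp add: \<beta>)
lemma half_dim: "real CARD('n) / 2 = \<beta> + 1" by (simp add: \<beta>)

lemma P_bound: "\<exists>C\<ge>0. \<forall>u. \<forall>t>0. P u t \<le> C * t powr (- (\<beta> + 1))"
  and P_shift_bound: "\<exists>C\<ge>0. \<forall>u. \<forall>t>0. (LINT \<theta>|mu. (cos (ip u \<theta>) * ch \<theta>) * exp (t * phi a \<theta>)) \<le> C * t powr (- (\<beta> + 1))"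
proof -
  obtain C where C: "C \<ge> 0" "\<And>t. t > 0 \<Longrightarrow> (LINT \<theta>|mu. exp (t * phi a \<theta>)) \<le> C * t powr (- (CARD('n) / 2))"
    using heat_bound by auto
  note C = C(1) C(2)[unfolded half_dim]
  have "P u t \<le> C * t powr (- (\<beta> + 1))" if "t > 0" for u t
    using fourier_bound[of "\<lambda>\<theta>. cos (ip u \<theta>)" 1 t] C(2)[OF that] that by (simp add: P_def)
  then show "\<exists>C\<ge>0. \<forall>u. \<forall>t>0. P u t \<le> C * t powr (- (\<beta> + 1))" using C(1) by blast
  have "\<bar>cos (ip u \<theta>) * ch \<theta>\<bar> \<le> 1 * 1" for u \<theta> unfolding abs_mult by (intro mult_mono abs_ch) auto
  then have "(LINT \<theta>|mu. (cos (ip u \<theta>) * ch \<theta>) * exp (t * phi a \<theta>)) \<le> C * t powr (- (\<beta> + 1))" if "t > 0" for u t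
    using fourier_bound[of "\<lambda>\<theta>. cos (ip u \<theta>) * ch \<theta>" 1 t] C(2)[OF that] that by simp
  then show "\<exists>C\<ge>0. \<forall>u. \<forall>t>0. (LINT \<theta>|mu. (cos (ip u \<theta>) * ch \<theta>) * exp (t * phi a \<theta>)) \<le> C * t powr (- (\<beta> + 1))" using C(1) by blast
qed

lemma P_integrable: "integrable lborel (\<lambda>s. indicator {0..} s * (r * P u s))"
proof -
  obtain C where C: "C \<ge> 0" "\<And>t. t > 0 \<Longrightarrow> P u t \<le> C * t powr (- (\<beta> + 1))" using P_bound by blast
  have i: "integrable lborel (indicator {0..1} :: real \<Rightarrow> real)" by (rule integrable_real_indicator) (auto simp: emeasure_lborel_Icc_eq)
  have j: "integrable lborel (\<lambda>s::real. indicator {1..} s * s powr (- (\<beta> + 1)))"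
    using has_bochner_integral_powr_tail[OF \<beta>_pos, of 1] by (simp add: has_bochner_integral_iff)
  have "integrable lborel (\<lambda>s. r * indicator {0..1} s + (r * C) * (indicator {1..} s * s powr (- (\<beta> + 1))))"
    by (intro Bochner_Integration.integrable_add integrable_mult_right i j)
  then show ?thesis
  proof (rule Bochner_Integration.integrable_bound)
    show "AE s in lborel. norm (indicator {0..} s * (r * P u s)) \<le> norm (r * indicator {0..1} s + (r * C) * (indicator {1..} s * s powr (- (\<beta> + 1))))"
    proof (rule AE_I2)
      fix s :: real
      have rp: "0 \<le> r" using r_pos by simp
      have "0 \<le> r * indicator {0..1} s + (r * C) * (indicator {1..} s * s powr (- (\<beta> + 1)))" using rp C(1) by simp
      moreover have "indicator {0..} s * (r * P u s) \<le> r * indicator {0..1} s + (r * C) * (indicator {1..} s * s powr (- (\<beta> + 1)))"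
      proof (cases "s < 0 \<or> s > 1")
        case True
        then show ?thesis using mult_left_mono[OF C(2)[of s] rp] by (auto simp: mult.assoc)
      next
        case False
        then have "indicator {0..} s * (r * P u s) \<le> r" using mult_left_mono[OF P_le_1[of s u] rp] by simp
        also have "r \<le> r * indicator {0..1} s + (r * C) * (indicator {1..} s * s powr (- (\<beta> + 1)))" using False rp C(1) by simp
        finally show ?thesis .
      qed
      moreover have "0 \<le> indicator {0..} s * (r * P u s)" using rp P_nonneg[of s u] by (simp add: indicator_def)
      ultimately show "norm (indicator {0..} s * (r * P u s)) \<le> norm (r * indicator {0..1} s + (r * C) * (indicator {1..} s * s powr (- (\<beta> + 1))))" by simp
    qed
  qed auto
qed

text \<open>With u = x - y: r times the expected time that the walk from x spends at y after t. At t
  = 0 it is r times the Green function and equals the expected number of visits of the jump chain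
  (\<open>q_sums\<close>). The inner indicator discards negative times, where \<open>P\<close> need
  not be a probability.\<close>

definition W :: "int^'n \<Rightarrow> real \<Rightarrow> real" where
  "W u t = (LINT s|lborel. indicator {t..} s * (indicator {0..} s * (r * P u s)))"

lemma W_integrable: "integrable lborel (\<lambda>s. indicator {t..} s * (indicator {0..} s * (r * P u s)))"
proof (rule Bochner_Integration.integrable_bound[OF P_integrable[of u]])
  show "AE s in lborel. norm (indicator {t..} s * (indicator {0..} s * (r * P u s))) \<le> norm (indicator {0..} s * (r * P u s))"
    by (intro AE_I2) (simp add: indicator_def)
qed auto

lemma rP_nonneg: "0 \<le> indicator {0..} s * (r * P u s)" using r_pos P_nonneg[of s u] by (simp add: indicator_def)

lemma W_nonneg: "0 \<le> W u t"
  unfolding W_def by (intro integral_nonneg_AE AE_I2 mult_nonneg_nonneg rP_nonneg) simp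

lemma W_antimono: "s \<le> t \<Longrightarrow> W u t \<le> W u s"
  unfolding W_def
proof (rule integral_mono[OF W_integrable W_integrable])
  fix s' assume "s \<le> t"
  then show "indicator {t..} s' * (indicator {0..} s' * (r * P u s')) \<le> indicator {s..} s' * (indicator {0..} s' * (r * P u s'))"
    using rP_nonneg by (intro mult_right_mono) (auto simp: indicator_def)
qed

lemma W_meas[measurable]: "W u \<in> borel_measurable borel"
proof -
  have "mono (\<lambda>t. - W u t)" using W_antimono by (auto intro: monoI)
  from borel_measurable_mono[OF this] have "(\<lambda>t. - (- W u t)) \<in> borel_measurable borel" by measurable
  then show ?thesis by simp
qed

text \<open>The walk sits at its n-th position until jump n + 1, and r times the expected part of
  this stay after t is the probability that jump n + 1 comes after t.\<close>

lemma W_sums: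
  assumes t: "t \<ge> 0"
  shows "(\<lambda>n. q n u * (\<Sum>k\<le>n. pois k t)) sums W u t"
proof -
  have "(\<lambda>n. LINT s|lborel. indicator {t..} s * (q n u * (r * pois n s))) sums (LINT s|lborel. indicator {t..} s * (indicator {0..} s * (r * P u s)))"
  proof (rule sums_integral_nonneg(1))
    show "0 \<le> indicator {t..} s * (q n u * (r * pois n s))" for n s
      using t r_pos q_nonneg pois_nonneg by (auto simp: indicator_def)
    show "(\<lambda>n. indicator {t..} s * (q n u * (r * pois n s))) sums (indicator {t..} s * (indicator {0..} s * (r * P u s)))" for s
    proof (cases "s \<ge> t")
      case True
      then show ?thesis using sums_mult[OF P_sums[of s u], of r] t by (simp add: mult_ac)
    qed simp
    show "integrable lborel (\<lambda>s. indicator {t..} s * (indicator {0..} s * (r * P u s)))" by (rule W_integrable)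
  qed auto
  moreover have "(LINT s|lborel. indicator {t..} s * (q n u * (r * pois n s))) = q n u * (\<Sum>k\<le>n. pois k t)" for n
  proof -
    have "(LINT s|lborel. indicator {t..} s * (q n u * (r * pois n s))) = (LINT s|lborel. q n u * (indicator {t..} s * (r * pois n s)))"
      by (intro Bochner_Integration.integral_cong) auto
    also have "\<dots> = q n u * (\<Sum>k\<le>n. pois k t)"
      using has_bochner_integral_integral_eq[OF has_bochner_integral_pois_tail[OF t, of n]] by simp
    finally show ?thesis .
  qed
  ultimately show ?thesis by (simp add: W_def)
qed

lemma q_sums: "(\<lambda>n. q n u) sums W u 0"
proof -
  have "(\<Sum>k\<le>n. pois k 0) = 1" for n by (induction n) (auto simp: pois_def)
  then show ?thesis using W_sums[of 0 u] by simp
qed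

lemma W_bound: "\<exists>K. \<forall>t>0. W u t \<le> K * t powr (- \<beta>)"
proof -
  obtain C where C: "C \<ge> 0" "\<And>t. t > 0 \<Longrightarrow> P u t \<le> C * t powr (- (\<beta> + 1))" using P_bound by blast
  have "W u t \<le> (r * C / \<beta>) * t powr (- \<beta>)" if t: "t > 0" for t
  proof -
    have hb: "has_bochner_integral lborel (\<lambda>s. (r * C) * (indicator {t..} s * s powr (- (\<beta> + 1)))) ((r * C) * (t powr (- \<beta>) / \<beta>))"
      by (intro has_bochner_integral_mult_right has_bochner_integral_powr_tail \<beta>_pos t)
    have "W u t \<le> (LINT s|lborel. (r * C) * (indicator {t..} s * s powr (- (\<beta> + 1))))"
      unfolding W_def
    proof (rule integral_mono[OF W_integrable])
      show "integrable lborel (\<lambda>s. (r * C) * (indicator {t..} s * s powr (- (\<beta> + 1))))" using hb by (simp add: has_bochner_integral_iff)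
      fix s :: real
      show "indicator {t..} s * (indicator {0..} s * (r * P u s)) \<le> (r * C) * (indicator {t..} s * s powr (- (\<beta> + 1)))"
        using mult_left_mono[OF C(2)[of s], of r] r_pos t by (cases "s \<ge> t") (auto simp: mult.assoc)
    qed
    also have "\<dots> = (r * C / \<beta>) * t powr (- \<beta>)" unfolding has_bochner_integral_integral_eq[OF hb] by simp
    finally show ?thesis .
  qed
  then show ?thesis by blast
qed

text \<open>Substitute s = t * v and use the local limit theorem pointwise; the factor 1 / \<beta>
  is the integral of \<open>v powr (- (\<beta> + 1))\<close> over [1, \<infinity>).\<close>

lemma W_limit: "((\<lambda>t. t powr \<beta> * W u t) \<longlongrightarrow> r * gamma_d a / \<beta>) at_top"
proof -
  obtain C where C: "C \<ge> 0" "\<And>t. t > 0 \<Longrightarrow> P u t \<le> C * t powr (- (\<beta> + 1))" using P_bound by blast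
  have hb: "has_bochner_integral lborel (\<lambda>v. indicator {1..} v * v powr (- (\<beta> + 1))) (1 / \<beta>)"
    using has_bochner_integral_powr_tail[OF \<beta>_pos, of 1] by simp
  have Plim: "((\<lambda>t. t powr (\<beta> + 1) * P u t) \<longlongrightarrow> gamma_d a) at_top"
  proof -
    have "continuous (at 0) (\<lambda>\<theta>. cos (ip u \<theta>))" unfolding ip_def by (intro continuous_intros)
    then have "((\<lambda>\<theta>. cos (ip u \<theta>)) \<longlongrightarrow> 1) (at 0)" by (simp add: continuous_within)
    from local_clt[OF _ _ this, of 1] show ?thesis by (simp add: P_def half_dim)
  qed
  have "((\<lambda>t. LINT v|lborel. indicator {1..} v * (r * (t powr (\<beta> + 1) * P u (t * v)))) \<longlongrightarrow> (LINT v|lborel. (r * gamma_d a) * (indicator {1..} v * v powr (- (\<beta> + 1))))) at_top"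
  proof (rule integral_dominated_convergence_at_top)
    show "integrable lborel (\<lambda>v. (r * C) * (indicator {1..} v * v powr (- (\<beta> + 1))))"
      using hb by (auto simp: has_bochner_integral_iff intro!: integrable_mult_right)
    show "\<forall>\<^sub>F t in at_top. AE v in lborel. norm (indicator {1..} v * (r * (t powr (\<beta> + 1) * P u (t * v)))) \<le> (r * C) * (indicator {1..} v * v powr (- (\<beta> + 1)))"
      using eventually_gt_at_top[of "0::real"]
    proof eventually_elim
      case (elim t)
      have "norm (indicator {1..} v * (r * (t powr (\<beta> + 1) * P u (t * v)))) \<le> (r * C) * (indicator {1..} v * v powr (- (\<beta> + 1)))" for v
      proof (cases "v \<ge> 1")
        case True
        then have tv: "t * v > 0" using elim by simp
        have "r * (t powr (\<beta> + 1) * P u (t * v)) \<le> r * (t powr (\<beta> + 1) * (C * (t * v) powr (- (\<beta> + 1))))"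
          using r_pos by (intro mult_left_mono C(2) tv) auto
        also have "\<dots> = r * C * (t powr (\<beta> + 1) * t powr (- (\<beta> + 1))) * v powr (- (\<beta> + 1))"
          using elim True by (simp add: powr_mult)
        also have "t powr (\<beta> + 1) * t powr (- (\<beta> + 1)) = 1" using elim by (simp only: powr_add[symmetric]) simp
        finally have "r * (t powr (\<beta> + 1) * P u (t * v)) \<le> r * C * 1 * v powr (- (\<beta> + 1))" .
        moreover have "0 \<le> r * (t powr (\<beta> + 1) * P u (t * v))" using r_pos P_nonneg[of "t * v"] tv by simp
        ultimately show ?thesis using True by simp
      qed simp
      then show ?case by simp
    qed
    show "AE v in lborel. ((\<lambda>t. indicator {1..} v * (r * (t powr (\<beta> + 1) * P u (t * v)))) \<longlongrightarrow> (r * gamma_d a) * (indicator {1..} v * v powr (- (\<beta> + 1)))) at_top"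
    proof (rule AE_I2)
      fix v :: real
      show "((\<lambda>t. indicator {1..} v * (r * (t powr (\<beta> + 1) * P u (t * v)))) \<longlongrightarrow> (r * gamma_d a) * (indicator {1..} v * v powr (- (\<beta> + 1)))) at_top"
      proof (cases "v \<ge> 1")
        case True
        have "filterlim (\<lambda>t. t * v) at_top at_top"
          using filterlim_tendsto_pos_mult_at_top[OF tendsto_const _ filterlim_ident, of v] True by (simp add: mult.commute)
        from filterlim_compose[OF Plim this]
        have "((\<lambda>t. r * v powr (- (\<beta> + 1)) * ((t * v) powr (\<beta> + 1) * P u (t * v))) \<longlongrightarrow> r * v powr (- (\<beta> + 1)) * gamma_d a) at_top"
          by (intro tendsto_mult tendsto_const)
        then have "((\<lambda>t. r * v powr (- (\<beta> + 1)) * ((t * v) powr (\<beta> + 1) * P u (t * v))) \<longlongrightarrow> (r * gamma_d a) * (indicator {1..} v * v powr (- (\<beta> + 1)))) at_top"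
          using True by (simp add: mult_ac)
        then show ?thesis
        proof (rule Lim_transform_eventually)
          show "\<forall>\<^sub>F t in at_top. r * v powr (- (\<beta> + 1)) * ((t * v) powr (\<beta> + 1) * P u (t * v)) = indicator {1..} v * (r * (t powr (\<beta> + 1) * P u (t * v)))"
            using eventually_gt_at_top[of "0::real"]
          proof eventually_elim
            case (elim t)
            have "v powr (- (\<beta> + 1)) * (t * v) powr (\<beta> + 1) = t powr (\<beta> + 1) * (v powr (- (\<beta> + 1)) * v powr (\<beta> + 1))"
              using elim True by (simp add: powr_mult)
            also have "v powr (- (\<beta> + 1)) * v powr (\<beta> + 1) = 1" using True by (simp only: powr_add[symmetric]) simp
            finally have "v powr (- (\<beta> + 1)) * (t * v) powr (\<beta> + 1) = t powr (\<beta> + 1)" by simp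
            then have "r * (v powr (- (\<beta> + 1)) * (t * v) powr (\<beta> + 1)) * P u (t * v) = r * t powr (\<beta> + 1) * P u (t * v)" by (simp only:)
            then show ?case using True by (simp add: mult.assoc)
          qed
        qed
      qed simp
    qed
  qed auto
  also have "(LINT v|lborel. (r * gamma_d a) * (indicator {1..} v * v powr (- (\<beta> + 1)))) = r * gamma_d a / \<beta>"
    unfolding integral_mult_right_zero has_bochner_integral_integral_eq[OF hb] by simp
  finally show ?thesis
  proof (rule Lim_transform_eventually)
    show "\<forall>\<^sub>F t in at_top. (LINT v|lborel. indicator {1..} v * (r * (t powr (\<beta> + 1) * P u (t * v)))) = t powr \<beta> * W u t"
      using eventually_gt_at_top[of "0::real"]
    proof eventually_elim
      case (elim t)
      have "W u t = t * (LINT v|lborel. indicator {t..} (t * v) * (indicator {0..} (t * v) * (r * P u (t * v))))"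
        unfolding W_def using lborel_integral_scale[of "\<lambda>s. indicator {t..} s * (indicator {0..} s * (r * P u s))" t] elim by simp
      also have "(LINT v|lborel. indicator {t..} (t * v) * (indicator {0..} (t * v) * (r * P u (t * v)))) = (LINT v|lborel. indicator {1..} v * (r * P u (t * v)))"
        using elim by (intro Bochner_Integration.integral_cong) (auto simp: indicator_def zero_le_mult_iff)
      finally have "t powr \<beta> * W u t = (t powr \<beta> * t powr 1) * (LINT v|lborel. indicator {1..} v * (r * P u (t * v)))" using elim by simp
      also have "t powr \<beta> * t powr 1 = t powr (\<beta> + 1)" by (rule powr_add[symmetric])
      also have "t powr (\<beta> + 1) * (LINT v|lborel. indicator {1..} v * (r * P u (t * v))) = (LINT v|lborel. t powr (\<beta> + 1) * (indicator {1..} v * (r * P u (t * v))))"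
        by (rule integral_mult_right_zero[symmetric])
      also have "\<dots> = (LINT v|lborel. indicator {1..} v * (r * (t powr (\<beta> + 1) * P u (t * v))))"
        by (intro Bochner_Integration.integral_cong) auto
      finally show ?case by simp
    qed
  qed
qed

lemma G0_eq: "G0 a x y = W (x - y) 0 / r"
proof -
  have hb: "has_bochner_integral lborel (\<lambda>s. indicator {0..} s * (r * P (x - y) s)) (W (x - y) 0)"
  proof -
    have ii: "indicator {0..} s * (indicator {0..} s * w) = (indicator {0..} s * w :: real)" for s w :: real by (simp add: indicator_def)
    show ?thesis unfolding has_bochner_integral_iff W_def ii using P_integrable by simp
  qed
  have "has_bochner_integral lborel (\<lambda>s. (1 / r) * (indicator {0..} s * (r * P (x - y) s))) ((1 / r) * W (x - y) 0)"
    by (rule has_bochner_integral_mult_right[OF hb])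
  moreover have "(1 / r) * (indicator {0..} s * (r * P (x - y) s)) = (if s \<in> {0..} then p a s x y else 0)" for s
    using r_pos by (simp add: p_eq_P)
  ultimately have "has_bochner_integral lborel (\<lambda>s. if s \<in> {0..} then p a s x y else 0) (W (x - y) 0 / r)" by simp
  then have "((\<lambda>s. if s \<in> {0..} then p a s x y else 0) has_integral (W (x - y) 0 / r)) UNIV"
    using has_integral_integral_lborel[of "\<lambda>s. if s \<in> {0..} then p a s x y else 0"] by (simp add: has_bochner_integral_iff)
  then have "((\<lambda>s. p a s x y) has_integral (W (x - y) 0 / r)) {0..}" by (simp only: has_integral_restrict_UNIV)
  then show ?thesis unfolding G0_def by (rule integral_unique)
qed

lemma Qs_tendsto: "((\<lambda>s. Qs s u) \<longlongrightarrow> W u 0) (at_left 1)"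
proof -
  have "uniform_limit {0..1} (\<lambda>n s. \<Sum>i<n. s ^ i * q i u) (\<lambda>s. \<Sum>i. s ^ i * q i u) sequentially"
  proof (rule Weierstrass_m_test[OF _ sums_summable[OF q_sums[of u]]])
    fix n and s :: real assume "s \<in> {0..1}"
    then show "norm (s ^ n * q n u) \<le> q n u"
      using power_le_one[of s n] by (simp add: abs_mult q_nonneg mult_left_le_one_le)
  qed
  then have "continuous_on {0..1} (\<lambda>s. \<Sum>i. s ^ i * q i u)"
    by (rule uniform_limit_theorem[rotated]) (auto intro!: always_eventually continuous_intros)
  then have "((\<lambda>s. \<Sum>i. s ^ i * q i u) \<longlongrightarrow> (\<Sum>i. 1 ^ i * q i u)) (at 1 within {0..1})"
    unfolding continuous_on_def by (rule bspec) simp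
  then have "((\<lambda>s. \<Sum>i. s ^ i * q i u) \<longlongrightarrow> W u 0) (at_left 1)"
    using at_within_Icc_at_left[of 0 "1::real"] sums_unique[OF q_sums[of u]] by simp
  then show ?thesis
  proof (rule Lim_transform_eventually)
    show "\<forall>\<^sub>F s in at_left 1. (\<Sum>i. s ^ i * q i u) = Qs s u"
      using eventually_unit_interval_at_left by eventually_elim (use sums_unique[OF Qs_sums] in auto)
  qed
qed

text \<open>Abel limit of \<open>Rs_eq\<close>; in the transient case both resolvents converge
  separately.\<close>

lemma rho_W: "u \<noteq> 0 \<Longrightarrow> rho a u = W 0 0 - W u 0"
proof -
  assume u: "u \<noteq> 0"
  have "((\<lambda>s. Rs s u) \<longlongrightarrow> W 0 0 - W u 0) (at_left 1)"
  proof (rule Lim_transform_eventually)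
    show "((\<lambda>s. Qs s 0 - Qs s u) \<longlongrightarrow> W 0 0 - W u 0) (at_left 1)" by (intro tendsto_diff Qs_tendsto)
    show "\<forall>\<^sub>F s in at_left 1. Qs s 0 - Qs s u = Rs s u" using eventually_unit_interval_at_left by eventually_elim (use u in \<open>simp add: Rs_eq\<close>)
  qed
  from tendsto_unique[OF _ Rs_tendsto this] show ?thesis by simp
qed

lemma F1_transient:
  assumes yz: "y \<noteq> z"
  shows "F1 x y z = (W 0 0 * (rho a (x - z) + rho a (y - z) - rho a (x - y)) - rho a (x - z) * rho a (y - z)) / (rho a (y - z) * (W 0 0 + W (y - z) 0))"
proof -
  have R: "rho a (y - z) = W 0 0 - W (y - z) 0" using yz by (intro rho_W) simp
  have rp: "rho a (y - z) > 0" by (rule rho_pos)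
  have W0: "W (y - z) 0 \<ge> 0" by (rule W_nonneg)
  have D: "2 * W 0 0 - rho a (y - z) = W 0 0 + W (y - z) 0" unfolding R by simp
  have Dp: "2 * W 0 0 - rho a (y - z) > 0" unfolding D using R rp W0 by linarith
  have "((\<lambda>s. (Qs s 0 * (Rs s (x - z) + Rs s (y - z) - Rs s (x - y)) - Rs s (x - z) * Rs s (y - z)) / (Rs s (y - z) * (2 * Qs s 0 - Rs s (y - z)))) \<longlongrightarrow>
     (W 0 0 * (rho a (x - z) + rho a (y - z) - rho a (x - y)) - rho a (x - z) * rho a (y - z)) / (rho a (y - z) * (2 * W 0 0 - rho a (y - z)))) (at_left 1)"
    by (intro tendsto_intros Qs_tendsto Rs_tendsto) (use rp Dp in simp)
  then have "((\<lambda>s. Fs x y z s) \<longlongrightarrow> (W 0 0 * (rho a (x - z) + rho a (y - z) - rho a (x - y)) - rho a (x - z) * rho a (y - z)) / (rho a (y - z) * (2 * W 0 0 - rho a (y - z)))) (at_left 1)"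
  proof (rule Lim_transform_eventually)
    show "\<forall>\<^sub>F s in at_left 1. (Qs s 0 * (Rs s (x - z) + Rs s (y - z) - Rs s (x - y)) - Rs s (x - z) * Rs s (y - z)) / (Rs s (y - z) * (2 * Qs s 0 - Rs s (y - z))) = Fs x y z s"
      using eventually_unit_interval_at_left by eventually_elim (use Fs_formula[OF yz] in simp)
  qed
  from tendsto_unique[OF _ Fs_tendsto[OF yz] this] show ?thesis unfolding D by simp
qed

end

lemma has_bochner_integral_sums:
  fixes f :: "nat \<Rightarrow> 'a \<Rightarrow> real"
  assumes int: "\<And>n. integrable M (f n)" and nn: "\<And>n s. 0 \<le> f n s"
    and s: "\<And>s. (\<lambda>n. f n s) sums F s" and c: "(\<lambda>n. LINT s|M. f n s) sums C"
  shows "has_bochner_integral M F C"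
proof -
  have F: "(\<Sum>n. f n s) = F s" for s by (rule sums_unique[OF s, symmetric])
  have 1: "AE s in M. summable (\<lambda>n. norm (f n s))" using nn sums_summable[OF s] by simp
  have 2: "summable (\<lambda>n. LINT s|M. norm (f n s))" using nn sums_summable[OF c] by simp
  show ?thesis
    using integrable_suminf[OF int 1 2] integral_suminf[OF int 1 2] sums_unique[OF c] by (simp add: F has_bochner_integral_iff)
qed

lemma powr_exp_tendsto_0:
  fixes c \<beta> :: real
  assumes "c > 0" shows "((\<lambda>t. t powr \<beta> * exp (- c * t)) \<longlongrightarrow> 0) at_top"
  using assms by real_asymp

section \<open>The renewal equation in continuous time\<close>

context transient_walk begin

text \<open>Only the summand j = n of the renewal equation is kept.\<close>

lemma fh_le_q:
  assumes yz: "y \<noteq> z" shows "fh y z n x \<le> q (Suc n) (x - y)"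
proof -
  have "fh y z n x \<le> fh y z n x * q (n - n) 0 + fh z y n x * q (n - n) (z - y)"
    using fh_nonneg q_nonneg by (simp add: q_def)
  also have "\<dots> \<le> (\<Sum>j\<le>n. fh y z j x * q (n - j) 0 + fh z y j x * q (n - j) (z - y))"
    by (rule member_le_sum) (auto intro!: add_nonneg_nonneg mult_nonneg_nonneg fh_nonneg q_nonneg)
  finally show ?thesis unfolding renewal_fh[OF yz] .
qed

text \<open>Defective density of the hitting time \<open>tau_yz\<close> for the walk from x; its
  mass is \<open>F1 x y z\<close> by \<open>kd_integral\<close>.\<close>

definition kd :: "int^'n \<Rightarrow> int^'n \<Rightarrow> int^'n \<Rightarrow> real \<Rightarrow> real" where
  "kd y z x s = (\<Sum>n. fh y z n x * (r * pois n s))"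

lemma kd_sums:
  assumes yz: "y \<noteq> z" and s: "s \<ge> 0"
  shows "(\<lambda>n. fh y z n x * (r * pois n s)) sums kd y z x s"
  unfolding kd_def
proof (rule summable_sums, rule summable_comparison_test')
  show "summable (\<lambda>n. r * pois n s)" by (intro summable_mult sums_summable[OF pois_sums])
  have "fh y z n x \<le> 1" for n using fh_le_q[OF yz, of n x] q_le_1[of "Suc n" "x - y"] by linarith
  then show "norm (fh y z n x * (r * pois n s)) \<le> r * pois n s" for n
    using fh_nonneg r_pos pois_nonneg[OF s, of n] by (simp add: abs_mult mult_left_le_one_le)
qed

lemma kd_nonneg: "y \<noteq> z \<Longrightarrow> s \<ge> 0 \<Longrightarrow> 0 \<le> kd y z x s"
  by (rule sums_le[OF _ sums_zero kd_sums]) (use r_pos in \<open>auto intro!: mult_nonneg_nonneg fh_nonneg pois_nonneg\<close>)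

lemma kd_meas[measurable]: "kd y z x \<in> borel_measurable borel"
  unfolding kd_def[abs_def] by measurable

text \<open>First visits are dominated by visits, so the density inherits the decay of the
  transition probabilities. This is the full power by which it is lighter than \<open>W\<close>, as
  \<open>tendsto_convolution\<close> requires.\<close>

lemma kd_bound:
  assumes yz: "y \<noteq> z" shows "\<exists>A. \<forall>s>0. kd y z x s \<le> A * s powr (- (\<beta> + 1))"
proof -
  obtain C where C: "C \<ge> 0" "\<And>u t. t > 0 \<Longrightarrow> (LINT \<theta>|mu. (cos (ip u \<theta>) * ch \<theta>) * exp (t * phi a \<theta>)) \<le> C * t powr (- (\<beta> + 1))"
    using P_shift_bound by blast
  have "kd y z x s \<le> r * C * s powr (- (\<beta> + 1))" if s: "s > 0" for s
  proof -
    have s0: "s \<ge> 0" using s by simp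
    have "kd y z x s \<le> r * (LINT \<theta>|mu. (cos (ip (x - y) \<theta>) * ch \<theta>) * exp (s * phi a \<theta>))"
    proof (rule sums_le[OF _ kd_sums[OF yz s0] sums_mult[OF P_shift_sums[OF s0]]])
      fix n
      have "(r * pois n s) * fh y z n x \<le> (r * pois n s) * q (Suc n) (x - y)"
        using r_pos pois_nonneg[OF s0, of n] by (intro mult_left_mono fh_le_q yz) simp
      then show "fh y z n x * (r * pois n s) \<le> r * (pois n s * q (Suc n) (x - y))" by (simp add: mult_ac)
    qed
    also have "\<dots> \<le> r * (C * s powr (- (\<beta> + 1)))" using r_pos by (intro mult_left_mono C(2) s) simp
    finally show ?thesis by simp
  qed
  then show ?thesis by blast
qed

lemma sum_pois_0: "(\<Sum>k\<le>n. pois k 0) = 1" by (induction n) (auto simp: pois_def)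

lemma kd_integral:
  assumes yz: "y \<noteq> z" shows "has_bochner_integral lborel (\<lambda>s. indicator {0..} s * kd y z x s) (F1 x y z)"
proof (rule has_bochner_integral_sums)
  have hb: "has_bochner_integral lborel (\<lambda>s. indicator {0..} s * (fh y z n x * (r * pois n s))) (fh y z n x)" for n
  proof -
    have "(\<lambda>s. indicator {0..} s * (fh y z n x * (r * pois n s))) = (\<lambda>s. fh y z n x * (indicator {0..} s * (r * pois n s)))" by (simp add: fun_eq_iff)
    then show ?thesis using has_bochner_integral_mult_right[OF has_bochner_integral_pois_tail[of 0 n], of "fh y z n x"] by (simp add: sum_pois_0)
  qed
  show "integrable lborel (\<lambda>s. indicator {0..} s * (fh y z n x * (r * pois n s)))" for n using hb[of n] by (simp add: has_bochner_integral_iff)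
  show "0 \<le> indicator {0..} s * (fh y z n x * (r * pois n s))" for n s
    using r_pos fh_nonneg pois_nonneg[of s n] by (simp add: indicator_def)
  show "(\<lambda>n. indicator {0..} s * (fh y z n x * (r * pois n s))) sums (indicator {0..} s * kd y z x s)" for s
    using kd_sums[OF yz, of s x] by (cases "s \<ge> 0") auto
  show "(\<lambda>n. LINT s|lborel. indicator {0..} s * (fh y z n x * (r * pois n s))) sums F1 x y z"
    unfolding has_bochner_integral_integral_eq[OF hb] F1_def by (rule summable_sums[OF summable_fh[OF yz]])
qed

lemma W_le_0: "t \<ge> 0 \<Longrightarrow> W u t \<le> W u 0" by (rule W_antimono)

text \<open>First visit at jump j + 1, then m further jumps: the stay ends at jump j + m + 2, whence
  the upper index \<open>j + m + 1\<close>. If the first visit comes after t all of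
  \<open>W u 0\<close> counts; if it comes at s \<le> t, only \<open>W u (t - s)\<close>
  does.\<close>

lemma pois_W_sums:
  assumes t: "t \<ge> 0"
  shows "(\<lambda>m. q m u * (\<Sum>k\<le>j + m + 1. pois k t)) sums (W u 0 * (\<Sum>k\<le>j. pois k t) + (LINT s|lborel. indicator {0..t} s * (r * pois j s * W u (t - s))))"
    and "integrable lborel (\<lambda>s. indicator {0..t} s * (r * pois j s * W u (t - s)))"
proof -
  show int: "integrable lborel (\<lambda>s. indicator {0..t} s * (r * pois j s * W u (t - s)))"
  proof (rule Bochner_Integration.integrable_bound)
    show "integrable lborel (\<lambda>s. W u 0 * (indicator {0..} s * (r * pois j s)))"
      using has_bochner_integral_pois_tail[of 0 j] by (auto simp: has_bochner_integral_iff intro!: integrable_mult_right)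
    show "AE s in lborel. norm (indicator {0..t} s * (r * pois j s * W u (t - s))) \<le> norm (W u 0 * (indicator {0..} s * (r * pois j s)))"
    proof (rule AE_I2)
      fix s
      show "norm (indicator {0..t} s * (r * pois j s * W u (t - s))) \<le> norm (W u 0 * (indicator {0..} s * (r * pois j s)))"
      proof (cases "s \<in> {0..t}")
        case True
        have "(r * pois j s) * W u (t - s) \<le> (r * pois j s) * W u 0"
          using True r_pos pois_nonneg[of s j] by (intro mult_left_mono W_le_0) auto
        then show ?thesis using True r_pos pois_nonneg[of s j] W_nonneg[of u "t - s"] W_nonneg[of u 0] by (simp add: abs_mult mult_ac)
      qed simp
    qed
  qed auto
  have "(\<lambda>m. LINT s|lborel. indicator {0..t} s * (r * pois j s * (q m u * (\<Sum>k\<le>m. pois k (t - s))))) sums (LINT s|lborel. indicator {0..t} s * (r * pois j s * W u (t - s)))"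
  proof (rule sums_integral_nonneg(1)[OF _ _ _ int])
    show "0 \<le> indicator {0..t} s * (r * pois j s * (q m u * (\<Sum>k\<le>m. pois k (t - s))))" for m s
      using r_pos pois_nonneg[of s j] q_nonneg by (auto simp: indicator_def intro!: mult_nonneg_nonneg sum_nonneg pois_nonneg)
    show "(\<lambda>m. indicator {0..t} s * (r * pois j s * (q m u * (\<Sum>k\<le>m. pois k (t - s))))) sums (indicator {0..t} s * (r * pois j s * W u (t - s)))" for s
    proof (cases "s \<in> {0..t}")
      case True
      then show ?thesis by (intro sums_mult W_sums) simp
    qed simp
  qed auto
  moreover have "(LINT s|lborel. indicator {0..t} s * (r * pois j s * (q m u * (\<Sum>k\<le>m. pois k (t - s))))) = q m u * ((\<Sum>k\<le>j + m + 1. pois k t) - (\<Sum>k\<le>j. pois k t))" for m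
  proof -
    have "(LINT s|lborel. indicator {0..t} s * (r * pois j s * (q m u * (\<Sum>k\<le>m. pois k (t - s))))) = (LINT s|lborel. q m u * (indicator {0..t} s * (r * pois j s * (\<Sum>k\<le>m. pois k (t - s)))))"
      by (intro Bochner_Integration.integral_cong) auto
    then show ?thesis unfolding integral_mult_right_zero has_bochner_integral_integral_eq[OF pois_tail_convolution[OF t]] .
  qed
  ultimately have "(\<lambda>m. q m u * ((\<Sum>k\<le>j + m + 1. pois k t) - (\<Sum>k\<le>j. pois k t))) sums (LINT s|lborel. indicator {0..t} s * (r * pois j s * W u (t - s)))"
    by (simp only:)
  from sums_add[OF sums_mult2[OF q_sums[of u], of "\<Sum>k\<le>j. pois k t"] this]
  show "(\<lambda>m. q m u * (\<Sum>k\<le>j + m + 1. pois k t)) sums (W u 0 * (\<Sum>k\<le>j. pois k t) + (LINT s|lborel. indicator {0..t} s * (r * pois j s * W u (t - s))))"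
    by (simp add: right_diff_distrib)
qed

text \<open>\<open>pois_W_sums\<close> weighted with \<open>fh\<close> and summed over j; regrouping
  by n = j + m brings it into the shape of \<open>renewal_fh\<close>.\<close>

lemma first_hit_W_sums:
  assumes t: "t \<ge> 0" and yz: "y \<noteq> z"
  shows "(\<lambda>n. (\<Sum>j\<le>n. fh y z j x * q (n - j) u) * (\<Sum>k\<le>Suc n. pois k t)) sums
    (W u 0 * (F1 x y z - H a x y z t) + (LINT s|lborel. indicator {0..t} s * (kd y z x s * W u (t - s))))"
proof -
  have int: "integrable lborel (\<lambda>s. indicator {0..t} s * (kd y z x s * W u (t - s)))"
  proof (rule Bochner_Integration.integrable_bound)
    show "integrable lborel (\<lambda>s. W u 0 * (indicator {0..} s * kd y z x s))"
      using kd_integral[OF yz, of x] by (auto simp: has_bochner_integral_iff intro!: integrable_mult_right)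
    show "AE s in lborel. norm (indicator {0..t} s * (kd y z x s * W u (t - s))) \<le> norm (W u 0 * (indicator {0..} s * kd y z x s))"
    proof (rule AE_I2)
      fix s
      show "norm (indicator {0..t} s * (kd y z x s * W u (t - s))) \<le> norm (W u 0 * (indicator {0..} s * kd y z x s))"
      proof (cases "s \<in> {0..t}")
        case True
        have "kd y z x s * W u (t - s) \<le> kd y z x s * W u 0"
          using True kd_nonneg[OF yz, of s x] by (intro mult_left_mono W_le_0) auto
        then show ?thesis using True kd_nonneg[OF yz, of s x] W_nonneg[of u "t - s"] W_nonneg[of u 0] by (simp add: abs_mult mult_ac)
      qed simp
    qed
  qed auto
  have "(\<lambda>j. LINT s|lborel. indicator {0..t} s * (fh y z j x * (r * pois j s) * W u (t - s))) sums (LINT s|lborel. indicator {0..t} s * (kd y z x s * W u (t - s)))"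
  proof (rule sums_integral_nonneg(1)[OF _ _ _ int])
    show "0 \<le> indicator {0..t} s * (fh y z j x * (r * pois j s) * W u (t - s))" for j s
      using r_pos pois_nonneg[of s j] fh_nonneg W_nonneg by (auto simp: indicator_def intro!: mult_nonneg_nonneg)
    show "(\<lambda>j. indicator {0..t} s * (fh y z j x * (r * pois j s) * W u (t - s))) sums (indicator {0..t} s * (kd y z x s * W u (t - s)))" for s
    proof (cases "s \<in> {0..t}")
      case True
      then show ?thesis by (intro sums_mult sums_mult2 kd_sums yz) simp
    qed simp
  qed auto
  moreover have "(LINT s|lborel. indicator {0..t} s * (fh y z j x * (r * pois j s) * W u (t - s))) = fh y z j x * (LINT s|lborel. indicator {0..t} s * (r * pois j s * W u (t - s)))" for j
  proof -
    have "(LINT s|lborel. indicator {0..t} s * (fh y z j x * (r * pois j s) * W u (t - s))) = (LINT s|lborel. fh y z j x * (indicator {0..t} s * (r * pois j s * W u (t - s))))"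
      by (intro Bochner_Integration.integral_cong) auto
    then show ?thesis unfolding integral_mult_right_zero .
  qed
  ultimately have c: "(\<lambda>j. fh y z j x * (LINT s|lborel. indicator {0..t} s * (r * pois j s * W u (t - s)))) sums (LINT s|lborel. indicator {0..t} s * (kd y z x s * W u (t - s)))"
    by (simp only:)
  have "(\<lambda>j. W u 0 * (fh y z j x * (\<Sum>k\<le>j. pois k t)) + fh y z j x * (LINT s|lborel. indicator {0..t} s * (r * pois j s * W u (t - s)))) sums
     (W u 0 * (F1 x y z - H a x y z t) + (LINT s|lborel. indicator {0..t} s * (kd y z x s * W u (t - s))))"
    by (intro sums_add c sums_mult H_tail_sums t yz)
  then have col: "(\<lambda>j. fh y z j x * (W u 0 * (\<Sum>k\<le>j. pois k t) + (LINT s|lborel. indicator {0..t} s * (r * pois j s * W u (t - s))))) sums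
     (W u 0 * (F1 x y z - H a x y z t) + (LINT s|lborel. indicator {0..t} s * (kd y z x s * W u (t - s))))"
    by (simp only: distrib_left mult.left_commute)
  have "(\<lambda>n. \<Sum>j\<le>n. fh y z j x * (q (n - j) u * (\<Sum>k\<le>j + (n - j) + 1. pois k t))) sums
    (W u 0 * (F1 x y z - H a x y z t) + (LINT s|lborel. indicator {0..t} s * (kd y z x s * W u (t - s))))"
    by (rule sums_diagonal[OF _ sums_mult[OF pois_W_sums(1)[OF t]] col])
      (auto intro!: mult_nonneg_nonneg fh_nonneg q_nonneg sum_nonneg pois_nonneg t simp del: sum.atMost_Suc)
  moreover have "(\<Sum>j\<le>n. fh y z j x * (q (n - j) u * (\<Sum>k\<le>j + (n - j) + 1. pois k t))) = (\<Sum>j\<le>n. fh y z j x * q (n - j) u) * (\<Sum>k\<le>Suc n. pois k t)" for n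
    unfolding sum_distrib_right by (intro sum.cong) (auto simp del: sum.atMost_Suc)
  ultimately show ?thesis by (simp only:)
qed

text \<open>The time at y after t consists of the initial stay if x = y, and of what follows a first
  visit to y or to z, each split by whether that visit comes after or before t.\<close>

lemma W_renewal:
  assumes t: "t \<ge> 0" and yz: "y \<noteq> z"
  shows "W (x - y) t = q 0 (x - y) * exp (- r * t)
    + (W 0 0 * (F1 x y z - H a x y z t) + (LINT s|lborel. indicator {0..t} s * (kd y z x s * W 0 (t - s))))
    + (W (z - y) 0 * (F1 x z y - H a x z y t) + (LINT s|lborel. indicator {0..t} s * (kd z y x s * W (z - y) (t - s))))"
proof -
  have zy: "z \<noteq> y" using yz by simp
  have "(\<lambda>n. q (Suc n) (x - y) * (\<Sum>k\<le>Suc n. pois k t)) sums (W (x - y) t - q 0 (x - y) * (\<Sum>k\<le>0. pois k t))"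
    unfolding sums_Suc_iff[of "\<lambda>n. q n (x - y) * (\<Sum>k\<le>n. pois k t)"] using W_sums[OF t, of "x - y"] by simp
  moreover have "(\<lambda>n. q (Suc n) (x - y) * (\<Sum>k\<le>Suc n. pois k t)) sums
    ((W 0 0 * (F1 x y z - H a x y z t) + (LINT s|lborel. indicator {0..t} s * (kd y z x s * W 0 (t - s))))
    + (W (z - y) 0 * (F1 x z y - H a x z y t) + (LINT s|lborel. indicator {0..t} s * (kd z y x s * W (z - y) (t - s)))))"
    using sums_add[OF first_hit_W_sums[OF t yz, of x 0] first_hit_W_sums[OF t zy, of x "z - y"]]
    unfolding renewal_fh[OF yz] sum.distrib distrib_right .
  ultimately have "W (x - y) t - q 0 (x - y) * (\<Sum>k\<le>0. pois k t) = 
    ((W 0 0 * (F1 x y z - H a x y z t) + (LINT s|lborel. indicator {0..t} s * (kd y z x s * W 0 (t - s))))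
    + (W (z - y) 0 * (F1 x z y - H a x z y t) + (LINT s|lborel. indicator {0..t} s * (kd z y x s * W (z - y) (t - s)))))"
    by (rule sums_unique2)
  then show ?thesis by (simp add: pois_def)
qed

lemma W_sym: "W (- u) t = W u t" by (simp add: W_def P_def ip_minus)

lemma conv_limit:
  assumes yz: "y \<noteq> z"
  shows "((\<lambda>t. t powr \<beta> * (LINT s|lborel. indicator {0..t} s * (kd y z x s * W u (t - s)))) \<longlongrightarrow> r * gamma_d a / \<beta> * F1 x y z) at_top"
proof -
  obtain A where A: "\<And>s. s > 0 \<Longrightarrow> kd y z x s \<le> A * s powr (- (\<beta> + 1))" using kd_bound[OF yz] by blast
  obtain K where K: "\<And>t. t > 0 \<Longrightarrow> W u t \<le> K * t powr (- \<beta>)" using W_bound by blast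
  show ?thesis
    by (rule tendsto_convolution[OF \<beta>_pos kd_meas W_meas kd_nonneg[OF yz] A kd_integral[OF yz] W_nonneg W_le_0 K W_limit])
qed

text \<open>In \<open>W_renewal\<close> the initial stay is exponentially small, and
  \<open>W\<close> and the convolutions have explicit limits on the scale
  \<open>t powr - \<beta>\<close>; what remains are the two tails.\<close>

lemma tail_combination:
  assumes yz: "y \<noteq> z"
  shows "((\<lambda>t. t powr \<beta> * (W 0 0 * (F1 x y z - H a x y z t) + W (y - z) 0 * (F1 x z y - H a x z y t))) \<longlongrightarrow> r * gamma_d a / \<beta> * (1 - F1 x y z - F1 x z y)) at_top"
proof -
  let ?c = "r * gamma_d a / \<beta>"
  let ?I = "\<lambda>y z u t. LINT s|lborel. indicator {0..t} s * (kd y z x s * W u (t - s))"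
  have zy: "z \<noteq> y" using yz by simp
  have "((\<lambda>t. t powr \<beta> * W (x - y) t - q 0 (x - y) * (t powr \<beta> * exp (- r * t)) - t powr \<beta> * ?I y z 0 t - t powr \<beta> * ?I z y (z - y) t) \<longlongrightarrow>
     ?c - q 0 (x - y) * 0 - ?c * F1 x y z - ?c * F1 x z y) at_top"
    by (intro tendsto_diff tendsto_mult[OF tendsto_const] W_limit conv_limit yz zy powr_exp_tendsto_0 r_pos)
  also have "?c - q 0 (x - y) * 0 - ?c * F1 x y z - ?c * F1 x z y = ?c * (1 - F1 x y z - F1 x z y)" by (simp add: algebra_simps)
  finally show ?thesis
  proof (rule Lim_transform_eventually)
    show "\<forall>\<^sub>F t in at_top. t powr \<beta> * W (x - y) t - q 0 (x - y) * (t powr \<beta> * exp (- r * t)) - t powr \<beta> * ?I y z 0 t - t powr \<beta> * ?I z y (z - y) t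
       = t powr \<beta> * (W 0 0 * (F1 x y z - H a x y z t) + W (y - z) 0 * (F1 x z y - H a x z y t))"
      using eventually_ge_at_top[of "0::real"]
    proof eventually_elim
      case (elim t)
      have "p * X - q0 * (p * E) - p * I1 - p * I2 = p * (A1 + A2)" if "X = q0 * E + (A1 + I1) + (A2 + I2)" for p X q0 E I1 I2 A1 A2 :: real
        unfolding that by (simp add: algebra_simps)
      from this[OF W_renewal[OF elim yz, of x]] show ?case using W_sym[of "z - y" 0] by simp
    qed
  qed
qed

lemma transient_rho_W:
  assumes yz: "y \<noteq> z"
  shows "rho a (y - z) = W 0 0 - W (y - z) 0" "W 0 0 + W (y - z) 0 > 0" "W 0 0 - W (y - z) 0 > 0"
proof -
  show R: "rho a (y - z) = W 0 0 - W (y - z) 0" using yz by (intro rho_W) simp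
  show "W 0 0 - W (y - z) 0 > 0" using R rho_pos[of "y - z"] by simp
  then show "W 0 0 + W (y - z) 0 > 0" using W_nonneg[of "y - z" 0] by linarith
qed

text \<open>Exchanging y and z gives a second equation with the same limit on the right and swapped
  coefficients. The system is regular because \<open>W 0 0 > W (y - z) 0\<close>, and symmetry
  reduces its solution to \<open>D / (g0 + g1)\<close>.\<close>

lemma tail_high:
  assumes yz: "y \<noteq> z"
  shows "((\<lambda>t. (F1 x y z - H a x y z t) * t powr \<beta>) \<longlongrightarrow> Cd a (x - z) (y - z)) at_top"
proof -
  let ?c = "r * gamma_d a / \<beta>"
  define g0 g1 where "g0 = W 0 0" and "g1 = W (y - z) 0"
  define R A B where "R = rho a (y - z)" and "A = rho a (y - x)" and "B = rho a (x - z)"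
  have R: "R = g0 - g1" "g0 + g1 > 0" "g0 - g1 > 0" using transient_rho_W[OF yz] by (auto simp: g0_def g1_def R_def)
  have zy: "z \<noteq> y" using yz by simp
  have W': "W (z - y) 0 = g1" using W_sym[of "y - z" 0] by (simp add: g1_def)
  have A': "rho a (x - y) = A" using rho_sym[of "y - x"] by (simp add: A_def)
  have R': "rho a (z - y) = R" using rho_sym[of "y - z"] by (simp add: R_def)
  let ?T = "\<lambda>t. t powr \<beta> * (F1 x y z - H a x y z t)" and ?U = "\<lambda>t. t powr \<beta> * (F1 x z y - H a x z y t)"
  define D where "D = ?c * (1 - F1 x y z - F1 x z y)"
  have l1: "((\<lambda>t. g0 * ?T t + g1 * ?U t) \<longlongrightarrow> D) at_top"
    using tail_combination[OF yz, of x] by (simp add: g0_def g1_def D_def algebra_simps)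
  have "((\<lambda>t. t powr \<beta> * (g0 * (F1 x z y - H a x z y t) + g1 * (F1 x y z - H a x y z t))) \<longlongrightarrow> ?c * (1 - F1 x z y - F1 x y z)) at_top"
    using tail_combination[OF zy, of x] unfolding W' g0_def[symmetric] .
  then have l2: "((\<lambda>t. g0 * ?U t + g1 * ?T t) \<longlongrightarrow> D) at_top"
    by (simp add: D_def algebra_simps)
  have g2: "g0\<^sup>2 - g1\<^sup>2 = (g0 + g1) * (g0 - g1)" by (simp add: power2_eq_square algebra_simps)
  have g2n: "g0\<^sup>2 - g1\<^sup>2 \<noteq> 0" unfolding g2 using R by simp
  have "((\<lambda>t. (g0 * (g0 * ?T t + g1 * ?U t) - g1 * (g0 * ?U t + g1 * ?T t)) / (g0\<^sup>2 - g1\<^sup>2)) \<longlongrightarrow> (g0 * D - g1 * D) / (g0\<^sup>2 - g1\<^sup>2)) at_top"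
    by (intro tendsto_intros l1 l2 g2n)
  moreover have "(g0 * (g0 * X + g1 * Y) - g1 * (g0 * Y + g1 * X)) / (g0\<^sup>2 - g1\<^sup>2) = X" for X Y :: real
  proof -
    have "g0 * (g0 * X + g1 * Y) - g1 * (g0 * Y + g1 * X) = (g0\<^sup>2 - g1\<^sup>2) * X" by (simp add: power2_eq_square algebra_simps)
    then show ?thesis using g2n by simp
  qed
  moreover have "(g0 * D - g1 * D) / (g0\<^sup>2 - g1\<^sup>2) = D / (g0 + g1)"
    unfolding g2 left_diff_distrib[symmetric] using R by simp
  ultimately have lim: "((\<lambda>t. ?T t) \<longlongrightarrow> D / (g0 + g1)) at_top" by simp
  have F: "F1 x y z = (g0 * (B + R - A) - B * R) / (R * (g0 + g1))"
    using F1_transient[OF yz, of x] unfolding A' by (simp add: g0_def g1_def R_def B_def)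
  have F': "F1 x z y = (g0 * (A + R - B) - A * R) / (R * (g0 + g1))"
    using F1_transient[OF zy, of x] unfolding A' R' W' by (simp add: g0_def B_def)
  \<comment> \<open>The probability that neither y nor z is ever visited after the first jump. The
    relation R = g0 - g1 lets a factor R cancel.\<close>
  have "1 - F1 x y z - F1 x z y = (R * (g0 + g1) - (g0 * (B + R - A) - B * R) - (g0 * (A + R - B) - A * R)) / (R * (g0 + g1))"
    unfolding F F' using R by (simp add: diff_divide_distrib)
  also have "\<dots> = (R * (A + B - R)) / (R * (g0 + g1))"
    unfolding R(1) by (simp add: algebra_simps)
  also have "\<dots> = (A + B - R) / (g0 + g1)" using R by simp
  finally have D: "D = ?c * ((A + B - R) / (g0 + g1))" by (simp only: D_def)
  have "D / (g0 + g1) = Cd a (x - z) (y - z)"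
  proof -
    have g: "G0 a 0 0 = g0 / r" "G0 a 0 (y - z) = g1 / r" using W' by (simp_all add: G0_eq g0_def)
    have d: "real CARD('n) - 2 = 2 * \<beta>" by (simp add: \<beta>)
    have vu: "y - z - (x - z) = y - x" by simp
    have "2 * \<gamma> * w / (r * (2 * \<beta>) * (g / r)\<^sup>2) = r * \<gamma> / \<beta> * (w / g) / g" if "g > 0" for \<gamma> w g :: real
      using that r_pos \<beta>_pos by (simp add: power2_eq_square) (simp add: mult_ac)
    from this[OF R(2)] have "2 * \<gamma> * w / (r * (2 * \<beta>) * (g0 / r + g1 / r)\<^sup>2) = r * \<gamma> / \<beta> * (w / (g0 + g1)) / (g0 + g1)" for \<gamma> w :: real
      unfolding add_divide_distrib[symmetric] .
    then show ?thesis unfolding Cd_def g d D vu A_def[symmetric] B_def[symmetric] R_def[symmetric] by simp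
  qed
  then show ?thesis using lim by (simp add: mult.commute)
qed

lemma Cd_pos:
  assumes "\<not> is_srw a" "v \<noteq> 0" shows "Cd a u v > 0"
proof -
  have "G0 a 0 0 + G0 a 0 v > 0" using transient_rho_W(2)[of v 0] assms(2) r_pos W_sym[of v 0]
    by (simp add: G0_eq add_divide_distrib[symmetric])
  moreover have "real CARD('n) - 2 > 0" using dim by simp
  ultimately show ?thesis unfolding Cd_def using rho_strict[OF assms, of u] r_pos gamma_pos
    by (intro divide_pos_pos mult_pos_pos zero_less_power) auto
qed

text \<open>\<open>F1_transient\<close> with the product in the numerator expanded by means of
  \<open>rho a (y - z) = g0 - g1\<close>; the factor r between \<open>W\<close> and
  \<open>G0\<close> cancels.\<close>

lemma Hinf_high:
  assumes yz: "y \<noteq> z"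
  shows "F1 x y z = (G0 a 0 0 * rho a (y - z) - G0 a 0 0 * rho a (y - x) + G0 a y z * rho a (x - z)) / (rho a (y - z) * (G0 a 0 0 + G0 a y z))"
proof -
  define g0 g1 where "g0 = W 0 0" and "g1 = W (y - z) 0"
  have R: "rho a (y - z) = g0 - g1" using transient_rho_W[OF yz] by (simp add: g0_def g1_def)
  have A': "rho a (x - y) = rho a (y - x)" using rho_sym[of "y - x"] by simp
  have g: "G0 a 0 0 = g0 / r" "G0 a y z = g1 / r" by (simp_all add: G0_eq g0_def g1_def)
  have "F1 x y z = (g0 * (rho a (x - z) + (g0 - g1) - rho a (y - x)) - rho a (x - z) * (g0 - g1)) / ((g0 - g1) * (g0 + g1))"
    using F1_transient[OF yz, of x] unfolding A' R by (simp add: g0_def g1_def)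
  also have "g0 * (rho a (x - z) + (g0 - g1) - rho a (y - x)) - rho a (x - z) * (g0 - g1) = g0 * (g0 - g1) - g0 * rho a (y - x) + g1 * rho a (x - z)"
    by (simp add: algebra_simps)
  also have "\<dots> / ((g0 - g1) * (g0 + g1)) = ((g0 * (g0 - g1) - g0 * rho a (y - x) + g1 * rho a (x - z)) / r) / (((g0 - g1) * (g0 + g1)) / r)"
    using r_pos by simp
  also have "(g0 * (g0 - g1) - g0 * rho a (y - x) + g1 * rho a (x - z)) / r = g0 / r * (g0 - g1) - g0 / r * rho a (y - x) + g1 / r * rho a (x - z)"
    by (simp add: add_divide_distrib diff_divide_distrib)
  also have "((g0 - g1) * (g0 + g1)) / r = (g0 - g1) * (g0 / r + g1 / r)"
    by (simp add: add_divide_distrib[symmetric])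
  finally show ?thesis unfolding R g .
qed

end

text \<open>Dividing by the limit presupposes that it does not vanish, so positivity of
  \<open>C1\<close>, \<open>C2\<close> and \<open>Cd\<close> is a prerequisite of the asymptotic
  statements.\<close>

lemma asymp_equiv_divideI:
  fixes f e :: "real \<Rightarrow> real"
  assumes lim: "((\<lambda>t. f t * e t) \<longlongrightarrow> c) at_top" and c: "c > 0"
  shows "f \<sim>[at_top] (\<lambda>t. c / e t)"
proof (rule asymp_equivI')
  show "((\<lambda>t. f t / (c / e t)) \<longlongrightarrow> 1) at_top"
    using tendsto_divide[OF lim tendsto_const[of c]] c by simp
qed

theorem theorem1:
  fixes a :: "int^'n \<Rightarrow> real" and x y z :: "int^'n"
  assumes "admissible a" and "y \<noteq> z" and "\<not> is_srw a"
  shows "(H a x y z \<longlongrightarrow> Hinf a x y z) at_top \<and>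
    (CARD('n) \<le> 2 \<longrightarrow>
       Hinf a x y z = (rho a (x - z) + rho a (y - z) - rho a (y - x)) / (2 * rho a (y - z))) \<and>
    (CARD('n) \<ge> 3 \<longrightarrow>
       Hinf a x y z = (G0 a 0 0 * rho a (y - z) - G0 a 0 0 * rho a (y - x) + G0 a y z * rho a (x - z))
                      / (rho a (y - z) * (G0 a 0 0 + G0 a y z))) \<and>
    0 < Hinf a x y z \<and> Hinf a x y z < 1 \<and>
    (CARD('n) = 1 \<longrightarrow> (\<forall>u v. v \<noteq> 0 \<longrightarrow> C1 a u v > 0) \<and>
       (\<lambda>t. Hinf a x y z - H a x y z t) \<sim>[at_top] (\<lambda>t. C1 a (x - z) (y - z) / sqrt t)) \<and>
    (CARD('n) = 2 \<longrightarrow> (\<forall>u v. v \<noteq> 0 \<longrightarrow> C2 a u v > 0) \<and>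
       (\<lambda>t. Hinf a x y z - H a x y z t) \<sim>[at_top] (\<lambda>t. C2 a (x - z) (y - z) / ln t)) \<and>
    (CARD('n) \<ge> 3 \<longrightarrow> (\<forall>u v. v \<noteq> 0 \<longrightarrow> Cd a u v > 0) \<and>
       (\<lambda>t. Hinf a x y z - H a x y z t) \<sim>[at_top]
         (\<lambda>t. Cd a (x - z) (y - z) / t powr (real CARD('n) / 2 - 1)))"
proof -
  interpret walk a by unfold_locales (rule assms(1))
  note yz = assms(2) and ns = assms(3)
  have v: "y - z \<noteq> 0" using yz by simp
  have F: "Hinf a x y z = F1 x y z" by (rule Hinf_eq[OF yz])
  have dims: "CARD('n) = 1 \<or> CARD('n) = 2 \<or> CARD('n) \<ge> 3"
    using zero_less_card_finite[where 'a = 'n] by linarith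
  have low: "F1 x y z = (rho a (x - z) + rho a (y - z) - rho a (y - x)) / (2 * rho a (y - z))" if "CARD('n) \<le> 2"
  proof -
    from dims that have "CARD('n) = 1 \<or> CARD('n) = 2" by linarith
    then show ?thesis by (elim disjE) (erule tail_one(1)[OF _ yz] tail_two(1)[OF _ yz])+
  qed
  have one: "(\<forall>u v. v \<noteq> 0 \<longrightarrow> C1 a u v > 0) \<and> (\<lambda>t. F1 x y z - H a x y z t) \<sim>[at_top] (\<lambda>t. C1 a (x - z) (y - z) / sqrt t)"
    if d: "CARD('n) = 1"
  proof (intro conjI allI impI)
    show pos: "C1 a u v > 0" if "v \<noteq> 0" for u v by (rule C1_pos[OF d ns that])
    show "(\<lambda>t. F1 x y z - H a x y z t) \<sim>[at_top] (\<lambda>t. C1 a (x - z) (y - z) / sqrt t)"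
      by (rule asymp_equiv_divideI[OF tail_one(3)[OF d yz pos[OF v]] pos[OF v]])
  qed
  have two: "(\<forall>u v. v \<noteq> 0 \<longrightarrow> C2 a u v > 0) \<and> (\<lambda>t. F1 x y z - H a x y z t) \<sim>[at_top] (\<lambda>t. C2 a (x - z) (y - z) / ln t)"
    if d: "CARD('n) = 2"
  proof (intro conjI allI impI)
    show pos: "C2 a u v > 0" if "v \<noteq> 0" for u v by (rule C2_pos[OF ns that])
    show "(\<lambda>t. F1 x y z - H a x y z t) \<sim>[at_top] (\<lambda>t. C2 a (x - z) (y - z) / ln t)"
      by (rule asymp_equiv_divideI[OF tail_two(2)[OF d yz pos[OF v]] pos[OF v]])
  qed
  have high: "F1 x y z = (G0 a 0 0 * rho a (y - z) - G0 a 0 0 * rho a (y - x) + G0 a y z * rho a (x - z)) / (rho a (y - z) * (G0 a 0 0 + G0 a y z)) \<and>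
      (\<forall>u v. v \<noteq> 0 \<longrightarrow> Cd a u v > 0) \<and>
      (\<lambda>t. F1 x y z - H a x y z t) \<sim>[at_top] (\<lambda>t. Cd a (x - z) (y - z) / t powr (real CARD('n) / 2 - 1))"
    if d: "CARD('n) \<ge> 3"
  proof -
    interpret transient_walk a "real CARD('n) / 2 - 1" by unfold_locales (use d in auto)
    show ?thesis
    proof (intro conjI allI impI)
      show pos: "Cd a u v > 0" if "v \<noteq> 0" for u v by (rule Cd_pos[OF ns that])
      show "(\<lambda>t. F1 x y z - H a x y z t) \<sim>[at_top] (\<lambda>t. Cd a (x - z) (y - z) / t powr (real CARD('n) / 2 - 1))"
        by (rule asymp_equiv_divideI[OF tail_high[OF yz] pos[OF v]])
    qed (rule Hinf_high[OF yz])
  qed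
  show ?thesis unfolding F
  proof (intro conjI)
    show "(H a x y z \<longlongrightarrow> F1 x y z) at_top" by (rule H_tendsto[OF yz])
    show "0 < F1 x y z" "F1 x y z < 1" by (rule F1_pos[OF ns yz], rule F1_less_1[OF ns yz])
  qed (rule impI, erule low one two high[THEN conjunct1] high[THEN conjunct2])+
qed

end
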